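(* For every $\alpha\in(0,2\pi)$, $$\xi(\mathcal C_\alpha)\le\frac{4\pi}{2\pi-\alpha}\left[1-\frac{(\log 2)^2}{4\pi^2}\right],$$ where $\mathcal C_\alpha=\{e^{i\theta}:\theta\in[0,\alpha]\}$.
   Context: For $E_1,E_2\subset\mathbb C$, $E_1E_2=\{xy:x\in E_1,y\in E_2\}$. Let $B^1,B^2$ be two independent planar Brownian motions with independent starting points uniformly distributed on the unit circle, and let $T^i_R$ be the hitting time by $B^i$ of the circle of centre $0$ and radius $R\ge1$. For non-empty $A\subset\mathbb C$, $$p_R(A)=P\big(B^1_{[0,T^1_R]}\cap A\,B^2_{[0,T^2_R]}=\varnothing\big).$$ If there are $c,C>0$ with $p_R(A)\ge cR^{-C}$ for all $R\ge 1$, then $\xi(A)=-\lim_{R\to\infty}\log p_R(A)/\log R$ (the limit exists and is real); otherwise $\xi(A)=\infty$. *)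

theory Defs
  imports "HOL-Probability.Probability" "HOL-Library.Set_Algebras"
begin

text \<open>
  The sequence \<open>\<tau>\<close> of times below starts at \<open>0\<close>, and the initial position is the first member of
  the independent family, so the starting point may be random and is independent of the increments.
  The density of an increment makes its real and imaginary parts independent centred normal
  variables of variance \<open>t - s\<close>.
\<close>

locale planar_brownian_motion = prob_space M
  for M :: "'w measure" and B :: "real \<Rightarrow> 'w \<Rightarrow> complex" +
  assumes measurable_at: "0 \<le> t \<Longrightarrow> B t \<in> borel_measurable M"
    and continuous_paths: "\<omega> \<in> space M \<Longrightarrow> continuous_on {0..} (\<lambda>t. B t \<omega>)"
    and independent_increments:
      "\<lbrakk>\<tau> 0 = 0; strict_mono \<tau>\<rbrakk> \<Longrightarrow>
        indep_vars (\<lambda>_. borel)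
          (case_nat (B 0) (\<lambda>k \<omega>. B (\<tau> (Suc k)) \<omega> - B (\<tau> k) \<omega>)) UNIV"
    and gaussian_increments:
      "\<lbrakk>0 \<le> s; s < t\<rbrakk> \<Longrightarrow>
        distributed M lborel (\<lambda>\<omega>. B t \<omega> - B s \<omega>)
          (\<lambda>z. ennreal (normal_density 0 (sqrt (t - s)) (Re z)
                      * normal_density 0 (sqrt (t - s)) (Im z)))"

definition uniform_unit_circle :: "complex measure" where
  "uniform_unit_circle = distr (uniform_measure lborel {0..2 * pi}) borel cis"

locale independent_brownian_pair =
  B1: planar_brownian_motion M B1 + B2: planar_brownian_motion M B2
  for M :: "'w measure" and B1 B2 :: "real \<Rightarrow> 'w \<Rightarrow> complex" +
  assumes uniform_start1: "distr M borel (B1 0) = uniform_unit_circle"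
    and uniform_start2: "distr M borel (B2 0) = uniform_unit_circle"
    and independent_processes:
      "B1.indep_var
        (\<Pi>\<^sub>M t\<in>{0..}. borel) (\<lambda>\<omega>. \<lambda>t\<in>{0..}. B1 t \<omega>)
        (\<Pi>\<^sub>M t\<in>{0..}. borel) (\<lambda>\<omega>. \<lambda>t\<in>{0..}. B2 t \<omega>)"

definition circle_hitting_time :: "(real \<Rightarrow> 'w \<Rightarrow> complex) \<Rightarrow> real \<Rightarrow> 'w \<Rightarrow> ereal" where
  "circle_hitting_time B R \<omega> = (INF t\<in>{t. 0 \<le> t \<and> cmod (B t \<omega>) = R}. ereal t)"

definition path_until_hit :: "(real \<Rightarrow> 'w \<Rightarrow> complex) \<Rightarrow> real \<Rightarrow> 'w \<Rightarrow> complex set" where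
  "path_until_hit B R \<omega> = {B t \<omega> | t. 0 \<le> t \<and> ereal t \<le> circle_hitting_time B R \<omega>}"

text \<open>In the next definition \<open>*\<close> is the elementwise product of sets.\<close>

definition nonintersection_prob ::
  "'w measure \<Rightarrow> (real \<Rightarrow> 'w \<Rightarrow> complex) \<Rightarrow> (real \<Rightarrow> 'w \<Rightarrow> complex) \<Rightarrow> complex set \<Rightarrow> real \<Rightarrow> real"
  where
  "nonintersection_prob M B1 B2 A R =
    measure M {\<omega> \<in> space M. path_until_hit B1 R \<omega> \<inter> (A * path_until_hit B2 R \<omega>) = {}}"

definition nonintersection_exponent ::
  "'w measure \<Rightarrow> (real \<Rightarrow> 'w \<Rightarrow> complex) \<Rightarrow> (real \<Rightarrow> 'w \<Rightarrow> complex) \<Rightarrow> complex set \<Rightarrow> ereal"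
  where
  "nonintersection_exponent M B1 B2 A =
    (if \<exists>c>0. \<exists>C>0. \<forall>R\<ge>1. nonintersection_prob M B1 B2 A R \<ge> c * R powr (- C)
     then ereal (- Lim at_top (\<lambda>R. ln (nonintersection_prob M B1 B2 A R) / ln R))
     else \<infinity>)"

definition circle_arc :: "real \<Rightarrow> complex set" where
  "circle_arc \<alpha> = {cis \<theta> | \<theta>. \<theta> \<in> {0..\<alpha>}}"

end

theory Submission imports Defs "HOL-Complex_Analysis.Complex_Analysis" begin

text \<open>
  Conditioning the two paths at the circle of radius \<open>R\<close> and rescaling shows that the supremum of the
  non-intersection probability over starting points in the unit disc is submultiplicative in \<open>R\<close>;
  averaging over starting points bounds it by a constant times \<open>p (R / 2)\<close>. Hence the limit defining
  the exponent exists, and it suffices to bound \<open>p\<close> from below along a geometric sequence of radii.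

  In the coordinate \<open>k Ln y + i pi / 2\<close>, with \<open>k\<close> slightly larger than \<open>pi / (2 pi - \<alpha>)\<close>, keeping the
  first path in \<open>arg < 0\<close> and the second one in \<open>arg > 0\<close>, each within an angle \<open>pi / (2 k)\<close>, prevents
  an intersection; this gives only the exponent \<open>4 pi / (2 pi - \<alpha>)\<close>. The improvement comes from
  letting the separating curve fluctuate: in each block of logarithmic length 13 it is bent to one of
  five levels. For each level sequence an explicit harmonic function that is positive in the bent tube
  bounds from below the probability that a path stays in it, and the contributions of all level
  sequences are added up, with weights that avoid counting a pair of paths repeatedly.
\<close>

section \<open>Paths up to a hitting time\<close>

text \<open>Bending the curve hurts one path more than it helps the other: the gains of opposite
  levels add up to at most 0, so no single bent curve beats the straight one, and only their number
  does. The difficulty is that a pair of paths may be separated by many curves at once, while the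
  harmonic functions give only lower bounds for the probability of a tube, so overlaps cannot be
  subtracted. Instead, for a fixed first path, the sum over the curves is a summation by parts with
  nonnegative weights: all tubes that contain this path are charged to one tube left for the second
  path, and then lower bounds suffice.

  For a straight curve a block costs the pair \<open>exp (- 4 * 13)\<close>. The claim needs a
  saving of about 0.63 in this exponent. Correcting for neighbouring blocks costs 0.13, the
  strictness of the angle condition 0.03, and the five levels earn 0.8. The length 13 is a plateau
  of 5, on which the curve is bent, and two margins of 4, which make the influence on other blocks
  of the order \<open>exp (- 4)\<close>.\<close>

definition trace_until :: "real \<Rightarrow> (real \<Rightarrow> complex) \<Rightarrow> complex set" where
  "trace_until R f = {f t |t. 0 \<le> t \<and> (\<forall>s. 0 \<le> s \<and> s < t \<longrightarrow> cmod (f s) \<noteq> R)}"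

text \<open>A time is at most the infimum of the hits iff no hit strictly precedes it. This includes
  a path that never hits: the infimum is then infinite and the trace is the whole path.\<close>

lemma path_until_hit_eq: "path_until_hit B R \<omega> = trace_until R (\<lambda>t. B t \<omega>)"
proof -
  have "ereal t \<le> circle_hitting_time B R \<omega> \<longleftrightarrow> (\<forall>s. 0 \<le> s \<and> s < t \<longrightarrow> cmod (B s \<omega>) \<noteq> R)" for t
    unfolding circle_hitting_time_def le_INF_iff by (auto simp: not_less)
  then show ?thesis
    unfolding path_until_hit_def trace_until_def by auto
qed

definition avoids :: "complex set \<Rightarrow> real \<Rightarrow> (real \<Rightarrow> complex) \<Rightarrow> (real \<Rightarrow> complex) \<Rightarrow> bool" where
  "avoids A R f g \<longleftrightarrow> trace_until R f \<inter> (A * trace_until R g) = {}"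

definition hits_before :: "(real \<Rightarrow> complex) \<Rightarrow> real \<Rightarrow> real \<Rightarrow> bool" where
  "hits_before f R b \<longleftrightarrow> (\<exists>t. 0 \<le> t \<and> t < b \<and> cmod (f t) = R)"

text \<open>Countable reformulations, valid for continuous paths, which make the events measurable.\<close>

definition hits_before_rat :: "(real \<Rightarrow> complex) \<Rightarrow> real \<Rightarrow> real \<Rightarrow> bool" where
  "hits_before_rat f R b \<longleftrightarrow>
    (\<exists>m::nat. \<forall>k::nat. \<exists>q\<in>\<rat> \<inter> {0..b - 1 / (real m + 1)}. \<bar>cmod (f q) - R\<bar> < 1 / (real k + 1))"

lemma rational_dense_image:
  fixes h :: "real \<Rightarrow> 'b::metric_space"
  assumes h: "continuous_on {0..c} h" and s: "s \<in> {0..c}" and e: "0 < e"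
  shows "\<exists>q\<in>\<rat> \<inter> {0..c}. dist (h q) (h s) < e"
proof (cases "c = 0")
  case True
  then show ?thesis using s e by (intro bexI[of _ 0]) auto
next
  case False
  with s have c: "0 < c" by auto
  from h[unfolded continuous_on_iff, rule_format, OF s e]
  obtain d where d: "d > 0" "\<And>x. x \<in> {0..c} \<Longrightarrow> dist x s < d \<Longrightarrow> dist (h x) (h s) < e" by auto
  have "max 0 (s - d) < min c (s + d)" using s c d by auto
  from Rats_dense_in_real[OF this] obtain q where "q \<in> \<rat>" "max 0 (s - d) < q" "q < min c (s + d)" by auto
  then show ?thesis
    by (intro bexI[of _ q] d(2)) (auto simp: dist_real_def)
qed

text \<open>The margin \<open>1 / (real m + 1)\<close> puts all approximate hits into one compact
  interval that ends strictly before \<open>b\<close>, so an accumulation point of them is a genuine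
  hit before \<open>b\<close>. Without a margin they could accumulate at \<open>b\<close>
  itself.\<close>

lemma hits_before_rat_iff:
  assumes f: "continuous_on {0..} f"
  shows "hits_before_rat f R b \<longleftrightarrow> hits_before f R b"
proof
  assume "hits_before f R b"
  then obtain t where t: "0 \<le> t" "t < b" "cmod (f t) = R" unfolding hits_before_def by auto
  then obtain m :: nat where m: "1 / (real m + 1) < b - t"
    using reals_Archimedean[of "b - t"] by (auto simp: inverse_eq_divide add.commute)
  show "hits_before_rat f R b" unfolding hits_before_rat_def
  proof (intro exI[of _ m] allI)
    fix k :: nat
    have "continuous_on {0..b - 1/(real m+1)} (\<lambda>t. cmod (f t))"
      by (intro continuous_intros continuous_on_subset[OF f]) auto
    from rational_dense_image[OF this, of t "1/(real k+1)"] t m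
    show "\<exists>q\<in>\<rat> \<inter> {0..b - 1 / (real m + 1)}. \<bar>cmod (f q) - R\<bar> < 1 / (real k + 1)"
      by (auto simp: dist_real_def add.commute)
  qed
next
  assume "hits_before_rat f R b"
  then obtain m :: nat where "\<forall>k::nat. \<exists>q\<in>\<rat> \<inter> {0..b - 1 / (real m + 1)}. \<bar>cmod (f q) - R\<bar> < 1 / (real k + 1)"
    unfolding hits_before_rat_def ..
  then have "\<forall>k::nat. \<exists>q. q \<in> {0..b - 1 / (real m + 1)} \<and> \<bar>cmod (f q) - R\<bar> < 1 / (real k + 1)"
    by (meson IntE bexE)
  from choice[OF this] obtain q
    where q: "\<And>k::nat. q k \<in> {0..b - 1 / (real m + 1)}" "\<And>k. \<bar>cmod (f (q k)) - R\<bar> < 1 / (real k + 1)"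
    by auto
  have "compact {0..b - 1 / (real m + 1)}" by simp
  then obtain l r where l: "l \<in> {0..b - 1 / (real m + 1)}" and r: "strict_mono (r::nat\<Rightarrow>nat)" "(q \<circ> r) \<longlonglongrightarrow> l"
    using q(1) unfolding compact_def by meson
  have cont: "continuous_on {0..b - 1/(real m+1)} (\<lambda>t. cmod (f t))"
    by (intro continuous_intros continuous_on_subset[OF f]) auto
  have 1: "(\<lambda>n. cmod (f ((q \<circ> r) n))) \<longlonglongrightarrow> cmod (f l)"
    using continuous_on_tendsto_compose[OF cont r(2) l] q(1) by (auto simp: o_def)
  have "(\<lambda>n. \<bar>cmod (f (q n)) - R\<bar>) \<longlonglongrightarrow> 0"
  proof (rule tendsto_sandwich[OF _ _ tendsto_const LIMSEQ_inverse_real_of_nat])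
    show "\<forall>\<^sub>F n in sequentially. \<bar>cmod (f (q n)) - R\<bar> \<le> inverse (real (Suc n))"
    proof (rule always_eventually, rule allI)
      fix n show "\<bar>cmod (f (q n)) - R\<bar> \<le> inverse (real (Suc n))"
        using q(2)[of n] by (simp add: inverse_eq_divide add.commute)
    qed
  qed auto
  from LIMSEQ_subseq_LIMSEQ[OF this r(1)] have "(\<lambda>n. cmod (f (q (r n))) - R) \<longlonglongrightarrow> 0"
    by (auto simp: o_def tendsto_rabs_zero_iff)
  then have "(\<lambda>n. cmod (f (q (r n)))) \<longlonglongrightarrow> R" by (simp add: LIM_zero_iff)
  with 1 have "cmod (f l) = R" by (auto simp: o_def intro: LIMSEQ_unique)
  moreover have "l < b"
  proof -
    define e where "e = 1 / (real m + 1)"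
    have "0 < e" by (simp add: e_def)
    moreover have "l \<le> b - e" using l by (simp add: e_def)
    ultimately show ?thesis by simp
  qed
  moreover have "0 \<le> l" using l by (simp only: atLeastAtMost_iff)
  ultimately show "hits_before f R b" unfolding hits_before_def by blast
qed

lemma hits_before_rat_restrict [simp]:
  "hits_before_rat (restrict f {0..}) R b = hits_before_rat f R b"
  unfolding hits_before_rat_def by (auto intro!: ex_cong all_cong bex_cong)

lemma pred_countable_Bex:
  "countable I \<Longrightarrow> (\<And>i. i \<in> I \<Longrightarrow> Measurable.pred M (\<lambda>x. P x i)) \<Longrightarrow> Measurable.pred M (\<lambda>x. \<exists>i\<in>I. P x i)"
  unfolding pred_def by (rule sets.sets_Collect_countable_Ex')

lemma measurable_hits_before_rat:
  assumes X: "\<And>t. 0 \<le> t \<Longrightarrow> X t \<in> borel_measurable N"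
  shows "Measurable.pred N (\<lambda>x. hits_before_rat (\<lambda>t. X t x) R b)"
  unfolding hits_before_rat_def
proof (intro pred_intros_countable pred_countable_Bex)
  fix m k :: nat
  show "countable (\<rat> \<inter> {0..b - 1 / (real m + 1)})" using countable_rat by auto
  fix q assume "q \<in> \<rat> \<inter> {0..b - 1 / (real m + 1)}"
  then have [measurable]: "X q \<in> borel_measurable N" using X by auto
  show "Measurable.pred N (\<lambda>x. \<bar>cmod (X q x) - R\<bar> < 1 / (real k + 1))" by measurable
qed

text \<open>The bound \<open>n\<close> on the times, uniform in \<open>k\<close>, provides
  compactness. The conditions of not having hit earlier are kept exact: they cut out closed
  intervals of times, on which rational times suffice.\<close>

definition avoids_rat :: "real \<Rightarrow> real \<Rightarrow> (real \<Rightarrow> complex) \<Rightarrow> (real \<Rightarrow> complex) \<Rightarrow> bool" where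
  "avoids_rat \<alpha> R f g \<longleftrightarrow> \<not> (\<exists>n::nat. \<forall>k::nat. \<exists>s\<in>\<rat>\<inter>{0..real n}. \<exists>t\<in>\<rat>\<inter>{0..real n}. \<exists>\<theta>\<in>\<rat>\<inter>{0..\<alpha>}.
     \<not> hits_before_rat f R s \<and> \<not> hits_before_rat g R t \<and> cmod (f s - cis \<theta> * g t) < 1 / (real k + 1))"

lemma measurable_avoids_rat:
  assumes X: "\<And>t. 0 \<le> t \<Longrightarrow> X t \<in> borel_measurable N"
  assumes Y: "\<And>t. 0 \<le> t \<Longrightarrow> Y t \<in> borel_measurable N"
  shows "Measurable.pred N (\<lambda>x. avoids_rat \<alpha> R (\<lambda>t. X t x) (\<lambda>t. Y t x))"
  unfolding avoids_rat_def
proof (intro pred_intros_countable pred_countable_Bex pred_intros_logic countable_Int1 countable_rat)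
  fix n k :: nat
  fix s t \<theta> assume s: "s \<in> \<rat> \<inter> {0..real n}" and t: "t \<in> \<rat> \<inter> {0..real n}"
  show "Measurable.pred N (\<lambda>x. hits_before_rat (\<lambda>t. X t x) R s)" "Measurable.pred N (\<lambda>x. hits_before_rat (\<lambda>t. Y t x) R t)"
    by (intro measurable_hits_before_rat X Y; assumption)+
  have [measurable]: "X s \<in> borel_measurable N" "Y t \<in> borel_measurable N" using s t X Y by auto
  show "Measurable.pred N (\<lambda>x. cmod (X s x - cis \<theta> * Y t x) < 1 / (real k + 1))" by measurable
qed

text \<open>\<open>hits_before\<close> looks only at times strictly below its bound, so the supremum
  of the times without an earlier hit is again such a time. The resulting interval is closed:
  rational times approximate in it and it is compact, the two facts behind
  \<open>avoids_rat_iff\<close>.\<close>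

lemma before_hit_interval:
  assumes "0 \<le> c"
  shows "\<exists>d. 0 \<le> d \<and> d \<le> c \<and> (\<forall>s. 0 \<le> s \<longrightarrow> s \<le> c \<longrightarrow> (\<not> hits_before f R s \<longleftrightarrow> s \<le> d))"
proof -
  define S where "S = {s. 0 \<le> s \<and> s \<le> c \<and> \<not> hits_before f R s}"
  have 0: "0 \<in> S" using assms by (auto simp: S_def hits_before_def)
  have bdd: "bdd_above S" by (auto simp: S_def intro: bdd_aboveI[of _ c])
  have "\<not> hits_before f R (Sup S)"
  proof
    assume "hits_before f R (Sup S)"
    then obtain t where t: "0 \<le> t" "t < Sup S" "cmod (f t) = R" by (auto simp: hits_before_def)
    then obtain s where "s \<in> S" "t < s" using less_cSup_iff[of S t] 0 bdd by auto
    then show False using t by (auto simp: S_def hits_before_def)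
  qed
  then have 1: "\<not> hits_before f R s" if "s \<le> Sup S" for s
    using that unfolding hits_before_def by (metis less_le_trans)
  have 2: "s \<le> Sup S" if "0 \<le> s" "s \<le> c" "\<not> hits_before f R s" for s
    using that bdd by (intro cSup_upper) (auto simp: S_def)
  show ?thesis
  proof (intro exI[of _ "Sup S"] conjI allI impI)
    show "0 \<le> Sup S" using 0 bdd by (rule cSup_upper)
    show "Sup S \<le> c" using 0 by (intro cSup_least) (auto simp: S_def)
    show "\<not> hits_before f R s \<longleftrightarrow> s \<le> Sup S" if "0 \<le> s" "s \<le> c" for s
      using 1[of s] 2[of s] that by metis
  qed
qed

lemma avoids_iff_hits:
  "avoids (circle_arc \<alpha>) R f g \<longleftrightarrow> \<not> (\<exists>s\<ge>0. \<exists>t\<ge>0. \<exists>\<theta>\<in>{0..\<alpha>}. \<not> hits_before f R s \<and> \<not> hits_before g R t \<and> f s = cis \<theta> * g t)"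
proof -
  have tr: "trace_until R h = h ` {s. 0 \<le> s \<and> \<not> hits_before h R s}" for h
    unfolding trace_until_def hits_before_def by auto
  have arc: "circle_arc \<alpha> = cis ` {0..\<alpha>}"
    unfolding circle_arc_def by auto
  have "avoids (circle_arc \<alpha>) R f g \<longleftrightarrow>
      \<not> (\<exists>x\<in>trace_until R f. \<exists>b\<in>trace_until R g. \<exists>a\<in>circle_arc \<alpha>. x = a * b)"
    unfolding avoids_def set_times_def by auto
  also have "\<dots> \<longleftrightarrow> \<not> (\<exists>s\<ge>0. \<exists>t\<ge>0. \<exists>\<theta>\<in>{0..\<alpha>}. \<not> hits_before f R s \<and> \<not> hits_before g R t \<and> f s = cis \<theta> * g t)"
    unfolding tr arc bex_simps by blast
  finally show ?thesis .
qed

text \<open>From an exact meeting to approximate ones by density of rational times in the intervals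
  before the hits; back by compactness of the product of these two intervals with
  \<open>{0..\<alpha>}\<close>.\<close>

lemma avoids_rat_iff:
  assumes f: "continuous_on {0..} f" and g: "continuous_on {0..} g" and "0 \<le> \<alpha>"
  shows "avoids_rat \<alpha> R f g \<longleftrightarrow> avoids (circle_arc \<alpha>) R f g"
proof -
  have "(\<exists>n::nat. \<forall>k::nat. \<exists>s\<in>\<rat>\<inter>{0..real n}. \<exists>t\<in>\<rat>\<inter>{0..real n}. \<exists>\<theta>\<in>\<rat>\<inter>{0..\<alpha>}.
     \<not> hits_before f R s \<and> \<not> hits_before g R t \<and> cmod (f s - cis \<theta> * g t) < 1 / (real k + 1))
    \<longleftrightarrow> (\<exists>s\<ge>0. \<exists>t\<ge>0. \<exists>\<theta>\<in>{0..\<alpha>}. \<not> hits_before f R s \<and> \<not> hits_before g R t \<and> f s = cis \<theta> * g t)" (is "?L = ?R")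
  proof
    assume ?R
    then obtain s t \<theta> where st: "0 \<le> s" "0 \<le> t" "\<theta> \<in> {0..\<alpha>}" "\<not> hits_before f R s" "\<not> hits_before g R t" "f s = cis \<theta> * g t" by auto
    obtain n :: nat where "max s t \<le> n" using real_arch_simple by blast
    then have n: "s \<le> n" "t \<le> n" by simp_all
    from before_hit_interval[of "real n" f R, OF of_nat_0_le_iff]
    obtain c where c': "0 \<le> c \<and> c \<le> real n \<and> (\<forall>s. 0 \<le> s \<longrightarrow> s \<le> real n \<longrightarrow> (\<not> hits_before f R s \<longleftrightarrow> s \<le> c))" ..
    note c = c'[THEN conjunct1] c'[THEN conjunct2, THEN conjunct1]
      c'[THEN conjunct2, THEN conjunct2, rule_format]
    from before_hit_interval[of "real n" g R, OF of_nat_0_le_iff]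
    obtain d where d': "0 \<le> d \<and> d \<le> real n \<and> (\<forall>s. 0 \<le> s \<longrightarrow> s \<le> real n \<longrightarrow> (\<not> hits_before g R s \<longleftrightarrow> s \<le> d))" ..
    note d = d'[THEN conjunct1] d'[THEN conjunct2, THEN conjunct1]
      d'[THEN conjunct2, THEN conjunct2, rule_format]
    show ?L
    proof (intro exI[of _ n] allI)
      fix k :: nat
      \<comment> \<open>A third of the tolerance for each of the three perturbations: of
        \<open>s\<close>, of \<open>t\<close> and of \<theta>.\<close>
      define e where "e = 1 / (3 * (real k + 1))"
      have e: "0 < e" "3 * e = 1 / (real k + 1)" by (auto simp: e_def field_simps)
      have "continuous_on {0..c} f" by (rule continuous_on_subset[OF f]) auto
      from this have "\<exists>p\<in>\<rat> \<inter> {0..c}. dist (f p) (f s) < e"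
      proof (rule rational_dense_image[OF _ _ e(1)])
        show "s \<in> {0..c}" using st(1,4) n c(3)[of s] by simp
      qed
      then obtain p where p: "p \<in> \<rat> \<inter> {0..c}" "cmod (f p - f s) < e"
        unfolding dist_norm by (rule bexE)
      have "continuous_on {0..d} g" by (rule continuous_on_subset[OF g]) auto
      from this have "\<exists>q\<in>\<rat> \<inter> {0..d}. dist (g q) (g t) < e"
      proof (rule rational_dense_image[OF _ _ e(1)])
        show "t \<in> {0..d}" using st(2,5) n d(3)[of t] by simp
      qed
      then obtain q where q: "q \<in> \<rat> \<inter> {0..d}" "cmod (g q - g t) < e"
        unfolding dist_norm by (rule bexE)
      have "continuous_on {0..\<alpha>} (\<lambda>\<theta>. cis \<theta> * g t)" by (intro continuous_intros)
      from rational_dense_image[OF this st(3) e(1)] have "\<exists>\<phi>\<in>\<rat> \<inter> {0..\<alpha>}. dist (cis \<phi> * g t) (cis \<theta> * g t) < e" .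
      then
      obtain \<phi> where \<phi>: "\<phi> \<in> \<rat> \<inter> {0..\<alpha>}" "cmod (cis \<phi> * g t - cis \<theta> * g t) < e"
        unfolding dist_norm by (rule bexE)
      have "f p - cis \<phi> * g q = (f p - f s) - (cis \<phi> * (g q - g t)) - (cis \<phi> * g t - cis \<theta> * g t)"
        using st(6) by (simp add: algebra_simps)
      then have "cmod (f p - cis \<phi> * g q) \<le> cmod (f p - f s) + cmod (cis \<phi> * (g q - g t)) + cmod (cis \<phi> * g t - cis \<theta> * g t)"
        by (metis norm_triangle_ineq4 add_mono_thms_linordered_semiring(3) order_trans)
      then have lt: "cmod (f p - cis \<phi> * g q) < 3 * e" using p(2) q(2) \<phi>(2) by (simp add: norm_mult)
      show "\<exists>s\<in>\<rat>\<inter>{0..real n}. \<exists>t\<in>\<rat>\<inter>{0..real n}. \<exists>\<theta>\<in>\<rat>\<inter>{0..\<alpha>}.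
         \<not> hits_before f R s \<and> \<not> hits_before g R t \<and> cmod (f s - cis \<theta> * g t) < 1 / (real k + 1)"
      proof (rule bexI[of _ p], rule bexI[of _ q], rule bexI[of _ \<phi>], intro conjI)
        show "\<not> hits_before f R p" using c(2) c(3)[of p] p(1) by simp
        show "\<not> hits_before g R q" using d(2) d(3)[of q] q(1) by simp
        show "cmod (f p - cis \<phi> * g q) < 1 / (real k + 1)"
          using lt e(2) by simp
        show "p \<in> \<rat> \<inter> {0..real n}" "q \<in> \<rat> \<inter> {0..real n}" "\<phi> \<in> \<rat> \<inter> {0..\<alpha>}"
          using p(1) q(1) \<phi>(1) c(2) d(2) by simp_all
      qed
    qed
  next
    assume ?L
    then obtain n :: nat where n: "\<forall>k::nat. \<exists>s\<in>\<rat>\<inter>{0..real n}. \<exists>t\<in>\<rat>\<inter>{0..real n}. \<exists>\<theta>\<in>\<rat>\<inter>{0..\<alpha>}.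
     \<not> hits_before f R s \<and> \<not> hits_before g R t \<and> cmod (f s - cis \<theta> * g t) < 1 / (real k + 1)" ..
    define P where "P k s t \<theta> \<longleftrightarrow> s \<in> {0..real n} \<and> t \<in> {0..real n} \<and> \<theta> \<in> {0..\<alpha>} \<and>
      \<not> hits_before f R s \<and> \<not> hits_before g R t \<and> cmod (f s - cis \<theta> * g t) < 1 / (real k + 1)" for k :: nat and s t \<theta>
    have "\<forall>k. \<exists>s t \<theta>. P k s t \<theta>"
      using n unfolding P_def by (meson IntE)
    then obtain xs xt xa where P: "\<And>k. P k (xs k) (xt k) (xa k)" by metis
    define x where "x k = (xs k, xt k, xa k)" for k
    have x: "fst (x k) \<in> {0..real n}" "fst (snd (x k)) \<in> {0..real n}" "snd (snd (x k)) \<in> {0..\<alpha>}"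
      "\<not> hits_before f R (fst (x k))" "\<not> hits_before g R (fst (snd (x k)))"
      "cmod (f (fst (x k)) - cis (snd (snd (x k))) * g (fst (snd (x k)))) < 1 / (real k + 1)" for k
      using P[of k] unfolding P_def x_def fst_conv snd_conv by (simp_all only: simp_thms)
    from before_hit_interval[of "real n" f R, OF of_nat_0_le_iff]
    obtain c where c': "0 \<le> c \<and> c \<le> real n \<and> (\<forall>s. 0 \<le> s \<longrightarrow> s \<le> real n \<longrightarrow> (\<not> hits_before f R s \<longleftrightarrow> s \<le> c))" ..
    note c = c'[THEN conjunct1] c'[THEN conjunct2, THEN conjunct1]
      c'[THEN conjunct2, THEN conjunct2, rule_format]
    from before_hit_interval[of "real n" g R, OF of_nat_0_le_iff]
    obtain d where d': "0 \<le> d \<and> d \<le> real n \<and> (\<forall>s. 0 \<le> s \<longrightarrow> s \<le> real n \<longrightarrow> (\<not> hits_before g R s \<longleftrightarrow> s \<le> d))" ..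
    note d = d'[THEN conjunct1] d'[THEN conjunct2, THEN conjunct1]
      d'[THEN conjunct2, THEN conjunct2, rule_format]
    let ?K = "{0..c} \<times> {0..d} \<times> {0..\<alpha>}"
    have xK: "x k \<in> ?K" for k
      using x(1-5)[of k] c(3)[of "fst (x k)"] d(3)[of "fst (snd (x k))"] by (simp add: mem_Times_iff)
    have "compact ?K" by (intro compact_Times) auto
    then obtain l r where l: "l \<in> ?K" and r: "strict_mono (r::nat\<Rightarrow>nat)" "(x \<circ> r) \<longlonglongrightarrow> l"
      using xK unfolding compact_def by meson
    let ?F = "\<lambda>x. cmod (f (fst x) - cis (snd (snd x)) * g (fst (snd x)))"
    have cont: "continuous_on ?K ?F"
      by (intro continuous_intros continuous_on_compose2[OF f] continuous_on_compose2[OF g]) auto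
    have 1: "(\<lambda>n. ?F ((x \<circ> r) n)) \<longlonglongrightarrow> ?F l"
      using continuous_on_tendsto_compose[OF cont r(2) l] xK by (auto simp: o_def)
    have "(\<lambda>n. ?F (x n)) \<longlonglongrightarrow> 0"
    proof (rule tendsto_sandwich[OF _ _ tendsto_const LIMSEQ_inverse_real_of_nat])
      show "\<forall>\<^sub>F n in sequentially. ?F (x n) \<le> inverse (real (Suc n))"
      proof (rule always_eventually, rule allI)
        fix n show "?F (x n) \<le> inverse (real (Suc n))"
          using x(6)[of n] by (simp add: inverse_eq_divide add.commute)
      qed
    qed auto
    from LIMSEQ_subseq_LIMSEQ[OF this r(1)] have z: "(\<lambda>n. ?F ((x \<circ> r) n)) \<longlonglongrightarrow> 0"
      by (simp only: o_def)
    have "?F l = 0" by (rule LIMSEQ_unique[OF 1 z])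
    have lm: "0 \<le> fst l" "0 \<le> fst (snd l)" "snd (snd l) \<in> {0..\<alpha>}"
      using l by (simp_all add: mem_Times_iff)
    have nf: "\<not> hits_before f R (fst l)" using c(2) c(3)[of "fst l"] l by (simp add: mem_Times_iff)
    have ng: "\<not> hits_before g R (fst (snd l))" using d(2) d(3)[of "fst (snd l)"] l by (simp add: mem_Times_iff)
    have eq: "f (fst l) = cis (snd (snd l)) * g (fst (snd l))" using \<open>?F l = 0\<close> by simp
    show ?R
      by (rule exI[of _ "fst l"], rule conjI, fact, rule exI[of _ "fst (snd l)"], rule conjI, fact,
          rule bexI[of _ "snd (snd l)"], intro conjI) (fact nf ng eq lm)+
  qed
  then show ?thesis
    unfolding avoids_rat_def avoids_iff_hits hits_before_rat_iff[OF f] hits_before_rat_iff[OF g] by (simp only:)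
qed

text \<open>Only nonnegative times are read, so the condition makes sense for elements of
  \<open>path_space\<close>, which are functions restricted to \<open>{0..}\<close>.\<close>

lemma avoids_rat_restrict [simp]:
  "avoids_rat \<alpha> R (restrict f {0..}) g = avoids_rat \<alpha> R f g" "avoids_rat \<alpha> R f (restrict g {0..}) = avoids_rat \<alpha> R f g"
  unfolding avoids_rat_def by (simp_all cong: bex_cong)

section \<open>Brownian processes and their laws\<close>

definition gauss_density :: "real \<Rightarrow> complex \<Rightarrow> real" where
  "gauss_density r z = normal_density 0 (sqrt r) (Re z) * normal_density 0 (sqrt r) (Im z)"

definition gauss :: "real \<Rightarrow> complex measure" where
  "gauss r = density lborel (\<lambda>z. ennreal (gauss_density r z))"

lemma gauss_density_measurable [measurable]: "gauss_density r \<in> borel_measurable borel"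
  unfolding gauss_density_def by measurable

lemma gauss_density_eq: "0 < r \<Longrightarrow> gauss_density r z = exp (- (cmod z)\<^sup>2 / (2 * r)) / (2 * pi * r)"
proof -
  assume r: "0 < r"
  have "gauss_density r z = (exp (- (Re z)\<^sup>2 / (2 * r)) * exp (- (Im z)\<^sup>2 / (2 * r))) / (sqrt (2 * pi * r) * sqrt (2 * pi * r))"
    using r by (simp add: gauss_density_def normal_density_def)
  also have "exp (- (Re z)\<^sup>2 / (2 * r)) * exp (- (Im z)\<^sup>2 / (2 * r)) = exp (- (cmod z)\<^sup>2 / (2 * r))"
    unfolding exp_add[symmetric] cmod_power2 by (simp add: add_divide_distrib diff_divide_distrib)
  finally show ?thesis using r by simp
qed

lemma sets_gauss [measurable_cong, simp]: "sets (gauss r) = sets borel"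
  and space_gauss [simp]: "space (gauss r) = UNIV"
  by (simp_all add: gauss_def)

lemma Complex_measurable [measurable (raw)]:
  "f \<in> borel_measurable M \<Longrightarrow> g \<in> borel_measurable M \<Longrightarrow> (\<lambda>x. Complex (f x) (g x)) \<in> borel_measurable M"
  by (simp add: borel_measurable_complex_iff)

lemma cnj_measurable [measurable]: "cnj \<in> borel_measurable borel"
  by (intro borel_measurable_continuous_onI continuous_intros)

lemma lborel_complex: "(lborel :: complex measure) = distr (lborel \<Otimes>\<^sub>M lborel) borel (\<lambda>p. Complex (fst p) (snd p))"
proof (rule lborel_eqI)
  fix l u :: complex assume le: "\<And>b. b \<in> Basis \<Longrightarrow> l \<bullet> b \<le> u \<bullet> b"
  have [measurable]: "(\<lambda>p. Complex (fst p) (snd p)) \<in> borel_measurable (lborel \<Otimes>\<^sub>M lborel)"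
    by measurable
  have 1: "Re l \<le> Re u" using le[of 1] by (simp add: Basis_complex_def)
  have 2: "Im l \<le> Im u" using le[of \<i>] by (simp add: Basis_complex_def)
  have "(\<lambda>p. Complex (fst p) (snd p)) -` box l u \<inter> space (lborel \<Otimes>\<^sub>M lborel) = {Re l<..<Re u} \<times> {Im l<..<Im u}"
    by (auto simp: box_def Basis_complex_def space_pair_measure)
  then have "emeasure (distr (lborel \<Otimes>\<^sub>M lborel) borel (\<lambda>p. Complex (fst p) (snd p))) (box l u)
      = emeasure (lborel \<Otimes>\<^sub>M lborel) ({Re l<..<Re u} \<times> {Im l<..<Im u})"
    by (simp add: emeasure_distr)
  also have "\<dots> = ennreal (Re u - Re l) * ennreal (Im u - Im l)"
    using 1 2 by (simp add: lborel.emeasure_pair_measure_Times)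
  also have "\<dots> = (\<Prod>b\<in>Basis. (u - l) \<bullet> b)"
    using 1 2 by (simp add: Basis_complex_def ennreal_mult)
  finally show "emeasure (distr (lborel \<Otimes>\<^sub>M lborel) borel (\<lambda>p. Complex (fst p) (snd p))) (box l u) = (\<Prod>b\<in>Basis. (u - l) \<bullet> b)" .
qed simp

lemma nn_integral_complex:
  assumes [measurable]: "f \<in> borel_measurable borel"
  shows "(\<integral>\<^sup>+z. f z \<partial>lborel) = (\<integral>\<^sup>+x. (\<integral>\<^sup>+y. f (Complex x y) \<partial>lborel) \<partial>lborel)" (is "_ = ?A")
    and "(\<integral>\<^sup>+z. f z \<partial>lborel) = (\<integral>\<^sup>+y. (\<integral>\<^sup>+x. f (Complex x y) \<partial>lborel) \<partial>lborel)"
proof -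
  have "(\<integral>\<^sup>+z. f z \<partial>lborel) = (\<integral>\<^sup>+p. f (Complex (fst p) (snd p)) \<partial>(lborel \<Otimes>\<^sub>M lborel))"
    by (subst lborel_complex) (simp add: nn_integral_distr)
  also have "\<dots> = ?A"
    by (subst lborel.nn_integral_fst[symmetric]) simp_all
  finally show 1: "(\<integral>\<^sup>+z. f z \<partial>lborel) = ?A" .
  show "(\<integral>\<^sup>+z. f z \<partial>lborel) = (\<integral>\<^sup>+y. (\<integral>\<^sup>+x. f (Complex x y) \<partial>lborel) \<partial>lborel)"
    unfolding 1 by (rule lborel_pair.Fubini') measurable
qed

lemma nn_integral_complex_shear:
  assumes [measurable]: "f \<in> borel_measurable (borel :: complex measure)"
  shows "(\<integral>\<^sup>+z. f (Complex (Re z + a * Im z) (Im z)) \<partial>lborel) = (\<integral>\<^sup>+z. f z \<partial>lborel)"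
    and "(\<integral>\<^sup>+z. f (Complex (Re z) (Im z + a * Re z)) \<partial>lborel) = (\<integral>\<^sup>+z. f z \<partial>lborel)"
proof -
  have "(\<integral>\<^sup>+x. f (Complex x y) \<partial>lborel) = (\<integral>\<^sup>+x. f (Complex (x + a * y) y) \<partial>lborel)" for y
    by (subst nn_integral_real_affine[where c=1 and t="a * y"]) (simp_all add: add.commute)
  then show "(\<integral>\<^sup>+z. f (Complex (Re z + a * Im z) (Im z)) \<partial>lborel) = (\<integral>\<^sup>+z. f z \<partial>lborel)"
    by (subst (1 2) nn_integral_complex(2)) simp_all
  have "(\<integral>\<^sup>+y. f (Complex x y) \<partial>lborel) = (\<integral>\<^sup>+y. f (Complex x (y + a * x)) \<partial>lborel)" for x
    by (subst nn_integral_real_affine[where c=1 and t="a * x"]) (simp_all add: add.commute)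
  then show "(\<integral>\<^sup>+z. f (Complex (Re z) (Im z + a * Re z)) \<partial>lborel) = (\<integral>\<^sup>+z. f z \<partial>lborel)"
    by (subst (1 2) nn_integral_complex(1)) simp_all
qed

text \<open>A rotation other than the one by \<open>\<pi>\<close> is a product of three shears.\<close>

lemma nn_integral_lborel_rotate:
  assumes [measurable]: "f \<in> borel_measurable (borel :: complex measure)" and c: "cmod c = 1"
  shows "(\<integral>\<^sup>+z. f (c * z) \<partial>lborel) = (\<integral>\<^sup>+z. f z \<partial>lborel)"
proof -
  have *: "(\<integral>\<^sup>+z. f (c * z) \<partial>lborel) = (\<integral>\<^sup>+z. f z \<partial>lborel)"
    if f [measurable]: "f \<in> borel_measurable (borel :: complex measure)" and c: "cmod c = 1" and "Re c \<noteq> -1"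
    for f :: "complex \<Rightarrow> ennreal" and c
  proof -
    define s where "s = Im c"
    \<comment> \<open>The tangent of half the angle of rotation, up to sign the coefficient of the
      two outer shears; the middle shear has the sine \<open>s\<close>.\<close>
    define t where "t = s / (1 + Re c)"
    have n: "(Re c)\<^sup>2 + s\<^sup>2 = 1" using c cmod_power2[of c] by (simp add: s_def)
    have nz: "1 + Re c \<noteq> 0" using that(3) by auto
    have ts: "t * s = 1 - Re c" "t * (1 + Re c) = s"
      using n nz by (simp_all add: t_def field_simps power2_eq_square)
    have eq: "c * z = Complex (Re z - t * Im z - t * (Im z + s * (Re z - t * Im z))) (Im z + s * (Re z - t * Im z))" for z
    proof (rule complex_eqI)
      have "Re z - t * Im z - t * (Im z + s * (Re z - t * Im z)) = Re z * (1 - t * s) - Im z * (t * (1 + (1 - t * s)))"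
        by (simp add: algebra_simps)
      also have "\<dots> = Re (c * z)" unfolding ts using ts(2) by (simp add: s_def algebra_simps)
      finally show "Re (c * z) = Re (Complex (Re z - t * Im z - t * (Im z + s * (Re z - t * Im z))) (Im z + s * (Re z - t * Im z)))" by simp
      have "Im z + s * (Re z - t * Im z) = Im z * (1 - t * s) + s * Re z" by (simp add: algebra_simps)
      also have "\<dots> = Im (c * z)" unfolding ts by (simp add: s_def algebra_simps)
      finally show "Im (c * z) = Im (Complex (Re z - t * Im z - t * (Im z + s * (Re z - t * Im z))) (Im z + s * (Re z - t * Im z)))" by simp
    qed
    let ?f1 = "\<lambda>z. f (Complex (Re z + (- t) * Im z) (Im z))"
    let ?f2 = "\<lambda>z. ?f1 (Complex (Re z) (Im z + s * Re z))"
    have "(\<integral>\<^sup>+z. f (c * z) \<partial>lborel) = (\<integral>\<^sup>+z. ?f2 (Complex (Re z + (- t) * Im z) (Im z)) \<partial>lborel)"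
      unfolding eq by simp
    also have "\<dots> = (\<integral>\<^sup>+z. ?f2 z \<partial>lborel)" by (rule nn_integral_complex_shear) measurable
    also have "\<dots> = (\<integral>\<^sup>+z. ?f1 z \<partial>lborel)" by (rule nn_integral_complex_shear) measurable
    also have "\<dots> = (\<integral>\<^sup>+z. f z \<partial>lborel)" by (rule nn_integral_complex_shear) measurable
    finally show ?thesis .
  qed
  show ?thesis
  proof (cases "Re c = -1")
    \<comment> \<open>The excluded half turn is two quarter turns.\<close>
    case True
    then have "c = \<i> * \<i>" using c cmod_power2[of c] by (simp add: complex_eq_iff)
    then have "(\<integral>\<^sup>+z. f (c * z) \<partial>lborel) = (\<integral>\<^sup>+z. (\<lambda>w. f (\<i> * w)) (\<i> * z) \<partial>lborel)" by (simp add: mult.assoc)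
    also have "\<dots> = (\<integral>\<^sup>+z. f (\<i> * z) \<partial>lborel)" by (rule *) (simp_all, measurable)
    also have "\<dots> = (\<integral>\<^sup>+z. f z \<partial>lborel)" by (rule *) simp_all
    finally show ?thesis .
  next
    case False
    show ?thesis by (rule *[OF assms(1) c False])
  qed
qed

lemma nn_integral_lborel_cnj:
  assumes [measurable]: "f \<in> borel_measurable (borel :: complex measure)"
  shows "(\<integral>\<^sup>+z. f (cnj z) \<partial>lborel) = (\<integral>\<^sup>+z. f z \<partial>lborel)"
proof -
  have "(\<integral>\<^sup>+y. f (Complex x y) \<partial>lborel) = (\<integral>\<^sup>+y. f (Complex x (- y)) \<partial>lborel)" for x
    by (subst nn_integral_real_affine[where c="-1" and t=0]) simp_all
  moreover have "cnj (Complex x y) = Complex x (- y)" for x y by (simp add: complex_eq_iff)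
  ultimately show ?thesis
    by (subst (1 2) nn_integral_complex(1)) simp_all
qed

lemma nn_integral_lborel_scale:
  assumes [measurable]: "f \<in> borel_measurable (borel :: complex measure)" and a: "0 < a"
  shows "(\<integral>\<^sup>+z. f z \<partial>lborel) = ennreal (a\<^sup>2) * (\<integral>\<^sup>+z. f (complex_of_real a * z) \<partial>lborel)"
proof -
  have m: "complex_of_real a * Complex x y = Complex (a * x) (a * y)" for x y by (simp add: complex_eq_iff)
  have "(\<integral>\<^sup>+y. f (Complex x y) \<partial>lborel) = ennreal a * (\<integral>\<^sup>+y. f (Complex x (a * y)) \<partial>lborel)" for x
    using a by (subst nn_integral_real_affine[where c=a and t=0]) simp_all
  then have "(\<integral>\<^sup>+z. f z \<partial>lborel) = (\<integral>\<^sup>+x. ennreal a * (\<integral>\<^sup>+y. f (Complex x (a * y)) \<partial>lborel) \<partial>lborel)"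
    by (subst nn_integral_complex(1)) simp_all
  also have "\<dots> = ennreal a * (\<integral>\<^sup>+x. (\<integral>\<^sup>+y. f (Complex x (a * y)) \<partial>lborel) \<partial>lborel)"
    by (rule nn_integral_cmult) measurable
  also have "(\<integral>\<^sup>+x. (\<integral>\<^sup>+y. f (Complex x (a * y)) \<partial>lborel) \<partial>lborel) = ennreal a * (\<integral>\<^sup>+x. (\<integral>\<^sup>+y. f (Complex (a * x) (a * y)) \<partial>lborel) \<partial>lborel)"
    using a by (subst nn_integral_real_affine[where c=a and t=0]) simp_all
  also have "(\<integral>\<^sup>+x. (\<integral>\<^sup>+y. f (Complex (a * x) (a * y)) \<partial>lborel) \<partial>lborel) = (\<integral>\<^sup>+z. f (complex_of_real a * z) \<partial>lborel)"
    by (subst nn_integral_complex(1)) (simp_all add: m)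
  finally show ?thesis using a by (simp add: mult.assoc[symmetric] ennreal_mult' power2_eq_square)
qed

lemma nn_integral_gauss:
  assumes [measurable]: "f \<in> borel_measurable borel"
  shows "(\<integral>\<^sup>+z. f z \<partial>gauss r) = (\<integral>\<^sup>+z. ennreal (gauss_density r z) * f z \<partial>lborel)"
  unfolding gauss_def by (rule nn_integral_density) simp_all

lemma nn_integral_gauss_rotate:
  assumes [measurable]: "f \<in> borel_measurable borel" and r: "0 < r" and c: "cmod c = 1"
  shows "(\<integral>\<^sup>+z. f (c * z) \<partial>gauss r) = (\<integral>\<^sup>+z. f z \<partial>gauss r)"
proof -
  have "gauss_density r (c * z) = gauss_density r z" for z
    using r c by (simp add: gauss_density_eq norm_mult)
  then show ?thesis
    using nn_integral_lborel_rotate[of "\<lambda>z. ennreal (gauss_density r z) * f z" c] c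
    by (simp add: nn_integral_gauss)
qed

lemma nn_integral_gauss_cnj:
  assumes [measurable]: "f \<in> borel_measurable borel" and r: "0 < r"
  shows "(\<integral>\<^sup>+z. f (cnj z) \<partial>gauss r) = (\<integral>\<^sup>+z. f z \<partial>gauss r)"
proof -
  have "gauss_density r (cnj z) = gauss_density r z" for z
    using r by (simp add: gauss_density_eq)
  then show ?thesis
    using nn_integral_lborel_cnj[of "\<lambda>z. ennreal (gauss_density r z) * f z"]
    by (simp add: nn_integral_gauss)
qed

lemma nn_integral_gauss_scale:
  assumes [measurable]: "f \<in> borel_measurable borel" and r: "0 < r" and a: "0 < a"
  shows "(\<integral>\<^sup>+z. f (complex_of_real a * z) \<partial>gauss r) = (\<integral>\<^sup>+z. f z \<partial>gauss (a\<^sup>2 * r))"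
proof -
  have d: "a\<^sup>2 * gauss_density (a\<^sup>2 * r) (complex_of_real a * z) = gauss_density r z" for z
  proof -
    have "- (cmod (complex_of_real a * z))\<^sup>2 / (2 * (a\<^sup>2 * r)) = - (cmod z)\<^sup>2 / (2 * r)"
      using a by (simp add: norm_mult power_mult_distrib)
    then show ?thesis using a r by (simp add: gauss_density_eq)
  qed
  have "(\<integral>\<^sup>+z. f z \<partial>gauss (a\<^sup>2 * r)) = ennreal (a\<^sup>2) * (\<integral>\<^sup>+z. ennreal (gauss_density (a\<^sup>2 * r) (complex_of_real a * z)) * f (complex_of_real a * z) \<partial>lborel)"
    unfolding nn_integral_gauss[OF assms(1)] using a by (intro nn_integral_lborel_scale) measurable
  also have "\<dots> = (\<integral>\<^sup>+z. ennreal (a\<^sup>2) * (ennreal (gauss_density (a\<^sup>2 * r) (complex_of_real a * z)) * f (complex_of_real a * z)) \<partial>lborel)"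
    by (subst nn_integral_cmult) simp_all
  also have "\<dots> = (\<integral>\<^sup>+z. f (complex_of_real a * z) \<partial>gauss r)"
    by (simp add: nn_integral_gauss mult.assoc[symmetric] d ennreal_mult'[symmetric])
  finally show ?thesis ..
qed

lemma prob_space_gauss: "0 < r \<Longrightarrow> prob_space (gauss r)"
proof
  assume r: "0 < r"
  have n: "(\<integral>\<^sup>+x. ennreal (normal_density 0 (sqrt r) x) \<partial>lborel) = 1"
    using prob_space.emeasure_space_1[OF prob_space_normal_density[of "sqrt r" 0]] r
    by (simp add: emeasure_density)
  have "emeasure (gauss r) (space (gauss r)) = (\<integral>\<^sup>+z. ennreal (gauss_density r z) \<partial>lborel)"
    by (simp add: gauss_def emeasure_density)
  also have "\<dots> = (\<integral>\<^sup>+x. (\<integral>\<^sup>+y. ennreal (normal_density 0 (sqrt r) x) * ennreal (normal_density 0 (sqrt r) y) \<partial>lborel) \<partial>lborel)"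
    by (subst nn_integral_complex(1)) (simp_all add: gauss_density_def ennreal_mult')
  also have "\<dots> = 1"
    by (simp add: nn_integral_cmult n)
  finally show "emeasure (gauss r) (space (gauss r)) = 1" .
qed

text \<open>The Markov property with respect to finitely many past times. Unlike the definition by independent
  increments it is visibly preserved under gluing at a stopping time, and it determines the law of the
  path from the law of the starting point.\<close>

definition brownian_process :: "'a measure \<Rightarrow> (real \<Rightarrow> 'a \<Rightarrow> complex) \<Rightarrow> bool" where
  "brownian_process N X \<longleftrightarrow> prob_space N \<and> (\<forall>t\<ge>0. X t \<in> borel_measurable N) \<and>
    (\<forall>x\<in>space N. continuous_on {0..} (\<lambda>t. X t x)) \<and>
    (\<forall>u t J \<Phi> g. 0 \<le> u \<longrightarrow> u < t \<longrightarrow> finite J \<longrightarrow> J \<subseteq> {0..u} \<longrightarrow>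
       \<Phi> \<in> borel_measurable (PiM J (\<lambda>_. borel)) \<longrightarrow> g \<in> borel_measurable borel \<longrightarrow>
       (\<integral>\<^sup>+x. \<Phi> (\<lambda>i\<in>J. X i x) * g (X t x) \<partial>N) =
       (\<integral>\<^sup>+x. \<Phi> (\<lambda>i\<in>J. X i x) * (\<integral>\<^sup>+y. g (X u x + y) \<partial>gauss (t - u)) \<partial>N))"

lemma brownian_processD:
  assumes "brownian_process N X"
  shows "prob_space N" "\<And>t. 0 \<le> t \<Longrightarrow> X t \<in> borel_measurable N"
    "\<And>x. x \<in> space N \<Longrightarrow> continuous_on {0..} (\<lambda>t. X t x)"
    "\<And>u t J \<Phi> g. 0 \<le> u \<Longrightarrow> u < t \<Longrightarrow> finite J \<Longrightarrow> J \<subseteq> {0..u} \<Longrightarrow>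
       \<Phi> \<in> borel_measurable (PiM J (\<lambda>_. borel)) \<Longrightarrow> g \<in> borel_measurable borel \<Longrightarrow>
       (\<integral>\<^sup>+x. \<Phi> (\<lambda>i\<in>J. X i x) * g (X t x) \<partial>N) =
       (\<integral>\<^sup>+x. \<Phi> (\<lambda>i\<in>J. X i x) * (\<integral>\<^sup>+y. g (X u x + y) \<partial>gauss (t - u)) \<partial>N)"
  using assms unfolding brownian_process_def by (simp_all only: simp_thms)

lemma brownian_processI:
  assumes "prob_space N" "\<And>t. 0 \<le> t \<Longrightarrow> X t \<in> borel_measurable N"
    "\<And>x. x \<in> space N \<Longrightarrow> continuous_on {0..} (\<lambda>t. X t x)"
    "\<And>u t J \<Phi> g. 0 \<le> u \<Longrightarrow> u < t \<Longrightarrow> finite J \<Longrightarrow> J \<subseteq> {0..u} \<Longrightarrow>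
       \<Phi> \<in> borel_measurable (PiM J (\<lambda>_. borel)) \<Longrightarrow> g \<in> borel_measurable borel \<Longrightarrow>
       (\<integral>\<^sup>+x. \<Phi> (\<lambda>i\<in>J. X i x) * g (X t x) \<partial>N) =
       (\<integral>\<^sup>+x. \<Phi> (\<lambda>i\<in>J. X i x) * (\<integral>\<^sup>+y. g (X u x + y) \<partial>gauss (t - u)) \<partial>N)"
  shows "brownian_process N X"
  unfolding brownian_process_def using assms by simp

text \<open>Independence of increments is assumed along infinite increasing sequences that start at
  0. Finitely many past times together with 0, \<open>u\<close> and \<open>t\<close> therefore have
  to be embedded into such a sequence, with \<open>u\<close> and \<open>t\<close> as
  neighbours.\<close>

lemma ex_increasing_enumeration:
  fixes u t :: real
  assumes J: "finite J" "J \<subseteq> {0..u}" and u: "0 \<le> u" "u < t"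
  obtains \<tau> m where "\<tau> 0 = 0" "strict_mono \<tau>" "\<tau> m = u" "\<tau> (Suc m) = t" "J \<subseteq> \<tau> ` {..m}"
proof -
  define S where "S = insert 0 (insert u J)"
  define xs where "xs = sorted_list_of_set S"
  have fS: "finite S" using J by (simp add: S_def)
  have xs: "sorted_wrt (<) xs" "set xs = S" by (simp_all add: xs_def fS strict_sorted_iff)
  have ne: "xs \<noteq> []" using xs(2) by (auto simp: S_def)
  define m where "m = length xs - 1"
  have len: "length xs = Suc m" using ne by (simp add: m_def)
  have mono: "xs ! i < xs ! j" if "i < j" "j \<le> m" for i j
    using xs(1) that len by (simp add: sorted_wrt_nth_less)
  have mem: "xs ! i \<in> S" if "i \<le> m" for i using that len xs(2) by (metis less_Suc_eq_le nth_mem)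
  have S_le: "x \<le> u" "0 \<le> x" if "x \<in> S" for x using that J u by (auto simp: S_def)
  have ex: "\<exists>i\<le>m. xs ! i = x" if "x \<in> S" for x
    using that xs(2) len by (metis in_set_conv_nth less_Suc_eq_le)
  obtain i where i: "i \<le> m" "xs ! i = 0" using ex[of 0] by (auto simp: S_def)
  have x0: "xs ! 0 = 0"
    using mono[of 0 i] i S_le(2)[OF mem[of 0]] by (cases "i = 0") auto
  obtain j where j: "j \<le> m" "xs ! j = u" using ex[of u] by (auto simp: S_def)
  have xm: "xs ! m = u"
    using mono[of j m] j S_le(1)[OF mem[of m]] by (cases "j = m") auto
  \<comment> \<open>The tail beyond \<open>t\<close> only completes the finite list to an infinite
    sequence.\<close>
  define \<tau> where "\<tau> k = (if k \<le> m then xs ! k else t + real (k - Suc m))" for k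
  have "strict_mono \<tau>"
  proof (rule strict_monoI_Suc)
    fix k show "\<tau> k < \<tau> (Suc k)"
    proof (cases "Suc k \<le> m")
      case True then show ?thesis using mono[of k "Suc k"] by (simp add: \<tau>_def)
    next
      case False
      then show ?thesis using xm u by (cases "k = m") (auto simp: \<tau>_def Suc_diff_le)
    qed
  qed
  moreover have "J \<subseteq> \<tau> ` {..m}"
  proof
    fix x assume "x \<in> J"
    then obtain i where "i \<le> m" "xs ! i = x" using ex[of x] by (auto simp: S_def)
    then show "x \<in> \<tau> ` {..m}" by (intro image_eqI[of _ _ i]) (auto simp: \<tau>_def)
  qed
  ultimately show ?thesis by (intro that[of \<tau> m]) (simp_all add: \<tau>_def x0 xm)
qed

text \<open>The values at the times in \<open>J\<close> are partial sums of the start and the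
  increments up to \<open>u\<close>, hence functions of the block \<open>Y\<close>; the increment
  from \<open>u\<close> to \<open>t\<close> is the next member of the independent family. Fubini for
  their product law yields the Markov identity.\<close>

lemma planar_brownian_motion_process:
  assumes "planar_brownian_motion M B"
  shows "brownian_process M B"
proof -
  interpret planar_brownian_motion M B by fact
  show ?thesis
  proof (rule brownian_processI)
    show "prob_space M" by (rule prob_space_axioms)
    show "B t \<in> borel_measurable M" if "0 \<le> t" for t by (rule measurable_at[OF that])
    show "continuous_on {0..} (\<lambda>t. B t \<omega>)" if "\<omega> \<in> space M" for \<omega> by (rule continuous_paths[OF that])
    fix u t :: real and J and \<Phi> :: "(real \<Rightarrow> complex) \<Rightarrow> ennreal" and g :: "complex \<Rightarrow> ennreal"
    assume u: "0 \<le> u" "u < t" and J: "finite J" "J \<subseteq> {0..u}"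
      and \<Phi>[measurable]: "\<Phi> \<in> borel_measurable (PiM J (\<lambda>_. borel))" and g[measurable]: "g \<in> borel_measurable borel"
    from ex_increasing_enumeration[OF J u] obtain \<tau> m
      where \<tau>: "\<tau> 0 = 0" "strict_mono \<tau>" "\<tau> m = u" "\<tau> (Suc m) = t" "J \<subseteq> \<tau> ` {..m}" .
    define D where "D = case_nat (B 0) (\<lambda>k \<omega>. B (\<tau> (Suc k)) \<omega> - B (\<tau> k) \<omega>)"
    have ind: "indep_vars (\<lambda>_. borel) D UNIV"
      unfolding D_def by (rule independent_increments[OF \<tau>(1,2)])
    have Bsum: "B (\<tau> k) \<omega> = (\<Sum>j\<le>k. D j \<omega>)" for k \<omega>
      by (induction k) (simp_all add: D_def \<tau>(1))
    define \<xi> where "\<xi> \<omega> = B t \<omega> - B u \<omega>" for \<omega>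
    have \<xi>: "\<xi> = D (Suc m)" by (simp add: \<xi>_def D_def \<tau> fun_eq_iff)
    define Y where "Y \<omega> = restrict (\<lambda>i. D i \<omega>) {..m}" for \<omega>
    define Z where "Z \<omega> = restrict (\<lambda>i. D i \<omega>) {Suc m}" for \<omega>
    have iv: "indep_var (PiM {..m} (\<lambda>_. borel)) Y (PiM {Suc m} (\<lambda>_. borel)) Z"
      unfolding Y_def Z_def by (rule indep_var_restrict[OF ind]) auto
    have Ym: "Y \<in> measurable M (PiM {..m} (\<lambda>_. borel))" and Zm [measurable]: "Z \<in> measurable M (PiM {Suc m} (\<lambda>_. borel))"
      using iv by (auto dest: indep_var_rv1 indep_var_rv2)
    have Z\<xi>: "Z \<omega> (Suc m) = \<xi> \<omega>" for \<omega> by (simp add: Z_def \<xi>)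
    have Zc: "(\<lambda>z. z (Suc m)) \<in> borel_measurable (PiM {Suc m} (\<lambda>_. borel))"
      by (rule measurable_component_singleton) simp
    have \<xi>m [measurable]: "\<xi> \<in> borel_measurable M"
      using measurable_compose[OF Zm Zc] by (simp add: Z\<xi>[abs_def])
    interpret Z: prob_space "distr M (PiM {Suc m} (\<lambda>_. borel)) Z" by (rule prob_space_distr) measurable
    note Ym [measurable]
    have dist\<xi>: "distr M borel \<xi> = gauss (t - u)"
    proof -
      have "distr M lborel \<xi> = gauss (t - u)"
        using gaussian_increments[OF u] unfolding distributed_def \<xi>_def gauss_def gauss_density_def by simp
      moreover have "distr M lborel \<xi> = distr M borel \<xi>" by (rule distr_cong) simp_all
      ultimately show ?thesis by simp
    qed
    interpret G: prob_space "gauss (t - u)" using u by (intro prob_space_gauss) simp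
    define idx where "idx i = (SOME k. k \<le> m \<and> \<tau> k = i)" for i
    have idx: "idx i \<le> m \<and> \<tau> (idx i) = i" if "i \<in> J" for i
      unfolding idx_def by (rule someI_ex) (use \<tau>(5) that in auto)
    define F where "F y = \<Phi> (\<lambda>i\<in>J. \<Sum>j\<le>idx i. y j)" for y :: "nat \<Rightarrow> complex"
    define h where "h y = (\<Sum>j\<le>m. y j)" for y :: "nat \<Rightarrow> complex"
    have comp [measurable]: "(\<lambda>y. y j) \<in> borel_measurable (PiM {..m} (\<lambda>_. borel))" if "j \<le> m" for j
      using that by (intro measurable_component_singleton) simp
    have [measurable]: "h \<in> borel_measurable (PiM {..m} (\<lambda>_. borel))"
      unfolding h_def by (intro borel_measurable_sum) simp
    have "(\<lambda>y. \<lambda>i\<in>J. \<Sum>j\<le>idx i. y j) \<in> measurable (PiM {..m} (\<lambda>_. borel :: complex measure)) (PiM J (\<lambda>_. borel))"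
      by (intro measurable_restrict borel_measurable_sum comp) (use idx in fastforce)
    from measurable_compose[OF this \<Phi>]
    have [measurable]: "F \<in> borel_measurable (PiM {..m} (\<lambda>_. borel))" unfolding F_def .
    have FY: "F (Y \<omega>) = \<Phi> (\<lambda>i\<in>J. B i \<omega>)" for \<omega>
    proof -
      have "(\<Sum>j\<le>idx i. Y \<omega> j) = B i \<omega>" if "i \<in> J" for i
      proof -
        have "(\<Sum>j\<le>idx i. Y \<omega> j) = (\<Sum>j\<le>idx i. D j \<omega>)"
          using idx[OF that] by (intro sum.cong) (auto simp: Y_def)
        then show ?thesis using Bsum[of "idx i" \<omega>] idx[OF that] by simp
      qed
      then show ?thesis unfolding F_def by (intro arg_cong[of _ _ \<Phi>] restrict_ext)
    qed
    have hY: "h (Y \<omega>) = B u \<omega>" for \<omega>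
      using Bsum[of m \<omega>] by (simp add: h_def Y_def \<tau>)
    let ?L = "distr M (PiM {..m} (\<lambda>_. borel)) Y" and ?R = "distr M (PiM {Suc m} (\<lambda>_. borel)) Z"
    let ?H = "\<lambda>p. F (fst p) * g (h (fst p) + snd p (Suc m))"
    have gm: "(\<lambda>x. g (w + x)) \<in> borel_measurable borel" for w by measurable
    have m: "(\<lambda>z. F y * g (h y + z (Suc m))) \<in> borel_measurable (PiM {Suc m} (\<lambda>_. borel))" for y
      by (intro borel_measurable_times_ennreal borel_measurable_const measurable_compose[OF Zc gm])
    have inner: "(\<integral>\<^sup>+z. F y * g (h y + z (Suc m)) \<partial>?R) = F y * (\<integral>\<^sup>+x. g (h y + x) \<partial>gauss (t - u))" for y
    proof -
      have "(\<integral>\<^sup>+z. F y * g (h y + z (Suc m)) \<partial>?R) = (\<integral>\<^sup>+\<omega>. F y * g (h y + \<xi> \<omega>) \<partial>M)"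
        by (subst nn_integral_distr[OF Zm]) (simp_all add: Z\<xi> m)
      also have "\<dots> = (\<integral>\<^sup>+x. F y * g (h y + x) \<partial>distr M borel \<xi>)"
        by (subst nn_integral_distr) simp_all
      also have "\<dots> = F y * (\<integral>\<^sup>+x. g (h y + x) \<partial>gauss (t - u))"
        unfolding dist\<xi> by (rule nn_integral_cmult) (simp add: measurable_cong_sets[OF sets_gauss refl] gm)
      finally show ?thesis .
    qed
    have Hs: "(\<lambda>p. snd p (Suc m)) \<in> borel_measurable (PiM {..m} (\<lambda>_. borel :: complex measure) \<Otimes>\<^sub>M PiM {Suc m} (\<lambda>_. borel :: complex measure))"
      by (rule measurable_compose[OF measurable_snd Zc])
    have Hm: "?H \<in> borel_measurable (PiM {..m} (\<lambda>_. borel) \<Otimes>\<^sub>M PiM {Suc m} (\<lambda>_. borel))"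
      by (intro borel_measurable_times_ennreal measurable_compose[OF _ g] borel_measurable_add Hs) measurable
    have Hm': "?H \<in> borel_measurable (?L \<Otimes>\<^sub>M ?R)"
      using Hm by (simp cong: measurable_cong_sets sets_pair_measure_cong)
    have YZ: "(\<lambda>\<omega>. (Y \<omega>, Z \<omega>)) \<in> measurable M (PiM {..m} (\<lambda>_. borel) \<Otimes>\<^sub>M PiM {Suc m} (\<lambda>_. borel))"
      by (intro measurable_Pair Ym Zm)
    have "(\<integral>\<^sup>+\<omega>. \<Phi> (\<lambda>i\<in>J. B i \<omega>) * g (B t \<omega>) \<partial>M) = (\<integral>\<^sup>+\<omega>. ?H (Y \<omega>, Z \<omega>) \<partial>M)"
      by (simp add: FY hY Z\<xi>) (simp add: \<xi>_def)
    also have "\<dots> = (\<integral>\<^sup>+p. ?H p \<partial>(distr M (PiM {..m} (\<lambda>_. borel) \<Otimes>\<^sub>M PiM {Suc m} (\<lambda>_. borel)) (\<lambda>\<omega>. (Y \<omega>, Z \<omega>))))"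
      by (rule nn_integral_distr[OF YZ, symmetric]) (simp add: Hm)
    also have "distr M (PiM {..m} (\<lambda>_. borel) \<Otimes>\<^sub>M PiM {Suc m} (\<lambda>_. borel)) (\<lambda>\<omega>. (Y \<omega>, Z \<omega>)) = ?L \<Otimes>\<^sub>M ?R"
      using iv unfolding indep_var_distribution_eq by simp
    also have "(\<integral>\<^sup>+p. ?H p \<partial>(?L \<Otimes>\<^sub>M ?R)) = (\<integral>\<^sup>+y. (\<integral>\<^sup>+z. F y * g (h y + z (Suc m)) \<partial>?R) \<partial>?L)"
      using Z.nn_integral_fst[OF Hm'] by simp
    also have "\<dots> = (\<integral>\<^sup>+\<omega>. F (Y \<omega>) * (\<integral>\<^sup>+x. g (h (Y \<omega>) + x) \<partial>gauss (t - u)) \<partial>M)"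
      unfolding inner by (subst nn_integral_distr) simp_all
    also have "\<dots> = (\<integral>\<^sup>+\<omega>. \<Phi> (\<lambda>i\<in>J. B i \<omega>) * (\<integral>\<^sup>+y. g (B u \<omega> + y) \<partial>gauss (t - u)) \<partial>M)"
      by (simp add: FY hY)
    finally show "(\<integral>\<^sup>+\<omega>. \<Phi> (\<lambda>i\<in>J. B i \<omega>) * g (B t \<omega>) \<partial>M) = (\<integral>\<^sup>+\<omega>. \<Phi> (\<lambda>i\<in>J. B i \<omega>) * (\<integral>\<^sup>+y. g (B u \<omega> + y) \<partial>gauss (t - u)) \<partial>M)" .
  qed
qed

section \<open>Laws on path space and their uniqueness\<close>

definition path_space :: "(real \<Rightarrow> complex) measure" where
  "path_space = PiM {0..} (\<lambda>_. borel)"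

definition path_law :: "'a measure \<Rightarrow> (real \<Rightarrow> 'a \<Rightarrow> complex) \<Rightarrow> (real \<Rightarrow> complex) measure" where
  "path_law N X = distr N path_space (\<lambda>x. \<lambda>t\<in>{0..}. X t x)"

lemma measurable_path:
  assumes "\<And>t. 0 \<le> t \<Longrightarrow> X t \<in> borel_measurable N"
  shows "(\<lambda>x. \<lambda>t\<in>{0..}. X t x) \<in> measurable N path_space"
  unfolding path_space_def by (intro measurable_restrict assms) simp

lemma emeasure_path_law_cylinder:
  fixes K :: "'c measure" and A :: "real \<Rightarrow> complex set"
  assumes Z: "\<And>t. 0 \<le> t \<Longrightarrow> Z t \<in> borel_measurable K"
    and J: "finite J" "J \<subseteq> {0..}" and A: "\<And>i. i \<in> J \<Longrightarrow> A i \<in> sets borel"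
  shows "emeasure (path_law K Z) (prod_emb {0..} (\<lambda>_. borel) J (Pi\<^sub>E J A)) = (\<integral>\<^sup>+x. (\<Prod>i\<in>J. indicator (if i \<in> J then A i else {}) (Z i x)) \<partial>K)"
proof -
    have "emeasure (path_law K Z) (prod_emb {0..} (\<lambda>_. borel) J (Pi\<^sub>E J A))
      = emeasure K ((\<lambda>x. \<lambda>t\<in>{0..}. Z t x) -` prod_emb {0..} (\<lambda>_. borel) J (Pi\<^sub>E J A) \<inter> space K)"
      unfolding path_law_def
      by (rule emeasure_distr[OF measurable_path[OF Z]]) (use J A in \<open>auto simp: path_space_def intro!: sets_PiM_I\<close>)
    also have "(\<lambda>x. \<lambda>t\<in>{0..}. Z t x) -` prod_emb {0..} (\<lambda>_. borel) J (Pi\<^sub>E J A) \<inter> space K = {x\<in>space K. \<forall>i\<in>J. Z i x \<in> A i}"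
      using J by (auto simp: prod_emb_def PiE_iff subset_iff extensional_def)
    also have "emeasure K {x\<in>space K. \<forall>i\<in>J. Z i x \<in> A i} = (\<integral>\<^sup>+x. indicator {x\<in>space K. \<forall>i\<in>J. Z i x \<in> A i} x \<partial>K)"
    proof (rule nn_integral_indicator[symmetric])
      have [measurable]: "Z i \<in> borel_measurable K" "A i \<in> sets borel" if "i \<in> J" for i using that J Z A by auto
      show "{x\<in>space K. \<forall>i\<in>J. Z i x \<in> A i} \<in> sets K" using J(1) by measurable
    qed
    also have "\<dots> = (\<integral>\<^sup>+x. (\<Prod>i\<in>J. indicator (if i \<in> J then A i else {}) (Z i x)) \<partial>K)"
    proof (rule nn_integral_cong)
      fix x assume x: "x \<in> space K"
      show "indicator {x \<in> space K. \<forall>i\<in>J. Z i x \<in> A i} x = (\<Prod>i\<in>J. indicator (if i \<in> J then A i else {}) (Z i x) :: ennreal)"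
      proof (cases "\<forall>i\<in>J. Z i x \<in> A i")
        case True then show ?thesis using x by simp
      next
        case False
        then obtain i where "i \<in> J" "Z i x \<notin> A i" by auto
        then have "(\<Prod>i\<in>J. indicator (if i \<in> J then A i else {}) (Z i x) :: ennreal) = 0"
          using J(1) by (intro prod_zero bexI[of _ i]) auto
        then show ?thesis using False by simp
      qed
    qed
    finally show ?thesis .
qed

lemma path_law_eqI:
  assumes N: "prob_space N" "\<And>t. 0 \<le> t \<Longrightarrow> X t \<in> borel_measurable N"
    and N': "prob_space N'" "\<And>t. 0 \<le> t \<Longrightarrow> X' t \<in> borel_measurable N'"
    and eq: "\<And>J A. finite J \<Longrightarrow> J \<subseteq> {0..} \<Longrightarrow> (\<And>i. A i \<in> sets borel) \<Longrightarrow>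
      (\<integral>\<^sup>+x. (\<Prod>i\<in>J. indicator (A i) (X i x)) \<partial>N) = (\<integral>\<^sup>+x. (\<Prod>i\<in>J. indicator (A i) (X' i x)) \<partial>N')"
  shows "path_law N X = path_law N' X'"
proof (rule measure_eqI_PiM_infinite)
  show "sets (path_law N X) = sets (PiM {0..} (\<lambda>_. borel))" "sets (path_law N' X') = sets (PiM {0..} (\<lambda>_. borel))"
    by (simp_all add: path_law_def path_space_def)
  show "finite_measure (path_law N X)"
    unfolding path_law_def by (intro prob_space.finite_measure prob_space.prob_space_distr N measurable_path)
  fix A :: "real \<Rightarrow> complex set" and J
  assume J: "finite J" "J \<subseteq> {0..}" and A: "\<And>i. i \<in> J \<Longrightarrow> A i \<in> sets borel"
  show "emeasure (path_law N X) (prod_emb {0..} (\<lambda>_. borel) J (Pi\<^sub>E J A)) = emeasure (path_law N' X') (prod_emb {0..} (\<lambda>_. borel) J (Pi\<^sub>E J A))"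
    
    using eq[OF J, of "\<lambda>i. if i \<in> J then A i else {}"] A
      emeasure_path_law_cylinder[OF N(2) J A] emeasure_path_law_cylinder[OF N'(2) J A]
    by simp
qed

text \<open>The Markov property integrates out the factor at the last time \<open>b\<close> and
  merges it into the factor at the preceding time \<open>u\<close>. The new factors
  \<open>f'\<close> are built without reference to the process, so two processes can be reduced in
  parallel, down to time 0, where their starting laws agree.\<close>

lemma brownian_process_prod_step:
  assumes Z: "brownian_process K Z" and fin: "finite (insert 0 A)" and u: "u \<in> insert 0 A"
    and Au: "insert 0 A \<subseteq> {0..u}" and ub: "0 \<le> u" "u < b"
    and f: "\<And>i. f i \<in> borel_measurable borel"
    and f': "\<And>i. f' i = (if i = u then (\<lambda>z. f u z * (\<integral>\<^sup>+y. f b (z + y) \<partial>gauss (b - u))) else f i)"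
  shows "(\<integral>\<^sup>+x. (\<Prod>i\<in>insert 0 (insert b A). f i (Z i x)) \<partial>K) = (\<integral>\<^sup>+x. (\<Prod>i\<in>insert 0 A. f' i (Z i x)) \<partial>K)"
proof -
    define \<Phi> where "\<Phi> y = (\<Prod>i\<in>insert 0 A. f i (y i))" for y :: "real \<Rightarrow> complex"
    have \<Phi>: "\<Phi> \<in> borel_measurable (PiM (insert 0 A) (\<lambda>_. borel))"
      unfolding \<Phi>_def
    proof (intro borel_measurable_prod_ennreal)
    fix i assume "i \<in> insert 0 A"
    then show "(\<lambda>y. f i (y i)) \<in> borel_measurable (PiM (insert 0 A) (\<lambda>_. borel))"
      by (intro measurable_compose[where f="\<lambda>y. y i" and g="f i" and N=borel] f) (rule measurable_component_singleton)
  qed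
    have \<Phi>Z: "\<Phi> (\<lambda>i\<in>insert 0 A. Z i x) = (\<Prod>i\<in>insert 0 A. f i (Z i x))" for x
      unfolding \<Phi>_def by (intro prod.cong) auto
    have bn: "b \<notin> insert 0 A" using Au ub by auto
    have "(\<integral>\<^sup>+x. (\<Prod>i\<in>insert 0 (insert b A). f i (Z i x)) \<partial>K) = (\<integral>\<^sup>+x. \<Phi> (\<lambda>i\<in>insert 0 A. Z i x) * f b (Z b x) \<partial>K)"
      using bn fin unfolding \<Phi>Z insert_commute[of 0 b] by (simp add: mult.commute)
    also have "\<dots> = (\<integral>\<^sup>+x. \<Phi> (\<lambda>i\<in>insert 0 A. Z i x) * (\<integral>\<^sup>+y. f b (Z u x + y) \<partial>gauss (b - u)) \<partial>K)"
      by (rule brownian_processD(4)[OF Z ub fin Au \<Phi> f])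
    also have "\<dots> = (\<integral>\<^sup>+x. (\<Prod>i\<in>insert 0 A. f' i (Z i x)) \<partial>K)"
    proof (rule nn_integral_cong)
      fix x
      have "(\<Prod>i\<in>insert 0 A. f i (Z i x)) = f u (Z u x) * (\<Prod>i\<in>insert 0 A - {u}. f i (Z i x))"
        by (rule prod.remove[OF fin u])
      moreover have "(\<Prod>i\<in>insert 0 A. f' i (Z i x)) = f' u (Z u x) * (\<Prod>i\<in>insert 0 A - {u}. f' i (Z i x))"
        by (rule prod.remove[OF fin u])
      moreover have "(\<Prod>i\<in>insert 0 A - {u}. f' i (Z i x)) = (\<Prod>i\<in>insert 0 A - {u}. f i (Z i x))"
        by (intro prod.cong) (auto simp: f')
      ultimately show "\<Phi> (\<lambda>i\<in>insert 0 A. Z i x) * (\<integral>\<^sup>+y. f b (Z u x + y) \<partial>gauss (b - u)) = (\<Prod>i\<in>insert 0 A. f' i (Z i x))"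
        unfolding \<Phi>Z by (simp add: f' mult_ac)
    qed
    finally show ?thesis .
qed

lemma brownian_process_prod_eq:
  assumes X: "brownian_process N X" and X': "brownian_process N' X'"
    and start: "distr N borel (X 0) = distr N' borel (X' 0)"
    and J: "finite J" "J \<subseteq> {0<..}" and f: "\<And>i. f i \<in> borel_measurable borel"
  shows "(\<integral>\<^sup>+x. (\<Prod>i\<in>insert 0 J. f i (X i x)) \<partial>N) = (\<integral>\<^sup>+x. (\<Prod>i\<in>insert 0 J. f i (X' i x)) \<partial>N')"
  using J f
proof (induction J arbitrary: f rule: finite_linorder_max_induct)
  case empty
  note [measurable] = brownian_processD(2)[OF X, of 0] brownian_processD(2)[OF X', of 0] empty(2)
  have "(\<integral>\<^sup>+x. f 0 (X 0 x) \<partial>N) = (\<integral>\<^sup>+z. f 0 z \<partial>distr N borel (X 0))" by (simp add: nn_integral_distr)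
  also have "\<dots> = (\<integral>\<^sup>+x. f 0 (X' 0 x) \<partial>N')" unfolding start by (simp add: nn_integral_distr)
  finally show ?case by simp
next
  case (insert b A)
  define u where "u = Max (insert 0 A)"
  have u: "u \<in> insert 0 A" unfolding u_def by (rule Max_in) (use insert in auto)
  have Au: "insert 0 A \<subseteq> {0..u}" using insert(1,4) by (auto simp: u_def less_imp_le)
  have ub: "0 \<le> u" "u < b" using u insert(2,4) Au by auto
  note [measurable] = insert(5)
  have fin: "finite (insert 0 A)" using insert by simp
  interpret G: prob_space "gauss (b - u)" using ub by (intro prob_space_gauss) simp
  define f' where "f' i = (if i = u then (\<lambda>z. f u z * (\<integral>\<^sup>+y. f b (z + y) \<partial>gauss (b - u))) else f i)" for i
  have f'm: "f' i \<in> borel_measurable borel" for i unfolding f'_def by simp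
  show ?case unfolding brownian_process_prod_step[OF X fin u Au ub insert(5) f'_def] brownian_process_prod_step[OF X' fin u Au ub insert(5) f'_def]
    by (rule insert(3)) (use insert(4) f'm in auto)
qed

lemma brownian_process_law_unique:
  assumes X: "brownian_process N X" and X': "brownian_process N' X'"
    and start: "distr N borel (X 0) = distr N' borel (X' 0)"
  shows "path_law N X = path_law N' X'"
proof (rule path_law_eqI)
  fix J :: "real set" and A :: "real \<Rightarrow> complex set"
  assume J: "finite J" "J \<subseteq> {0..}" and A: "\<And>i. A i \<in> sets borel"
  define f :: "real \<Rightarrow> complex \<Rightarrow> ennreal" where "f i = (if i \<in> J then indicator (A i) else (\<lambda>_. 1))" for i
  have f: "f i \<in> borel_measurable borel" for i using A[of i] by (simp add: f_def)
  have *: "(\<Prod>i\<in>insert 0 (J - {0}). f i (Z i)) = (\<Prod>i\<in>J. indicator (A i) (Z i) :: ennreal)" for Z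
    by (rule prod.mono_neutral_cong_right) (use J in \<open>auto simp: f_def\<close>)
  show "(\<integral>\<^sup>+x. (\<Prod>i\<in>J. indicator (A i) (X i x)) \<partial>N) = (\<integral>\<^sup>+x. (\<Prod>i\<in>J. indicator (A i) (X' i x)) \<partial>N')"
    using brownian_process_prod_eq[OF X X' start, of "J - {0}" f] J f unfolding * by (simp add: subset_iff less_le)
qed (use brownian_processD[OF X] brownian_processD[OF X'] in auto)

lemma measurable_path_restrict:
  assumes "\<And>i. i \<in> J \<Longrightarrow> f i \<in> borel_measurable N"
  shows "(\<lambda>x. \<lambda>i\<in>J. f i x) \<in> measurable N (PiM J (\<lambda>_. borel))"
  by (intro measurable_restrict assms)

text \<open>One statement for translations, rotations and conjugation: \<open>h\<close> has to turn
  a Gaussian increment into an equally distributed one. Scaling also changes the clock and is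
  treated separately.\<close>

lemma brownian_process_map:
  assumes X: "brownian_process N X" and h: "continuous_on UNIV h"
    and inv: "\<And>r w g. 0 < r \<Longrightarrow> g \<in> borel_measurable borel \<Longrightarrow>
      (\<integral>\<^sup>+y. g (h (w + y)) \<partial>gauss r) = (\<integral>\<^sup>+y. g (h w + y) \<partial>gauss r)"
  shows "brownian_process N (\<lambda>t x. h (X t x))"
proof (rule brownian_processI)
  have hm [measurable]: "h \<in> borel_measurable borel" by (rule borel_measurable_continuous_onI[OF h])
  show "prob_space N" by (rule brownian_processD[OF X])
  show "(\<lambda>x. h (X t x)) \<in> borel_measurable N" if "0 \<le> t" for t
    using brownian_processD(2)[OF X that] by measurable
  show "continuous_on {0..} (\<lambda>t. h (X t x))" if "x \<in> space N" for x
    by (rule continuous_on_compose2[OF h brownian_processD(3)[OF X that]]) simp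
  fix u t :: real and J and \<Phi> :: "(real \<Rightarrow> complex) \<Rightarrow> ennreal" and g :: "complex \<Rightarrow> ennreal"
  assume u: "0 \<le> u" "u < t" and J: "finite J" "J \<subseteq> {0..u}"
    and \<Phi>[measurable]: "\<Phi> \<in> borel_measurable (PiM J (\<lambda>_. borel))" and g[measurable]: "g \<in> borel_measurable borel"
  define \<Phi>' where "\<Phi>' y = \<Phi> (\<lambda>i\<in>J. h (y i))" for y
  have "(\<lambda>y. \<lambda>i\<in>J. h (y i)) \<in> measurable (PiM J (\<lambda>_. borel)) (PiM J (\<lambda>_. borel))"
    by (intro measurable_path_restrict measurable_compose[OF _ hm] measurable_component_singleton)
  from measurable_compose[OF this \<Phi>] have \<Phi>': "\<Phi>' \<in> borel_measurable (PiM J (\<lambda>_. borel))"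
    unfolding \<Phi>'_def .
  have \<Phi>eq: "\<Phi>' (\<lambda>i\<in>J. X i x) = \<Phi> (\<lambda>i\<in>J. h (X i x))" for x
    unfolding \<Phi>'_def by (intro arg_cong[of _ _ \<Phi>] restrict_ext) simp
  have "(\<integral>\<^sup>+x. \<Phi>' (\<lambda>i\<in>J. X i x) * (\<lambda>w. g (h w)) (X t x) \<partial>N) =
       (\<integral>\<^sup>+x. \<Phi>' (\<lambda>i\<in>J. X i x) * (\<integral>\<^sup>+y. (\<lambda>w. g (h w)) (X u x + y) \<partial>gauss (t - u)) \<partial>N)"
    by (rule brownian_processD(4)[OF X u J \<Phi>']) measurable
  then show "(\<integral>\<^sup>+x. \<Phi> (\<lambda>i\<in>J. h (X i x)) * g (h (X t x)) \<partial>N) =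
       (\<integral>\<^sup>+x. \<Phi> (\<lambda>i\<in>J. h (X i x)) * (\<integral>\<^sup>+y. g (h (X u x) + y) \<partial>gauss (t - u)) \<partial>N)"
    unfolding \<Phi>eq using inv[OF _ g] u by simp
qed

lemma brownian_process_translate:
  "brownian_process N X \<Longrightarrow> brownian_process N (\<lambda>t x. z + X t x)"
  by (rule brownian_process_map[where h="\<lambda>w. z + w"]) (auto intro!: continuous_intros simp: add.assoc)

lemma brownian_process_rotate:
  assumes X: "brownian_process N X" and c: "cmod c = 1"
  shows "brownian_process N (\<lambda>t x. c * X t x)"
proof (rule brownian_process_map[OF X, where h="\<lambda>w. c * w"])
  fix r w and g :: "complex \<Rightarrow> ennreal" assume r: "(0::real) < r" and [measurable]: "g \<in> borel_measurable borel"
  show "(\<integral>\<^sup>+y. g (c * (w + y)) \<partial>gauss r) = (\<integral>\<^sup>+y. g (c * w + y) \<partial>gauss r)"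
    using nn_integral_gauss_rotate[of "\<lambda>y. g (c * w + y)" r c] r c by (simp add: distrib_left)
qed (intro continuous_intros)

lemma brownian_process_cnj:
  assumes X: "brownian_process N X"
  shows "brownian_process N (\<lambda>t x. cnj (X t x))"
proof (rule brownian_process_map[OF X, where h=cnj])
  fix r w and g :: "complex \<Rightarrow> ennreal" assume r: "(0::real) < r" and [measurable]: "g \<in> borel_measurable borel"
  show "(\<integral>\<^sup>+y. g (cnj (w + y)) \<partial>gauss r) = (\<integral>\<^sup>+y. g (cnj w + y) \<partial>gauss r)"
    using nn_integral_gauss_cnj[of "\<lambda>y. g (cnj w + y)" r] r by simp
qed (intro continuous_intros)

lemma brownian_process_scale:
  assumes X: "brownian_process N X" and a: "0 < a"
  shows "brownian_process N (\<lambda>t x. complex_of_real a * X (t / a\<^sup>2) x)"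
proof (rule brownian_processI)
  show "prob_space N" by (rule brownian_processD[OF X])
  show "(\<lambda>x. complex_of_real a * X (t / a\<^sup>2) x) \<in> borel_measurable N" if "0 \<le> t" for t
    using brownian_processD(2)[OF X, of "t / a\<^sup>2"] that a by simp
  show "continuous_on {0..} (\<lambda>t. complex_of_real a * X (t / a\<^sup>2) x)" if "x \<in> space N" for x
    by (intro continuous_intros continuous_on_compose2[OF brownian_processD(3)[OF X that]]) (use a in auto)
  fix u t :: real and J and \<Phi> :: "(real \<Rightarrow> complex) \<Rightarrow> ennreal" and g :: "complex \<Rightarrow> ennreal"
  assume u: "0 \<le> u" "u < t" and J: "finite J" "J \<subseteq> {0..u}"
    and \<Phi>[measurable]: "\<Phi> \<in> borel_measurable (PiM J (\<lambda>_. borel))" and g[measurable]: "g \<in> borel_measurable borel"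
  define J' where "J' = (\<lambda>i. i / a\<^sup>2) ` J"
  have J': "finite J'" "J' \<subseteq> {0..u / a\<^sup>2}"
    using J a by (auto simp: J'_def divide_right_mono)
  have u': "0 \<le> u / a\<^sup>2" "u / a\<^sup>2 < t / a\<^sup>2" using u a by (auto intro: divide_strict_right_mono)
  define \<Phi>' where "\<Phi>' y = \<Phi> (\<lambda>i\<in>J. complex_of_real a * y (i / a\<^sup>2))" for y
  have "(\<lambda>y. \<lambda>i\<in>J. complex_of_real a * y (i / a\<^sup>2)) \<in> measurable (PiM J' (\<lambda>_. borel)) (PiM J (\<lambda>_. borel))"
    by (intro measurable_path_restrict borel_measurable_times borel_measurable_const measurable_component_singleton) (unfold J'_def, erule imageI)
  from measurable_compose[OF this \<Phi>] have \<Phi>': "\<Phi>' \<in> borel_measurable (PiM J' (\<lambda>_. borel))"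
    unfolding \<Phi>'_def .
  have memJ': "i / a\<^sup>2 \<in> J'" if "i \<in> J" for i using that unfolding J'_def by (rule imageI)
  have \<Phi>eq: "\<Phi>' (\<lambda>i\<in>J'. X i x) = \<Phi> (\<lambda>i\<in>J. complex_of_real a * X (i / a\<^sup>2) x)" for x
    unfolding \<Phi>'_def by (intro arg_cong[of _ _ \<Phi>] restrict_ext) (simp add: memJ')
  have inv: "(\<integral>\<^sup>+y. g (complex_of_real a * (w + y)) \<partial>gauss (t / a\<^sup>2 - u / a\<^sup>2)) = (\<integral>\<^sup>+y. g (complex_of_real a * w + y) \<partial>gauss (t - u))" for w
  proof -
    have "a\<^sup>2 * (t / a\<^sup>2 - u / a\<^sup>2) = t - u" using a by (simp add: right_diff_distrib)
    then show ?thesis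
      using nn_integral_gauss_scale[of "\<lambda>y. g (complex_of_real a * w + y)" "t / a\<^sup>2 - u / a\<^sup>2" a] u' a
      by (simp add: distrib_left)
  qed
  have "(\<integral>\<^sup>+x. \<Phi>' (\<lambda>i\<in>J'. X i x) * (\<lambda>w. g (complex_of_real a * w)) (X (t / a\<^sup>2) x) \<partial>N) =
       (\<integral>\<^sup>+x. \<Phi>' (\<lambda>i\<in>J'. X i x) * (\<integral>\<^sup>+y. (\<lambda>w. g (complex_of_real a * w)) (X (u / a\<^sup>2) x + y) \<partial>gauss (t / a\<^sup>2 - u / a\<^sup>2)) \<partial>N)"
    by (rule brownian_processD(4)[OF X u' J' \<Phi>']) measurable
  then show "(\<integral>\<^sup>+x. \<Phi> (\<lambda>i\<in>J. complex_of_real a * X (i / a\<^sup>2) x) * g (complex_of_real a * X (t / a\<^sup>2) x) \<partial>N) =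
       (\<integral>\<^sup>+x. \<Phi> (\<lambda>i\<in>J. complex_of_real a * X (i / a\<^sup>2) x) * (\<integral>\<^sup>+y. g (complex_of_real a * X (u / a\<^sup>2) x + y) \<partial>gauss (t - u)) \<partial>N)"
    unfolding \<Phi>eq inv .
qed

text \<open>The recentred motion starts at 0 at every sample point, not only almost surely, so it
  can be translated to any starting point. In its independent family the start is replaced by a
  constant, a function of the old start.\<close>

lemma planar_brownian_motion_from_0:
  assumes "planar_brownian_motion M B"
  shows "brownian_process M (\<lambda>t \<omega>. B t \<omega> - B 0 \<omega>)"
proof (rule planar_brownian_motion_process)
  interpret planar_brownian_motion M B by fact
  show "planar_brownian_motion M (\<lambda>t \<omega>. B t \<omega> - B 0 \<omega>)"
  proof
    show "(\<lambda>\<omega>. B t \<omega> - B 0 \<omega>) \<in> borel_measurable M" if "0 \<le> t" for t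
      by (intro borel_measurable_diff measurable_at that) simp
    show "continuous_on {0..} (\<lambda>t. B t \<omega> - B 0 \<omega>)" if "\<omega> \<in> space M" for \<omega>
      by (intro continuous_intros continuous_paths that)
    show "distributed M lborel (\<lambda>\<omega>. B t \<omega> - B 0 \<omega> - (B s \<omega> - B 0 \<omega>))
          (\<lambda>z. ennreal (normal_density 0 (sqrt (t - s)) (Re z) * normal_density 0 (sqrt (t - s)) (Im z)))"
      if "0 \<le> s" "s < t" for s t using gaussian_increments[OF that] by simp
    fix \<tau> :: "nat \<Rightarrow> real" assume \<tau>: "\<tau> 0 = 0" "strict_mono \<tau>"
    have "indep_vars (\<lambda>_. borel) (\<lambda>i \<omega>. (case_nat (\<lambda>_. 0) (\<lambda>_ z. z) i :: complex \<Rightarrow> complex)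
        ((case_nat (B 0) (\<lambda>k \<omega>. B (\<tau> (Suc k)) \<omega> - B (\<tau> k) \<omega>)) i \<omega>)) UNIV"
      by (rule indep_vars_compose2[OF independent_increments[OF \<tau>]]) (simp split: nat.split)
    moreover have "(\<lambda>i \<omega>. (case_nat (\<lambda>_. 0) (\<lambda>_ z. z) i :: complex \<Rightarrow> complex)
        ((case_nat (B 0) (\<lambda>k \<omega>. B (\<tau> (Suc k)) \<omega> - B (\<tau> k) \<omega>)) i \<omega>)) =
        case_nat (\<lambda>\<omega>. B 0 \<omega> - B 0 \<omega>) (\<lambda>k \<omega>. B (\<tau> (Suc k)) \<omega> - B 0 \<omega> - (B (\<tau> k) \<omega> - B 0 \<omega>))"
      by (auto simp: fun_eq_iff split: nat.split)
    ultimately show "indep_vars (\<lambda>_. borel) (case_nat (\<lambda>\<omega>. B 0 \<omega> - B 0 \<omega>)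
       (\<lambda>k \<omega>. B (\<tau> (Suc k)) \<omega> - B 0 \<omega> - (B (\<tau> k) \<omega> - B 0 \<omega>))) UNIV" by simp
  qed
qed

lemma brownian_process_random_start:
  assumes X: "brownian_process N X" and \<mu>: "prob_space \<mu>" "sets \<mu> = sets borel"
  shows "brownian_process (\<mu> \<Otimes>\<^sub>M N) (\<lambda>t p. fst p + X t (snd p))"
proof (rule brownian_processI)
  interpret N: prob_space N by (rule brownian_processD[OF X])
  interpret \<mu>: prob_space \<mu> by fact
  interpret P: pair_prob_space \<mu> N ..
  show "prob_space (\<mu> \<Otimes>\<^sub>M N)" by (rule P.prob_space_axioms)
  note [measurable_cong] = \<mu>(2)
  have Xm: "(\<lambda>p. fst p + X t (snd p)) \<in> borel_measurable (\<mu> \<Otimes>\<^sub>M N)" if "0 \<le> t" for t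
    using brownian_processD(2)[OF X that] by measurable
  then show "(\<lambda>p. fst p + X t (snd p)) \<in> borel_measurable (\<mu> \<Otimes>\<^sub>M N)" if "0 \<le> t" for t using that .
  show "continuous_on {0..} (\<lambda>t. fst p + X t (snd p))" if "p \<in> space (\<mu> \<Otimes>\<^sub>M N)" for p
    using that by (intro continuous_intros brownian_processD(3)[OF X]) (auto simp: space_pair_measure)
  fix u t :: real and J and \<Phi> :: "(real \<Rightarrow> complex) \<Rightarrow> ennreal" and g :: "complex \<Rightarrow> ennreal"
  assume u: "0 \<le> u" "u < t" and J: "finite J" "J \<subseteq> {0..u}"
    and \<Phi>[measurable]: "\<Phi> \<in> borel_measurable (PiM J (\<lambda>_. borel))" and g[measurable]: "g \<in> borel_measurable borel"
  have [measurable]: "(\<lambda>p. \<lambda>i\<in>J. fst p + X i (snd p)) \<in> measurable (\<mu> \<Otimes>\<^sub>M N) (PiM J (\<lambda>_. borel))"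
    by (intro measurable_path_restrict Xm) (use J in auto)
  note [measurable] = Xm[of t] Xm[of u]
  interpret G: prob_space "gauss (t - u)" using u by (intro prob_space_gauss) simp
  have t0: "0 \<le> t" using u by simp
  have m1: "(\<lambda>p. \<Phi> (\<lambda>i\<in>J. fst p + X i (snd p)) * g (fst p + X t (snd p))) \<in> borel_measurable (\<mu> \<Otimes>\<^sub>M N)"
    using t0 by measurable
  have m2: "(\<lambda>p. \<Phi> (\<lambda>i\<in>J. fst p + X i (snd p)) * (\<integral>\<^sup>+y. g (fst p + X u (snd p) + y) \<partial>gauss (t - u))) \<in> borel_measurable (\<mu> \<Otimes>\<^sub>M N)"
    using u by measurable
  have "(\<integral>\<^sup>+p. \<Phi> (\<lambda>i\<in>J. fst p + X i (snd p)) * g (fst p + X t (snd p)) \<partial>(\<mu> \<Otimes>\<^sub>M N))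
     = (\<integral>\<^sup>+z. (\<integral>\<^sup>+x. \<Phi> (\<lambda>i\<in>J. z + X i x) * g (z + X t x) \<partial>N) \<partial>\<mu>)"
    using N.nn_integral_fst[OF m1] by simp
  also have "\<dots> = (\<integral>\<^sup>+z. (\<integral>\<^sup>+x. \<Phi> (\<lambda>i\<in>J. z + X i x) * (\<integral>\<^sup>+y. g (z + X u x + y) \<partial>gauss (t - u)) \<partial>N) \<partial>\<mu>)"
    by (intro nn_integral_cong brownian_processD(4)[OF brownian_process_translate[OF X] u J \<Phi> g])
  also have "\<dots> = (\<integral>\<^sup>+p. \<Phi> (\<lambda>i\<in>J. fst p + X i (snd p)) * (\<integral>\<^sup>+y. g (fst p + X u (snd p) + y) \<partial>gauss (t - u)) \<partial>(\<mu> \<Otimes>\<^sub>M N))"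
    using N.nn_integral_fst[OF m2] by simp
  finally show "(\<integral>\<^sup>+p. \<Phi> (\<lambda>i\<in>J. fst p + X i (snd p)) * g (fst p + X t (snd p)) \<partial>(\<mu> \<Otimes>\<^sub>M N))
     = (\<integral>\<^sup>+p. \<Phi> (\<lambda>i\<in>J. fst p + X i (snd p)) * (\<integral>\<^sup>+y. g (fst p + X u (snd p) + y) \<partial>gauss (t - u)) \<partial>(\<mu> \<Otimes>\<^sub>M N))" .
qed

lemma brownian_process_gauss:
  assumes W: "brownian_process N W" and W0: "\<And>x. x \<in> space N \<Longrightarrow> W 0 x = 0"
    and t: "0 < t" and g: "g \<in> borel_measurable borel"
  shows "(\<integral>\<^sup>+x. g (W t x) \<partial>N) = (\<integral>\<^sup>+y. g y \<partial>gauss t)"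
proof -
  interpret N: prob_space N by (rule brownian_processD[OF W])
  have "(\<integral>\<^sup>+x. 1 * g (W t x) \<partial>N) = (\<integral>\<^sup>+x. 1 * (\<integral>\<^sup>+y. g (W 0 x + y) \<partial>gauss (t - 0)) \<partial>N)"
    by (rule brownian_processD(4)[OF W, of 0 t "{}" "\<lambda>_. 1" g]) (use t g in auto)
  also have "\<dots> = (\<integral>\<^sup>+x. (\<integral>\<^sup>+y. g y \<partial>gauss t) \<partial>N)"
    by (rule nn_integral_cong) (simp add: W0)
  finally show ?thesis by (simp add: N.emeasure_space_1)
qed

text \<open>The semigroup property is read off from an existing Brownian process, whose value at
  time \<open>a + b\<close> is described once directly and once through time \<open>a\<close>; no
  densities have to be convolved.\<close>

lemma gauss_convolution:
  assumes W: "brownian_process N W" and W0: "\<And>x. x \<in> space N \<Longrightarrow> W 0 x = 0"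
    and ab: "0 < a" "0 < b" and g [measurable]: "g \<in> borel_measurable borel"
  shows "(\<integral>\<^sup>+y. (\<integral>\<^sup>+y'. g (w + y + y') \<partial>gauss b) \<partial>gauss a) = (\<integral>\<^sup>+y. g (w + y) \<partial>gauss (a + b))"
proof -
  interpret G: prob_space "gauss b" using ab by (intro prob_space_gauss)
  have "(\<integral>\<^sup>+y. g (w + y) \<partial>gauss (a + b)) = (\<integral>\<^sup>+x. 1 * g (w + W (a + b) x) \<partial>N)"
    by (subst brownian_process_gauss[OF W W0, symmetric]) (use ab in simp_all)
  also have "\<dots> = (\<integral>\<^sup>+x. 1 * (\<integral>\<^sup>+y'. g (w + (W a x + y')) \<partial>gauss (a + b - a)) \<partial>N)"
    by (rule brownian_processD(4)[OF W, of a "a + b" "{}" "\<lambda>_. 1" "\<lambda>z. g (w + z)"]) (use ab in auto)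
  also have "\<dots> = (\<integral>\<^sup>+y. (\<integral>\<^sup>+y'. g (w + y + y') \<partial>gauss b) \<partial>gauss a)"
    by (subst brownian_process_gauss[OF W W0, symmetric]) (use ab in \<open>simp_all add: add.assoc\<close>)
  finally show ?thesis ..
qed

section \<open>Continuing a path by an independent one\<close>

definition glue_at :: "real \<Rightarrow> (real \<Rightarrow> complex) \<Rightarrow> (real \<Rightarrow> complex) \<Rightarrow> real \<Rightarrow> complex" where
  "glue_at s f g t = (if t \<le> s then f t else f s + g (t - s))"

lemma continuous_on_glue_at:
  assumes f: "continuous_on {0..} f" and g: "continuous_on {0..} g" and g0: "g 0 = 0" and s: "0 \<le> s"
  shows "continuous_on {0..} (glue_at s f g)"
proof -
  have "continuous_on ({0..s} \<union> {s..}) (\<lambda>t. if t \<le> s then f t else f s + g (t - s))"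
    by (intro continuous_on_If continuous_intros continuous_on_subset[OF f] continuous_on_compose2[OF g])
       (use s g0 in auto)
  moreover have "{0..s} \<union> {s..} = {0..}" using s by auto
  ultimately show ?thesis by (simp add: glue_at_def[abs_def])
qed

text \<open>If the gluing time \<open>s\<close> is at most \<open>u\<close>, the Markov property of
  \<open>W\<close> applies for each fixed first path; if \<open>t\<close> is at most
  \<open>s\<close>, that of \<open>X\<close> does. If \<open>s\<close> separates \<open>u\<close>
  from \<open>t\<close>, the increment is a sum of two independent Gaussian ones, and
  \<open>gauss_convolution\<close> merges them.\<close>

lemma brownian_process_glue_at:
  assumes X: "brownian_process N X" and W: "brownian_process N' W"
    and W0: "\<And>x. x \<in> space N' \<Longrightarrow> W 0 x = 0" and s: "0 \<le> s"
  shows "brownian_process (N \<Otimes>\<^sub>M N') (\<lambda>t p. glue_at s (\<lambda>t. X t (fst p)) (\<lambda>t. W t (snd p)) t)"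
    (is "brownian_process _ (\<lambda>t p. ?Z t p)")
proof (rule brownian_processI)
  interpret N: prob_space N by (rule brownian_processD[OF X])
  interpret N': prob_space N' by (rule brownian_processD[OF W])
  interpret P: pair_prob_space N N' ..
  show "prob_space (N \<Otimes>\<^sub>M N')" by (rule P.prob_space_axioms)
  have Zm: "?Z t \<in> borel_measurable (N \<Otimes>\<^sub>M N')" if "0 \<le> t" for t
  proof (cases "t \<le> s")
    case True
    then show ?thesis using brownian_processD(2)[OF X that] by (simp add: glue_at_def)
  next
    case False
    then show ?thesis
      using brownian_processD(2)[OF X s] brownian_processD(2)[OF W, of "t - s"] by (simp add: glue_at_def)
  qed
  then show "?Z t \<in> borel_measurable (N \<Otimes>\<^sub>M N')" if "0 \<le> t" for t using that .
  show "continuous_on {0..} (\<lambda>t. ?Z t p)" if "p \<in> space (N \<Otimes>\<^sub>M N')" for p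
    using that s W0 by (intro continuous_on_glue_at brownian_processD(3)[OF X] brownian_processD(3)[OF W]) (auto simp: space_pair_measure)
  fix u t :: real and J and \<Phi> :: "(real \<Rightarrow> complex) \<Rightarrow> ennreal" and g :: "complex \<Rightarrow> ennreal"
  assume u: "0 \<le> u" "u < t" and J: "finite J" "J \<subseteq> {0..u}"
    and \<Phi>[measurable]: "\<Phi> \<in> borel_measurable (PiM J (\<lambda>_. borel))" and g[measurable]: "g \<in> borel_measurable borel"
  have [measurable]: "(\<lambda>p. \<lambda>i\<in>J. ?Z i p) \<in> measurable (N \<Otimes>\<^sub>M N') (PiM J (\<lambda>_. borel))"
    by (intro measurable_path_restrict Zm) (use J in auto)
  interpret G: prob_space "gauss (t - u)" using u by (intro prob_space_gauss) simp
  have t0: "0 \<le> t" using u by simp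
  note [measurable] = Zm[OF t0] Zm[OF u(1)]
  define L where "L = (\<integral>\<^sup>+p. \<Phi> (\<lambda>i\<in>J. ?Z i p) * g (?Z t p) \<partial>(N \<Otimes>\<^sub>M N'))"
  define R where "R = (\<integral>\<^sup>+p. \<Phi> (\<lambda>i\<in>J. ?Z i p) * (\<integral>\<^sup>+y. g (?Z u p + y) \<partial>gauss (t - u)) \<partial>(N \<Otimes>\<^sub>M N'))"
  have L: "L = (\<integral>\<^sup>+x. (\<integral>\<^sup>+x'. \<Phi> (\<lambda>i\<in>J. ?Z i (x, x')) * g (?Z t (x, x')) \<partial>N') \<partial>N)"
    unfolding L_def by (subst N'.nn_integral_fst[symmetric]) simp_all
  have R: "R = (\<integral>\<^sup>+x. (\<integral>\<^sup>+x'. \<Phi> (\<lambda>i\<in>J. ?Z i (x, x')) * (\<integral>\<^sup>+y. g (?Z u (x, x') + y) \<partial>gauss (t - u)) \<partial>N') \<partial>N)"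
    unfolding R_def by (subst N'.nn_integral_fst[symmetric]) simp_all
  have "L = R"
  proof (cases "s \<le> u")
    case True
    have "(\<integral>\<^sup>+x'. \<Phi> (\<lambda>i\<in>J. ?Z i (x, x')) * g (?Z t (x, x')) \<partial>N') =
        (\<integral>\<^sup>+x'. \<Phi> (\<lambda>i\<in>J. ?Z i (x, x')) * (\<integral>\<^sup>+y. g (?Z u (x, x') + y) \<partial>gauss (t - u)) \<partial>N')"
      if x: "x \<in> space N" for x
    proof -
      define J' where "J' = (\<lambda>i. i - s) ` {i\<in>J. s < i}"
      have J': "finite J'" "J' \<subseteq> {0..u - s}" using J by (auto simp: J'_def)
      define \<Phi>' where "\<Phi>' y = \<Phi> (\<lambda>i\<in>J. if i \<le> s then X i x else X s x + y (i - s))" for y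
      have "(\<lambda>y. \<lambda>i\<in>J. if i \<le> s then X i x else X s x + y (i - s)) \<in> measurable (PiM J' (\<lambda>_. borel)) (PiM J (\<lambda>_. borel))"
      proof (rule measurable_path_restrict)
        fix i assume i: "i \<in> J"
        show "(\<lambda>y. if i \<le> s then X i x else X s x + y (i - s)) \<in> borel_measurable (PiM J' (\<lambda>_. borel))"
        proof (cases "i \<le> s")
          case False
          then have "i - s \<in> J'" using i by (auto simp: J'_def)
          then have "(\<lambda>y. y (i - s)) \<in> borel_measurable (PiM J' (\<lambda>_. borel :: complex measure))"
            by (rule measurable_component_singleton)
          then show ?thesis using False by simp
        qed simp
      qed
      from measurable_compose[OF this \<Phi>] have \<Phi>': "\<Phi>' \<in> borel_measurable (PiM J' (\<lambda>_. borel))"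
        unfolding \<Phi>'_def .
      have \<Phi>eq: "\<Phi> (\<lambda>i\<in>J. ?Z i (x, x')) = \<Phi>' (\<lambda>i\<in>J'. W i x')" for x'
        unfolding \<Phi>'_def by (intro arg_cong[of _ _ \<Phi>] restrict_ext) (auto simp: J'_def glue_at_def)
      have Zt: "?Z t (x, x') = X s x + W (t - s) x'" for x' using True u by (simp add: glue_at_def)
      have Zu: "?Z u (x, x') = X s x + W (u - s) x'" if "x' \<in> space N'" for x'
        using True W0[OF that] by (auto simp: glue_at_def)
      have "(\<integral>\<^sup>+x'. \<Phi>' (\<lambda>i\<in>J'. W i x') * (\<lambda>z. g (X s x + z)) (W (t - s) x') \<partial>N') =
         (\<integral>\<^sup>+x'. \<Phi>' (\<lambda>i\<in>J'. W i x') * (\<integral>\<^sup>+y. (\<lambda>z. g (X s x + z)) (W (u - s) x' + y) \<partial>gauss (t - s - (u - s))) \<partial>N')"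
        by (rule brownian_processD(4)[OF W _ _ J' \<Phi>']) (use True u in auto)
      also have "\<dots> = (\<integral>\<^sup>+x'. \<Phi> (\<lambda>i\<in>J. ?Z i (x, x')) * (\<integral>\<^sup>+y. g (?Z u (x, x') + y) \<partial>gauss (t - u)) \<partial>N')"
      proof (rule nn_integral_cong)
        fix x' assume x': "x' \<in> space N'"
        show "\<Phi>' (\<lambda>i\<in>J'. W i x') * (\<integral>\<^sup>+y. (\<lambda>z. g (X s x + z)) (W (u - s) x' + y) \<partial>gauss (t - s - (u - s))) =
          \<Phi> (\<lambda>i\<in>J. ?Z i (x, x')) * (\<integral>\<^sup>+y. g (?Z u (x, x') + y) \<partial>gauss (t - u))"
          unfolding \<Phi>eq Zu[OF x'] by (simp add: add.assoc)
      qed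
      finally show ?thesis unfolding \<Phi>eq Zt by simp
    qed
    then show ?thesis unfolding L R by (rule nn_integral_cong)
  next
    case False
    have Js: "\<Phi> (\<lambda>i\<in>J. ?Z i (x, x')) = \<Phi> (\<lambda>i\<in>J. X i x)" for x x'
      by (intro arg_cong[of _ _ \<Phi>] restrict_ext) (use False J in \<open>auto simp: glue_at_def\<close>)
    have Zu: "?Z u (x, x') = X u x" for x x' using False by (simp add: glue_at_def)
    have R': "R = (\<integral>\<^sup>+x. \<Phi> (\<lambda>i\<in>J. X i x) * (\<integral>\<^sup>+y. g (X u x + y) \<partial>gauss (t - u)) \<partial>N)"
      unfolding R Js Zu by (simp add: N'.emeasure_space_1)
    show ?thesis
    proof (cases "t \<le> s")
      case True
      have Zt: "?Z t (x, x') = X t x" for x x' using True by (simp add: glue_at_def)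
      have "L = (\<integral>\<^sup>+x. \<Phi> (\<lambda>i\<in>J. X i x) * g (X t x) \<partial>N)"
        unfolding L Js Zt by (simp add: N'.emeasure_space_1)
      then show ?thesis unfolding R' by (simp add: brownian_processD(4)[OF X u J \<Phi> g])
    next
      case st: False
      interpret G2: prob_space "gauss (t - s)" using st by (intro prob_space_gauss) simp
      have Zt: "?Z t (x, x') = X s x + W (t - s) x'" for x x' using st by (simp add: glue_at_def)
      have [measurable]: "W (t - s) \<in> borel_measurable N'" using st by (intro brownian_processD(2)[OF W]) simp
      have "L = (\<integral>\<^sup>+x. \<Phi> (\<lambda>i\<in>J. X i x) * (\<integral>\<^sup>+x'. g (X s x + W (t - s) x') \<partial>N') \<partial>N)"
        unfolding L Js Zt by (simp add: nn_integral_cmult)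
      also have "\<dots> = (\<integral>\<^sup>+x. \<Phi> (\<lambda>i\<in>J. X i x) * (\<lambda>z. \<integral>\<^sup>+y. g (z + y) \<partial>gauss (t - s)) (X s x) \<partial>N)"
        by (subst brownian_process_gauss[OF W W0]) (use st in simp_all)
      also have "\<dots> = (\<integral>\<^sup>+x. \<Phi> (\<lambda>i\<in>J. X i x) * (\<integral>\<^sup>+y'. (\<lambda>z. \<integral>\<^sup>+y. g (z + y) \<partial>gauss (t - s)) (X u x + y') \<partial>gauss (s - u)) \<partial>N)"
        by (rule brownian_processD(4)[OF X u(1) _ J \<Phi>]) (use False in simp_all)
      also have "\<dots> = R"
        unfolding R' using False st by (subst gauss_convolution[OF W W0]) simp_all
      finally show ?thesis .
    qed
  qed
  then show "(\<integral>\<^sup>+p. \<Phi> (\<lambda>i\<in>J. ?Z i p) * g (?Z t p) \<partial>(N \<Otimes>\<^sub>M N')) =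
    (\<integral>\<^sup>+p. \<Phi> (\<lambda>i\<in>J. ?Z i p) * (\<integral>\<^sup>+y. g (?Z u p + y) \<partial>gauss (t - u)) \<partial>(N \<Otimes>\<^sub>M N'))"
    unfolding L_def R_def .
qed

lemma nn_integral_path_law:
  assumes X: "\<And>t. 0 \<le> t \<Longrightarrow> X t \<in> borel_measurable N" and J: "finite J" "J \<subseteq> {0..}"
    and f: "\<And>i. f i \<in> borel_measurable borel"
  shows "(\<integral>\<^sup>+y. (\<Prod>i\<in>J. f i (y i)) \<partial>path_law N X) = (\<integral>\<^sup>+x. (\<Prod>i\<in>J. f i (X i x) :: ennreal) \<partial>N)"
proof -
  have "(\<lambda>y. \<Prod>i\<in>J. f i (y i)) \<in> borel_measurable path_space"
    unfolding path_space_def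
  proof (rule borel_measurable_prod_ennreal)
    fix i assume "i \<in> J"
    then have "(\<lambda>y. y i) \<in> borel_measurable (PiM {0..} (\<lambda>_. borel :: complex measure))"
      using J by (intro measurable_component_singleton) auto
    from measurable_compose[OF this f] show "(\<lambda>y. f i (y i)) \<in> borel_measurable (PiM {0..} (\<lambda>_. borel))" .
  qed
  then have "(\<integral>\<^sup>+y. (\<Prod>i\<in>J. f i (y i)) \<partial>path_law N X) = (\<integral>\<^sup>+x. (\<Prod>i\<in>J. f i ((\<lambda>t\<in>{0..}. X t x) i)) \<partial>N)"
    unfolding path_law_def
    by (intro nn_integral_distr measurable_path X) (simp_all only: measurable_distr_eq1)
  also have "\<dots> = (\<integral>\<^sup>+x. (\<Prod>i\<in>J. f i (X i x)) \<partial>N)"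
    by (intro nn_integral_cong prod.cong) (use J in auto)
  finally show ?thesis .
qed

lemma path_law_fst:
  assumes X: "prob_space N" "\<And>t. 0 \<le> t \<Longrightarrow> X t \<in> borel_measurable N" and N': "prob_space N'"
  shows "path_law (N \<Otimes>\<^sub>M N') (\<lambda>t p. X t (fst p)) = path_law N X"
proof (rule path_law_eqI)
  interpret N: prob_space N by fact
  interpret N': prob_space N' by fact
  interpret P: pair_prob_space N N' ..
  show "prob_space (N \<Otimes>\<^sub>M N')" by (rule P.prob_space_axioms)
  show "(\<lambda>p. X t (fst p)) \<in> borel_measurable (N \<Otimes>\<^sub>M N')" if "0 \<le> t" for t
    using X(2)[OF that] by measurable
  fix J :: "real set" and A :: "real \<Rightarrow> complex set"
  assume J: "finite J" "J \<subseteq> {0..}" and A: "\<And>i. A i \<in> sets borel"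
  have m: "(\<lambda>p. \<Prod>i\<in>J. indicator (A i) (X i (fst p)) :: ennreal) \<in> borel_measurable (N \<Otimes>\<^sub>M N')"
  proof (rule borel_measurable_prod_ennreal)
    fix i assume "i \<in> J"
    then have [measurable]: "X i \<in> borel_measurable N" "A i \<in> sets borel" using X J A by auto
    show "(\<lambda>p. indicator (A i) (X i (fst p)) :: ennreal) \<in> borel_measurable (N \<Otimes>\<^sub>M N')" by measurable
  qed
  show "(\<integral>\<^sup>+p. (\<Prod>i\<in>J. indicator (A i) (X i (fst p))) \<partial>(N \<Otimes>\<^sub>M N')) = (\<integral>\<^sup>+x. (\<Prod>i\<in>J. indicator (A i) (X i x)) \<partial>N)"
    using N'.nn_integral_fst[OF m] by (simp add: N'.emeasure_space_1)
qed (use X in auto)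

lemma borel_measurable_countable_switch:
  fixes Z :: "'a \<Rightarrow> complex"
  assumes F: "\<And>k::nat. {p\<in>space Q. P k p} \<in> sets Q" "\<And>p. p \<in> space Q \<Longrightarrow> \<exists>k. P k p"
    and V: "\<And>k. V k \<in> borel_measurable Q" and Z: "\<And>k p. p \<in> space Q \<Longrightarrow> P k p \<Longrightarrow> Z p = V k p"
  shows "Z \<in> borel_measurable Q"
proof (rule borel_measurableI)
  fix S :: "complex set" assume S: "open S"
  have "Z -` S \<inter> space Q = (\<Union>k. {p\<in>space Q. P k p} \<inter> (V k -` S \<inter> space Q))"
    using F(2) Z by fastforce
  also have "\<dots> \<in> sets Q"
    using S F(1) V by (intro sets.countable_UN sets.Int) (auto intro!: measurable_sets)
  finally show "Z -` S \<inter> space Q \<in> sets Q" .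
qed

text \<open>The strong Markov property at a time with countably many values. On the piece
  \<open>F k\<close> the process \<open>Z\<close> follows \<open>V k\<close>, which has the law of
  \<open>X\<close> and lies in \<open>F k\<close> exactly when \<open>X\<close> does. Hence the part
  of the law of \<open>Z\<close> on that piece is the part of the law of \<open>X\<close> inside
  \<open>F k\<close>, and the pieces add up.\<close>

lemma path_law_countable_switch:
  fixes F :: "nat \<Rightarrow> (real \<Rightarrow> complex) set"
  assumes X: "\<And>t. 0 \<le> t \<Longrightarrow> X t \<in> borel_measurable Q"
    and V: "\<And>k t. 0 \<le> t \<Longrightarrow> V k t \<in> borel_measurable Q"
    and F: "\<And>k. F k \<in> sets path_space" "disjoint_family F"
    and cover: "\<And>p. p \<in> space Q \<Longrightarrow> \<exists>k. (\<lambda>t\<in>{0..}. X t p) \<in> F k"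
    and same: "\<And>k p. p \<in> space Q \<Longrightarrow> (\<lambda>t\<in>{0..}. V k t p) \<in> F k \<longleftrightarrow> (\<lambda>t\<in>{0..}. X t p) \<in> F k"
    and Z: "\<And>k p t. p \<in> space Q \<Longrightarrow> (\<lambda>t\<in>{0..}. X t p) \<in> F k \<Longrightarrow> 0 \<le> t \<Longrightarrow> Z t p = V k t p"
    and law: "\<And>k. path_law Q (V k) = path_law Q X"
  shows "\<And>t. 0 \<le> t \<Longrightarrow> Z t \<in> borel_measurable Q" and "path_law Q Z = path_law Q X"
proof -
  let ?p = "\<lambda>X p. \<lambda>t\<in>{0..}. X t p"
  have Fm: "{p\<in>space Q. ?p X p \<in> F k} \<in> sets Q" for k
    using measurable_sets[OF measurable_path[OF X] F(1)[of k]] by (simp add: vimage_def Int_def conj_commute)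
  show Zm: "Z t \<in> borel_measurable Q" if "0 \<le> t" for t
    by (rule borel_measurable_countable_switch[where P="\<lambda>k p. ?p X p \<in> F k" and V="\<lambda>k. V k t"])
       (use Fm cover V[OF that] Z that in auto)
  show "path_law Q Z = path_law Q X"
  proof (rule measure_eqI)
    show "sets (path_law Q Z) = sets (path_law Q X)" by (simp add: path_law_def)
    fix S assume "S \<in> sets (path_law Q Z)"
    then have S: "S \<in> sets path_space" by (simp add: path_law_def)
    have split: "emeasure (path_law Q Y) S = (\<Sum>k. emeasure Q {p\<in>space Q. ?p Y p \<in> S \<and> ?p X p \<in> F k})"
      if Y: "\<And>t. 0 \<le> t \<Longrightarrow> Y t \<in> borel_measurable Q" for Y
    proof -
      have Sm: "{p\<in>space Q. ?p Y p \<in> S} \<in> sets Q"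
        using measurable_sets[OF measurable_path[OF Y] S] by (simp add: vimage_def Int_def conj_commute)
      have eq: "{p\<in>space Q. ?p Y p \<in> S \<and> ?p X p \<in> F k} = {p\<in>space Q. ?p Y p \<in> S} \<inter> {p\<in>space Q. ?p X p \<in> F k}" for k
        by auto
      have "(\<Sum>k. emeasure Q {p\<in>space Q. ?p Y p \<in> S \<and> ?p X p \<in> F k}) = emeasure Q (\<Union>k. {p\<in>space Q. ?p Y p \<in> S \<and> ?p X p \<in> F k})"
      proof (rule suminf_emeasure)
        show "range (\<lambda>k. {p\<in>space Q. ?p Y p \<in> S \<and> ?p X p \<in> F k}) \<subseteq> sets Q"
          unfolding eq using Sm Fm by auto
        show "disjoint_family (\<lambda>k. {p\<in>space Q. ?p Y p \<in> S \<and> ?p X p \<in> F k})"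
          using F(2) unfolding disjoint_family_on_def by blast
      qed
      also have "(\<Union>k. {p\<in>space Q. ?p Y p \<in> S \<and> ?p X p \<in> F k}) = ?p Y -` S \<inter> space Q"
        using cover by auto
      also have "emeasure Q \<dots> = emeasure (path_law Q Y) S"
        unfolding path_law_def by (rule emeasure_distr[OF measurable_path[OF Y] S, symmetric])
      finally show ?thesis ..
    qed
    have "emeasure Q {p\<in>space Q. ?p Z p \<in> S \<and> ?p X p \<in> F k} = emeasure Q {p\<in>space Q. ?p X p \<in> S \<and> ?p X p \<in> F k}" for k
    proof -
      have e: "emeasure (path_law Q Y) (S \<inter> F k) = emeasure Q {p\<in>space Q. ?p Y p \<in> S \<inter> F k}"
        if Y: "\<And>t. 0 \<le> t \<Longrightarrow> Y t \<in> borel_measurable Q" for Y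
        unfolding path_law_def
        by (subst emeasure_distr[OF measurable_path[OF Y]]) (use S F(1) in \<open>auto intro!: arg_cong[of _ _ "emeasure Q"]\<close>)
      have zv: "?p Z p = ?p (V k) p" if "p \<in> space Q" "?p X p \<in> F k" for p
        using Z[OF that] by (intro restrict_ext) auto
      have "{p\<in>space Q. ?p Z p \<in> S \<and> ?p X p \<in> F k} = {p\<in>space Q. ?p (V k) p \<in> S \<inter> F k}"
        using zv same[of _ k] by (intro Collect_cong) (metis IntE IntI)
      then have "emeasure Q {p\<in>space Q. ?p Z p \<in> S \<and> ?p X p \<in> F k} = emeasure (path_law Q (V k)) (S \<inter> F k)"
        using e[OF V] by simp
      also have "\<dots> = emeasure Q {p\<in>space Q. ?p X p \<in> S \<inter> F k}" unfolding law using e[OF X] by simp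
      finally show ?thesis by simp
    qed
    then show "emeasure (path_law Q Z) S = emeasure (path_law Q X) S"
      using split[OF Zm] split[OF X] by simp
  qed
qed

text \<open>Closed sets are handled by approximating their indicators from above.\<close>

lemma finite_measure_eqI_continuous:
  fixes m1 m2 :: "complex measure"
  assumes sets: "sets m1 = sets borel" "sets m2 = sets borel" and fin: "finite_measure m1" "finite_measure m2"
    and eq: "\<And>f. continuous_on UNIV f \<Longrightarrow> (\<And>x. 0 \<le> f x \<and> f x \<le> 1) \<Longrightarrow> (\<integral>\<^sup>+x. ennreal (f x) \<partial>m1) = (\<integral>\<^sup>+x. ennreal (f x) \<partial>m2)"
  shows "m1 = m2"
proof (rule measure_eqI_generator_eq[where E="Collect closed" and \<Omega>=UNIV and A="\<lambda>_. UNIV"])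
  show "Int_stable (Collect (closed :: complex set \<Rightarrow> bool))" by (auto simp: Int_stable_def)
  show "sets m1 = sigma_sets UNIV (Collect closed)" "sets m2 = sigma_sets UNIV (Collect closed)"
    unfolding sets borel_eq_closed by simp_all
  show "emeasure m1 UNIV \<noteq> \<infinity>" for i :: nat
    using finite_measure.emeasure_finite[OF fin(1)] by simp
  fix C :: "complex set" assume "C \<in> Collect closed"
  then have C: "closed C" by simp
  show "emeasure m1 C = emeasure m2 C"
  proof (cases "C = {}")
    case False
    define f where "f n x = max 0 (1 - real n * infdist x C)" for n x
    have f01: "0 \<le> f n x \<and> f n x \<le> 1" for n x by (simp add: f_def infdist_nonneg)
    have cont: "continuous_on UNIV (f n)" for n unfolding f_def by (intro continuous_intros)
    have lim: "(\<lambda>n. ennreal (f n x)) \<longlonglongrightarrow> indicator C x" for x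
    proof (cases "x \<in> C")
      case True
      then show ?thesis by (simp add: f_def)
    next
      case False
      then have "infdist x C > 0" using C \<open>C \<noteq> {}\<close> by (metis in_closed_iff_infdist_zero infdist_nonneg less_eq_real_def)
      then obtain n0 :: nat where n0: "1 < real n0 * infdist x C"
        using ex_less_of_nat_mult by blast
      have "f n x = 0" if "n \<ge> n0" for n
      proof -
        have "real n0 * infdist x C \<le> real n * infdist x C" using that by (intro mult_right_mono infdist_nonneg) simp
        then show ?thesis using n0 by (simp add: f_def)
      qed
      then have "\<forall>\<^sub>F n in sequentially. ennreal (f n x) = 0" 
        unfolding eventually_sequentially by (intro exI[of _ n0]) simp
      then show ?thesis using False by (simp add: tendsto_eventually)
    qed
    have c: "(\<lambda>n. \<integral>\<^sup>+x. ennreal (f n x) \<partial>m) \<longlonglongrightarrow> emeasure m C"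
      if m: "sets m = sets borel" "finite_measure m" for m
    proof -
      have [measurable]: "f n \<in> borel_measurable m" for n
        using borel_measurable_continuous_onI[OF cont] m(1) by (simp cong: measurable_cong_sets)
      have Cm: "C \<in> sets m" using C m by simp
      have "(\<lambda>n. \<integral>\<^sup>+x. ennreal (f n x) \<partial>m) \<longlonglongrightarrow> (\<integral>\<^sup>+x. indicator C x \<partial>m)"
      proof (rule nn_integral_dominated_convergence[where w="\<lambda>_. 1"])
        show "(\<integral>\<^sup>+x. 1 \<partial>m) < \<infinity>" using finite_measure.emeasure_finite[OF m(2)] by (simp add: top.not_eq_extremum)
      qed (use f01 lim Cm in auto)
      then show ?thesis using Cm by simp
    qed
    have "(\<lambda>n. \<integral>\<^sup>+x. ennreal (f n x) \<partial>m1) = (\<lambda>n. \<integral>\<^sup>+x. ennreal (f n x) \<partial>m2)"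
      by (intro ext eq cont f01)
    with c[OF sets(1) fin(1)] c[OF sets(2) fin(2)] show ?thesis by (auto intro: LIMSEQ_unique)
  qed simp
qed auto

text \<open>The factors are replaced one coordinate at a time. With all other factors fixed, both
  sides are finite measures of the set in coordinate \<open>j\<close>, and by induction they agree
  on continuous functions; \<open>I\<close> collects the coordinates whose factor may already be an
  arbitrary measurable function.\<close>

lemma prod_indicator_eqI:
  fixes J :: "'i set"
  assumes Q: "prob_space Q" "\<And>t. t \<in> J \<Longrightarrow> X t \<in> borel_measurable Q"
    and K: "prob_space K" "\<And>t. t \<in> J \<Longrightarrow> Y t \<in> borel_measurable K" and J: "finite J"
    and eq: "\<And>f. (\<And>i. continuous_on UNIV (f i)) \<Longrightarrow> (\<And>i x. 0 \<le> f i x \<and> f i x \<le> 1) \<Longrightarrow>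
      (\<integral>\<^sup>+x. (\<Prod>i\<in>J. ennreal (f i (X i x))) \<partial>Q) = (\<integral>\<^sup>+x. (\<Prod>i\<in>J. ennreal (f i (Y i x))) \<partial>K)"
    and A: "\<And>i. A i \<in> sets borel"
  shows "(\<integral>\<^sup>+x. (\<Prod>i\<in>J. indicator (A i) (X i x)) \<partial>Q) = (\<integral>\<^sup>+x. (\<Prod>i\<in>J. indicator (A i) (Y i x :: complex)) \<partial>K)"
proof -
  interpret Q: prob_space Q by fact
  interpret K: prob_space K by fact
  define ok where "ok I h \<longleftrightarrow> (\<forall>i. (h i :: complex \<Rightarrow> ennreal) \<in> borel_measurable borel) \<and> (\<forall>i x. h i x \<le> 1) \<and>
     (\<forall>i. i \<notin> I \<longrightarrow> (\<exists>f. continuous_on UNIV f \<and> (\<forall>x. 0 \<le> f x \<and> f x \<le> 1) \<and> h i = (\<lambda>x. ennreal (f x))))"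
    for I :: "'i set" and h
  have main: "(\<integral>\<^sup>+x. (\<Prod>i\<in>J. h i (X i x)) \<partial>Q) = (\<integral>\<^sup>+x. (\<Prod>i\<in>J. h i (Y i x)) \<partial>K)"
    if "finite I" "I \<subseteq> J" "ok I h" for I h
    using that
  proof (induction I arbitrary: h rule: finite_induct)
    case empty
    then obtain f where "\<And>i. continuous_on UNIV (f i) \<and> (\<forall>x. 0 \<le> f i x \<and> f i x \<le> 1) \<and> h i = (\<lambda>x. ennreal (f i x))"
      unfolding ok_def by (metis empty_iff)
    then show ?case using eq[of f] by simp
  next
    case (insert j I)
    have j: "j \<in> J" using insert by auto
    have hm: "h i \<in> borel_measurable borel" and h1: "h i x \<le> 1" for i x using insert(5) by (auto simp: ok_def)
    have gQ: "(\<lambda>x. \<Prod>i\<in>J - {j}. h i (X i x)) \<in> borel_measurable Q"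
      by (intro borel_measurable_prod_ennreal measurable_compose[OF Q(2) hm]) auto
    have gK: "(\<lambda>x. \<Prod>i\<in>J - {j}. h i (Y i x)) \<in> borel_measurable K"
      by (intro borel_measurable_prod_ennreal measurable_compose[OF K(2) hm]) auto
    define m1 where "m1 = distr (density Q (\<lambda>x. \<Prod>i\<in>J - {j}. h i (X i x))) borel (X j)"
    define m2 where "m2 = distr (density K (\<lambda>x. \<Prod>i\<in>J - {j}. h i (Y i x))) borel (Y j)"
    have X1: "X j \<in> borel_measurable (density Q (\<lambda>x. \<Prod>i\<in>J - {j}. h i (X i x)))" using Q(2)[OF j] by simp
    have Y1: "Y j \<in> borel_measurable (density K (\<lambda>x. \<Prod>i\<in>J - {j}. h i (Y i x)))" using K(2)[OF j] by simp
    have int1: "(\<integral>\<^sup>+z. k z \<partial>m1) = (\<integral>\<^sup>+x. (\<Prod>i\<in>J. (h(j := k)) i (X i x)) \<partial>Q)"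
      if k: "k \<in> borel_measurable borel" for k
    proof -
      have "(\<integral>\<^sup>+z. k z \<partial>m1) = (\<integral>\<^sup>+x. (\<Prod>i\<in>J - {j}. h i (X i x)) * k (X j x) \<partial>Q)"
        unfolding m1_def using k X1 by (subst nn_integral_distr[OF X1]) (simp_all add: nn_integral_density gQ measurable_compose[OF Q(2)[OF j]])
      also have "\<dots> = (\<integral>\<^sup>+x. (\<Prod>i\<in>J. (h(j := k)) i (X i x)) \<partial>Q)"
        by (subst prod.remove[OF J j]) (simp add: mult.commute)
      finally show ?thesis .
    qed
    have int2: "(\<integral>\<^sup>+z. k z \<partial>m2) = (\<integral>\<^sup>+x. (\<Prod>i\<in>J. (h(j := k)) i (Y i x)) \<partial>K)"
      if k: "k \<in> borel_measurable borel" for k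
    proof -
      have "(\<integral>\<^sup>+z. k z \<partial>m2) = (\<integral>\<^sup>+x. (\<Prod>i\<in>J - {j}. h i (Y i x)) * k (Y j x) \<partial>K)"
        unfolding m2_def using k Y1 by (subst nn_integral_distr[OF Y1]) (simp_all add: nn_integral_density gK measurable_compose[OF K(2)[OF j]])
      also have "\<dots> = (\<integral>\<^sup>+x. (\<Prod>i\<in>J. (h(j := k)) i (Y i x)) \<partial>K)"
        by (subst prod.remove[OF J j]) (simp add: mult.commute)
      finally show ?thesis .
    qed
    have "m1 = m2"
    proof (rule finite_measure_eqI_continuous)
      show "sets m1 = sets borel" "sets m2 = sets borel" by (simp_all add: m1_def m2_def)
      have p1: "(\<Prod>i\<in>J. (h(j := (\<lambda>_. 1))) i (w i)) \<le> 1" for w :: "'i \<Rightarrow> complex"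
        using h1 by (intro prod_le_1) auto
      have "(\<integral>\<^sup>+z. 1 \<partial>m1) = (\<integral>\<^sup>+x. (\<Prod>i\<in>J. (h(j := (\<lambda>_. 1))) i (X i x)) \<partial>Q)"
        by (rule int1) simp
      also have "\<dots> \<le> (\<integral>\<^sup>+x. 1 \<partial>Q)"
        by (intro nn_integral_mono p1)
      finally have "emeasure m1 (space m1) \<le> 1" by (simp add: Q.emeasure_space_1)
      then show "finite_measure m1"
        by (intro finite_measureI) (metis ennreal_one_neq_top infinity_ennreal_def top.extremum_uniqueI)
      have "(\<integral>\<^sup>+z. 1 \<partial>m2) = (\<integral>\<^sup>+x. (\<Prod>i\<in>J. (h(j := (\<lambda>_. 1))) i (Y i x)) \<partial>K)"
        by (rule int2) simp
      also have "\<dots> \<le> (\<integral>\<^sup>+x. 1 \<partial>K)"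
        by (intro nn_integral_mono p1)
      finally have "emeasure m2 (space m2) \<le> 1" by (simp add: K.emeasure_space_1)
      then show "finite_measure m2"
        by (intro finite_measureI) (metis ennreal_one_neq_top infinity_ennreal_def top.extremum_uniqueI)
      fix f :: "complex \<Rightarrow> real" assume f: "continuous_on UNIV f" "\<And>x. 0 \<le> f x \<and> f x \<le> 1"
      have fm: "(\<lambda>x. ennreal (f x)) \<in> borel_measurable borel"
        using borel_measurable_continuous_onI[OF f(1)] by simp
      have "ok I (h(j := (\<lambda>x. ennreal (f x))))"
        unfolding ok_def
      proof (intro conjI allI impI)
        fix i x
        show "(h(j := \<lambda>x. ennreal (f x))) i \<in> borel_measurable borel" using hm fm by simp
        show "(h(j := \<lambda>x. ennreal (f x))) i x \<le> 1" using h1 f(2) by (simp add: ennreal_le_1)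
        assume "i \<notin> I"
        then show "\<exists>fa. continuous_on UNIV fa \<and> (\<forall>x. 0 \<le> fa x \<and> fa x \<le> 1) \<and> (h(j := \<lambda>x. ennreal (f x))) i = (\<lambda>x. ennreal (fa x))"
          using f insert(5) unfolding ok_def by (cases "i = j") auto
      qed
      then show "(\<integral>\<^sup>+x. ennreal (f x) \<partial>m1) = (\<integral>\<^sup>+x. ennreal (f x) \<partial>m2)"
        unfolding int1[OF fm] int2[OF fm] using insert by blast
    qed
    then show ?case using int1[OF hm[of j]] int2[OF hm[of j]] by simp
  qed
  have "ok J (\<lambda>i. if i \<in> J then indicator (A i) else (\<lambda>_. ennreal 0))"
    using A unfolding ok_def by (auto simp: indicator_def intro!: exI[of _ "\<lambda>_. 0"])
  from main[OF J order_refl this] show ?thesis by (simp cong: prod.cong)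
qed

text \<open>Pointwise convergence passes, by dominated convergence, to expectations of products of
  bounded continuous functions, but not to those of indicators; hence the reduction to continuous
  factors.\<close>

lemma path_law_limit:
  assumes Q: "prob_space Q" "\<And>n t. 0 \<le> t \<Longrightarrow> Xs n t \<in> borel_measurable Q"
    and K: "prob_space K" "\<And>t. 0 \<le> t \<Longrightarrow> Y t \<in> borel_measurable K"
    and law: "\<And>n. path_law Q (Xs n) = path_law K Y"
    and lim: "\<And>p t. p \<in> space Q \<Longrightarrow> 0 \<le> t \<Longrightarrow> (\<lambda>n. Xs n t p) \<longlonglongrightarrow> X t p"
  shows "\<And>t. 0 \<le> t \<Longrightarrow> X t \<in> borel_measurable Q" and "path_law Q X = path_law K Y"
proof -
  interpret Q: prob_space Q by fact
  show Xm: "X t \<in> borel_measurable Q" if "0 \<le> t" for t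
    by (rule borel_measurable_LIMSEQ_metric[OF Q(2) lim]) (use that in auto)
  show "path_law Q X = path_law K Y"
  proof (rule path_law_eqI[OF Q(1) Xm K])
    fix J :: "real set" and A :: "real \<Rightarrow> complex set"
    assume J: "finite J" "J \<subseteq> {0..}" and A: "\<And>i. A i \<in> sets borel"
    show "(\<integral>\<^sup>+x. (\<Prod>i\<in>J. indicator (A i) (X i x)) \<partial>Q) = (\<integral>\<^sup>+x. (\<Prod>i\<in>J. indicator (A i) (Y i x)) \<partial>K)"
    proof (rule prod_indicator_eqI[OF Q(1) _ K(1) _ J(1) _ A])
      show "X t \<in> borel_measurable Q" "Y t \<in> borel_measurable K" if "t \<in> J" for t
        using that J Xm K(2) by auto
      fix f :: "real \<Rightarrow> complex \<Rightarrow> real" assume f: "\<And>i. continuous_on UNIV (f i)" "\<And>i x. 0 \<le> f i x \<and> f i x \<le> 1"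
      have fm: "(\<lambda>x. ennreal (f i x)) \<in> borel_measurable borel" for i
        using borel_measurable_continuous_onI[OF f(1)] by simp
      have le1: "(\<Prod>i\<in>J. ennreal (f i (w i))) \<le> 1" for w
        using f(2) by (intro prod_le_1) (auto simp: ennreal_le_1)
      have "(\<lambda>n. \<integral>\<^sup>+x. (\<Prod>i\<in>J. ennreal (f i (Xs n i x))) \<partial>Q) \<longlonglongrightarrow> (\<integral>\<^sup>+x. (\<Prod>i\<in>J. ennreal (f i (X i x))) \<partial>Q)"
      proof (rule nn_integral_dominated_convergence[where w="\<lambda>_. 1"])
        show "(\<lambda>x. \<Prod>i\<in>J. ennreal (f i (Xs n i x))) \<in> borel_measurable Q" for n
          by (intro borel_measurable_prod_ennreal measurable_compose[OF Q(2) fm]) (use J in auto)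
        show "(\<lambda>x. \<Prod>i\<in>J. ennreal (f i (X i x))) \<in> borel_measurable Q"
          by (intro borel_measurable_prod_ennreal measurable_compose[OF Xm fm]) (use J in auto)
        show "AE x in Q. (\<lambda>n. \<Prod>i\<in>J. ennreal (f i (Xs n i x))) \<longlonglongrightarrow> (\<Prod>i\<in>J. ennreal (f i (X i x)))"
        proof (rule AE_I2)
          fix x assume x: "x \<in> space Q"
          have "(\<lambda>n. \<Prod>i\<in>J. f i (Xs n i x)) \<longlonglongrightarrow> (\<Prod>i\<in>J. f i (X i x))"
          proof (rule tendsto_prod)
            fix i assume "i \<in> J"
            then have "(\<lambda>n. Xs n i x) \<longlonglongrightarrow> X i x" using J lim[OF x] by auto
            then show "(\<lambda>n. f i (Xs n i x)) \<longlonglongrightarrow> f i (X i x)"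
              by (rule continuous_on_tendsto_compose[OF f(1)]) auto
          qed
          then have "(\<lambda>n. ennreal (\<Prod>i\<in>J. f i (Xs n i x))) \<longlonglongrightarrow> ennreal (\<Prod>i\<in>J. f i (X i x))"
            by (rule tendsto_ennrealI)
          then show "(\<lambda>n. \<Prod>i\<in>J. ennreal (f i (Xs n i x))) \<longlonglongrightarrow> (\<Prod>i\<in>J. ennreal (f i (X i x)))"
            using f(2) by (simp add: prod_ennreal)
        qed
      qed (use le1 Q.emeasure_space_1 in auto)
      moreover have "(\<integral>\<^sup>+x. (\<Prod>i\<in>J. ennreal (f i (Xs n i x))) \<partial>Q) = (\<integral>\<^sup>+x. (\<Prod>i\<in>J. ennreal (f i (Y i x))) \<partial>K)" for n
        
        using nn_integral_path_law[of "Xs n" Q J "\<lambda>i x. ennreal (f i x)", OF Q(2) J fm]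
          nn_integral_path_law[of Y K J "\<lambda>i x. ennreal (f i x)", OF K(2) J fm] law[of n] by simp
      ultimately show "(\<integral>\<^sup>+x. (\<Prod>i\<in>J. ennreal (f i (X i x))) \<partial>Q) = (\<integral>\<^sup>+x. (\<Prod>i\<in>J. ennreal (f i (Y i x))) \<partial>K)"
        by (simp add: LIMSEQ_const_iff)
    qed
  qed
qed

section \<open>The strong Markov property at hitting times\<close>

definition hits :: "(real \<Rightarrow> complex) \<Rightarrow> real \<Rightarrow> bool" where
  "hits f r \<longleftrightarrow> (\<exists>t\<ge>0. cmod (f t) = r)"

definition hit_time :: "(real \<Rightarrow> complex) \<Rightarrow> real \<Rightarrow> real" where
  "hit_time f r = Inf {t. 0 \<le> t \<and> cmod (f t) = r}"

lemma hit_time: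
  assumes f: "continuous_on {0..} f" and h: "hits f r"
  shows "0 \<le> hit_time f r" "cmod (f (hit_time f r)) = r"
    "\<And>s. 0 \<le> s \<Longrightarrow> s < hit_time f r \<Longrightarrow> cmod (f s) \<noteq> r"
    "\<And>s. 0 \<le> s \<Longrightarrow> cmod (f s) = r \<Longrightarrow> hit_time f r \<le> s"
proof -
  let ?H = "{t. 0 \<le> t \<and> cmod (f t) = r}"
  have "closed ({0..} \<inter> (\<lambda>t. cmod (f t)) -` {r})"
    by (intro continuous_closed_preimage continuous_intros f)
  also have "{0..} \<inter> (\<lambda>t. cmod (f t)) -` {r} = ?H" by auto
  finally have cl: "closed ?H" .
  have ne: "?H \<noteq> {}" using h by (auto simp: hits_def)
  have bdd: "bdd_below ?H" by (auto intro: bdd_belowI[of _ 0])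
  have "Inf ?H \<in> ?H" by (rule closed_contains_Inf[OF ne bdd cl])
  then show "0 \<le> hit_time f r" "cmod (f (hit_time f r)) = r" by (auto simp: hit_time_def)
  show *: "hit_time f r \<le> s" if "0 \<le> s" "cmod (f s) = r" for s
    unfolding hit_time_def by (rule cInf_lower[OF _ bdd]) (use that in simp)
  show "cmod (f s) \<noteq> r" if "0 \<le> s" "s < hit_time f r" for s using *[of s] that by auto
qed

lemma hits_before_iff:
  assumes f: "continuous_on {0..} f"
  shows "hits_before f r b \<longleftrightarrow> hits f r \<and> hit_time f r < b"
proof
  assume "hits_before f r b"
  then obtain t where t: "0 \<le> t" "t < b" "cmod (f t) = r" by (auto simp: hits_before_def)
  then have h: "hits f r" by (auto simp: hits_def)
  show "hits f r \<and> hit_time f r < b" using hit_time(4)[OF f h t(1,3)] h t by simp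
next
  assume "hits f r \<and> hit_time f r < b"
  then show "hits_before f r b" using hit_time(1,2)[OF f] unfolding hits_before_def by blast
qed

lemma hits_before_rat_mono:
  assumes "hits_before_rat f r a" "a \<le> b"
  shows "hits_before_rat f r b"
proof -
  from assms(1) obtain m :: nat where m: "\<forall>k::nat. \<exists>q\<in>\<rat> \<inter> {0..a - 1 / (real m + 1)}. \<bar>cmod (f q) - r\<bar> < 1 / (real k + 1)"
    unfolding hits_before_rat_def ..
  have "\<rat> \<inter> {0..a - 1 / (real m + 1)} \<subseteq> \<rat> \<inter> {0..b - 1 / (real m + 1)}" using assms(2) by auto
  with m have "\<forall>k::nat. \<exists>q\<in>\<rat> \<inter> {0..b - 1 / (real m + 1)}. \<bar>cmod (f q) - r\<bar> < 1 / (real k + 1)"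
    by (meson subsetD)
  then show ?thesis unfolding hits_before_rat_def ..
qed

lemma hits_before_glue_at: "b \<le> s \<Longrightarrow> hits_before (glue_at s f g) r b \<longleftrightarrow> hits_before f r b"
  unfolding hits_before_def by (intro ex_cong) (auto simp: glue_at_def)

definition glue :: "real \<Rightarrow> (real \<Rightarrow> complex) \<Rightarrow> (real \<Rightarrow> complex) \<Rightarrow> real \<Rightarrow> complex" where
  "glue r f g = (if hits f r then glue_at (hit_time f r) f g else f)"

text \<open>Strictly above \<open>x\<close> even if \<open>x\<close> is itself dyadic. Strictness
  means that the path has already hit when its continuation begins, so the time of gluing is decided
  by the path before that time.\<close>

definition dyadic_above :: "nat \<Rightarrow> real \<Rightarrow> real" where
  "dyadic_above n x = (real_of_int \<lfloor>2 ^ n * x\<rfloor> + 1) / 2 ^ n"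

lemma dyadic_above_gt: "x < dyadic_above n x"
proof -
  have "2 ^ n * x < real_of_int \<lfloor>2 ^ n * x\<rfloor> + 1" by linarith
  then show ?thesis by (simp add: dyadic_above_def field_simps)
qed

lemma dyadic_above_le: "dyadic_above n x \<le> x + 1 / 2 ^ n"
proof -
  have "real_of_int \<lfloor>2 ^ n * x\<rfloor> + 1 \<le> 2 ^ n * x + 1" by simp
  then have "dyadic_above n x \<le> (2 ^ n * x + 1) / 2 ^ n"
    unfolding dyadic_above_def by (intro divide_right_mono) auto
  then show ?thesis by (simp add: add_divide_distrib)
qed

lemma dyadic_above_tendsto: "(\<lambda>n. dyadic_above n x) \<longlonglongrightarrow> x"
proof (rule tendsto_sandwich)
  show "\<forall>\<^sub>F n in sequentially. x \<le> dyadic_above n x" by (intro always_eventually allI less_imp_le dyadic_above_gt)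
  show "\<forall>\<^sub>F n in sequentially. dyadic_above n x \<le> x + 1 / 2 ^ n" by (intro always_eventually allI dyadic_above_le)
  have "(\<lambda>n. x + (1 / 2) ^ n) \<longlonglongrightarrow> x + 0" by (intro tendsto_intros LIMSEQ_realpow_zero) auto
  then show "(\<lambda>n. x + 1 / 2 ^ n) \<longlonglongrightarrow> x" by (simp add: power_one_over)
qed simp

definition glue_dyadic :: "nat \<Rightarrow> real \<Rightarrow> (real \<Rightarrow> complex) \<Rightarrow> (real \<Rightarrow> complex) \<Rightarrow> real \<Rightarrow> complex" where
  "glue_dyadic n r f g = (if hits f r then glue_at (dyadic_above n (hit_time f r)) f g else f)"

lemma glue_dyadic_tendsto:
  assumes f: "continuous_on {0..} f" and g: "continuous_on {0..} g" and t: "0 \<le> t"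
  shows "(\<lambda>n. glue_dyadic n r f g t) \<longlonglongrightarrow> glue r f g t"
proof (cases "hits f r")
  case True
  define T where "T = hit_time f r"
  have T: "0 \<le> T" using hit_time(1)[OF f True] by (simp add: T_def)
  have Tn: "T < dyadic_above n T" for n by (rule dyadic_above_gt)
  show ?thesis
  proof (cases "t \<le> T")
    case le: True
    have "glue_dyadic n r f g t = glue r f g t" for n
      using True le Tn[of n] by (simp add: glue_dyadic_def glue_def glue_at_def T_def[symmetric])
    then show ?thesis by simp
  next
    case False
    have lim: "(\<lambda>n. dyadic_above n T) \<longlonglongrightarrow> T" by (rule dyadic_above_tendsto)
    have ev: "\<forall>\<^sub>F n in sequentially. dyadic_above n T < t"
      using order_tendstoD(2)[OF lim, of t] False by simp
    have Tn0: "0 \<le> dyadic_above n T" for n using T Tn[of n] by simp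
    have 1: "(\<lambda>n. f (dyadic_above n T)) \<longlonglongrightarrow> f T"
      by (rule continuous_on_tendsto_compose[OF f lim]) (simp_all add: T Tn0)
    have ev': "\<forall>\<^sub>F n in sequentially. t - dyadic_above n T \<in> {0..}"
      using ev by eventually_elim simp
    have tT: "t - T \<in> {0..}" using False by simp
    have 2: "(\<lambda>n. g (t - dyadic_above n T)) \<longlonglongrightarrow> g (t - T)"
      by (rule continuous_on_tendsto_compose[OF g tendsto_diff[OF tendsto_const lim] tT ev'])
    have "(\<lambda>n. f (dyadic_above n T) + g (t - dyadic_above n T)) \<longlonglongrightarrow> f T + g (t - T)"
      by (rule tendsto_add[OF 1 2])
    moreover have "\<forall>\<^sub>F n in sequentially. glue_dyadic n r f g t = f (dyadic_above n T) + g (t - dyadic_above n T)"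
      using ev by eventually_elim (use True in \<open>simp add: glue_dyadic_def glue_at_def T_def[symmetric]\<close>)
    moreover have "glue r f g t = f T + g (t - T)"
      using True False by (simp add: glue_def glue_at_def T_def[symmetric])
    ultimately show ?thesis by (simp add: tendsto_cong)
  qed
qed (simp add: glue_dyadic_def glue_def)

lemma distr_pair_fst:
  assumes N: "prob_space N" and N': "prob_space N'" and Y: "Y \<in> borel_measurable N"
  shows "distr (N \<Otimes>\<^sub>M N') borel (\<lambda>p. Y (fst p)) = distr N borel (Y :: _ \<Rightarrow> complex)"
proof (rule measure_eqI)
  interpret N': prob_space N' by fact
  note [measurable] = Y
  fix A assume "A \<in> sets (distr (N \<Otimes>\<^sub>M N') borel (\<lambda>p. Y (fst p)))"
  then have A [measurable]: "A \<in> sets borel" by simp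
  have "(\<lambda>p. Y (fst p)) -` A \<inter> space (N \<Otimes>\<^sub>M N') = (Y -` A \<inter> space N) \<times> space N'"
    by (auto simp: space_pair_measure)
  then have "emeasure (distr (N \<Otimes>\<^sub>M N') borel (\<lambda>p. Y (fst p))) A = emeasure (N \<Otimes>\<^sub>M N') ((Y -` A \<inter> space N) \<times> space N')"
    by (subst emeasure_distr) simp_all
  also have "\<dots> = emeasure N (Y -` A \<inter> space N)"
    by (subst N'.emeasure_pair_measure_Times) (simp_all add: N'.emeasure_space_1)
  finally show "emeasure (distr (N \<Otimes>\<^sub>M N') borel (\<lambda>p. Y (fst p))) A = emeasure (distr N borel Y) A"
    by (simp add: emeasure_distr)
qed simp

text \<open>The event \<open>F (Suc k)\<close> that the hitting time falls into the
  \<open>k\<close>-th dyadic interval depends only on the path before the right end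
  \<open>s k\<close>. Gluing at \<open>s k\<close> therefore does not change membership and the
  countable switch applies; on \<open>F 0\<close>, the event of no hit, nothing is glued.\<close>

lemma path_law_glue_dyadic:
  assumes X: "brownian_process N X" and W: "brownian_process N' W"
    and W0: "\<And>x. x \<in> space N' \<Longrightarrow> W 0 x = 0"
  shows "\<And>t. 0 \<le> t \<Longrightarrow> (\<lambda>p. glue_dyadic n r (\<lambda>t. X t (fst p)) (\<lambda>t. W t (snd p)) t) \<in> borel_measurable (N \<Otimes>\<^sub>M N')"
    and "path_law (N \<Otimes>\<^sub>M N') (\<lambda>t p. glue_dyadic n r (\<lambda>t. X t (fst p)) (\<lambda>t. W t (snd p)) t) = path_law N X"
proof -
  let ?Q = "N \<Otimes>\<^sub>M N'"
  note NX = brownian_processD[OF X] and NW = brownian_processD[OF W]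
  define X' where "X' t p = X t (fst p)" for t and p :: "'a \<times> 'b"
  define s where "s k = (real k + 1) / 2 ^ n" for k
  define V where "V k = (case k of 0 \<Rightarrow> X' | Suc k \<Rightarrow> (\<lambda>t p. glue_at (s k) (\<lambda>t. X t (fst p)) (\<lambda>t. W t (snd p)) t))" for k
  define F where "F k = (case k of 0 \<Rightarrow> {f\<in>space path_space. \<forall>b::nat. \<not> hits_before_rat f r b}
     | Suc k \<Rightarrow> {f\<in>space path_space. \<not> hits_before_rat f r (real k / 2 ^ n) \<and> hits_before_rat f r (s k)})" for k
  define Z where "Z t p = glue_dyadic n r (\<lambda>t. X t (fst p)) (\<lambda>t. W t (snd p)) t" for t and p :: "'a \<times> 'b"
  have s0: "0 \<le> s k" for k by (simp add: s_def)
  have glueV: "brownian_process ?Q (V (Suc k))" for k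
    unfolding V_def by (simp, rule brownian_process_glue_at[OF X W W0 s0])
  have X'm: "X' t \<in> borel_measurable ?Q" if "0 \<le> t" for t
    using NX(2)[OF that] unfolding X'_def by measurable
  have contX: "continuous_on {0..} (\<lambda>t. X t (fst p))" if "p \<in> space ?Q" for p
    using that by (intro NX(3)) (auto simp: space_pair_measure)
  have contW: "continuous_on {0..} (\<lambda>t. W t (snd p))" if "p \<in> space ?Q" for p
    using that by (intro NW(3)) (auto simp: space_pair_measure)
  have Vm: "V k t \<in> borel_measurable ?Q" if "0 \<le> t" for k t
    using X'm[OF that] brownian_processD(2)[OF glueV that] by (cases k) (simp_all add: V_def)
  have ps: "(\<lambda>t\<in>{0..}. x t) \<in> space path_space" for x by (simp add: path_space_def space_PiM)
  have ev: "(\<lambda>f. f t) \<in> borel_measurable path_space" if "0 \<le> t" for t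
    unfolding path_space_def by (rule measurable_component_singleton) (use that in simp)
  have hm: "Measurable.pred path_space (\<lambda>f. hits_before_rat f r b)" for b
    using measurable_hits_before_rat[of "\<lambda>t f. f t" path_space r b] ev by simp
  have Fm: "F k \<in> sets path_space" for k
  proof (cases k)
    case 0
    have "Measurable.pred path_space (\<lambda>f. \<forall>b::nat. \<not> hits_before_rat f r b)"
      by (intro pred_intros_countable pred_intros_logic hm)
    then show ?thesis by (simp add: 0 F_def pred_def)
  next
    case (Suc l)
    have "Measurable.pred path_space (\<lambda>f. \<not> hits_before_rat f r (real l / 2 ^ n) \<and> hits_before_rat f r (s l))"
      by (intro pred_intros_logic hm)
    then show ?thesis by (simp add: Suc F_def pred_def)
  qed
  have disj: "disjoint_family F"
  proof -
    have *: "F (Suc k) \<inter> F (Suc l) = {}" if "k < l" for k l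
    proof -
      have "s k \<le> real l / 2 ^ n" using that unfolding s_def by (intro divide_right_mono) auto
      from hits_before_rat_mono[OF _ this] show ?thesis by (auto simp: F_def)
    qed
    have **: "F 0 \<inter> F (Suc k) = {}" for k
    proof -
      obtain b :: nat where b: "s k \<le> real b" using real_arch_simple by blast
      show ?thesis using hits_before_rat_mono[OF _ b] by (auto simp: F_def)
    qed
    have "F i \<inter> F j = {}" if "i \<noteq> j" for i j
    proof (cases i; cases j)
      fix k l assume "i = Suc k" "j = Suc l"
      then show ?thesis using *[of k l] *[of l k] that by (cases k l rule: linorder_cases) auto
    next
      fix l assume "i = 0" "j = Suc l" then show ?thesis using **[of l] by simp
    next
      fix l assume "i = Suc l" "j = 0" then show ?thesis using **[of l] by (simp add: Int_commute)
    qed (use that in simp)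
    then show ?thesis by (auto simp: disjoint_family_on_def)
  qed
  have F0: "(\<lambda>t\<in>{0..}. X' t p) \<in> F 0 \<longleftrightarrow> \<not> hits (\<lambda>t. X t (fst p)) r" if p: "p \<in> space ?Q" for p
  proof -
    have "hits_before (\<lambda>t. X t (fst p)) r b \<longleftrightarrow> hits (\<lambda>t. X t (fst p)) r \<and> hit_time (\<lambda>t. X t (fst p)) r < b" for b
      by (rule hits_before_iff[OF contX[OF p]])
    moreover have "\<exists>b::nat. hit_time (\<lambda>t. X t (fst p)) r < b" using reals_Archimedean2 by blast
    ultimately show ?thesis
      by (auto simp: F_def ps X'_def hits_before_rat_iff[OF contX[OF p]])
  qed
  have FS: "(\<lambda>t\<in>{0..}. X' t p) \<in> F (Suc k) \<longleftrightarrow> hits (\<lambda>t. X t (fst p)) r \<and> real k / 2 ^ n \<le> hit_time (\<lambda>t. X t (fst p)) r \<and> hit_time (\<lambda>t. X t (fst p)) r < s k"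
    if p: "p \<in> space ?Q" for p k
    by (auto simp: F_def ps X'_def hits_before_rat_iff[OF contX[OF p]] hits_before_iff[OF contX[OF p]])
  have fl: "real k / 2 ^ n \<le> x \<and> x < s k \<longleftrightarrow> \<lfloor>2 ^ n * x\<rfloor> = int k" for k x
    by (auto simp: s_def floor_eq_iff field_simps)
  have cover: "\<exists>k. (\<lambda>t\<in>{0..}. X' t p) \<in> F k" if p: "p \<in> space ?Q" for p
  proof (cases "hits (\<lambda>t. X t (fst p)) r")
    case True
    have "0 \<le> \<lfloor>2 ^ n * hit_time (\<lambda>t. X t (fst p)) r\<rfloor>" using hit_time(1)[OF contX[OF p] True] by simp
    then have "\<lfloor>2 ^ n * hit_time (\<lambda>t. X t (fst p)) r\<rfloor> = int (nat \<lfloor>2 ^ n * hit_time (\<lambda>t. X t (fst p)) r\<rfloor>)" by simp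
    then show ?thesis using FS[OF p] True fl by blast
  next
    case False then show ?thesis using F0[OF p] by blast
  qed
  have same: "(\<lambda>t\<in>{0..}. V k t p) \<in> F k \<longleftrightarrow> (\<lambda>t\<in>{0..}. X' t p) \<in> F k" if p: "p \<in> space ?Q" for k p
  proof (cases k)
    case 0 then show ?thesis by (simp add: V_def)
  next
    case (Suc l)
    have c: "continuous_on {0..} (\<lambda>t. V (Suc l) t p)" by (rule brownian_processD(3)[OF glueV p])
    have Veq: "(\<lambda>t. V (Suc l) t p) = glue_at (s l) (\<lambda>t. X t (fst p)) (\<lambda>t. W t (snd p))" by (auto simp: V_def)
    have le: "real l / 2 ^ n \<le> s l" unfolding s_def by (intro divide_right_mono) auto
    have "hits_before (\<lambda>t. V (Suc l) t p) r b \<longleftrightarrow> hits_before (\<lambda>t. X t (fst p)) r b" if "b \<le> s l" for b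
      unfolding Veq by (rule hits_before_glue_at[OF that])
    then show ?thesis
      using le by (simp add: Suc F_def ps X'_def hits_before_rat_iff[OF contX[OF p]] hits_before_rat_iff[OF c])
  qed
  have ZV: "Z t p = V k t p" if p: "p \<in> space ?Q" "(\<lambda>t\<in>{0..}. X' t p) \<in> F k" "0 \<le> t" for k p t
  proof (cases k)
    case 0 then show ?thesis using F0[OF p(1)] p(2) by (simp add: Z_def V_def glue_dyadic_def X'_def)
  next
    case (Suc l)
    with FS[OF p(1)] p(2) have h: "hits (\<lambda>t. X t (fst p)) r" and "\<lfloor>2 ^ n * hit_time (\<lambda>t. X t (fst p)) r\<rfloor> = int l"
      using fl by blast+
    then show ?thesis by (simp add: Z_def V_def glue_dyadic_def Suc dyadic_above_def s_def)
  qed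
  have lawX: "path_law ?Q X' = path_law N X"
    unfolding X'_def by (rule path_law_fst[OF NX(1,2) NW(1)])
  have lawV: "path_law ?Q (V k) = path_law ?Q X'" for k
  proof (cases k)
    case 0 then show ?thesis by (simp add: V_def)
  next
    case (Suc l)
    have "path_law ?Q (V (Suc l)) = path_law N X"
    proof (rule brownian_process_law_unique[OF glueV X])
      have "V (Suc l) 0 = (\<lambda>p. X 0 (fst p))" using s0 by (auto simp: V_def glue_at_def)
      then show "distr ?Q borel (V (Suc l) 0) = distr N borel (X 0)"
        using distr_pair_fst[OF NX(1) NW(1) NX(2)[of 0]] by simp
    qed
    then show ?thesis by (simp add: Suc lawX)
  qed
  note sw = path_law_countable_switch[where X=X' and V=V and F=F and Z=Z and Q="?Q", OF X'm Vm Fm disj cover same ZV lawV]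
  show "(\<lambda>p. glue_dyadic n r (\<lambda>t. X t (fst p)) (\<lambda>t. W t (snd p)) t) \<in> borel_measurable ?Q" if "0 \<le> t" for t
    using sw(1)[OF _ _ _ _ _ _ _ that] unfolding Z_def by simp
  show "path_law ?Q (\<lambda>t p. glue_dyadic n r (\<lambda>t. X t (fst p)) (\<lambda>t. W t (snd p)) t) = path_law N X"
    using sw(2) lawX unfolding Z_def by simp
qed

text \<open>The strong Markov property in the form used below: restarting at the first hit with an
  independent copy leaves the law unchanged. The dyadic gluing times converge to the hitting time,
  and continuity of both paths gives pointwise convergence of the glued ones.\<close>

theorem path_law_glue:
  assumes X: "brownian_process N X" and W: "brownian_process N' W"
    and W0: "\<And>x. x \<in> space N' \<Longrightarrow> W 0 x = 0"
  shows "\<And>t. 0 \<le> t \<Longrightarrow> (\<lambda>p. glue r (\<lambda>t. X t (fst p)) (\<lambda>t. W t (snd p)) t) \<in> borel_measurable (N \<Otimes>\<^sub>M N')"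
    and "path_law (N \<Otimes>\<^sub>M N') (\<lambda>t p. glue r (\<lambda>t. X t (fst p)) (\<lambda>t. W t (snd p)) t) = path_law N X"
proof -
  note NX = brownian_processD[OF X] and NW = brownian_processD[OF W]
  interpret N: prob_space N by (rule NX)
  interpret N': prob_space N' by (rule NW)
  interpret P: pair_prob_space N N' ..
  have lim: "(\<lambda>n. glue_dyadic n r (\<lambda>t. X t (fst p)) (\<lambda>t. W t (snd p)) t) \<longlonglongrightarrow> glue r (\<lambda>t. X t (fst p)) (\<lambda>t. W t (snd p)) t"
    if "p \<in> space (N \<Otimes>\<^sub>M N')" "0 \<le> t" for p t
    using that by (intro glue_dyadic_tendsto NX(3) NW(3)) (auto simp: space_pair_measure)
  note L = path_law_limit[where Xs="\<lambda>n t p. glue_dyadic n r (\<lambda>t. X t (fst p)) (\<lambda>t. W t (snd p)) t" and K=N and Y=X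
      and X="\<lambda>t p. glue r (\<lambda>t. X t (fst p)) (\<lambda>t. W t (snd p)) t",
      OF P.prob_space_axioms path_law_glue_dyadic(1)[OF X W W0] NX(1,2) path_law_glue_dyadic(2)[OF X W W0] lim]
  show "(\<lambda>p. glue r (\<lambda>t. X t (fst p)) (\<lambda>t. W t (snd p)) t) \<in> borel_measurable (N \<Otimes>\<^sub>M N')" if "0 \<le> t" for t
    by (rule L(1)) (use that in auto)
  show "path_law (N \<Otimes>\<^sub>M N') (\<lambda>t p. glue r (\<lambda>t. X t (fst p)) (\<lambda>t. W t (snd p)) t) = path_law N X"
    by (rule L(2)) auto
qed

section \<open>The non-intersection probability as a function of the two path laws\<close>

lemma sets_avoids:
  assumes X: "\<And>t. 0 \<le> t \<Longrightarrow> X t \<in> borel_measurable Q" "\<And>x. x \<in> space Q \<Longrightarrow> continuous_on {0..} (\<lambda>t. X t x)"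
    and Y: "\<And>t. 0 \<le> t \<Longrightarrow> Y t \<in> borel_measurable Q" "\<And>x. x \<in> space Q \<Longrightarrow> continuous_on {0..} (\<lambda>t. Y t x)"
    and \<alpha>: "0 \<le> \<alpha>"
  shows "{x\<in>space Q. avoids (circle_arc \<alpha>) S (\<lambda>t. X t x) (\<lambda>t. Y t x)} \<in> sets Q"
proof -
  have "{x\<in>space Q. avoids (circle_arc \<alpha>) S (\<lambda>t. X t x) (\<lambda>t. Y t x)} = {x\<in>space Q. avoids_rat \<alpha> S (\<lambda>t. X t x) (\<lambda>t. Y t x)}"
    using avoids_rat_iff[OF X(2) Y(2) \<alpha>] by (intro Collect_cong) metis
  then show ?thesis using measurable_avoids_rat[of X Q Y \<alpha> S] X(1) Y(1) by (simp add: pred_def)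
qed

definition noninter :: "real \<Rightarrow> real \<Rightarrow> 'a measure \<Rightarrow> (real \<Rightarrow> 'a \<Rightarrow> complex) \<Rightarrow> 'b measure \<Rightarrow> (real \<Rightarrow> 'b \<Rightarrow> complex) \<Rightarrow> ennreal" where
  "noninter \<alpha> S N X N' Y =
    emeasure (N \<Otimes>\<^sub>M N') {p\<in>space (N \<Otimes>\<^sub>M N'). avoids (circle_arc \<alpha>) S (\<lambda>t. X t (fst p)) (\<lambda>t. Y t (snd p))}"

definition avoid_left :: "real \<Rightarrow> real \<Rightarrow> 'b measure \<Rightarrow> (real \<Rightarrow> 'b \<Rightarrow> complex) \<Rightarrow> (real \<Rightarrow> complex) \<Rightarrow> ennreal" where
  "avoid_left \<alpha> S N Y f = (\<integral>\<^sup>+y. indicator {y. avoids_rat \<alpha> S f (\<lambda>t. Y t y)} y \<partial>N)"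

definition avoid_right :: "real \<Rightarrow> real \<Rightarrow> 'b measure \<Rightarrow> (real \<Rightarrow> 'b \<Rightarrow> complex) \<Rightarrow> (real \<Rightarrow> complex) \<Rightarrow> ennreal" where
  "avoid_right \<alpha> S N Y f = (\<integral>\<^sup>+y. indicator {y. avoids_rat \<alpha> S (\<lambda>t. Y t y) f} y \<partial>N)"

lemma path_space_component: "0 \<le> t \<Longrightarrow> (\<lambda>f. f t) \<in> borel_measurable path_space"
  unfolding path_space_def by (rule measurable_component_singleton) simp

lemma avoid_left_measurable:
  assumes N: "prob_space N" and Y: "\<And>t. 0 \<le> t \<Longrightarrow> Y t \<in> borel_measurable N"
  shows "avoid_left \<alpha> S N Y \<in> borel_measurable path_space"
    and "avoid_right \<alpha> S N Y \<in> borel_measurable path_space"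
proof -
  interpret prob_space N by fact
  have 1: "(\<lambda>p. fst p t) \<in> borel_measurable (path_space \<Otimes>\<^sub>M N)" if "0 \<le> t" for t
    by (rule measurable_compose[OF measurable_fst path_space_component[OF that]])
  have 2: "(\<lambda>p. Y t (snd p)) \<in> borel_measurable (path_space \<Otimes>\<^sub>M N)" if "0 \<le> t" for t
    by (rule measurable_compose[OF measurable_snd Y[OF that]])
  have "Measurable.pred (path_space \<Otimes>\<^sub>M N) (\<lambda>p. avoids_rat \<alpha> S (\<lambda>t. fst p t) (\<lambda>t. Y t (snd p)))"
    by (rule measurable_avoids_rat[OF 1 2])
  then have "(\<lambda>p. indicator {p. avoids_rat \<alpha> S (fst p) (\<lambda>t. Y t (snd p))} p :: ennreal) \<in> borel_measurable (path_space \<Otimes>\<^sub>M N)"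
    by (simp add: pred_def borel_measurable_indicator_iff Int_def conj_commute)
  then have "(\<lambda>(f, y). indicator {y. avoids_rat \<alpha> S f (\<lambda>t. Y t y)} y :: ennreal) \<in> borel_measurable (path_space \<Otimes>\<^sub>M N)"
    by (rule measurable_cong[THEN iffD1, rotated]) (auto simp: indicator_def)
  then show "avoid_left \<alpha> S N Y \<in> borel_measurable path_space"
    unfolding avoid_left_def[abs_def] by (rule borel_measurable_nn_integral)
  have "Measurable.pred (path_space \<Otimes>\<^sub>M N) (\<lambda>p. avoids_rat \<alpha> S (\<lambda>t. Y t (snd p)) (\<lambda>t. fst p t))"
    by (rule measurable_avoids_rat[OF 2 1])
  then have "(\<lambda>p. indicator {p. avoids_rat \<alpha> S (\<lambda>t. Y t (snd p)) (fst p)} p :: ennreal) \<in> borel_measurable (path_space \<Otimes>\<^sub>M N)"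
    by (simp add: pred_def borel_measurable_indicator_iff Int_def conj_commute)
  then have "(\<lambda>(f, y). indicator {y. avoids_rat \<alpha> S (\<lambda>t. Y t y) f} y :: ennreal) \<in> borel_measurable (path_space \<Otimes>\<^sub>M N)"
    by (rule measurable_cong[THEN iffD1, rotated]) (auto simp: indicator_def)
  then show "avoid_right \<alpha> S N Y \<in> borel_measurable path_space"
    unfolding avoid_right_def[abs_def] by (rule borel_measurable_nn_integral)
qed

lemma nn_integral_path_law':
  assumes X: "\<And>t. 0 \<le> t \<Longrightarrow> X t \<in> borel_measurable N" and \<Phi>: "\<Phi> \<in> borel_measurable path_space"
  shows "(\<integral>\<^sup>+f. \<Phi> f \<partial>path_law N X) = (\<integral>\<^sup>+x. \<Phi> (\<lambda>t\<in>{0..}. X t x) \<partial>N)"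
  unfolding path_law_def
  by (intro nn_integral_distr measurable_path X) (simp_all only: measurable_distr_eq1 \<Phi>)

lemma noninter_eq_left:
  assumes X: "prob_space N" "\<And>t. 0 \<le> t \<Longrightarrow> X t \<in> borel_measurable N" "\<And>x. x \<in> space N \<Longrightarrow> continuous_on {0..} (\<lambda>t. X t x)"
    and Y: "prob_space N'" "\<And>t. 0 \<le> t \<Longrightarrow> Y t \<in> borel_measurable N'" "\<And>x. x \<in> space N' \<Longrightarrow> continuous_on {0..} (\<lambda>t. Y t x)"
    and \<alpha>: "0 \<le> \<alpha>"
  shows "noninter \<alpha> S N X N' Y = (\<integral>\<^sup>+x. avoid_left \<alpha> S N' Y (\<lambda>t\<in>{0..}. X t x) \<partial>N)"
    and "noninter \<alpha> S N X N' Y = (\<integral>\<^sup>+y. avoid_right \<alpha> S N X (\<lambda>t\<in>{0..}. Y t y) \<partial>N')"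
proof -
  interpret N: prob_space N by fact
  interpret N': prob_space N' by fact
  interpret P: pair_prob_space N N' ..
  let ?E = "{p\<in>space (N \<Otimes>\<^sub>M N'). avoids (circle_arc \<alpha>) S (\<lambda>t. X t (fst p)) (\<lambda>t. Y t (snd p))}"
  have E: "?E \<in> sets (N \<Otimes>\<^sub>M N')"
  proof (rule sets_avoids[OF _ _ _ _ \<alpha>])
    fix t :: real assume t: "0 \<le> t"
    show "(\<lambda>p. X t (fst p)) \<in> borel_measurable (N \<Otimes>\<^sub>M N')" by (rule measurable_compose[OF measurable_fst X(2)[OF t]])
    show "(\<lambda>p. Y t (snd p)) \<in> borel_measurable (N \<Otimes>\<^sub>M N')" by (rule measurable_compose[OF measurable_snd Y(2)[OF t]])
  qed (auto simp: space_pair_measure intro!: X(3) Y(3))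
  have e: "indicator ?E (x, y) = (indicator {y. avoids_rat \<alpha> S (\<lambda>t\<in>{0..}. X t x) (\<lambda>t. Y t y)} y :: ennreal)"
    if "x \<in> space N" "y \<in> space N'" for x y
    using that avoids_rat_iff[OF X(3) Y(3) \<alpha>, of x y S] by (auto simp: indicator_def space_pair_measure)
  have e': "indicator ?E (x, y) = (indicator {x. avoids_rat \<alpha> S (\<lambda>t. X t x) (\<lambda>t\<in>{0..}. Y t y)} x :: ennreal)"
    if "x \<in> space N" "y \<in> space N'" for x y
    using that avoids_rat_iff[OF X(3) Y(3) \<alpha>, of x y S] by (auto simp: indicator_def space_pair_measure)
  have "noninter \<alpha> S N X N' Y = (\<integral>\<^sup>+x. (\<integral>\<^sup>+y. indicator ?E (x, y) \<partial>N') \<partial>N)"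
    unfolding noninter_def by (rule N'.emeasure_pair_measure[OF E])
  also have "\<dots> = (\<integral>\<^sup>+x. avoid_left \<alpha> S N' Y (\<lambda>t\<in>{0..}. X t x) \<partial>N)"
    unfolding avoid_left_def by (intro nn_integral_cong e)
  finally show "noninter \<alpha> S N X N' Y = (\<integral>\<^sup>+x. avoid_left \<alpha> S N' Y (\<lambda>t\<in>{0..}. X t x) \<partial>N)" .
  have "noninter \<alpha> S N X N' Y = (\<integral>\<^sup>+p. indicator ?E p \<partial>(N \<Otimes>\<^sub>M N'))"
    unfolding noninter_def using E by simp
  also have "\<dots> = (\<integral>\<^sup>+y. (\<integral>\<^sup>+x. indicator ?E (x, y) \<partial>N) \<partial>N')"
    by (rule P.nn_integral_snd[symmetric]) (use E in simp)
  also have "\<dots> = (\<integral>\<^sup>+y. avoid_right \<alpha> S N X (\<lambda>t\<in>{0..}. Y t y) \<partial>N')"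
    unfolding avoid_right_def by (intro nn_integral_cong e')
  finally show "noninter \<alpha> S N X N' Y = (\<integral>\<^sup>+y. avoid_right \<alpha> S N X (\<lambda>t\<in>{0..}. Y t y) \<partial>N')" .
qed

text \<open>Integrating out one path leaves a functional of the other, whose mean depends only on a
  path law. Doing this in both orders of integration exchanges the two laws one after the
  other.\<close>

lemma noninter_law_cong:
  assumes X: "prob_space N" "\<And>t. 0 \<le> t \<Longrightarrow> X t \<in> borel_measurable N" "\<And>x. x \<in> space N \<Longrightarrow> continuous_on {0..} (\<lambda>t. X t x)"
    and Y: "prob_space N'" "\<And>t. 0 \<le> t \<Longrightarrow> Y t \<in> borel_measurable N'" "\<And>x. x \<in> space N' \<Longrightarrow> continuous_on {0..} (\<lambda>t. Y t x)"
    and X2: "prob_space K" "\<And>t. 0 \<le> t \<Longrightarrow> X2 t \<in> borel_measurable K" "\<And>x. x \<in> space K \<Longrightarrow> continuous_on {0..} (\<lambda>t. X2 t x)"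
    and Y2: "prob_space K'" "\<And>t. 0 \<le> t \<Longrightarrow> Y2 t \<in> borel_measurable K'" "\<And>x. x \<in> space K' \<Longrightarrow> continuous_on {0..} (\<lambda>t. Y2 t x)"
    and \<alpha>: "0 \<le> \<alpha>" and law: "path_law N X = path_law K X2" "path_law N' Y = path_law K' Y2"
  shows "noninter \<alpha> S N X N' Y = noninter \<alpha> S K X2 K' Y2"
proof -
  note e1 = noninter_eq_left(1)[where N=N and X=X and N'=N' and Y=Y and S=S, OF X Y \<alpha>]
  note e2 = noninter_eq_left(1)[where N=K and X=X2 and N'=N' and Y=Y and S=S, OF X2 Y \<alpha>]
  note e3 = noninter_eq_left(2)[where N=K and X=X2 and N'=N' and Y=Y and S=S, OF X2 Y \<alpha>]
  note e4 = noninter_eq_left(2)[where N=K and X=X2 and N'=K' and Y=Y2 and S=S, OF X2 Y2 \<alpha>]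
  note m1 = avoid_left_measurable(1)[where N=N' and Y=Y and S=S and \<alpha>=\<alpha>, OF Y(1,2)]
  note m2 = avoid_left_measurable(2)[where N=K and Y=X2 and S=S and \<alpha>=\<alpha>, OF X2(1,2)]
  have "noninter \<alpha> S N X N' Y = (\<integral>\<^sup>+f. avoid_left \<alpha> S N' Y f \<partial>path_law N X)"
    using nn_integral_path_law'[where X=X and N=N, OF X(2) m1] e1 by simp
  also have "\<dots> = noninter \<alpha> S K X2 N' Y"
    using nn_integral_path_law'[where X=X2 and N=K, OF X2(2) m1] e2 law(1) by simp
  also have "\<dots> = (\<integral>\<^sup>+f. avoid_right \<alpha> S K X2 f \<partial>path_law N' Y)"
    using nn_integral_path_law'[where X=Y and N=N', OF Y(2) m2] e3 by simp
  also have "\<dots> = noninter \<alpha> S K X2 K' Y2"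
    using nn_integral_path_law'[where X=Y2 and N=K', OF Y2(2) m2] e4 law(2) by simp
  finally show ?thesis .
qed

lemma path_law_const_start:
  assumes X: "brownian_process N X" and Y: "brownian_process N' Y"
    and "\<And>x. x \<in> space N \<Longrightarrow> X 0 x = z" "\<And>y. y \<in> space N' \<Longrightarrow> Y 0 y = z"
  shows "path_law N X = path_law N' Y"
proof (rule brownian_process_law_unique[OF X Y])
  interpret N: prob_space N by (rule brownian_processD[OF X])
  interpret N': prob_space N' by (rule brownian_processD[OF Y])
  have "distr N borel (X 0) = distr N borel (\<lambda>_. z)" by (rule distr_cong) (use assms in auto)
  also have "\<dots> = distr N' borel (\<lambda>_. z)" by (simp add: N.distr_const N'.distr_const)
  also have "\<dots> = distr N' borel (Y 0)" by (rule distr_cong) (use assms in auto)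
  finally show "distr N borel (X 0) = distr N' borel (Y 0)" .
qed

lemma cmod_less_before_hit:
  fixes f :: "real \<Rightarrow> complex"
  assumes f: "continuous_on {0..} f" and f0: "cmod (f 0) \<le> r" and h: "\<And>s. 0 \<le> s \<Longrightarrow> s \<le> t \<Longrightarrow> cmod (f s) \<noteq> r" and t: "0 \<le> t"
  shows "cmod (f t) < r"
proof (rule ccontr)
  assume "\<not> cmod (f t) < r"
  then have "r \<le> cmod (f t)" by simp
  moreover have "continuous_on {0..t} (\<lambda>s. cmod (f s))"
    by (intro continuous_intros continuous_on_subset[OF f]) auto
  ultimately obtain s where "0 \<le> s" "s \<le> t" "cmod (f s) = r"
    using IVT'[of "\<lambda>s. cmod (f s)" 0 r t] f0 t by auto
  with h show False by auto
qed

text \<open>The condition \<open>cmod c + r \<le> S\<close> keeps the rotated and shifted path off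
  the circle of radius \<open>S\<close> before its hitting time, so its continuation is not cut off
  early. Centre and rotation are general because averages over circles about arbitrary points will
  be taken.\<close>

lemma trace_until_after_glue:
  assumes f: "continuous_on {0..} f" and f0: "cmod (f 0) \<le> r" and h: "hits f r" and g0: "g 0 = 0"
    and S: "cmod c + r \<le> S" and u: "cmod u = 1"
  shows "trace_until S (\<lambda>t. c + u * (f (hit_time f r) + g t)) \<subseteq> trace_until S (\<lambda>t. c + u * glue r f g t)"
proof
  define T where "T = hit_time f r"
  note T = hit_time[OF f h, folded T_def]
  have G: "glue r f g (T + s) = f T + g s" if "0 \<le> s" for s
    using that h g0 by (auto simp: glue_def glue_at_def T_def[symmetric])
  fix w assume "w \<in> trace_until S (\<lambda>t. c + u * (f (hit_time f r) + g t))"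
  then obtain t where t: "0 \<le> t" "w = c + u * (f T + g t)" "\<And>s. 0 \<le> s \<Longrightarrow> s < t \<Longrightarrow> cmod (c + u * (f T + g s)) \<noteq> S"
    unfolding trace_until_def T_def by blast
  have "cmod (c + u * glue r f g s) \<noteq> S" if s: "0 \<le> s" "s < T + t" for s
  proof (cases "T \<le> s")
    case True
    then show ?thesis using t(3)[of "s - T"] G[of "s - T"] s by simp
  next
    case False
    have "cmod (f s) < r"
      by (rule cmod_less_before_hit[OF f f0 _ s(1)]) (use T(3) False in auto)
    moreover have "glue r f g s = f s" using False h by (simp add: glue_def glue_at_def T_def)
    moreover have "cmod (c + u * f s) \<le> cmod c + cmod (f s)"
      using norm_triangle_ineq[of c "u * f s"] u by (simp add: norm_mult)
    ultimately show ?thesis using S by auto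
  qed
  moreover have "w = c + u * glue r f g (T + t)" using t G by simp
  moreover have "0 \<le> T + t" using T(1) t(1) by simp
  ultimately show "w \<in> trace_until S (\<lambda>t. c + u * glue r f g t)" unfolding trace_until_def by blast
qed

lemma trace_until_before_glue:
  assumes f: "continuous_on {0..} f" and f0: "cmod (f 0) \<le> r" and h: "hits f r" and S: "r \<le> S"
  shows "trace_until r f \<subseteq> trace_until S (glue r f g)"
proof
  define T where "T = hit_time f r"
  note T = hit_time[OF f h, folded T_def]
  fix w assume "w \<in> trace_until r f"
  then obtain t where t: "0 \<le> t" "w = f t" "\<And>s. 0 \<le> s \<Longrightarrow> s < t \<Longrightarrow> cmod (f s) \<noteq> r"
    unfolding trace_until_def by blast
  have "t \<le> T" using t(3)[of T] T by (meson not_le)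
  then have G: "glue r f g s = f s" if "s \<le> t" for s
    using that h by (simp add: glue_def glue_at_def T_def)
  have "cmod (glue r f g s) \<noteq> S" if s: "0 \<le> s" "s < t" for s
  proof -
    have "cmod (f s) < r"
      by (rule cmod_less_before_hit[OF f f0 _ s(1)]) (use t(3) s in auto)
    then show ?thesis using G[of s] s S by simp
  qed
  moreover have "w = glue r f g t" using t(2) G[of t] by simp
  ultimately show "w \<in> trace_until S (glue r f g)" using t(1) unfolding trace_until_def by blast
qed

lemma avoids_mono:
  assumes "avoids A S f g" "trace_until S' f' \<subseteq> trace_until S f" "trace_until S' g' \<subseteq> trace_until S g"
  shows "avoids A S' f' g'"
  using assms set_times_mono2[of A A "trace_until S' g'" "trace_until S g"] unfolding avoids_def by blast

lemma hits_pred: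
  assumes X: "\<And>t. 0 \<le> t \<Longrightarrow> X t \<in> borel_measurable Q" "\<And>x. x \<in> space Q \<Longrightarrow> continuous_on {0..} (\<lambda>t. X t x)"
  shows "{x\<in>space Q. hits_before (\<lambda>t. X t x) r b} \<in> sets Q" and "{x\<in>space Q. hits (\<lambda>t. X t x) r} \<in> sets Q"
proof -
  have "{x\<in>space Q. hits_before (\<lambda>t. X t x) r b} = {x\<in>space Q. hits_before_rat (\<lambda>t. X t x) r b}" for b
    using hits_before_rat_iff[OF X(2)] by (intro Collect_cong) metis
  then show 1: "{x\<in>space Q. hits_before (\<lambda>t. X t x) r b} \<in> sets Q" for b
    using measurable_hits_before_rat[of X Q r b] X(1) by (simp add: pred_def)
  have "hits f r \<longleftrightarrow> (\<exists>b::nat. hits_before f r b)" for f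
    unfolding hits_def hits_before_def using reals_Archimedean2 by blast
  then have "{x\<in>space Q. hits (\<lambda>t. X t x) r} = (\<Union>b::nat. {x\<in>space Q. hits_before (\<lambda>t. X t x) r b})" by auto
  then show "{x\<in>space Q. hits (\<lambda>t. X t x) r} \<in> sets Q" using 1 by auto
qed

lemma gauss_density_le: "0 < r \<Longrightarrow> gauss_density r z \<le> 1 / (2 * pi * r)"
  by (simp add: gauss_density_eq divide_right_mono)

lemma emeasure_gauss_ball_le:
  assumes t: "0 < t"
  shows "emeasure (gauss t) (ball z r) \<le> ennreal (1 / (2 * pi * t)) * emeasure lborel (ball z r)"
proof -
  have "emeasure (gauss t) (ball z r) = (\<integral>\<^sup>+w. ennreal (gauss_density t w) * indicator (ball z r) w \<partial>lborel)"
    unfolding gauss_def by (rule emeasure_density) simp_all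
  also have "\<dots> \<le> (\<integral>\<^sup>+w. ennreal (1 / (2 * pi * t)) * indicator (ball z r) w \<partial>lborel)"
    by (intro nn_integral_mono mult_right_mono ennreal_leI gauss_density_le t) simp
  also have "\<dots> = ennreal (1 / (2 * pi * t)) * emeasure lborel (ball z r)"
    by (rule nn_integral_cmult_indicator) simp
  finally show ?thesis .
qed

text \<open>A path that has not hit by time \<open>t\<close> is still in the disc of radius
  \<open>r\<close>, which, moved by the start, has mass at most its area times
  \<open>1 / (2 * pi * t)\<close> under \<open>gauss t\<close>. This tends to 0.\<close>

lemma AE_hits:
  assumes W: "brownian_process M W" and W0: "\<And>x. x \<in> space M \<Longrightarrow> W 0 x = 0" and x: "cmod x \<le> r"
  shows "AE \<omega> in M. hits (\<lambda>t. x + W t \<omega>) r"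
proof -
  interpret prob_space M by (rule brownian_processD[OF W])
  note BX = brownian_processD[OF brownian_process_translate[OF W, of x]]
  let ?E = "{\<omega>\<in>space M. \<not> hits (\<lambda>t. x + W t \<omega>) r}"
  have E: "?E \<in> sets M"
  proof -
    have "?E = space M - {\<omega>\<in>space M. hits (\<lambda>t. x + W t \<omega>) r}" by auto
    then show ?thesis using hits_pred(2)[OF BX(2,3), of r] by simp
  qed
  define c where "c = measure lborel (ball (-x) r)"
  have ec: "emeasure lborel (ball (-x) r) = ennreal c"
    unfolding c_def by (rule emeasure_eq_ennreal_measure) (use emeasure_lborel_ball_finite[of "-x" r] in \<open>simp add: less_top\<close>)
  have bd: "emeasure M ?E \<le> ennreal (c / (2 * pi * real (Suc n)))" for n
  proof -
    have Wm: "W (real (Suc n)) \<in> borel_measurable M" by (rule brownian_processD(2)[OF W]) simp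
    let ?B = "W (real (Suc n)) -` ball (-x) r \<inter> space M"
    have Bm: "?B \<in> sets M" by (rule measurable_sets[OF Wm]) simp
    have "?E \<subseteq> ?B"
    proof
      fix \<omega> assume \<omega>: "\<omega> \<in> ?E"
      have "cmod (x + W (real (Suc n)) \<omega>) < r"
        by (rule cmod_less_before_hit[OF BX(3)]) (use \<omega> x W0 in \<open>auto simp: hits_def\<close>)
      moreover have "dist (-x) (W (real (Suc n)) \<omega>) = cmod (- (x + W (real (Suc n)) \<omega>))"
        unfolding dist_norm by (rule arg_cong[of _ _ cmod]) simp
      ultimately show "\<omega> \<in> ?B"
        using \<omega> unfolding norm_minus_cancel by simp
    qed
    then have "emeasure M ?E \<le> emeasure M ?B"
      by (rule emeasure_mono[OF _ Bm])
    also have "\<dots> = (\<integral>\<^sup>+\<omega>. indicator ?B \<omega> \<partial>M)"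
      using Bm by simp
    also have "\<dots> = (\<integral>\<^sup>+\<omega>. indicator (ball (-x) r) (W (real (Suc n)) \<omega>) \<partial>M)"
      by (intro nn_integral_cong) (simp add: indicator_def)
    also have "\<dots> = (\<integral>\<^sup>+y. indicator (ball (-x) r) y \<partial>gauss (real (Suc n)))"
      by (rule brownian_process_gauss[OF W W0]) (auto intro!: borel_measurable_indicator)
    also have "\<dots> = emeasure (gauss (real (Suc n))) (ball (-x) r)"
      by (rule nn_integral_indicator) simp
    also have "\<dots> \<le> ennreal (1 / (2 * pi * real (Suc n))) * ennreal c"
      unfolding ec[symmetric] by (rule emeasure_gauss_ball_le) simp
    also have "\<dots> = ennreal (c / (2 * pi * real (Suc n)))"
      by (simp add: ennreal_mult'[symmetric] c_def)
    finally show ?thesis .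
  qed
  have "(\<lambda>n. c / (2 * pi) * inverse (real (Suc n))) \<longlonglongrightarrow> c / (2 * pi) * 0"
    by (intro tendsto_intros LIMSEQ_inverse_real_of_nat)
  then have "(\<lambda>n. c / (2 * pi * real (Suc n))) \<longlonglongrightarrow> 0" by (simp add: field_simps)
  then have "(\<lambda>n. ennreal (c / (2 * pi * real (Suc n)))) \<longlonglongrightarrow> 0" using tendsto_ennrealI by fastforce
  then have "emeasure M ?E \<le> 0" by (rule LIMSEQ_le_const) (use bd in auto)
  then have "?E \<in> null_sets M" using E by auto
  then show ?thesis by (rule AE_I') auto
qed

lemma path_law_map:
  assumes X: "\<And>t. 0 \<le> t \<Longrightarrow> X t \<in> borel_measurable N" and X': "\<And>t. 0 \<le> t \<Longrightarrow> X' t \<in> borel_measurable N'"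
    and law: "path_law N X = path_law N' X'" and h: "h \<in> borel_measurable borel"
  shows "path_law N (\<lambda>t x. h (X t x)) = path_law N' (\<lambda>t x. h (X' t x))"
proof -
  have hm: "(\<lambda>f. \<lambda>t\<in>{0..}. h (f t)) \<in> measurable path_space path_space"
    by (rule measurable_path[where X="\<lambda>t f. h (f t)"]) (rule measurable_compose[OF path_space_component h])
  have e1: "path_law N (\<lambda>t x. h (X t x)) = distr (path_law N X) path_space (\<lambda>f. \<lambda>t\<in>{0..}. h (f t))"
  proof -
    have "distr (distr N path_space (\<lambda>x. \<lambda>t\<in>{0..}. X t x)) path_space (\<lambda>f. \<lambda>t\<in>{0..}. h (f t)) =
      distr N path_space ((\<lambda>f. \<lambda>t\<in>{0..}. h (f t)) \<circ> (\<lambda>x. \<lambda>t\<in>{0..}. X t x))"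
      by (rule distr_distr[OF hm], rule measurable_path, erule X)
    moreover have "((\<lambda>f. \<lambda>t\<in>{0..}. h (f t)) \<circ> (\<lambda>x. \<lambda>t\<in>{0..}. X t x)) = (\<lambda>x. \<lambda>t\<in>{0..}. h (X t x))"
      by (auto simp: fun_eq_iff)
    ultimately show ?thesis unfolding path_law_def by simp
  qed
  have e2: "path_law N' (\<lambda>t x. h (X' t x)) = distr (path_law N' X') path_space (\<lambda>f. \<lambda>t\<in>{0..}. h (f t))"
  proof -
    have "distr (distr N' path_space (\<lambda>x. \<lambda>t\<in>{0..}. X' t x)) path_space (\<lambda>f. \<lambda>t\<in>{0..}. h (f t)) =
      distr N' path_space ((\<lambda>f. \<lambda>t\<in>{0..}. h (f t)) \<circ> (\<lambda>x. \<lambda>t\<in>{0..}. X' t x))"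
      by (rule distr_distr[OF hm], rule measurable_path, erule X')
    moreover have "((\<lambda>f. \<lambda>t\<in>{0..}. h (f t)) \<circ> (\<lambda>x. \<lambda>t\<in>{0..}. X' t x)) = (\<lambda>x. \<lambda>t\<in>{0..}. h (X' t x))"
      by (auto simp: fun_eq_iff)
    ultimately show ?thesis unfolding path_law_def by simp
  qed
  show ?thesis unfolding e1 e2 law ..
qed

text \<open>The default for paths without a hit has modulus \<open>r\<close> too, for nonnegative
  \<open>r\<close>, so that \<open>norm_hit_point\<close> holds for all continuous paths.\<close>

definition hit_point :: "real \<Rightarrow> (real \<Rightarrow> complex) \<Rightarrow> complex" where
  "hit_point r f = (if hits f r then f (hit_time f r) else complex_of_real r)"

lemma norm_hit_point: "continuous_on {0..} f \<Longrightarrow> 0 \<le> r \<Longrightarrow> cmod (hit_point r f) = r"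
  unfolding hit_point_def using hit_time(2)[of f r] by auto

text \<open>The values at the dyadic times above the hitting time are measurable, since on each of
  countably many events they are values at a fixed time, and by continuity they converge to the
  value at the hit.\<close>

lemma hit_point_measurable:
  assumes X: "\<And>t. 0 \<le> t \<Longrightarrow> X t \<in> borel_measurable Q" "\<And>x. x \<in> space Q \<Longrightarrow> continuous_on {0..} (\<lambda>t. X t x)"
  shows "(\<lambda>x. hit_point r (\<lambda>t. X t x)) \<in> borel_measurable Q"
proof -
  define Z where "Z n x = (if hits (\<lambda>t. X t x) r then X (dyadic_above n (hit_time (\<lambda>t. X t x) r)) x else complex_of_real r)" for n x
  have "Z n \<in> borel_measurable Q" for n
  proof (rule borel_measurable_countable_switch[where
        P="\<lambda>k x. case k of 0 \<Rightarrow> \<not> hits (\<lambda>t. X t x) r | Suc k \<Rightarrow> hits_before (\<lambda>t. X t x) r ((real k + 1) / 2 ^ n) \<and> \<not> hits_before (\<lambda>t. X t x) r (real k / 2 ^ n)"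
        and V="\<lambda>k. case k of 0 \<Rightarrow> (\<lambda>_. complex_of_real r) | Suc k \<Rightarrow> X ((real k + 1) / 2 ^ n)"])
    have P: "hits_before (\<lambda>t. X t x) r ((real k + 1) / 2 ^ n) \<and> \<not> hits_before (\<lambda>t. X t x) r (real k / 2 ^ n) \<longleftrightarrow>
        hits (\<lambda>t. X t x) r \<and> \<lfloor>2 ^ n * hit_time (\<lambda>t. X t x) r\<rfloor> = int k" if "x \<in> space Q" for k x
      unfolding hits_before_iff[OF X(2)[OF that]] by (auto simp: floor_eq_iff field_simps)
    fix k
    show "{x\<in>space Q. case k of 0 \<Rightarrow> \<not> hits (\<lambda>t. X t x) r | Suc k \<Rightarrow> hits_before (\<lambda>t. X t x) r ((real k + 1) / 2 ^ n) \<and> \<not> hits_before (\<lambda>t. X t x) r (real k / 2 ^ n)} \<in> sets Q"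
    proof (cases k)
      case 0
      have "{x\<in>space Q. \<not> hits (\<lambda>t. X t x) r} = space Q - {x\<in>space Q. hits (\<lambda>t. X t x) r}" by auto
      also have "\<dots> \<in> sets Q" by (intro sets.compl_sets hits_pred(2)[where X=X] X)
      finally show ?thesis by (simp add: 0)
    next
      case (Suc l)
      have "{x\<in>space Q. hits_before (\<lambda>t. X t x) r ((real l + 1) / 2 ^ n) \<and> \<not> hits_before (\<lambda>t. X t x) r (real l / 2 ^ n)}
         = {x\<in>space Q. hits_before (\<lambda>t. X t x) r ((real l + 1) / 2 ^ n)} - {x\<in>space Q. hits_before (\<lambda>t. X t x) r (real l / 2 ^ n)}" by auto
      also have "\<dots> \<in> sets Q" by (intro sets.Diff hits_pred(1)[where X=X] X)
      finally show ?thesis by (simp add: Suc)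
    qed
    show "(case k of 0 \<Rightarrow> (\<lambda>_. complex_of_real r) | Suc k \<Rightarrow> X ((real k + 1) / 2 ^ n)) \<in> borel_measurable Q"
      by (cases k) (simp_all add: X(1))
    fix x assume x: "x \<in> space Q"
    show "\<exists>k. case k of 0 \<Rightarrow> \<not> hits (\<lambda>t. X t x) r | Suc k \<Rightarrow> hits_before (\<lambda>t. X t x) r ((real k + 1) / 2 ^ n) \<and> \<not> hits_before (\<lambda>t. X t x) r (real k / 2 ^ n)"
    proof (cases "hits (\<lambda>t. X t x) r")
      case True
      have "0 \<le> \<lfloor>2 ^ n * hit_time (\<lambda>t. X t x) r\<rfloor>" using hit_time(1)[OF X(2)[OF x] True] by simp
      then have "\<lfloor>2 ^ n * hit_time (\<lambda>t. X t x) r\<rfloor> = int (nat \<lfloor>2 ^ n * hit_time (\<lambda>t. X t x) r\<rfloor>)" by simp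
      then show ?thesis using P[OF x, of "nat \<lfloor>2 ^ n * hit_time (\<lambda>t. X t x) r\<rfloor>"] True
        by (intro exI[of _ "Suc (nat \<lfloor>2 ^ n * hit_time (\<lambda>t. X t x) r\<rfloor>)"]) (simp only: nat.case simp_thms)
    next
      case False then show ?thesis by (intro exI[of _ 0]) simp
    qed
    assume "case k of 0 \<Rightarrow> \<not> hits (\<lambda>t. X t x) r | Suc k \<Rightarrow> hits_before (\<lambda>t. X t x) r ((real k + 1) / 2 ^ n) \<and> \<not> hits_before (\<lambda>t. X t x) r (real k / 2 ^ n)"
    then show "Z n x = (case k of 0 \<Rightarrow> (\<lambda>_. complex_of_real r) | Suc k \<Rightarrow> X ((real k + 1) / 2 ^ n)) x"
    proof (cases k)
      case (Suc l)
      assume "case k of 0 \<Rightarrow> \<not> hits (\<lambda>t. X t x) r | Suc k \<Rightarrow> hits_before (\<lambda>t. X t x) r ((real k + 1) / 2 ^ n) \<and> \<not> hits_before (\<lambda>t. X t x) r (real k / 2 ^ n)"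
      then have "hits (\<lambda>t. X t x) r \<and> \<lfloor>2 ^ n * hit_time (\<lambda>t. X t x) r\<rfloor> = int l"
        using P[OF x, of l] by (simp add: Suc)
      then show ?thesis by (simp add: Suc Z_def dyadic_above_def)
    qed (simp add: Z_def)
  qed
  moreover have "(\<lambda>n. Z n x) \<longlonglongrightarrow> hit_point r (\<lambda>t. X t x)" if x: "x \<in> space Q" for x
  proof (cases "hits (\<lambda>t. X t x) r")
    case True
    define T where "T = hit_time (\<lambda>t. X t x) r"
    have T: "0 \<le> T" using hit_time(1)[OF X(2)[OF x] True] by (simp add: T_def)
    have "(\<lambda>n. X (dyadic_above n T) x) \<longlonglongrightarrow> X T x"
    proof (rule continuous_on_tendsto_compose[OF X(2)[OF x] dyadic_above_tendsto])
      show "\<forall>\<^sub>F n in sequentially. dyadic_above n T \<in> {0..}"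
        using T less_imp_le[OF dyadic_above_gt[of T]] by (intro always_eventually allI) (meson atLeast_iff order_trans)
    qed (use T in simp)
    then show ?thesis using True by (simp add: Z_def hit_point_def T_def)
  qed (simp add: Z_def hit_point_def)
  ultimately show ?thesis by (rule borel_measurable_LIMSEQ_metric)
qed

text \<open>\<open>\<Phi>\<close> will be the conditional probability of avoiding an independent second path; forgetting
  the part of a path before a hitting time can only increase it.\<close>

lemma markov_at_hitting:
  assumes W: "brownian_process M W" and W0: "\<And>x. x \<in> space M \<Longrightarrow> W 0 x = 0"
    and \<Phi>: "\<Phi> \<in> borel_measurable path_space" and x: "cmod x \<le> r" and u: "cmod u = 1"
    and mono: "\<And>f g. continuous_on {0..} f \<Longrightarrow> continuous_on {0..} g \<Longrightarrow> cmod (f 0) \<le> r \<Longrightarrow> hits f r \<Longrightarrow> g 0 = 0 \<Longrightarrow>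
      \<Phi> (\<lambda>t\<in>{0..}. c + u * glue r f g t) \<le> \<Phi> (\<lambda>t\<in>{0..}. c + u * (f (hit_time f r) + g t))"
  shows "(\<integral>\<^sup>+\<omega>. \<Phi> (\<lambda>t\<in>{0..}. (c + u * x) + W t \<omega>) \<partial>M) \<le>
    (\<integral>\<^sup>+\<omega>. (\<integral>\<^sup>+\<omega>'. \<Phi> (\<lambda>t\<in>{0..}. (c + u * hit_point r (\<lambda>t. x + W t \<omega>)) + W t \<omega>') \<partial>M) \<partial>M)"
proof -
  interpret prob_space M by (rule brownian_processD[OF W])
  interpret P: pair_prob_space M M ..
  have AEh: "AE \<omega> in M. hits (\<lambda>t. x + W t \<omega>) r" by (rule AE_hits[OF W W0 x])
  have X: "brownian_process M (\<lambda>t \<omega>. x + W t \<omega>)" by (rule brownian_process_translate[OF W])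
  note DX = brownian_processD[OF X] and DW = brownian_processD[OF W]
  let ?G = "\<lambda>p. glue r (\<lambda>t. x + W t (fst p)) (\<lambda>t. W t (snd p))"
  have uW: "brownian_process M (\<lambda>t \<omega>. c + u * (y + W t \<omega>))" for y
    by (intro brownian_process_translate brownian_process_rotate W u)
  have law0: "path_law M (\<lambda>t \<omega>. c + u * (y + W t \<omega>)) = path_law M (\<lambda>t \<omega>. (c + u * y) + W t \<omega>)" for y
    by (rule path_law_const_start[OF uW brownian_process_translate[OF W], of _ "c + u * y"]) (simp_all add: W0)
  have swap: "(\<integral>\<^sup>+\<omega>. \<Phi> (\<lambda>t\<in>{0..}. c + u * (y + W t \<omega>)) \<partial>M) = (\<integral>\<^sup>+\<omega>. \<Phi> (\<lambda>t\<in>{0..}. (c + u * y) + W t \<omega>) \<partial>M)" for y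
    using nn_integral_path_law'[where X="\<lambda>t \<omega>. c + u * (y + W t \<omega>)", OF brownian_processD(2)[OF uW] \<Phi>]
      nn_integral_path_law'[where X="\<lambda>t \<omega>. (c + u * y) + W t \<omega>", OF brownian_processD(2)[OF brownian_process_translate[OF W]] \<Phi>]
      law0[of y] by simp
  have Gm: "(\<lambda>p. ?G p t) \<in> borel_measurable (M \<Otimes>\<^sub>M M)" if "0 \<le> t" for t
    by (rule path_law_glue(1)[OF X W W0 that])
  have Gm': "(\<lambda>p. c + u * ?G p t) \<in> borel_measurable (M \<Otimes>\<^sub>M M)" if "0 \<le> t" for t
    using Gm[OF that] by measurable
  have law: "path_law (M \<Otimes>\<^sub>M M) (\<lambda>t p. c + u * ?G p t) = path_law M (\<lambda>t \<omega>. c + u * (x + W t \<omega>))"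
    using path_law_map[where X="\<lambda>t p. ?G p t" and X'="\<lambda>t \<omega>. x + W t \<omega>" and h="\<lambda>z. c + u * z",
        OF Gm DX(2) path_law_glue(2)[OF X W W0]] by simp
  have m: "(\<lambda>p. \<Phi> (\<lambda>t\<in>{0..}. c + u * ?G p t)) \<in> borel_measurable (M \<Otimes>\<^sub>M M)"
    by (rule measurable_compose[OF measurable_path[where X="\<lambda>t p. c + u * ?G p t", OF Gm'] \<Phi>])
  have "(\<integral>\<^sup>+\<omega>. \<Phi> (\<lambda>t\<in>{0..}. (c + u * x) + W t \<omega>) \<partial>M) = (\<integral>\<^sup>+p. \<Phi> (\<lambda>t\<in>{0..}. c + u * ?G p t) \<partial>(M \<Otimes>\<^sub>M M))"
    using nn_integral_path_law'[where X="\<lambda>t p. c + u * ?G p t", OF Gm' \<Phi>]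
      nn_integral_path_law'[where X="\<lambda>t \<omega>. c + u * (x + W t \<omega>)", OF brownian_processD(2)[OF uW] \<Phi>]
      law swap[of x] by simp
  also have "\<dots> = (\<integral>\<^sup>+\<omega>. (\<integral>\<^sup>+\<omega>'. \<Phi> (\<lambda>t\<in>{0..}. c + u * ?G (\<omega>, \<omega>') t) \<partial>M) \<partial>M)"
    by (rule nn_integral_fst[OF m, symmetric])
  also have "\<dots> \<le> (\<integral>\<^sup>+\<omega>. (\<integral>\<^sup>+\<omega>'. \<Phi> (\<lambda>t\<in>{0..}. c + u * (hit_point r (\<lambda>t. x + W t \<omega>) + W t \<omega>')) \<partial>M) \<partial>M)"
  proof (rule nn_integral_mono_AE)
    show "AE \<omega> in M. (\<integral>\<^sup>+\<omega>'. \<Phi> (\<lambda>t\<in>{0..}. c + u * ?G (\<omega>, \<omega>') t) \<partial>M) \<le> (\<integral>\<^sup>+\<omega>'. \<Phi> (\<lambda>t\<in>{0..}. c + u * (hit_point r (\<lambda>t. x + W t \<omega>) + W t \<omega>')) \<partial>M)"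
    proof (rule AE_mp[OF AEh], rule AE_I2, rule impI)
      fix \<omega> assume \<omega>: "\<omega> \<in> space M" and h: "hits (\<lambda>t. x + W t \<omega>) r"
      show "(\<integral>\<^sup>+\<omega>'. \<Phi> (\<lambda>t\<in>{0..}. c + u * ?G (\<omega>, \<omega>') t) \<partial>M) \<le> (\<integral>\<^sup>+\<omega>'. \<Phi> (\<lambda>t\<in>{0..}. c + u * (hit_point r (\<lambda>t. x + W t \<omega>) + W t \<omega>')) \<partial>M)"
      proof (rule nn_integral_mono)
        fix \<omega>' assume \<omega>': "\<omega>' \<in> space M"
        show "\<Phi> (\<lambda>t\<in>{0..}. c + u * ?G (\<omega>, \<omega>') t) \<le> \<Phi> (\<lambda>t\<in>{0..}. c + u * (hit_point r (\<lambda>t. x + W t \<omega>) + W t \<omega>'))"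
          using mono[OF DX(3)[OF \<omega>] DW(3)[OF \<omega>'] _ h W0[OF \<omega>']] x W0[OF \<omega>] h
          by (simp add: hit_point_def)
      qed
    qed
  qed
  finally show ?thesis unfolding swap .
qed

section \<open>Averages over circles\<close>

lemma nn_integral_circle:
  assumes f: "f \<in> borel_measurable borel"
  shows "(\<integral>\<^sup>+u. f u \<partial>uniform_unit_circle) = (\<integral>\<^sup>+\<theta>. f (cis \<theta>) * indicator {0..2 * pi} \<theta> \<partial>lborel) / ennreal (2 * pi)"
proof -
  have cm: "cis \<in> borel_measurable borel"
    by (intro borel_measurable_continuous_onI continuous_intros)
  have "(\<integral>\<^sup>+u. f u \<partial>uniform_unit_circle) = (\<integral>\<^sup>+\<theta>. f (cis \<theta>) \<partial>uniform_measure lborel {0..2 * pi})"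
    unfolding uniform_unit_circle_def
    by (rule nn_integral_distr) (simp_all add: cm f measurable_cong_sets[of "uniform_measure lborel {0..2 * pi}" borel])
  also have "\<dots> = (\<integral>\<^sup>+\<theta>. f (cis \<theta>) * indicator {0..2 * pi} \<theta> \<partial>lborel) / emeasure lborel {0..2 * pi}"
    by (rule nn_integral_uniform_measure) (simp_all add: measurable_compose[OF cm f])
  finally show ?thesis by simp
qed

lemma prob_space_circle: "prob_space uniform_unit_circle" and sets_circle [simp, measurable_cong]: "sets uniform_unit_circle = sets borel"
proof -
  have "prob_space (uniform_measure lborel {0..2 * pi})"
    by (rule prob_space_uniform_measure) simp_all
  then show "prob_space uniform_unit_circle" unfolding uniform_unit_circle_def
    by (rule prob_space.prob_space_distr)
       (simp add: borel_measurable_continuous_onI continuous_intros measurable_cong_sets[of "uniform_measure lborel {0..2 * pi}" borel])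
qed (simp add: uniform_unit_circle_def)

lemma space_circle [simp]: "space uniform_unit_circle = UNIV"
  by (simp add: uniform_unit_circle_def)

lemma AE_circle: "AE u in uniform_unit_circle. cmod u = 1"
proof -
  have "cis \<in> borel_measurable (uniform_measure lborel {0..2 * pi})"
    by (simp add: borel_measurable_continuous_onI continuous_intros measurable_cong_sets[of "uniform_measure lborel {0..2 * pi}" borel])
  moreover have "{x\<in>space borel. cmod x = 1} \<in> sets borel" by measurable
  ultimately show ?thesis
    unfolding uniform_unit_circle_def by (subst AE_distr_iff) simp_all
qed

lemma nn_integral_circle_rotate:
  assumes f [measurable]: "f \<in> borel_measurable borel" and v: "cmod v = 1"
  shows "(\<integral>\<^sup>+u. f (v * u) \<partial>uniform_unit_circle) = (\<integral>\<^sup>+u. f u \<partial>uniform_unit_circle)"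
proof -
  have [measurable]: "cis \<in> borel_measurable borel"
    by (intro borel_measurable_continuous_onI continuous_intros)
  obtain a where a: "v = cis a" "0 \<le> a" "a < 2 * pi"
  proof -
    have "v = cis (Arg2pi v)" using v Arg2pi_eq[of v] by (simp add: cis_conv_exp mult.commute)
    then show ?thesis using that[of "Arg2pi v"] Arg2pi_ge_0 Arg2pi_lt_2pi by blast
  qed
  let ?F = "\<lambda>\<theta>. f (cis \<theta>)"
  have per: "?F (\<theta> + 2 * pi) = ?F \<theta>" for \<theta> by (simp add: cis_mult[symmetric])
  have "(\<integral>\<^sup>+\<theta>. f (v * cis \<theta>) * indicator {0..2 * pi} \<theta> \<partial>lborel) = (\<integral>\<^sup>+\<theta>. ?F \<theta> * indicator {a..a + 2 * pi} \<theta> \<partial>lborel)"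
  proof -
    have "(\<integral>\<^sup>+\<theta>. ?F \<theta> * indicator {a..a + 2 * pi} \<theta> \<partial>lborel) = ennreal \<bar>1\<bar> * (\<integral>\<^sup>+\<theta>. ?F (a + 1 * \<theta>) * indicator {a..a + 2 * pi} (a + 1 * \<theta>) \<partial>lborel)"
      by (rule nn_integral_real_affine) simp_all
    also have "\<dots> = (\<integral>\<^sup>+\<theta>. f (v * cis \<theta>) * indicator {0..2 * pi} \<theta> \<partial>lborel)"
      by (simp add: a(1) cis_mult) (intro nn_integral_cong, simp add: indicator_def)
    finally show ?thesis ..
  qed
  also have "\<dots> = (\<integral>\<^sup>+\<theta>. ?F \<theta> * indicator {a..<2 * pi} \<theta> + ?F \<theta> * indicator {2 * pi..a + 2 * pi} \<theta> \<partial>lborel)"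
    by (rule nn_integral_cong) (use a in \<open>auto simp: indicator_def\<close>)
  also have "\<dots> = (\<integral>\<^sup>+\<theta>. ?F \<theta> * indicator {a..<2 * pi} \<theta> \<partial>lborel) + (\<integral>\<^sup>+\<theta>. ?F \<theta> * indicator {2 * pi..a + 2 * pi} \<theta> \<partial>lborel)"
    by (rule nn_integral_add) simp_all
  also have "(\<integral>\<^sup>+\<theta>. ?F \<theta> * indicator {2 * pi..a + 2 * pi} \<theta> \<partial>lborel) = (\<integral>\<^sup>+\<theta>. ?F \<theta> * indicator {0..a} \<theta> \<partial>lborel)"
  proof -
    have "(\<integral>\<^sup>+\<theta>. ?F \<theta> * indicator {2 * pi..a + 2 * pi} \<theta> \<partial>lborel) = ennreal \<bar>1\<bar> * (\<integral>\<^sup>+\<theta>. ?F (2 * pi + 1 * \<theta>) * indicator {2 * pi..a + 2 * pi} (2 * pi + 1 * \<theta>) \<partial>lborel)"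
      by (rule nn_integral_real_affine) simp_all
    also have "\<dots> = (\<integral>\<^sup>+\<theta>. ?F \<theta> * indicator {0..a} \<theta> \<partial>lborel)"
      using per by (simp add: add.commute) (intro nn_integral_cong, simp add: indicator_def)
    finally show ?thesis .
  qed
  also have "(\<integral>\<^sup>+\<theta>. ?F \<theta> * indicator {a..<2 * pi} \<theta> \<partial>lborel) + (\<integral>\<^sup>+\<theta>. ?F \<theta> * indicator {0..a} \<theta> \<partial>lborel)
     = (\<integral>\<^sup>+\<theta>. ?F \<theta> * indicator {a..<2 * pi} \<theta> + ?F \<theta> * indicator {0..a} \<theta> \<partial>lborel)"
    by (rule nn_integral_add[symmetric]) simp_all
  also have "\<dots> = (\<integral>\<^sup>+\<theta>. ?F \<theta> * indicator {0..2 * pi} \<theta> \<partial>lborel)"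
  proof (rule nn_integral_cong_AE)
    have "AE \<theta> in lborel. \<theta> \<noteq> a \<and> \<theta> \<noteq> 2 * pi"
      using AE_lborel_singleton[of a] AE_lborel_singleton[of "2 * pi"] by eventually_elim simp
    then show "AE \<theta> in lborel. ?F \<theta> * indicator {a..<2 * pi} \<theta> + ?F \<theta> * indicator {0..a} \<theta> = ?F \<theta> * indicator {0..2 * pi} \<theta>"
      by eventually_elim (use a in \<open>auto simp: indicator_def\<close>)
  qed
  finally show ?thesis by (subst (1 2) nn_integral_circle) simp_all
qed

text \<open>Let the path from \<open>x\<close> hit the circle of radius \<open>r\<close> at
  \<open>E\<close>. Forgetting its past bounds the left side by values of \<Psi> at
  \<open>c + u * E\<close>. After exchanging the integrals \<open>E\<close> is fixed, and
  \<open>u * E\<close> with uniform \<open>u\<close> is uniform on the circle wherever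
  \<open>E\<close> lies, so the distribution of \<open>E\<close> never has to be known.\<close>

lemma circle_average_mono:
  assumes W: "brownian_process M W" and W0: "\<And>x. x \<in> space M \<Longrightarrow> W 0 x = 0"
    and \<Phi>: "\<Phi> \<in> borel_measurable path_space" and x: "cmod x \<le> r"
    and mono: "\<And>f g u. cmod u = 1 \<Longrightarrow> continuous_on {0..} f \<Longrightarrow> continuous_on {0..} g \<Longrightarrow> cmod (f 0) \<le> r \<Longrightarrow> hits f r \<Longrightarrow> g 0 = 0 \<Longrightarrow>
      \<Phi> (\<lambda>t\<in>{0..}. c + u * glue r f g t) \<le> \<Phi> (\<lambda>t\<in>{0..}. c + u * (f (hit_time f r) + g t))"
    and \<Psi>: "\<And>z. \<Psi> z = (\<integral>\<^sup>+\<omega>. \<Phi> (\<lambda>t\<in>{0..}. z + W t \<omega>) \<partial>M)" and \<Psi>m [measurable]: "\<Psi> \<in> borel_measurable borel"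
  shows "(\<integral>\<^sup>+u. \<Psi> (c + u * x) \<partial>uniform_unit_circle) \<le> (\<integral>\<^sup>+u. \<Psi> (c + u * complex_of_real r) \<partial>uniform_unit_circle)"
proof -
  interpret M: prob_space M by (rule brownian_processD[OF W])
  interpret U: prob_space uniform_unit_circle by (rule prob_space_circle)
  interpret P: pair_prob_space M uniform_unit_circle ..
  have X: "brownian_process M (\<lambda>t \<omega>. x + W t \<omega>)" by (rule brownian_process_translate[OF W])
  note DX = brownian_processD[OF X]
  have r0: "0 \<le> r" using x norm_ge_zero[of x] by linarith
  define E where "E \<omega> = hit_point r (\<lambda>t. x + W t \<omega>)" for \<omega>
  have Em [measurable]: "E \<in> borel_measurable M"
    unfolding E_def by (rule hit_point_measurable[where X="\<lambda>t \<omega>. x + W t \<omega>", OF DX(2,3)])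
  have "(\<integral>\<^sup>+u. \<Psi> (c + u * x) \<partial>uniform_unit_circle) \<le> (\<integral>\<^sup>+u. (\<integral>\<^sup>+\<omega>. \<Psi> (c + u * E \<omega>) \<partial>M) \<partial>uniform_unit_circle)"
  proof (rule nn_integral_mono_AE)
    show "AE u in uniform_unit_circle. \<Psi> (c + u * x) \<le> (\<integral>\<^sup>+\<omega>. \<Psi> (c + u * E \<omega>) \<partial>M)"
      using AE_circle
    proof eventually_elim
      fix u assume u: "cmod u = 1"
      show "\<Psi> (c + u * x) \<le> (\<integral>\<^sup>+\<omega>. \<Psi> (c + u * E \<omega>) \<partial>M)"
        unfolding \<Psi> E_def by (rule markov_at_hitting[OF W W0 \<Phi> x u mono[OF u]])
    qed
  qed
  also have "\<dots> = (\<integral>\<^sup>+\<omega>. (\<integral>\<^sup>+u. \<Psi> (c + u * E \<omega>) \<partial>uniform_unit_circle) \<partial>M)"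
    by (rule P.Fubini') measurable
  also have "\<dots> = (\<integral>\<^sup>+\<omega>. (\<integral>\<^sup>+u. \<Psi> (c + u * complex_of_real r) \<partial>uniform_unit_circle) \<partial>M)"
  proof (rule nn_integral_cong)
    fix \<omega> assume \<omega>: "\<omega> \<in> space M"
    have nE: "cmod (E \<omega>) = r" unfolding E_def by (rule norm_hit_point[OF DX(3)[OF \<omega>] r0])
    obtain v where v: "cmod v = 1" "E \<omega> = v * complex_of_real r"
    proof (cases "r = 0")
      case True then show ?thesis using nE by (intro that[of 1]) auto
    next
      case False then show ?thesis using nE r0 by (intro that[of "E \<omega> / complex_of_real r"]) (auto simp: norm_divide)
    qed
    have "(\<integral>\<^sup>+u. \<Psi> (c + u * E \<omega>) \<partial>uniform_unit_circle) = (\<integral>\<^sup>+u. (\<lambda>w. \<Psi> (c + w * complex_of_real r)) (v * u) \<partial>uniform_unit_circle)"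
      by (simp add: v(2) mult_ac)
    also have "\<dots> = (\<integral>\<^sup>+u. \<Psi> (c + u * complex_of_real r) \<partial>uniform_unit_circle)"
      by (rule nn_integral_circle_rotate[OF _ v(1)]) measurable
    finally show "(\<integral>\<^sup>+u. \<Psi> (c + u * E \<omega>) \<partial>uniform_unit_circle) = (\<integral>\<^sup>+u. \<Psi> (c + u * complex_of_real r) \<partial>uniform_unit_circle)" .
  qed
  finally show ?thesis by (simp add: M.emeasure_space_1)
qed

section \<open>Existence of the exponent\<close>

lemma continuous_on_glue:
  assumes f: "continuous_on {0..} f" and g: "continuous_on {0..} g" and g0: "g 0 = 0"
  shows "continuous_on {0..} (glue r f g)"
  using continuous_on_glue_at[OF f g g0] hit_time(1)[OF f] f by (simp add: glue_def)

lemma avoid_left_mono: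
  assumes f: "continuous_on {0..} f" "continuous_on {0..} f'" and Y: "\<And>y. y \<in> space N \<Longrightarrow> continuous_on {0..} (\<lambda>t. Y t y)"
    and \<alpha>: "0 \<le> \<alpha>" and sub: "trace_until S f' \<subseteq> trace_until S f"
  shows "avoid_left \<alpha> S N Y (restrict f {0..}) \<le> avoid_left \<alpha> S N Y (restrict f' {0..})"
    and "avoid_right \<alpha> S N Y (restrict f {0..}) \<le> avoid_right \<alpha> S N Y (restrict f' {0..})"
proof -
  show "avoid_left \<alpha> S N Y (restrict f {0..}) \<le> avoid_left \<alpha> S N Y (restrict f' {0..})"
    unfolding avoid_left_def
  proof (rule nn_integral_mono)
    fix y assume y: "y \<in> space N"
    have "avoids_rat \<alpha> S f (\<lambda>t. Y t y) \<Longrightarrow> avoids_rat \<alpha> S f' (\<lambda>t. Y t y)"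
      unfolding avoids_rat_iff[OF f(1) Y[OF y] \<alpha>] avoids_rat_iff[OF f(2) Y[OF y] \<alpha>]
      by (erule avoids_mono[OF _ sub order_refl])
    then show "(indicator {y. avoids_rat \<alpha> S (restrict f {0..}) (\<lambda>t. Y t y)} y :: ennreal)
      \<le> indicator {y. avoids_rat \<alpha> S (restrict f' {0..}) (\<lambda>t. Y t y)} y" by (simp add: indicator_def)
  qed
  show "avoid_right \<alpha> S N Y (restrict f {0..}) \<le> avoid_right \<alpha> S N Y (restrict f' {0..})"
    unfolding avoid_right_def
  proof (rule nn_integral_mono)
    fix y assume y: "y \<in> space N"
    have "avoids_rat \<alpha> S (\<lambda>t. Y t y) f \<Longrightarrow> avoids_rat \<alpha> S (\<lambda>t. Y t y) f'"
      unfolding avoids_rat_iff[OF Y[OF y] f(1) \<alpha>] avoids_rat_iff[OF Y[OF y] f(2) \<alpha>]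
      by (erule avoids_mono[OF _ order_refl sub])
    then show "(indicator {y. avoids_rat \<alpha> S (\<lambda>t. Y t y) (restrict f {0..})} y :: ennreal)
      \<le> indicator {y. avoids_rat \<alpha> S (\<lambda>t. Y t y) (restrict f' {0..})} y" by (simp add: indicator_def)
  qed
qed

text \<open>Both paths are modelled on independent copies of one process from 0, translated to their
  starting points; the probabilities in question depend only on the path laws.\<close>

locale wiener =
  fixes M :: "'w measure" and W :: "real \<Rightarrow> 'w \<Rightarrow> complex" and \<alpha> :: real
  assumes W: "brownian_process M W" and W0: "\<And>x. x \<in> space M \<Longrightarrow> W 0 x = 0" and \<alpha>: "0 \<le> \<alpha>"
begin

sublocale prob_space M by (rule brownian_processD[OF W])

abbreviation start :: "complex \<Rightarrow> real \<Rightarrow> 'w \<Rightarrow> complex" where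
  "start z \<equiv> (\<lambda>t \<omega>. z + W t \<omega>)"

lemma start: "brownian_process M (start z)"
  by (rule brownian_process_translate[OF W])

lemma start_measurable: "0 \<le> t \<Longrightarrow> start z t \<in> borel_measurable M"
  by (rule brownian_processD(2)[OF start])

lemma start_continuous: "\<omega> \<in> space M \<Longrightarrow> continuous_on {0..} (\<lambda>t. start z t \<omega>)"
  by (rule brownian_processD(3)[OF start])

definition Q :: "real \<Rightarrow> complex \<Rightarrow> complex \<Rightarrow> ennreal" where
  "Q S z1 z2 = noninter \<alpha> S M (start z1) M (start z2)"

lemma Q_left: "Q S z1 z2 = (\<integral>\<^sup>+\<omega>. avoid_left \<alpha> S M (start z2) (\<lambda>t\<in>{0..}. start z1 t \<omega>) \<partial>M)"
  unfolding Q_def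
  by (rule noninter_eq_left(1)) (simp_all add: prob_space_axioms start_measurable start_continuous \<alpha>)

lemma Q_right: "Q S z1 z2 = (\<integral>\<^sup>+\<omega>. avoid_right \<alpha> S M (start z1) (\<lambda>t\<in>{0..}. start z2 t \<omega>) \<partial>M)"
  unfolding Q_def
  by (rule noninter_eq_left(2)) (simp_all add: prob_space_axioms start_measurable start_continuous \<alpha>)

lemma Q_law:
  assumes X: "brownian_process N X" "\<And>x. x \<in> space N \<Longrightarrow> X 0 x = z1"
    and Y: "brownian_process N' Y" "\<And>x. x \<in> space N' \<Longrightarrow> Y 0 x = z2"
  shows "noninter \<alpha> S N X N' Y = Q S z1 z2"
  unfolding Q_def
proof (rule noninter_law_cong)
  show "path_law N X = path_law M (start z1)" "path_law N' Y = path_law M (start z2)"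
    by (rule path_law_const_start[OF X(1) start]; simp add: X(2) W0) (rule path_law_const_start[OF Y(1) start]; simp add: Y(2) W0)
qed (simp_all add: brownian_processD[OF X(1)] brownian_processD[OF Y(1)] prob_space_axioms start_measurable start_continuous \<alpha>)

lemma Q_measurable [measurable]: "(\<lambda>p. Q S (fst p) (snd p)) \<in> borel_measurable (borel \<Otimes>\<^sub>M borel)"
proof -
  interpret P: pair_prob_space M M ..
  let ?B = "(borel :: complex measure) \<Otimes>\<^sub>M (borel :: complex measure)"
  let ?E = "{q\<in>space (?B \<Otimes>\<^sub>M (M \<Otimes>\<^sub>M M)). avoids (circle_arc \<alpha>) S (\<lambda>t. start (fst (fst q)) t (fst (snd q))) (\<lambda>t. start (snd (fst q)) t (snd (snd q)))}"
  have E: "?E \<in> sets (?B \<Otimes>\<^sub>M (M \<Otimes>\<^sub>M M))"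
  proof (rule sets_avoids[OF _ _ _ _ \<alpha>])
    fix t :: real assume t: "0 \<le> t"
    note [measurable] = brownian_processD(2)[OF W t]
    show "(\<lambda>q. start (fst (fst q)) t (fst (snd q))) \<in> borel_measurable (?B \<Otimes>\<^sub>M (M \<Otimes>\<^sub>M M))" by measurable
    show "(\<lambda>q. start (snd (fst q)) t (snd (snd q))) \<in> borel_measurable (?B \<Otimes>\<^sub>M (M \<Otimes>\<^sub>M M))" by measurable
  qed (auto simp: space_pair_measure intro!: start_continuous)
  have "(\<lambda>x. emeasure (M \<Otimes>\<^sub>M M) (Pair x -` ?E)) \<in> borel_measurable ?B"
    by (rule P.measurable_emeasure_Pair[OF E])
  moreover have "Pair x -` ?E = {p\<in>space (M \<Otimes>\<^sub>M M). avoids (circle_arc \<alpha>) S (\<lambda>t. start (fst x) t (fst p)) (\<lambda>t. start (snd x) t (snd p))}" for x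
    by (auto simp: space_pair_measure)
  ultimately show ?thesis by (simp add: Q_def noninter_def)
qed

lemma Q_measurable' [measurable]:
  assumes [measurable]: "f \<in> borel_measurable N" "g \<in> borel_measurable N"
  shows "(\<lambda>x. Q S (f x) (g x)) \<in> borel_measurable N"
  using measurable_compose[OF measurable_Pair[OF assms] Q_measurable[of S]] by simp

lemma Q_le_1: "Q S z1 z2 \<le> 1"
proof -
  interpret P: pair_prob_space M M ..
  show ?thesis unfolding Q_def noninter_def by (rule P.emeasure_le_1)
qed

lemma continuous_affine: "continuous_on {0..} f \<Longrightarrow> continuous_on {0..} (\<lambda>t. c + u * f t :: complex)"
  by (intro continuous_intros)

lemma circle_average_left:
  assumes x: "cmod x \<le> r" and S: "cmod c + r \<le> S"
  shows "(\<integral>\<^sup>+u. Q S (c + u * x) w \<partial>uniform_unit_circle) \<le> (\<integral>\<^sup>+u. Q S (c + u * complex_of_real r) w \<partial>uniform_unit_circle)"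
proof (rule circle_average_mono[OF W W0 avoid_left_measurable(1)[of M "start w" \<alpha> S] x _ Q_left])
  fix f g :: "real \<Rightarrow> complex" and u :: complex
  assume u: "cmod u = 1" and f: "continuous_on {0..} f" and g: "continuous_on {0..} g" and f0: "cmod (f 0) \<le> r" and h: "hits f r" and g0: "g 0 = 0"
  show "avoid_left \<alpha> S M (start w) (\<lambda>t\<in>{0..}. c + u * glue r f g t) \<le> avoid_left \<alpha> S M (start w) (\<lambda>t\<in>{0..}. c + u * (f (hit_time f r) + g t))"
    by (rule avoid_left_mono(1)[OF _ _ start_continuous \<alpha> trace_until_after_glue[where g=g, OF f f0 h g0 S u]])
       (intro continuous_affine continuous_on_glue f g g0 continuous_intros)+
qed (simp_all add: prob_space_axioms start_measurable)

lemma circle_average_right: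
  assumes x: "cmod x \<le> r" and S: "cmod c + r \<le> S"
  shows "(\<integral>\<^sup>+u. Q S w (c + u * x) \<partial>uniform_unit_circle) \<le> (\<integral>\<^sup>+u. Q S w (c + u * complex_of_real r) \<partial>uniform_unit_circle)"
proof (rule circle_average_mono[OF W W0 avoid_left_measurable(2)[of M "start w" \<alpha> S] x _ Q_right])
  fix f g :: "real \<Rightarrow> complex" and u :: complex
  assume u: "cmod u = 1" and f: "continuous_on {0..} f" and g: "continuous_on {0..} g" and f0: "cmod (f 0) \<le> r" and h: "hits f r" and g0: "g 0 = 0"
  show "avoid_right \<alpha> S M (start w) (\<lambda>t\<in>{0..}. c + u * glue r f g t) \<le> avoid_right \<alpha> S M (start w) (\<lambda>t\<in>{0..}. c + u * (f (hit_time f r) + g t))"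
    by (rule avoid_left_mono(2)[OF _ _ start_continuous \<alpha> trace_until_after_glue[where g=g, OF f f0 h g0 S u]])
       (intro continuous_affine continuous_on_glue f g g0 continuous_intros)+
qed (simp_all add: prob_space_axioms start_measurable)

text \<open>Brownian scaling: a positive factor commutes with the multiplication by the arc, and it
  carries the traces up to radius \<open>S\<close> to traces up to radius
  \<open>a * S\<close>.\<close>

lemma Q_scale:
  assumes a: "0 < a"
  shows "Q (a * S) (complex_of_real a * z1) (complex_of_real a * z2) = Q S z1 z2"
proof -
  let ?X = "\<lambda>z t \<omega>. complex_of_real a * start z (t / a\<^sup>2) \<omega>"
  have B: "brownian_process M (?X z)" for z by (rule brownian_process_scale[OF start a])
  have hb: "hits_before (\<lambda>t. complex_of_real a * f (t / a\<^sup>2)) (a * S) s \<longleftrightarrow> hits_before f S (s / a\<^sup>2)" for f s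
  proof
    assume "hits_before (\<lambda>t. complex_of_real a * f (t / a\<^sup>2)) (a * S) s"
    then obtain t where "0 \<le> t" "t < s" "cmod (complex_of_real a * f (t / a\<^sup>2)) = a * S" by (auto simp: hits_before_def)
    then show "hits_before f S (s / a\<^sup>2)" using a unfolding hits_before_def
      by (intro exI[of _ "t / a\<^sup>2"]) (auto simp: norm_mult intro: divide_strict_right_mono)
  next
    assume "hits_before f S (s / a\<^sup>2)"
    then obtain t where "0 \<le> t" "t < s / a\<^sup>2" "cmod (f t) = S" by (auto simp: hits_before_def)
    then show "hits_before (\<lambda>t. complex_of_real a * f (t / a\<^sup>2)) (a * S) s" using a unfolding hits_before_def
      by (intro exI[of _ "t * a\<^sup>2"]) (auto simp: norm_mult pos_less_divide_eq)
  qed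
  have tr: "trace_until (a * S) (\<lambda>t. complex_of_real a * f (t / a\<^sup>2)) = (\<lambda>z. complex_of_real a * z) ` trace_until S f" for f
  proof -
    have t: "trace_until R h = h ` {s. 0 \<le> s \<and> \<not> hits_before h R s}" for R h
      unfolding trace_until_def hits_before_def by auto
    have "{s. 0 \<le> s \<and> \<not> hits_before f S s} = (\<lambda>s. s / a\<^sup>2) ` {s. 0 \<le> s \<and> \<not> hits_before f S (s / a\<^sup>2)}"
    proof (intro set_eqI iffI)
      fix s assume "s \<in> {s. 0 \<le> s \<and> \<not> hits_before f S s}"
      then show "s \<in> (\<lambda>s. s / a\<^sup>2) ` {s. 0 \<le> s \<and> \<not> hits_before f S (s / a\<^sup>2)}"
        using a by (intro image_eqI[of _ _ "s * a\<^sup>2"]) auto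
    qed (use a in auto)
    then show ?thesis unfolding t hb by (simp add: image_image)
  qed
  have av: "avoids A (a * S) (\<lambda>t. complex_of_real a * f (t / a\<^sup>2)) (\<lambda>t. complex_of_real a * g (t / a\<^sup>2)) \<longleftrightarrow> avoids A S f g" for A f g
  proof -
    have inj: "inj (\<lambda>z. complex_of_real a * z)" using a by (auto intro!: injI)
    have "A * (\<lambda>z. complex_of_real a * z) ` trace_until S g = (\<lambda>z. complex_of_real a * z) ` (A * trace_until S g)"
    proof (intro set_eqI iffI)
      fix w assume "w \<in> A * (\<lambda>z. complex_of_real a * z) ` trace_until S g"
      then obtain x y where "x \<in> A" "y \<in> trace_until S g" "w = x * (complex_of_real a * y)" by (auto elim!: set_times_elim)
      then show "w \<in> (\<lambda>z. complex_of_real a * z) ` (A * trace_until S g)"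
        by (intro image_eqI[of _ _ "x * y"]) (auto intro: set_times_intro)
    next
      fix w assume "w \<in> (\<lambda>z. complex_of_real a * z) ` (A * trace_until S g)"
      then obtain x y where xy: "x \<in> A" "y \<in> trace_until S g" "w = complex_of_real a * (x * y)" by (auto elim!: set_times_elim)
      then have w: "w = x * (complex_of_real a * y)" by simp
      show "w \<in> A * (\<lambda>z. complex_of_real a * z) ` trace_until S g"
        unfolding w by (intro set_times_intro imageI xy)
    qed
    then show ?thesis unfolding avoids_def tr by (simp add: image_Int[OF inj, symmetric])
  qed
  have "Q (a * S) (complex_of_real a * z1) (complex_of_real a * z2) = noninter \<alpha> (a * S) M (?X z1) M (?X z2)"
    by (rule Q_law[OF B _ B, symmetric]) (simp_all add: W0)
  also have "\<dots> = Q S z1 z2"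
    unfolding Q_def noninter_def
    by (intro arg_cong[where f="emeasure _"] Collect_cong conj_cong refl av)
  finally show ?thesis .
qed

lemma Q_random_start:
  assumes \<mu>: "prob_space \<mu>" "sets \<mu> = sets borel"
  shows "noninter \<alpha> S (\<mu> \<Otimes>\<^sub>M M) (\<lambda>t p. fst p + W t (snd p)) (\<mu> \<Otimes>\<^sub>M M) (\<lambda>t p. fst p + W t (snd p)) =
    (\<integral>\<^sup>+z1. (\<integral>\<^sup>+z2. Q S z1 z2 \<partial>\<mu>) \<partial>\<mu>)"
proof -
  let ?N = "\<mu> \<Otimes>\<^sub>M M" and ?X = "\<lambda>t p. fst p + W t (snd p)"
  have B: "brownian_process ?N ?X" by (rule brownian_process_random_start[OF W \<mu>])
  note DB = brownian_processD[OF B]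
  have m1: "(\<lambda>p. avoid_left \<alpha> S ?N ?X (\<lambda>t\<in>{0..}. ?X t p)) \<in> borel_measurable ?N"
    by (rule measurable_compose[OF measurable_path[where X="?X"] avoid_left_measurable(1)]) (simp_all add: DB)
  have m2: "(\<lambda>p. avoid_right \<alpha> S M (start z1) (\<lambda>t\<in>{0..}. ?X t p)) \<in> borel_measurable ?N" for z1
    by (rule measurable_compose[OF measurable_path[where X="?X"] avoid_left_measurable(2)]) (simp_all add: DB prob_space_axioms start_measurable)
  have "noninter \<alpha> S ?N ?X ?N ?X = (\<integral>\<^sup>+p. avoid_left \<alpha> S ?N ?X (\<lambda>t\<in>{0..}. ?X t p) \<partial>?N)"
    by (rule noninter_eq_left(1)) (simp_all add: DB \<alpha>)
  also have "\<dots> = (\<integral>\<^sup>+z1. (\<integral>\<^sup>+\<omega>. avoid_left \<alpha> S ?N ?X (\<lambda>t\<in>{0..}. start z1 t \<omega>) \<partial>M) \<partial>\<mu>)"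
    using nn_integral_fst[OF m1] by simp
  also have "\<dots> = (\<integral>\<^sup>+z1. noninter \<alpha> S M (start z1) ?N ?X \<partial>\<mu>)"
    by (intro nn_integral_cong noninter_eq_left(1)[symmetric]) (simp_all add: DB \<alpha> prob_space_axioms start_measurable start_continuous)
  also have "\<dots> = (\<integral>\<^sup>+z1. (\<integral>\<^sup>+p. avoid_right \<alpha> S M (start z1) (\<lambda>t\<in>{0..}. ?X t p) \<partial>?N) \<partial>\<mu>)"
    by (intro nn_integral_cong noninter_eq_left(2)) (simp_all add: DB \<alpha> prob_space_axioms start_measurable start_continuous)
  also have "\<dots> = (\<integral>\<^sup>+z1. (\<integral>\<^sup>+z2. (\<integral>\<^sup>+\<omega>. avoid_right \<alpha> S M (start z1) (\<lambda>t\<in>{0..}. start z2 t \<omega>) \<partial>M) \<partial>\<mu>) \<partial>\<mu>)"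
    using nn_integral_fst[OF m2] by simp
  also have "\<dots> = (\<integral>\<^sup>+z1. (\<integral>\<^sup>+z2. Q S z1 z2 \<partial>\<mu>) \<partial>\<mu>)"
    by (simp add: Q_right)
  finally show ?thesis .
qed

definition hit_pt :: "real \<Rightarrow> complex \<Rightarrow> 'w \<Rightarrow> complex" where
  "hit_pt r z \<omega> = hit_point r (\<lambda>t. start z t \<omega>)"

lemma hit_pt_measurable [measurable]: "hit_pt r z \<in> borel_measurable M"
  unfolding hit_pt_def by (rule hit_point_measurable[where X="start z", OF start_measurable start_continuous])

text \<open>Both paths are glued at their first hits of the circle of radius \<open>r\<close>. If
  the glued paths avoid each other up to \<open>S\<close>, then so do the beginnings up to
  \<open>r\<close> (\<open>?pre\<close>) and the continuations from the two hit points
  (\<open>?post\<close>); given the beginnings, the latter has probability at most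
  \<open>b\<close>.\<close>

lemma Q_submult:
  assumes z: "cmod z1 \<le> r" "cmod z2 \<le> r" and r: "r \<le> S" "0 \<le> r"
    and B: "\<And>w1 w2. cmod w1 = r \<Longrightarrow> cmod w2 = r \<Longrightarrow> Q S w1 w2 \<le> b"
  shows "Q S z1 z2 \<le> Q r z1 z2 * b"
proof -
  interpret P: pair_prob_space M M ..
  let ?G = "\<lambda>z t p. glue r (\<lambda>t. start z t (fst p)) (\<lambda>t. W t (snd p)) t"
  let ?A = "circle_arc \<alpha>"
  have Wm: "W t \<in> borel_measurable M" if "0 \<le> t" for t by (rule brownian_processD(2)[OF W that])
  have Wc: "continuous_on {0..} (\<lambda>t. W t x)" if "x \<in> space M" for x by (rule brownian_processD(3)[OF W that])
  have Gm: "?G z t \<in> borel_measurable (M \<Otimes>\<^sub>M M)" if "0 \<le> t" for z t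
    by (rule path_law_glue(1)[OF start W W0 that])
  have Gc: "continuous_on {0..} (\<lambda>t. ?G z t p)" if "p \<in> space (M \<Otimes>\<^sub>M M)" for z p
    using that by (intro continuous_on_glue start_continuous Wc W0) (auto simp: space_pair_measure)
  have law: "path_law (M \<Otimes>\<^sub>M M) (?G z) = path_law M (start z)" for z
    by (rule path_law_glue(2)[OF start W W0])
  let ?I = "\<lambda>x x' y y'. indicator {q. avoids ?A S (\<lambda>t. ?G z1 t (x, x')) (\<lambda>t. ?G z2 t q)} (y, y') :: ennreal"
  let ?pre = "\<lambda>x y. indicator {y. avoids ?A r (\<lambda>t. start z1 t x) (\<lambda>t. start z2 t y)} y :: ennreal"
  let ?post = "\<lambda>x x' y y'. indicator {y'. avoids ?A S (\<lambda>t. start (hit_pt r z1 x) t x') (\<lambda>t. start (hit_pt r z2 y) t y')} y' :: ennreal"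
  have q: "Q S z1 z2 = (\<integral>\<^sup>+x. (\<integral>\<^sup>+x'. (\<integral>\<^sup>+y. (\<integral>\<^sup>+y'. ?I x x' y y' \<partial>M) \<partial>M) \<partial>M) \<partial>M)"
  proof -
    have Em: "{q\<in>space ((M \<Otimes>\<^sub>M M) \<Otimes>\<^sub>M (M \<Otimes>\<^sub>M M)). avoids ?A S (\<lambda>t. ?G z1 t (fst q)) (\<lambda>t. ?G z2 t (snd q))} \<in> sets ((M \<Otimes>\<^sub>M M) \<Otimes>\<^sub>M (M \<Otimes>\<^sub>M M))" (is "?E \<in> _")
    proof (rule sets_avoids[OF _ _ _ _ \<alpha>])
      fix t :: real assume t: "0 \<le> t"
      show "(\<lambda>q. ?G z1 t (fst q)) \<in> borel_measurable ((M \<Otimes>\<^sub>M M) \<Otimes>\<^sub>M (M \<Otimes>\<^sub>M M))" by (rule measurable_compose[OF measurable_fst Gm[OF t]])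
      show "(\<lambda>q. ?G z2 t (snd q)) \<in> borel_measurable ((M \<Otimes>\<^sub>M M) \<Otimes>\<^sub>M (M \<Otimes>\<^sub>M M))" by (rule measurable_compose[OF measurable_snd Gm[OF t]])
    next
      fix q assume "q \<in> space ((M \<Otimes>\<^sub>M M) \<Otimes>\<^sub>M (M \<Otimes>\<^sub>M M))"
      then have "fst q \<in> space (M \<Otimes>\<^sub>M M)" "snd q \<in> space (M \<Otimes>\<^sub>M M)" by (auto simp: space_pair_measure)
      then show "continuous_on {0..} (\<lambda>t. ?G z1 t (fst q))" "continuous_on {0..} (\<lambda>t. ?G z2 t (snd q))"
        using Gc[of "fst q" z1] Gc[of "snd q" z2] by simp_all
    qed
    have "Q S z1 z2 = noninter \<alpha> S (M \<Otimes>\<^sub>M M) (?G z1) (M \<Otimes>\<^sub>M M) (?G z2)"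
      unfolding Q_def by (rule noninter_law_cong) (simp_all add: law prob_space_axioms P.prob_space_axioms start_measurable start_continuous Gm Gc \<alpha>)
    also have "\<dots> = (\<integral>\<^sup>+p. (\<integral>\<^sup>+q. indicator ?E (p, q) \<partial>(M \<Otimes>\<^sub>M M)) \<partial>(M \<Otimes>\<^sub>M M))"
      unfolding noninter_def by (rule P.emeasure_pair_measure[OF Em])
    also have "\<dots> = (\<integral>\<^sup>+x. (\<integral>\<^sup>+x'. (\<integral>\<^sup>+q. indicator ?E ((x, x'), q) \<partial>(M \<Otimes>\<^sub>M M)) \<partial>M) \<partial>M)"
      by (rule nn_integral_fst[symmetric]) (use Em in measurable)
    also have "\<dots> = (\<integral>\<^sup>+x. (\<integral>\<^sup>+x'. (\<integral>\<^sup>+y. (\<integral>\<^sup>+y'. indicator ?E ((x, x'), (y, y')) \<partial>M) \<partial>M) \<partial>M) \<partial>M)"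
    proof (intro nn_integral_cong)
      fix x x' assume "x \<in> space M" "x' \<in> space M"
      then have "Pair (x, x') -` ?E \<in> sets (M \<Otimes>\<^sub>M M)" using Em by (rule_tac sets_Pair1) 
      moreover have ind: "(\<lambda>q. indicator ?E ((x, x'), q) :: ennreal) = indicator (Pair (x, x') -` ?E)"
        by (intro ext) (simp only: indicator_vimage)
      ultimately have "(\<lambda>q. indicator ?E ((x, x'), q) :: ennreal) \<in> borel_measurable (M \<Otimes>\<^sub>M M)"
        by (simp only: borel_measurable_indicator)
      from nn_integral_fst[OF this] show "(\<integral>\<^sup>+q. indicator ?E ((x, x'), q) \<partial>(M \<Otimes>\<^sub>M M)) = (\<integral>\<^sup>+y. (\<integral>\<^sup>+y'. indicator ?E ((x, x'), (y, y')) \<partial>M) \<partial>M)"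
        by simp
    qed
    also have "\<dots> = (\<integral>\<^sup>+x. (\<integral>\<^sup>+x'. (\<integral>\<^sup>+y. (\<integral>\<^sup>+y'. ?I x x' y y' \<partial>M) \<partial>M) \<partial>M) \<partial>M)"
      by (intro nn_integral_cong) (simp add: indicator_def space_pair_measure)
    finally show ?thesis .
  qed
  have AE1: "AE x in M. hits (\<lambda>t. start z1 t x) r" by (rule AE_hits[OF W W0 z(1)])
  have AE2: "AE x in M. hits (\<lambda>t. start z2 t x) r" by (rule AE_hits[OF W W0 z(2)])
  have after: "trace_until S (\<lambda>t. start (hit_pt r z x) t x') \<subseteq> trace_until S (\<lambda>t. ?G z t (x, x'))"
    if "x \<in> space M" "x' \<in> space M" "hits (\<lambda>t. start z t x) r" "cmod z \<le> r" for x x' z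
    using trace_until_after_glue[where c=0 and u=1 and f="\<lambda>t. start z t x" and g="\<lambda>t. W t x'" and r=r and S=S,
        OF start_continuous[OF that(1)]] that r W0[OF that(1)] W0[OF that(2)]
    by (simp add: hit_pt_def hit_point_def)
  have before: "trace_until r (\<lambda>t. start z t x) \<subseteq> trace_until S (\<lambda>t. ?G z t (x, x'))"
    if "x \<in> space M" "hits (\<lambda>t. start z t x) r" "cmod z \<le> r" for x x' z
    using trace_until_before_glue[where f="\<lambda>t. start z t x" and g="\<lambda>t. W t x'" and r=r and S=S,
        OF start_continuous[OF that(1)]] that r W0[OF that(1)]
    by simp
  have "Q S z1 z2 \<le> (\<integral>\<^sup>+x. (\<integral>\<^sup>+x'. (\<integral>\<^sup>+y. ?pre x y * (\<integral>\<^sup>+y'. ?post x x' y y' \<partial>M) \<partial>M) \<partial>M) \<partial>M)"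
    unfolding q
  proof (rule nn_integral_mono_AE, rule AE_mp[OF AE1], rule AE_I2, rule impI, rule nn_integral_mono, rule nn_integral_mono_AE, rule AE_mp[OF AE2], rule AE_I2, rule impI)
    fix x x' y assume x: "x \<in> space M" "hits (\<lambda>t. start z1 t x) r" and x': "x' \<in> space M" and y: "y \<in> space M" "hits (\<lambda>t. start z2 t y) r"
    have le: "?I x x' y y' \<le> ?pre x y * ?post x x' y y'" if y': "y' \<in> space M" for y'
      using avoids_mono[OF _ after[OF x(1) x' x(2) z(1)] after[OF y(1) y' y(2) z(2)]]
        avoids_mono[OF _ before[OF x z(1)] before[OF y z(2)]]
      by (auto simp: indicator_def)
    have "(\<integral>\<^sup>+y'. ?I x x' y y' \<partial>M) \<le> (\<integral>\<^sup>+y'. ?pre x y * ?post x x' y y' \<partial>M)"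
      by (rule nn_integral_mono[OF le])
    also have "\<dots> \<le> ?pre x y * (\<integral>\<^sup>+y'. ?post x x' y y' \<partial>M)"
      by (auto simp: indicator_def)
    finally show "(\<integral>\<^sup>+y'. ?I x x' y y' \<partial>M) \<le> ?pre x y * (\<integral>\<^sup>+y'. ?post x x' y y' \<partial>M)" .
  qed
  \<comment> \<open>\<open>?pre\<close> does not involve \<open>x'\<close>. Exchanging
    \<open>x'\<close> and \<open>y\<close> brings the two continuations together, so that their
    double integral is a value of \<open>Q\<close>.\<close>
  also have "\<dots> = (\<integral>\<^sup>+x. (\<integral>\<^sup>+y. (\<integral>\<^sup>+x'. ?pre x y * (\<integral>\<^sup>+y'. ?post x x' y y' \<partial>M) \<partial>M) \<partial>M) \<partial>M)"
  proof (rule nn_integral_cong)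
    fix x assume x: "x \<in> space M"
    have preE: "{y\<in>space M. avoids ?A r (\<lambda>t. start z1 t x) (\<lambda>t. start z2 t y)} \<in> sets M"
      by (rule sets_avoids[OF _ _ _ _ \<alpha>]) (use x in \<open>auto intro!: start_measurable start_continuous\<close>)
    have pre: "(\<lambda>p. ?pre x (fst p)) \<in> borel_measurable (M \<Otimes>\<^sub>M M)"
    proof (rule measurable_compose[OF measurable_fst])
      have "(indicator {y\<in>space M. avoids ?A r (\<lambda>t. start z1 t x) (\<lambda>t. start z2 t y)} :: 'w \<Rightarrow> ennreal) \<in> borel_measurable M"
        using preE by simp
      then show "(\<lambda>y. ?pre x y) \<in> borel_measurable M"
        by (rule measurable_cong[THEN iffD1, rotated]) (simp add: indicator_def)
    qed
    let ?F = "{q\<in>space ((M \<Otimes>\<^sub>M M) \<Otimes>\<^sub>M M). avoids ?A S (\<lambda>t. start (hit_pt r z1 x) t (snd (fst q))) (\<lambda>t. start (hit_pt r z2 (fst (fst q))) t (snd q))}"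
    have F: "?F \<in> sets ((M \<Otimes>\<^sub>M M) \<Otimes>\<^sub>M M)"
    proof (rule sets_avoids[OF _ _ _ _ \<alpha>])
      fix t :: real assume t: "0 \<le> t"
      note [measurable] = Wm[OF t]
      show "(\<lambda>q. start (hit_pt r z1 x) t (snd (fst q))) \<in> borel_measurable ((M \<Otimes>\<^sub>M M) \<Otimes>\<^sub>M M)" by measurable
      show "(\<lambda>q. start (hit_pt r z2 (fst (fst q))) t (snd q)) \<in> borel_measurable ((M \<Otimes>\<^sub>M M) \<Otimes>\<^sub>M M)" by measurable
    qed (auto simp: space_pair_measure intro!: start_continuous)
    have "(\<lambda>p. emeasure M (Pair p -` ?F)) \<in> borel_measurable (M \<Otimes>\<^sub>M M)"
      by (rule measurable_emeasure_Pair[OF F])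
    moreover have "emeasure M (Pair p -` ?F) = (\<integral>\<^sup>+y'. ?post x (snd p) (fst p) y' \<partial>M)" if p: "p \<in> space (M \<Otimes>\<^sub>M M)" for p
    proof -
      have "emeasure M (Pair p -` ?F) = (\<integral>\<^sup>+y'. indicator (Pair p -` ?F) y' \<partial>M)"
        using sets_Pair1[OF F, of p] by simp
      also have "\<dots> = (\<integral>\<^sup>+y'. ?post x (snd p) (fst p) y' \<partial>M)"
        by (rule nn_integral_cong) (use p in \<open>auto simp: indicator_def space_pair_measure\<close>)
      finally show ?thesis .
    qed
    ultimately have post: "(\<lambda>p. \<integral>\<^sup>+y'. ?post x (snd p) (fst p) y' \<partial>M) \<in> borel_measurable (M \<Otimes>\<^sub>M M)"
      by (rule measurable_cong[THEN iffD1, rotated]) simp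
    have "(\<lambda>p. ?pre x (fst p) * (\<integral>\<^sup>+y'. ?post x (snd p) (fst p) y' \<partial>M)) \<in> borel_measurable (M \<Otimes>\<^sub>M M)"
      by (rule borel_measurable_times_ennreal[OF pre post])
    then show "(\<integral>\<^sup>+x'. (\<integral>\<^sup>+y. ?pre x y * (\<integral>\<^sup>+y'. ?post x x' y y' \<partial>M) \<partial>M) \<partial>M) = (\<integral>\<^sup>+y. (\<integral>\<^sup>+x'. ?pre x y * (\<integral>\<^sup>+y'. ?post x x' y y' \<partial>M) \<partial>M) \<partial>M)"
      by (intro P.Fubini') (simp add: split_beta')
  qed
  also have "\<dots> \<le> (\<integral>\<^sup>+x. (\<integral>\<^sup>+y. ?pre x y * b \<partial>M) \<partial>M)"
  proof (intro nn_integral_mono)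
    fix x y assume x: "x \<in> space M" and y: "y \<in> space M"
    let ?w1 = "hit_pt r z1 x" and ?w2 = "hit_pt r z2 y"
    have n: "cmod ?w1 = r" "cmod ?w2 = r" unfolding hit_pt_def by (intro norm_hit_point start_continuous x y r)+
    have "(\<integral>\<^sup>+x'. (\<integral>\<^sup>+y'. ?post x x' y y' \<partial>M) \<partial>M) = Q S ?w1 ?w2"
    proof -
      have Em: "{q\<in>space (M \<Otimes>\<^sub>M M). avoids ?A S (\<lambda>t. start ?w1 t (fst q)) (\<lambda>t. start ?w2 t (snd q))} \<in> sets (M \<Otimes>\<^sub>M M)" (is "?E \<in> _")
      proof (rule sets_avoids[OF _ _ _ _ \<alpha>])
        fix t :: real assume t: "0 \<le> t"
        note [measurable] = Wm[OF t]
        show "(\<lambda>q. start ?w1 t (fst q)) \<in> borel_measurable (M \<Otimes>\<^sub>M M)" by measurable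
        show "(\<lambda>q. start ?w2 t (snd q)) \<in> borel_measurable (M \<Otimes>\<^sub>M M)" by measurable
      qed (auto simp: space_pair_measure intro!: start_continuous)
      have "Q S ?w1 ?w2 = (\<integral>\<^sup>+x'. (\<integral>\<^sup>+y'. indicator ?E (x', y') \<partial>M) \<partial>M)"
        unfolding Q_def noninter_def by (rule emeasure_pair_measure[OF Em])
      also have "\<dots> = (\<integral>\<^sup>+x'. (\<integral>\<^sup>+y'. ?post x x' y y' \<partial>M) \<partial>M)"
        by (intro nn_integral_cong) (simp add: indicator_def space_pair_measure)
      finally show ?thesis ..
    qed
    also have "\<dots> \<le> b" by (rule B[OF n])
    finally show "(\<integral>\<^sup>+x'. ?pre x y * (\<integral>\<^sup>+y'. ?post x x' y y' \<partial>M) \<partial>M) \<le> ?pre x y * b"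
      by (simp add: indicator_def)
  qed
  also have "\<dots> = Q r z1 z2 * b"
  proof -
    have Em: "{q\<in>space (M \<Otimes>\<^sub>M M). avoids ?A r (\<lambda>t. start z1 t (fst q)) (\<lambda>t. start z2 t (snd q))} \<in> sets (M \<Otimes>\<^sub>M M)" (is "?E \<in> _")
    proof (rule sets_avoids[OF _ _ _ _ \<alpha>])
      fix t :: real assume t: "0 \<le> t"
      note [measurable] = Wm[OF t]
      show "(\<lambda>q. start z1 t (fst q)) \<in> borel_measurable (M \<Otimes>\<^sub>M M)" by measurable
      show "(\<lambda>q. start z2 t (snd q)) \<in> borel_measurable (M \<Otimes>\<^sub>M M)" by measurable
    qed (auto simp: space_pair_measure intro!: start_continuous)
    have m: "(\<lambda>p. indicator ?E p * b) \<in> borel_measurable (M \<Otimes>\<^sub>M M)" using Em by measurable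
    have "Q r z1 z2 * b = (\<integral>\<^sup>+p. indicator ?E p * b \<partial>(M \<Otimes>\<^sub>M M))"
      unfolding Q_def noninter_def using Em by (simp add: nn_integral_multc)
    also have "\<dots> = (\<integral>\<^sup>+x. (\<integral>\<^sup>+y. indicator ?E (x, y) * b \<partial>M) \<partial>M)"
      using nn_integral_fst[OF m] by simp
    also have "\<dots> = (\<integral>\<^sup>+x. (\<integral>\<^sup>+y. ?pre x y * b \<partial>M) \<partial>M)"
      by (intro nn_integral_cong) (simp add: indicator_def space_pair_measure)
    finally show ?thesis ..
  qed
  finally show ?thesis .
qed

end

lemma emeasure_ball_bounds:
  assumes "0 < r"
  shows "emeasure lborel (ball (0::complex) r) \<noteq> 0" "emeasure lborel (ball (0::complex) r) \<noteq> \<infinity>"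
proof -
  show "emeasure lborel (ball (0::complex) r) \<noteq> \<infinity>"
    using emeasure_lborel_ball_finite[of "0::complex" r] by simp
  have "box 0 (Complex (r/2) (r/2)) \<subseteq> ball 0 r"
  proof
    fix z assume "z \<in> box 0 (Complex (r/2) (r/2))"
    then have "0 < Re z" "Re z < r/2" "0 < Im z" "Im z < r/2" by (auto simp: box_def Basis_complex_def)
    then show "z \<in> ball 0 r" using cmod_le[of z] by simp
  qed
  then have "emeasure lborel (box 0 (Complex (r/2) (r/2))) \<le> emeasure lborel (ball (0::complex) r)"
    by (rule emeasure_mono) simp
  moreover have "emeasure lborel (box 0 (Complex (r/2) (r/2))) = ennreal (r/2 * (r/2))"
    by (subst emeasure_lborel_box) (use assms in \<open>auto simp: Basis_complex_def\<close>)
  moreover have "0 < ennreal (r/2 * (r/2))" using assms by simp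
  ultimately show "emeasure lborel (ball (0::complex) r) \<noteq> 0" by (metis leD)
qed

text \<open>Averaging over circles, then over their radii with respect to area, bounds the value at a point
  of the unit disc by a mean over the disc of radius 2, and that mean by the mean over its boundary.\<close>

lemma point_le_circle_average:
  assumes f [measurable]: "f \<in> borel_measurable borel"
    and P1: "\<And>s. 0 \<le> s \<Longrightarrow> s < 1 \<Longrightarrow> f z \<le> (\<integral>\<^sup>+u. f (z + u * complex_of_real s) \<partial>uniform_unit_circle)"
    and P2: "\<And>x. cmod x \<le> 2 \<Longrightarrow> (\<integral>\<^sup>+u. f (u * x) \<partial>uniform_unit_circle) \<le> (\<integral>\<^sup>+u. f (u * 2) \<partial>uniform_unit_circle)"
    and z: "cmod z \<le> 1"
  shows "emeasure lborel (ball (0::complex) 1) * f z \<le> emeasure lborel (ball (0::complex) 2) * (\<integral>\<^sup>+u. f (u * 2) \<partial>uniform_unit_circle)"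
proof -
  let ?U = uniform_unit_circle
  interpret U: prob_space ?U by (rule prob_space_circle)
  interpret P: pair_sigma_finite lborel ?U ..
  have [measurable]: "ball (0::complex) r \<in> sets borel" "ball z r \<in> sets borel" for r by simp_all
  have im [measurable]: "(\<lambda>w. indicator (ball (0::complex) r) w :: ennreal) \<in> borel_measurable borel"
    "(\<lambda>w. indicator (ball z r) w :: ennreal) \<in> borel_measurable borel" for r
    by (auto intro!: borel_measurable_indicator)
  have "emeasure lborel (ball (0::complex) 1) * f z = (\<integral>\<^sup>+w. indicator (ball (0::complex) 1) w * f z \<partial>lborel)"
    by (subst nn_integral_multc) (use im(1)[of 1] in simp_all)
  also have "\<dots> \<le> (\<integral>\<^sup>+w. (\<integral>\<^sup>+u. indicator (ball 0 1) w * f (z + u * w) \<partial>?U) \<partial>lborel)"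
  proof (rule nn_integral_mono)
    fix w :: complex
    show "indicator (ball 0 1) w * f z \<le> (\<integral>\<^sup>+u. indicator (ball 0 1) w * f (z + u * w) \<partial>?U)"
    proof (cases "w \<in> ball 0 1")
      case True
      then have w: "cmod w < 1" by simp
      obtain v where v: "cmod v = 1" "w = v * complex_of_real (cmod w)"
      proof (cases "w = 0")
        case True then show ?thesis by (intro that[of 1]) auto
      next
        case False then show ?thesis by (intro that[of "w / complex_of_real (cmod w)"]) (auto simp: norm_divide)
      qed
      have "f z \<le> (\<integral>\<^sup>+u. f (z + u * complex_of_real (cmod w)) \<partial>?U)" by (rule P1) (use w in auto)
      also have "\<dots> = (\<integral>\<^sup>+u. (\<lambda>y. f (z + y * complex_of_real (cmod w))) (v * u) \<partial>?U)"
        by (rule nn_integral_circle_rotate[OF _ v(1), symmetric]) measurable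
      also have "\<dots> = (\<integral>\<^sup>+u. f (z + u * w) \<partial>?U)"
      proof -
        have "v * u * complex_of_real (cmod w) = u * w" for u by (subst (2) v(2)) (simp add: mult_ac)
        then show ?thesis by (simp only:)
      qed
      finally show ?thesis using True by simp
    qed simp
  qed
  also have "\<dots> = (\<integral>\<^sup>+u. (\<integral>\<^sup>+w. indicator (ball 0 1) w * f (z + u * w) \<partial>lborel) \<partial>?U)"
    by (rule P.Fubini'[symmetric]) measurable
  also have "\<dots> = (\<integral>\<^sup>+u. (\<integral>\<^sup>+w. indicator (ball 0 1) w * f (z + w) \<partial>lborel) \<partial>?U)"
  proof (rule nn_integral_cong_AE)
    show "AE u in ?U. (\<integral>\<^sup>+w. indicator (ball 0 1) w * f (z + u * w) \<partial>lborel) = (\<integral>\<^sup>+w. indicator (ball 0 1) w * f (z + w) \<partial>lborel)"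
      using AE_circle
    proof eventually_elim
      fix u :: complex assume u: "cmod u = 1"
      have "(\<integral>\<^sup>+w. (\<lambda>y. indicator (ball 0 1) y * f (z + y)) (u * w) \<partial>lborel) = (\<integral>\<^sup>+w. indicator (ball 0 1) w * f (z + w) \<partial>lborel)"
        by (rule nn_integral_lborel_rotate[OF _ u]) measurable
      moreover have "indicator (ball 0 1) (u * w) = (indicator (ball 0 1) w :: ennreal)" for w
        using u by (simp add: indicator_def norm_mult)
      ultimately show "(\<integral>\<^sup>+w. indicator (ball 0 1) w * f (z + u * w) \<partial>lborel) = (\<integral>\<^sup>+w. indicator (ball 0 1) w * f (z + w) \<partial>lborel)"
        by simp
    qed
  qed
  also have "\<dots> = (\<integral>\<^sup>+w. indicator (ball 0 1) w * f (z + w) \<partial>lborel)"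
    using U.emeasure_space_1 by simp
  also have "\<dots> = (\<integral>\<^sup>+w. indicator (ball 0 1) (w - z) * f w \<partial>lborel)"
  proof -
    have "(\<integral>\<^sup>+w. indicator (ball 0 1) (w - z) * f w \<partial>lborel) = (\<integral>\<^sup>+w. indicator (ball 0 1) (w - z) * f w \<partial>distr lborel borel ((+) z))"
      by (simp add: lborel_distr_plus)
    also have "\<dots> = (\<integral>\<^sup>+w. indicator (ball 0 1) (z + w - z) * f (z + w) \<partial>lborel)"
      by (rule nn_integral_distr) simp_all
    finally show ?thesis by simp
  qed
  also have "\<dots> \<le> (\<integral>\<^sup>+w. indicator (ball 0 2) w * f w \<partial>lborel)"
  proof (intro nn_integral_mono mult_right_mono)
    fix w :: complex
    have "cmod w \<le> cmod (w - z) + cmod z" using norm_triangle_ineq[of "w - z" z] by simp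
    then show "indicator (ball 0 1) (w - z) \<le> (indicator (ball 0 2) w :: ennreal)"
      using z by (auto simp: indicator_def)
  qed simp
  also have "\<dots> = (\<integral>\<^sup>+u. (\<integral>\<^sup>+w. indicator (ball 0 2) w * f w \<partial>lborel) \<partial>?U)"
    using U.emeasure_space_1 by simp
  also have "\<dots> = (\<integral>\<^sup>+u. (\<integral>\<^sup>+w. indicator (ball 0 2) w * f (u * w) \<partial>lborel) \<partial>?U)"
  proof (rule nn_integral_cong_AE)
    show "AE u in ?U. (\<integral>\<^sup>+w. indicator (ball 0 2) w * f w \<partial>lborel) = (\<integral>\<^sup>+w. indicator (ball 0 2) w * f (u * w) \<partial>lborel)"
      using AE_circle
    proof eventually_elim
      fix u :: complex assume u: "cmod u = 1"
      have "(\<integral>\<^sup>+w. (\<lambda>y. indicator (ball 0 2) y * f y) (u * w) \<partial>lborel) = (\<integral>\<^sup>+w. indicator (ball 0 2) w * f w \<partial>lborel)"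
        by (rule nn_integral_lborel_rotate[OF _ u]) measurable
      moreover have "indicator (ball 0 2) (u * w) = (indicator (ball 0 2) w :: ennreal)" for w
        using u by (simp add: indicator_def norm_mult)
      ultimately show "(\<integral>\<^sup>+w. indicator (ball 0 2) w * f w \<partial>lborel) = (\<integral>\<^sup>+w. indicator (ball 0 2) w * f (u * w) \<partial>lborel)"
        by simp
    qed
  qed
  also have "\<dots> = (\<integral>\<^sup>+w. (\<integral>\<^sup>+u. indicator (ball 0 2) w * f (u * w) \<partial>?U) \<partial>lborel)"
    by (rule P.Fubini') measurable
  also have "\<dots> \<le> (\<integral>\<^sup>+w. indicator (ball (0::complex) 2) w * (\<integral>\<^sup>+u. f (u * 2) \<partial>?U) \<partial>lborel)"
    by (rule nn_integral_mono) (auto simp: indicator_def intro!: P2)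
  also have "\<dots> = emeasure lborel (ball (0::complex) 2) * (\<integral>\<^sup>+u. f (u * 2) \<partial>?U)"
    by (simp add: nn_integral_multc)
  finally show ?thesis .
qed

context wiener
begin

definition QU :: "real \<Rightarrow> ennreal" where
  "QU S = (\<integral>\<^sup>+u1. (\<integral>\<^sup>+u2. Q S u1 u2 \<partial>uniform_unit_circle) \<partial>uniform_unit_circle)"

text \<open>The comparison at a point is applied to one starting point after the other. It ends on
  the circle of radius 2, and rescaling this to the unit circle turns \<open>S\<close> into
  \<open>S / 2\<close>.\<close>

lemma Q_le_QU:
  assumes z: "cmod z1 \<le> 1" "cmod z2 \<le> 1" and S: "2 \<le> S"
  shows "(emeasure lborel (ball (0::complex) 1))\<^sup>2 * Q S z1 z2 \<le> (emeasure lborel (ball (0::complex) 2))\<^sup>2 * QU (S / 2)"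
proof -
  let ?U = uniform_unit_circle and ?V1 = "emeasure lborel (ball (0::complex) 1)" and ?V2 = "emeasure lborel (ball (0::complex) 2)"
  interpret U: prob_space ?U by (rule prob_space_circle)
  have one: "?V1 * Q S z1 w \<le> ?V2 * (\<integral>\<^sup>+u. Q S (u * 2) w \<partial>?U)" for w
  proof (rule point_le_circle_average[OF _ _ _ z(1)])
    show "(\<lambda>z. Q S z w) \<in> borel_measurable borel" by measurable
    show "Q S z1 w \<le> (\<integral>\<^sup>+u. Q S (z1 + u * complex_of_real s) w \<partial>?U)" if "0 \<le> s" "s < 1" for s
      using circle_average_left[of 0 s z1 S w] z S that by (simp add: U.emeasure_space_1[simplified])
    show "(\<integral>\<^sup>+u. Q S (u * x) w \<partial>?U) \<le> (\<integral>\<^sup>+u. Q S (u * 2) w \<partial>?U)" if "cmod x \<le> 2" for x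
      using circle_average_left[of x 2 0 S w] S that by simp
  qed
  have two: "?V1 * Q S w z2 \<le> ?V2 * (\<integral>\<^sup>+u. Q S w (u * 2) \<partial>?U)" for w
  proof (rule point_le_circle_average[OF _ _ _ z(2)])
    show "(\<lambda>z. Q S w z) \<in> borel_measurable borel" by measurable
    show "Q S w z2 \<le> (\<integral>\<^sup>+u. Q S w (z2 + u * complex_of_real s) \<partial>?U)" if "0 \<le> s" "s < 1" for s
      using circle_average_right[of 0 s z2 S w] z S that by (simp add: U.emeasure_space_1[simplified])
    show "(\<integral>\<^sup>+u. Q S w (u * x) \<partial>?U) \<le> (\<integral>\<^sup>+u. Q S w (u * 2) \<partial>?U)" if "cmod x \<le> 2" for x
      using circle_average_right[of x 2 0 S w] S that by simp
  qed
  have "?V1\<^sup>2 * Q S z1 z2 = ?V1 * (?V1 * Q S z1 z2)" by (simp add: power2_eq_square mult.assoc)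
  also have "\<dots> \<le> ?V1 * (?V2 * (\<integral>\<^sup>+u. Q S (u * 2) z2 \<partial>?U))" by (intro mult_left_mono one) simp
  also have "\<dots> = ?V2 * (\<integral>\<^sup>+u. ?V1 * Q S (u * 2) z2 \<partial>?U)"
    by (subst nn_integral_cmult) (auto simp: mult_ac)
  also have "\<dots> \<le> ?V2 * (\<integral>\<^sup>+u. ?V2 * (\<integral>\<^sup>+u2. Q S (u * 2) (u2 * 2) \<partial>?U) \<partial>?U)"
    by (intro mult_left_mono nn_integral_mono two) simp
  also have "\<dots> = ?V2 * (?V2 * (\<integral>\<^sup>+u. (\<integral>\<^sup>+u2. Q S (u * 2) (u2 * 2) \<partial>?U) \<partial>?U))"
    by (subst nn_integral_cmult) auto
  also have "(\<integral>\<^sup>+u. (\<integral>\<^sup>+u2. Q S (u * 2) (u2 * 2) \<partial>?U) \<partial>?U) = QU (S / 2)"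
    unfolding QU_def using Q_scale[of 2 "S / 2"] by (simp add: mult.commute)
  finally show ?thesis by (simp add: power2_eq_square mult.assoc)
qed

text \<open>A supremum rather than an average: given that the paths have not met so far, the points
  where they hit an intermediate circle are not uniformly distributed, so a bound for all starting
  points is required.\<close>

definition q :: "real \<Rightarrow> real" where
  "q S = Sup ((\<lambda>z. enn2real (Q S (fst z) (snd z))) ` (cball 0 1 \<times> cball 0 1))"

lemma Q_real: "Q S z1 z2 = ennreal (enn2real (Q S z1 z2))" "enn2real (Q S z1 z2) \<le> 1"
proof -
  have "Q S z1 z2 < top" using Q_le_1[of S z1 z2] by (rule le_less_trans) simp
  then show "Q S z1 z2 = ennreal (enn2real (Q S z1 z2))" by simp
  show "enn2real (Q S z1 z2) \<le> 1" using Q_le_1[of S z1 z2] by (metis enn2real_mono enn2real_1 ennreal_one_less_top)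
qed

lemma q_upper: "cmod z1 \<le> 1 \<Longrightarrow> cmod z2 \<le> 1 \<Longrightarrow> Q S z1 z2 \<le> ennreal (q S)"
proof -
  assume z: "cmod z1 \<le> 1" "cmod z2 \<le> 1"
  have "enn2real (Q S z1 z2) \<le> q S" unfolding q_def
    by (rule cSup_upper) (use z Q_real(2) in \<open>auto intro!: bdd_aboveI[of _ 1] image_eqI[of _ _ "(z1, z2)"]\<close>)
  then show ?thesis using Q_real(1)[of S z1 z2] by (metis ennreal_leI)
qed

lemma q_least: "0 \<le> b \<Longrightarrow> (\<And>z1 z2. cmod z1 \<le> 1 \<Longrightarrow> cmod z2 \<le> 1 \<Longrightarrow> Q S z1 z2 \<le> ennreal b) \<Longrightarrow> q S \<le> b"
  unfolding q_def
  by (rule cSup_least) (auto intro!: enn2real_leI)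

lemma q_bounds: "0 \<le> q S" "q S \<le> 1"
proof -
  have "ennreal 0 \<le> Q S 0 0" by simp
  have "enn2real (Q S 0 0) \<le> q S" unfolding q_def
    by (rule cSup_upper) (use Q_real(2) in \<open>auto intro!: bdd_aboveI[of _ 1] image_eqI[of _ _ "(0, 0)"]\<close>)
  then show "0 \<le> q S" using enn2real_nonneg order_trans by blast
  show "q S \<le> 1" by (rule q_least) (simp_all add: Q_le_1)
qed

lemma q_submult:
  assumes R: "1 \<le> R" and S: "1 \<le> S"
  shows "q (R * S) \<le> q R * q S"
proof (rule q_least)
  show "0 \<le> q R * q S" using q_bounds by simp
  fix z1 z2 assume z: "cmod z1 \<le> 1" "cmod z2 \<le> 1"
  have "Q (R * S) w1 w2 \<le> ennreal (q S)" if w: "cmod w1 = R" "cmod w2 = R" for w1 w2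
  proof -
    have "Q (R * S) (complex_of_real R * (w1 / complex_of_real R)) (complex_of_real R * (w2 / complex_of_real R)) = Q S (w1 / complex_of_real R) (w2 / complex_of_real R)"
      by (rule Q_scale) (use R in simp)
    also have "\<dots> \<le> ennreal (q S)"
      by (rule q_upper) (use R w in \<open>simp_all add: norm_divide\<close>)
    finally show ?thesis using R by simp
  qed
  then have "Q (R * S) z1 z2 \<le> Q R z1 z2 * ennreal (q S)"
    by (intro Q_submult) (use z R S in \<open>auto simp: mult_le_cancel_left1\<close>)
  also have "\<dots> \<le> ennreal (q R) * ennreal (q S)"
    by (intro mult_right_mono q_upper z) simp
  finally show "Q (R * S) z1 z2 \<le> ennreal (q R * q S)" by (simp add: ennreal_mult' q_bounds)
qed

lemma QU_le_q: "QU S \<le> ennreal (q S)"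
proof -
  interpret U: prob_space uniform_unit_circle by (rule prob_space_circle)
  have "QU S \<le> (\<integral>\<^sup>+u1. (\<integral>\<^sup>+u2. ennreal (q S) \<partial>uniform_unit_circle) \<partial>uniform_unit_circle)"
    unfolding QU_def
  proof (rule nn_integral_mono_AE)
    show "AE u1 in uniform_unit_circle. (\<integral>\<^sup>+u2. Q S u1 u2 \<partial>uniform_unit_circle) \<le> (\<integral>\<^sup>+u2. ennreal (q S) \<partial>uniform_unit_circle)"
      using AE_circle
    proof eventually_elim
      fix u1 :: complex assume u1: "cmod u1 = 1"
      show "(\<integral>\<^sup>+u2. Q S u1 u2 \<partial>uniform_unit_circle) \<le> (\<integral>\<^sup>+u2. ennreal (q S) \<partial>uniform_unit_circle)"
      proof (rule nn_integral_mono_AE)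
        show "AE u2 in uniform_unit_circle. Q S u1 u2 \<le> ennreal (q S)"
          using AE_circle by eventually_elim (rule q_upper, simp_all add: u1)
      qed
    qed
  qed
  also have "\<dots> = ennreal (q S)" using U.emeasure_space_1 by simp
  finally show ?thesis .
qed

lemma q_le_QU: "\<exists>C>0. \<forall>S\<ge>2. q S \<le> C * enn2real (QU (S / 2))"
proof -
  define V1 where "V1 = enn2real (emeasure lborel (ball (0::complex) 1))"
  define V2 where "V2 = enn2real (emeasure lborel (ball (0::complex) 2))"
  have e1: "emeasure lborel (ball (0::complex) 1) = ennreal V1" "0 < V1"
    using emeasure_ball_bounds[of 1] by (auto simp: V1_def less_top enn2real_positive_iff zero_less_iff_neq_zero)
  have e2: "emeasure lborel (ball (0::complex) 2) = ennreal V2" "0 < V2"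
    using emeasure_ball_bounds[of 2] by (auto simp: V2_def less_top enn2real_positive_iff zero_less_iff_neq_zero)
  define C where "C = V2\<^sup>2 / V1\<^sup>2"
  have "q S \<le> C * enn2real (QU (S / 2))" if S: "2 \<le> S" for S
  proof (rule q_least)
    show "0 \<le> C * enn2real (QU (S / 2))" by (simp add: C_def)
    fix z1 z2 assume z: "cmod z1 \<le> 1" "cmod z2 \<le> 1"
    define a where "a = enn2real (Q S z1 z2)"
    define b where "b = enn2real (QU (S / 2))"
    have "QU (S / 2) < top" using QU_le_q[of "S / 2"] by (rule le_less_trans) simp
    then have b: "QU (S / 2) = ennreal b" "0 \<le> b" by (simp_all add: b_def)
    have a: "Q S z1 z2 = ennreal a" "0 \<le> a" using Q_real(1) by (simp_all add: a_def)
    have "ennreal (V1\<^sup>2 * a) \<le> ennreal (V2\<^sup>2 * b)"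
      using Q_le_QU[OF z S] unfolding e1(1) e2(1) a b using e1 e2 a b
      by (simp add: ennreal_mult' ennreal_power)
    then have "V1\<^sup>2 * a \<le> V2\<^sup>2 * b" using e2 b by (subst (asm) ennreal_le_iff) auto
    then have "a \<le> C * b" using e1 by (simp add: C_def field_simps)
    then show "Q S z1 z2 \<le> ennreal (C * enn2real (QU (S / 2)))" unfolding a b_def[symmetric] by (rule ennreal_leI)
  qed
  moreover have "0 < C" using e1 e2 by (simp add: C_def)
  ultimately show ?thesis by blast
qed

end

text \<open>By independence the joint law of the two paths is the product of their laws, and each of
  these is the law of a uniform start plus a process from 0. Hence one recentred path, that of
  \<open>B1\<close>, can serve as the model for both.\<close>

lemma nonintersection_prob_eq_QU:
  assumes "independent_brownian_pair M B1 B2" and \<alpha>: "0 \<le> \<alpha>"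
  shows "wiener M (\<lambda>t \<omega>. B1 t \<omega> - B1 0 \<omega>) \<alpha>"
    and "ennreal (nonintersection_prob M B1 B2 (circle_arc \<alpha>) R) = wiener.QU M (\<lambda>t \<omega>. B1 t \<omega> - B1 0 \<omega>) \<alpha> R"
proof -
  interpret independent_brownian_pair M B1 B2 by fact
  have p1: "planar_brownian_motion M B1" and p2: "planar_brownian_motion M B2" by unfold_locales
  let ?W = "\<lambda>t \<omega>. B1 t \<omega> - B1 0 \<omega>"
  show w: "wiener M ?W \<alpha>"
    by unfold_locales (simp_all add: planar_brownian_motion_from_0[OF p1] \<alpha>)
  interpret W: wiener M ?W \<alpha> by (rule w)
  let ?N = "uniform_unit_circle \<Otimes>\<^sub>M M" and ?X = "\<lambda>t p. fst p + ?W t (snd p)"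
  have X: "brownian_process ?N ?X" by (rule brownian_process_random_start[OF W.W prob_space_circle sets_circle])
  note DX = brownian_processD[OF X]
  note P1 = planar_brownian_motion_process[OF p1] and P2 = planar_brownian_motion_process[OF p2]
  note D1 = brownian_processD[OF P1] and D2 = brownian_processD[OF P2]
  have start: "distr ?N borel (?X 0) = uniform_unit_circle"
  proof -
    have "distr ?N borel (\<lambda>p. id (fst p)) = distr uniform_unit_circle borel id"
      by (rule distr_pair_fst[OF prob_space_circle]) (simp_all add: B1.prob_space_axioms)
    moreover have "distr uniform_unit_circle borel id = uniform_unit_circle"
      unfolding id_def by (rule distr_id2) simp
    ultimately show ?thesis by simp
  qed
  have law1: "path_law M B1 = path_law ?N ?X"
    by (rule brownian_process_law_unique[OF P1 X]) (simp only: start uniform_start1)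
  have law2: "path_law M B2 = path_law ?N ?X"
    by (rule brownian_process_law_unique[OF P2 X]) (simp only: start uniform_start2)
  let ?p1 = "\<lambda>\<omega>. \<lambda>t\<in>{0..}. B1 t \<omega>" and ?p2 = "\<lambda>\<omega>. \<lambda>t\<in>{0..}. B2 t \<omega>"
  let ?PP = "path_space \<Otimes>\<^sub>M path_space"
  let ?S = "{h\<in>space ?PP. avoids_rat \<alpha> R (\<lambda>t. fst h t) (\<lambda>t. snd h t)}"
  have Sm: "?S \<in> sets ?PP"
  proof -
    have "Measurable.pred ?PP (\<lambda>h. avoids_rat \<alpha> R (\<lambda>t. fst h t) (\<lambda>t. snd h t))"
      by (rule measurable_avoids_rat)
         (rule measurable_compose[OF measurable_fst path_space_component] measurable_compose[OF measurable_snd path_space_component]; assumption)+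
    then show ?thesis by (simp add: pred_def)
  qed
  have m1: "?p1 \<in> measurable M path_space" by (rule measurable_path[where X=B1, OF D1(2)])
  have m2: "?p2 \<in> measurable M path_space" by (rule measurable_path[where X=B2, OF D2(2)])
  have joint: "distr M ?PP (\<lambda>\<omega>. (?p1 \<omega>, ?p2 \<omega>)) = path_law M B1 \<Otimes>\<^sub>M path_law M B2"
    using independent_processes unfolding B1.indep_var_distribution_eq path_law_def path_space_def by simp
  have pr: "distr (M \<Otimes>\<^sub>M M) ?PP (\<lambda>(x, y). (?p1 x, ?p2 y)) = path_law M B1 \<Otimes>\<^sub>M path_law M B2"
    unfolding path_law_def
    by (rule pair_measure_distr[OF m1 m2, symmetric]) (rule prob_space_imp_sigma_finite[OF B1.prob_space_distr[OF m2]])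
  have mp: "(\<lambda>(x, y). (?p1 x, ?p2 y)) \<in> measurable (M \<Otimes>\<^sub>M M) ?PP"
    using measurable_compose[OF measurable_fst m1] measurable_compose[OF measurable_snd m2]
    by (auto simp: split_beta' intro!: measurable_Pair)
  have "{\<omega>\<in>space M. path_until_hit B1 R \<omega> \<inter> (circle_arc \<alpha> * path_until_hit B2 R \<omega>) = {}} = (\<lambda>\<omega>. (?p1 \<omega>, ?p2 \<omega>)) -` ?S \<inter> space M"
    unfolding path_until_hit_eq avoids_def[symmetric] using m1 m2
    by (auto simp: space_pair_measure avoids_rat_iff[OF D1(3) D2(3) \<alpha>] dest: measurable_space)
  then have "ennreal (nonintersection_prob M B1 B2 (circle_arc \<alpha>) R) = emeasure M ((\<lambda>\<omega>. (?p1 \<omega>, ?p2 \<omega>)) -` ?S \<inter> space M)"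
    unfolding nonintersection_prob_def by (simp add: B1.emeasure_eq_measure)
  also have "\<dots> = emeasure (path_law M B1 \<Otimes>\<^sub>M path_law M B2) ?S"
    unfolding joint[symmetric] by (rule emeasure_distr[symmetric, OF measurable_Pair[OF m1 m2] Sm])
  also have "\<dots> = emeasure (M \<Otimes>\<^sub>M M) ((\<lambda>(x, y). (?p1 x, ?p2 y)) -` ?S \<inter> space (M \<Otimes>\<^sub>M M))"
    unfolding pr[symmetric] by (rule emeasure_distr[OF mp Sm])
  also have "(\<lambda>(x, y). (?p1 x, ?p2 y)) -` ?S \<inter> space (M \<Otimes>\<^sub>M M) =
      {p\<in>space (M \<Otimes>\<^sub>M M). avoids (circle_arc \<alpha>) R (\<lambda>t. B1 t (fst p)) (\<lambda>t. B2 t (snd p))}"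
    using m1 m2 by (auto simp: space_pair_measure avoids_rat_iff[OF D1(3) D2(3) \<alpha>] dest: measurable_space)
  also have "emeasure (M \<Otimes>\<^sub>M M) \<dots> = noninter \<alpha> R M B1 M B2" by (simp add: noninter_def)
  also have "\<dots> = noninter \<alpha> R ?N ?X ?N ?X"
    by (rule noninter_law_cong) (simp_all add: D1 D2 DX \<alpha> law1 law2)
  also have "\<dots> = W.QU R"
    unfolding W.QU_def by (rule W.Q_random_start[OF prob_space_circle sets_circle])
  finally show "ennreal (nonintersection_prob M B1 B2 (circle_arc \<alpha>) R) = W.QU R" .
qed

text \<open>Fekete's argument on a logarithmic scale.\<close>

lemma exponent_exists:
  fixes p q :: "real \<Rightarrow> real"
  assumes q01: "\<And>R. q R \<le> 1" and sub: "\<And>R S. 1 \<le> R \<Longrightarrow> 1 \<le> S \<Longrightarrow> q (R * S) \<le> q R * q S"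
    and pq: "\<And>R. 1 \<le> R \<Longrightarrow> p R \<le> q R" and C: "0 < C" "\<And>R. 1 \<le> R \<Longrightarrow> q (2 * R) \<le> C * p R"
    and q0: "\<And>R. 0 \<le> q R"
    and lower: "0 < c" "1 \<le> \<sigma>" "1 < \<rho>" "\<And>n::nat. c * (\<sigma> * \<rho> ^ n) powr (- \<kappa>) \<le> p (\<sigma> * \<rho> ^ n)" "0 < \<kappa>"
  shows "\<exists>c>0. \<exists>D>0. \<forall>R\<ge>1. c * R powr (- D) \<le> p R"
    and "\<exists>l\<le>\<kappa>. ((\<lambda>R. ln (p R) / ln R) \<longlongrightarrow> - l) at_top"
proof -
  have r1: "1 \<le> \<sigma> * \<rho> ^ n" for n
    using lower(2,3) mult_mono[of 1 \<sigma> 1 "\<rho> ^ n"] one_le_power[of \<rho> n] by simp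
  have qanti: "q S \<le> q R" if "1 \<le> R" "R \<le> S" for R S
  proof -
    have "q (R * (S / R)) \<le> q R * q (S / R)" using that by (intro sub) (auto simp: le_divide_eq)
    also have "\<dots> \<le> q R * 1" using q0 q01 by (intro mult_left_mono) auto
    finally show ?thesis using that by simp
  qed
  have large: "\<exists>n. x \<le> \<sigma> * \<rho> ^ n \<and> (0 < n \<longrightarrow> \<sigma> * \<rho> ^ (n - 1) < x)" for x
  proof -
    obtain m where "x < \<rho> ^ m" using real_arch_pow[OF lower(3)] by blast
    moreover have "\<rho> ^ m \<le> \<sigma> * \<rho> ^ m" using lower(2,3) by simp
    ultimately have ex: "x \<le> \<sigma> * \<rho> ^ m" by simp
    define n where "n = (LEAST n. x \<le> \<sigma> * \<rho> ^ n)"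
    have "x \<le> \<sigma> * \<rho> ^ n" unfolding n_def by (rule LeastI[of "\<lambda>n. x \<le> \<sigma> * \<rho> ^ n", OF ex])
    moreover have "\<sigma> * \<rho> ^ (n - 1) < x" if "0 < n"
      using not_less_Least[of "n - 1" "\<lambda>n. x \<le> \<sigma> * \<rho> ^ n"] that by (simp add: n_def[symmetric] not_le)
    ultimately show ?thesis by blast
  qed
  \<comment> \<open>The loss in passing from the given radii to an arbitrary \<open>R\<close>: the
    first of them beyond \<open>2 * R\<close> exceeds it by a factor of at most \<rho>, unless it is
    \<sigma> itself. The 2 comes from the comparison of \<open>q (2 * R)\<close> with
    \<open>p R\<close>.\<close>
  define E where "E = (2 * \<sigma> * \<rho>) powr (- \<kappa>)"
  have E: "0 < E" using lower by (simp add: E_def)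
  have plow: "c / C * E * R powr (- \<kappa>) \<le> p R" if R: "1 \<le> R" for R
  proof -
    obtain n where n: "2 * R \<le> \<sigma> * \<rho> ^ n" "0 < n \<longrightarrow> \<sigma> * \<rho> ^ (n - 1) < 2 * R" using large by blast
    have up: "\<sigma> * \<rho> ^ n \<le> 2 * \<sigma> * \<rho> * R"
    proof (cases "n = 0")
      case True
      have "1 \<le> \<rho> * R" using lower(3) R mult_mono[of 1 \<rho> 1 R] by simp
      then have "\<sigma> * 1 \<le> \<sigma> * (2 * (\<rho> * R))" using lower(2) by (intro mult_left_mono) auto
      then show ?thesis using True by (simp add: mult_ac)
    next
      case False
      then have "\<sigma> * \<rho> ^ n = \<rho> * (\<sigma> * \<rho> ^ (n - 1))" by (cases n) auto
      also have "\<dots> \<le> \<rho> * (2 * R)" using n False lower(3) by (intro mult_left_mono) auto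
      also have "\<dots> \<le> \<sigma> * (\<rho> * (2 * R))" using mult_right_mono[OF lower(2), of "\<rho> * (2 * R)"] lower(3) R by simp
      finally show ?thesis by (simp add: mult_ac)
    qed
    have "c * (E * R powr (- \<kappa>)) = c * (2 * \<sigma> * \<rho> * R) powr (- \<kappa>)"
      using R lower by (simp add: E_def powr_mult)
    also have "\<dots> \<le> c * (\<sigma> * \<rho> ^ n) powr (- \<kappa>)"
      using up r1[of n] lower(1,5) by (intro mult_left_mono powr_mono2') auto
    also have "\<dots> \<le> p (\<sigma> * \<rho> ^ n)" by (rule lower)
    also have "\<dots> \<le> q (\<sigma> * \<rho> ^ n)" by (rule pq[OF r1])
    also have "\<dots> \<le> q (2 * R)" by (rule qanti) (use R n in auto)
    also have "\<dots> \<le> C * p R" by (rule C(2)[OF R])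
    finally show ?thesis using C(1) by (simp add: field_simps)
  qed
  have cE: "0 < c / C * E" using lower(1) C(1) E by simp
  show "\<exists>c>0. \<exists>D>0. \<forall>R\<ge>1. c * R powr (- D) \<le> p R"
    using cE lower(5) plow by blast
  have ppos: "0 < p R" if "1 \<le> R" for R
    using plow[OF that] cE that by (smt (verit, best) mult_pos_pos powr_gt_zero)
  have qpos: "0 < q R" if "1 \<le> R" for R using ppos[OF that] pq[OF that] by simp
  \<comment> \<open>\<open>a\<close> is superadditive; \<open>b\<close>, whose growth rate is
    wanted, lies between \<open>a x\<close> and \<open>a (x + ln 2) + ln C\<close>.\<close>
  define a where "a x = - ln (q (exp x))" for x
  define b where "b x = - ln (p (exp x))" for x
  have a0: "0 \<le> a x" if "0 \<le> x" for x
    using qpos[of "exp x"] q01[of "exp x"] that by (simp add: a_def)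
  have asup: "a x + a y \<le> a (x + y)" if "0 \<le> x" "0 \<le> y" for x y
  proof -
    have "ln (q (exp x * exp y)) \<le> ln (q (exp x) * q (exp y))"
      using that by (intro ln_mono sub mult_pos_pos qpos) (simp_all add: exp_add[symmetric])
    then show ?thesis using qpos[of "exp x"] qpos[of "exp y"] that by (simp add: a_def exp_add ln_mult)
  qed
  have amono: "a x \<le> a y" if "0 \<le> x" "x \<le> y" for x y
    using asup[of x "y - x"] a0[of "y - x"] that by simp
  have amult: "real n * a x \<le> a (real n * x)" if "0 \<le> x" for n x
  proof (induction n)
    case 0 then show ?case using a0[of 0] by simp
  next
    case (Suc n)
    have "real (Suc n) * a x = real n * a x + a x" by (simp add: algebra_simps)
    also have "\<dots> \<le> a (real n * x) + a x" using Suc by simp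
    also have "\<dots> \<le> a (real n * x + x)" by (rule asup) (use that in auto)
    finally show ?case by (simp add: algebra_simps)
  qed
  have alow: "(y / x - 1) * a x \<le> a y" if x: "0 < x" and y: "0 \<le> y" for x y
  proof -
    define n where "n = nat \<lfloor>y / x\<rfloor>"
    have n: "real n \<le> y / x" "y / x - 1 \<le> real n" using x y by (auto simp: n_def)
    have "(y / x - 1) * a x \<le> real n * a x" using n a0[of x] x by (intro mult_right_mono) auto
    also have "\<dots> \<le> a (real n * x)" using x by (intro amult) auto
    also have "\<dots> \<le> a y" using n(1) x by (intro amono) (auto simp: field_simps)
    finally show ?thesis .
  qed
  have ab: "a x \<le> b x" if "0 \<le> x" for x
    using pq[of "exp x"] ppos[of "exp x"] that by (simp add: a_def b_def)
  have ba: "b x \<le> a (x + ln 2) + ln C" if "0 \<le> x" for x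
  proof -
    have "ln (q (2 * exp x)) \<le> ln (C * p (exp x))"
      using that by (intro ln_mono C qpos) (auto intro: order_trans[of 1 "exp x"])
    moreover have "exp (x + ln 2) = 2 * exp x" by (simp add: exp_add)
    ultimately show ?thesis using ppos[of "exp x"] C(1) that by (simp add: a_def b_def ln_mult)
  qed
  \<comment> \<open>The hypothesis bounds \<open>b\<close> only along the given radii.
    Superadditivity, in the form \<open>alow\<close>, carries the resulting slope to every
    \<open>x\<close>.\<close>
  have aup: "a x \<le> \<kappa> * x" if x: "0 < x" for x
  proof -
    define y where "y n = ln (\<sigma> * \<rho> ^ n)" for n
    have yeq: "y n = ln \<sigma> + real n * ln \<rho>" for n using lower(2,3) by (simp add: y_def ln_mult ln_realpow)
    have y0: "0 \<le> y n" for n unfolding y_def using r1[of n] by simp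
    have ylim: "filterlim y at_top sequentially"
    proof -
      have "filterlim (\<lambda>n. real n * ln \<rho>) at_top sequentially"
        by (rule filterlim_at_top_mult_tendsto_pos[OF tendsto_const _ filterlim_real_sequentially]) (use lower(3) in simp)
      then have "filterlim (\<lambda>n. ln \<sigma> + real n * ln \<rho>) at_top sequentially"
        by (rule filterlim_tendsto_add_at_top[OF tendsto_const])
      then show ?thesis by (simp add: yeq[abs_def])
    qed
    have up: "(y n / x - 1) * a x \<le> \<kappa> * y n - ln c" for n
    proof -
      have ey: "exp (y n) = \<sigma> * \<rho> ^ n" using r1[of n] by (simp add: y_def)
      have "(y n / x - 1) * a x \<le> a (y n)" by (rule alow[OF x y0])
      also have "\<dots> \<le> b (y n)" by (rule ab[OF y0])
      also have "\<dots> \<le> - ln (c * (\<sigma> * \<rho> ^ n) powr (- \<kappa>))"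
        unfolding b_def ey using lower(1,3) r1[of n] by (intro le_imp_neg_le ln_mono lower(4) mult_pos_pos) auto
      also have "\<dots> = \<kappa> * y n - ln c"
        using lower(1,2,3) r1[of n] by (simp add: ln_mult ln_powr y_def algebra_simps)
      finally show ?thesis .
    qed
    have inv: "(\<lambda>n. inverse (y n)) \<longlonglongrightarrow> 0"
      by (rule tendsto_inverse_0_at_top[OF ylim])
    have ev: "\<forall>\<^sub>F n in sequentially. 0 < y n" using ylim by (rule eventually_compose_filterlim[OF eventually_gt_at_top])
    have "(\<lambda>n. (1 / x - inverse (y n)) * a x) \<longlonglongrightarrow> (1 / x - 0) * a x" by (intro tendsto_intros inv)
    moreover have "(\<lambda>n. \<kappa> - ln c * inverse (y n)) \<longlonglongrightarrow> \<kappa> - ln c * 0" by (intro tendsto_intros inv)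
    moreover have "\<forall>\<^sub>F n in sequentially. (1 / x - inverse (y n)) * a x \<le> \<kappa> - ln c * inverse (y n)"
      using ev
    proof eventually_elim
      fix n assume "0 < y n"
      then show "(1 / x - inverse (y n)) * a x \<le> \<kappa> - ln c * inverse (y n)"
        using mult_right_mono[OF up[of n], of "inverse (y n)"] by (simp add: field_simps)
    qed
    ultimately have "(1 / x - 0) * a x \<le> \<kappa> - ln c * 0"
      by (intro tendsto_le[OF sequentially_bot]) auto
    then show ?thesis using x by (simp add: field_simps)
  qed
  define l where "l = Sup ((\<lambda>x. a x / x) ` {0<..})"
  have bdd: "bdd_above ((\<lambda>x. a x / x) ` {0<..})"
    using aup by (intro bdd_aboveI[of _ \<kappa>]) (auto simp: divide_le_eq)
  have lup: "a x \<le> l * x" if "0 < x" for x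
  proof -
    have "a x / x \<le> l" unfolding l_def by (rule cSup_upper[OF _ bdd]) (use that in auto)
    then show ?thesis using that by (simp add: divide_le_eq)
  qed
  have lk: "l \<le> \<kappa>" unfolding l_def using aup by (intro cSup_least) (auto simp: divide_le_eq)
  have blim: "((\<lambda>x. b x / x) \<longlongrightarrow> l) at_top"
  proof (rule order_tendstoI)
    fix m assume m: "m < l"
    then obtain x where x: "0 < x" "m < a x / x"
      unfolding l_def by (subst (asm) less_cSup_iff[OF _ bdd]) auto
    have "((\<lambda>y. (1 / x - inverse y) * a x) \<longlongrightarrow> (1 / x - 0) * a x) at_top"
      by (intro tendsto_intros tendsto_inverse_0_at_top filterlim_ident)
    then have "\<forall>\<^sub>F y in at_top. m < (1 / x - inverse y) * a x"
      using x by (intro order_tendstoD(1)) auto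
    then show "\<forall>\<^sub>F y in at_top. m < b y / y"
      using eventually_gt_at_top[of 0]
    proof eventually_elim
      fix y :: real assume y: "m < (1 / x - inverse y) * a x" "0 < y"
      have "(1 / x - inverse y) * a x = (y / x - 1) * a x / y" using y x by (simp add: field_simps)
      also have "\<dots> \<le> b y / y"
        using alow[OF x(1), of y] ab[of y] y by (intro divide_right_mono) auto
      finally show "m < b y / y" using y by simp
    qed
  next
    fix m assume m: "l < m"
    have "((\<lambda>y. l + (l * ln 2 + ln C) * inverse y) \<longlongrightarrow> l + (l * ln 2 + ln C) * 0) at_top"
      by (intro tendsto_intros tendsto_inverse_0_at_top filterlim_ident)
    then have "\<forall>\<^sub>F y in at_top. l + (l * ln 2 + ln C) * inverse y < m"
      using m by (intro order_tendstoD(2)) auto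
    then show "\<forall>\<^sub>F y in at_top. b y / y < m"
      using eventually_gt_at_top[of 0]
    proof eventually_elim
      fix y :: real assume y: "l + (l * ln 2 + ln C) * inverse y < m" "0 < y"
      have "a (y + ln 2) \<le> l * (y + ln 2)" using y by (intro lup add_pos_pos) auto
      then have "b y / y \<le> (l * (y + ln 2) + ln C) / y"
        using ba[of y] y by (intro divide_right_mono) auto
      also have "\<dots> = l + (l * ln 2 + ln C) * inverse y" using y by (simp add: field_simps)
      finally show "b y / y < m" using y by simp
    qed
  qed
  have "((\<lambda>R. b (ln R) / ln R) \<longlongrightarrow> l) at_top"
    by (rule filterlim_compose[OF blim ln_at_top])
  then have "((\<lambda>R. - (b (ln R) / ln R)) \<longlongrightarrow> - l) at_top" by (rule tendsto_minus)
  moreover have "\<forall>\<^sub>F R in at_top. - (b (ln R) / ln R) = ln (p R) / ln R"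
    using eventually_gt_at_top[of 0] by eventually_elim (simp add: b_def)
  ultimately have "((\<lambda>R. ln (p R) / ln R) \<longlongrightarrow> - l) at_top" by (simp add: tendsto_cong)
  with lk show "\<exists>l\<le>\<kappa>. ((\<lambda>R. ln (p R) / ln R) \<longlongrightarrow> - l) at_top" by blast
qed

theorem nonintersection_exponent_le:
  assumes B: "independent_brownian_pair M B1 B2" and \<alpha>: "0 \<le> \<alpha>"
    and lower: "0 < c" "1 \<le> \<sigma>" "1 < \<rho>" "0 < \<kappa>"
      "\<And>n::nat. c * (\<sigma> * \<rho> ^ n) powr (- \<kappa>) \<le> nonintersection_prob M B1 B2 (circle_arc \<alpha>) (\<sigma> * \<rho> ^ n)"
  shows "nonintersection_exponent M B1 B2 (circle_arc \<alpha>) \<le> ereal \<kappa>"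
proof -
  interpret W: wiener M "\<lambda>t \<omega>. B1 t \<omega> - B1 0 \<omega>" \<alpha> by (rule nonintersection_prob_eq_QU(1)[OF B \<alpha>])
  let ?p = "nonintersection_prob M B1 B2 (circle_arc \<alpha>)"
  have pQU: "ennreal (?p R) = W.QU R" for R by (rule nonintersection_prob_eq_QU(2)[OF B \<alpha>])
  have p0: "0 \<le> ?p R" for R by (simp add: nonintersection_prob_def)
  have pe: "enn2real (W.QU R) = ?p R" for R unfolding pQU[symmetric] using p0 by simp
  obtain C where C: "0 < C" "\<And>S. 2 \<le> S \<Longrightarrow> W.q S \<le> C * ?p (S / 2)"
    using W.q_le_QU unfolding pe by blast
  have pq: "?p R \<le> W.q R" for R
    using W.QU_le_q[of R] unfolding pQU[symmetric] using W.q_bounds(1)[of R] by simp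
  have Cq: "W.q (2 * R) \<le> C * ?p R" if "1 \<le> R" for R using C(2)[of "2 * R"] that by simp
  note ex = exponent_exists[where p="?p" and q=W.q and C=C and c=c and \<sigma>=\<sigma> and \<rho>=\<rho> and \<kappa>=\<kappa>,
      OF W.q_bounds(2) W.q_submult pq C(1) Cq W.q_bounds(1) lower(1,2,3,5,4)]
  obtain l where l: "l \<le> \<kappa>" "((\<lambda>R. ln (?p R) / ln R) \<longlongrightarrow> - l) at_top" using ex(2) by blast
  have "Lim at_top (\<lambda>R. ln (?p R) / ln R) = - l" by (rule tendsto_Lim[OF _ l(2)]) simp
  then show ?thesis
    using ex(1) l(1) unfolding nonintersection_exponent_def by (auto simp: )
qed

section \<open>Staying in the support of a subharmonic function\<close>

text \<open>Outside the ball the density is at most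
  \<open>2 * exp (- \<eta>\<^sup>2 / (4 * s))\<close> times the density with variance
  \<open>2 * s\<close>. The exponential is weakened to the order \<open>s\<^sup>2\<close> because a
  bounded time interval contains of the order of \<open>1 / s\<close> steps and their total must
  still vanish.\<close>

lemma gauss_tail:
  assumes s: "0 < s" and \<eta>: "0 < \<eta>"
  shows "emeasure (gauss s) (- ball 0 \<eta>) \<le> ennreal (64 * s\<^sup>2 / \<eta> ^ 4)"
proof -
  interpret P: prob_space "gauss (2 * s)" by (rule prob_space_gauss) (use s in simp)
  define c where "c = 2 * exp (- \<eta>\<^sup>2 / (4 * s))"
  have [measurable]: "- ball (0::complex) \<eta> \<in> sets borel" by simp
  have "emeasure (gauss s) (- ball 0 \<eta>) = (\<integral>\<^sup>+z. ennreal (gauss_density s z) * indicator (- ball 0 \<eta>) z \<partial>lborel)"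
    unfolding gauss_def by (rule emeasure_density) simp_all
  also have "\<dots> \<le> (\<integral>\<^sup>+z. ennreal (gauss_density (2 * s) z) * ennreal c \<partial>lborel)"
  proof (rule nn_integral_mono)
    fix z :: complex
    show "ennreal (gauss_density s z) * indicator (- ball 0 \<eta>) z \<le> ennreal (gauss_density (2 * s) z) * ennreal c"
    proof (cases "\<eta> \<le> cmod z")
      case True
      then have "\<eta>\<^sup>2 \<le> (cmod z)\<^sup>2" using \<eta> by (intro power_mono) auto
      then have "- (cmod z)\<^sup>2 / (2 * s) \<le> - \<eta>\<^sup>2 / (4 * s) + - (cmod z)\<^sup>2 / (2 * (2 * s))"
        using s by (simp add: field_simps)
      then have "exp (- (cmod z)\<^sup>2 / (2 * s)) \<le> exp (- \<eta>\<^sup>2 / (4 * s)) * exp (- (cmod z)\<^sup>2 / (2 * (2 * s)))"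
        unfolding exp_add[symmetric] by simp
      then have "gauss_density s z \<le> gauss_density (2 * s) z * c"
        using s by (simp add: gauss_density_eq c_def field_simps)
      then have "ennreal (gauss_density s z) \<le> ennreal (gauss_density (2 * s) z * c)" by (rule ennreal_leI)
      also have "\<dots> = ennreal (gauss_density (2 * s) z) * ennreal c"
        by (rule ennreal_mult) (use s in \<open>simp_all add: gauss_density_eq c_def\<close>)
      finally show ?thesis using True by simp
    qed simp
  qed
  also have "\<dots> = ennreal c * (\<integral>\<^sup>+z. 1 \<partial>gauss (2 * s))"
    unfolding nn_integral_gauss[OF borel_measurable_const] by (subst nn_integral_multc) (simp_all add: mult.commute)
  also have "\<dots> = ennreal c" using P.emeasure_space_1 by simp
  also have "\<dots> \<le> ennreal (64 * s\<^sup>2 / \<eta> ^ 4)"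
  proof (rule ennreal_leI)
    define x where "x = \<eta>\<^sup>2 / (4 * s)"
    have x: "0 < x" using s \<eta> by (simp add: x_def)
    have "x\<^sup>2 / 2 \<le> exp x" using exp_lower_Taylor_quadratic[of x] x by simp
    then have "exp (- x) \<le> 2 / x\<^sup>2" using x by (simp add: exp_minus field_simps)
    moreover have "4 / x\<^sup>2 = 64 * s\<^sup>2 / \<eta> ^ 4" using s \<eta> by (simp add: x_def field_simps power2_eq_square power4_eq_xxxx)
    ultimately show "c \<le> 64 * s\<^sup>2 / \<eta> ^ 4" unfolding c_def x_def[symmetric] by (simp add: x_def[symmetric])
  qed
  finally show ?thesis .
qed

text \<open>By rotation invariance the Gaussian law is a mixture of circle averages. Only radii
  below \<eta> are covered by the hypothesis, hence the mass of the ball on the left; the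
  contribution of larger radii is dropped.\<close>

lemma gauss_submean:
  assumes f [measurable]: "f \<in> borel_measurable borel" and s: "0 < s"
    and sub: "\<And>\<rho>. 0 \<le> \<rho> \<Longrightarrow> \<rho> < \<eta> \<Longrightarrow> f z \<le> (\<integral>\<^sup>+u. f (z + u * complex_of_real \<rho>) \<partial>uniform_unit_circle)"
  shows "f z * emeasure (gauss s) (ball 0 \<eta>) \<le> (\<integral>\<^sup>+y. f (z + y) \<partial>gauss s)"
proof -
  let ?U = uniform_unit_circle
  interpret U: prob_space ?U by (rule prob_space_circle)
  interpret G: prob_space "gauss s" by (rule prob_space_gauss[OF s])
  interpret P: pair_sigma_finite "gauss s" ?U ..
  have im [measurable]: "(\<lambda>w. indicator (ball (0::complex) \<eta>) w :: ennreal) \<in> borel_measurable borel"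
    by (auto intro!: borel_measurable_indicator)
  have "f z * emeasure (gauss s) (ball 0 \<eta>) = (\<integral>\<^sup>+w. f z * indicator (ball 0 \<eta>) w \<partial>gauss s)"
    by (subst nn_integral_cmult) simp_all
  also have "\<dots> \<le> (\<integral>\<^sup>+w. (\<integral>\<^sup>+u. indicator (ball 0 \<eta>) w * f (z + u * w) \<partial>?U) \<partial>gauss s)"
  proof (rule nn_integral_mono)
    fix w :: complex
    show "f z * indicator (ball 0 \<eta>) w \<le> (\<integral>\<^sup>+u. indicator (ball 0 \<eta>) w * f (z + u * w) \<partial>?U)"
    proof (cases "w \<in> ball 0 \<eta>")
      case True
      then have w: "cmod w < \<eta>" by simp
      obtain v where v: "cmod v = 1" "w = v * complex_of_real (cmod w)"
      proof (cases "w = 0")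
        case True then show ?thesis by (intro that[of 1]) auto
      next
        case False then show ?thesis by (intro that[of "w / complex_of_real (cmod w)"]) (auto simp: norm_divide)
      qed
      have "f z \<le> (\<integral>\<^sup>+u. f (z + u * complex_of_real (cmod w)) \<partial>?U)" by (rule sub) (use w in auto)
      also have "\<dots> = (\<integral>\<^sup>+u. (\<lambda>y. f (z + y * complex_of_real (cmod w))) (v * u) \<partial>?U)"
        by (rule nn_integral_circle_rotate[OF _ v(1), symmetric]) measurable
      also have "\<dots> = (\<integral>\<^sup>+u. f (z + u * w) \<partial>?U)"
      proof -
        have "v * u * complex_of_real (cmod w) = u * w" for u by (subst (2) v(2)) (simp add: mult_ac)
        then show ?thesis by (simp only:)
      qed
      finally show ?thesis using True by simp
    qed simp
  qed
  also have "\<dots> = (\<integral>\<^sup>+u. (\<integral>\<^sup>+w. indicator (ball 0 \<eta>) w * f (z + u * w) \<partial>gauss s) \<partial>?U)"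
    by (rule P.Fubini'[symmetric]) measurable
  also have "\<dots> = (\<integral>\<^sup>+u. (\<integral>\<^sup>+w. indicator (ball 0 \<eta>) w * f (z + w) \<partial>gauss s) \<partial>?U)"
  proof (rule nn_integral_cong_AE)
    show "AE u in ?U. (\<integral>\<^sup>+w. indicator (ball 0 \<eta>) w * f (z + u * w) \<partial>gauss s) = (\<integral>\<^sup>+w. indicator (ball 0 \<eta>) w * f (z + w) \<partial>gauss s)"
      using AE_circle
    proof eventually_elim
      fix u :: complex assume u: "cmod u = 1"
      have "(\<integral>\<^sup>+w. (\<lambda>y. indicator (ball 0 \<eta>) y * f (z + y)) (u * w) \<partial>gauss s) = (\<integral>\<^sup>+w. indicator (ball 0 \<eta>) w * f (z + w) \<partial>gauss s)"
        by (rule nn_integral_gauss_rotate[OF _ s u]) measurable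
      moreover have "indicator (ball 0 \<eta>) (u * w) = (indicator (ball 0 \<eta>) w :: ennreal)" for w
        using u by (simp add: indicator_def norm_mult)
      ultimately show "(\<integral>\<^sup>+w. indicator (ball 0 \<eta>) w * f (z + u * w) \<partial>gauss s) = (\<integral>\<^sup>+w. indicator (ball 0 \<eta>) w * f (z + w) \<partial>gauss s)"
        by simp
    qed
  qed
  also have "\<dots> = (\<integral>\<^sup>+w. indicator (ball 0 \<eta>) w * f (z + w) \<partial>gauss s)"
    using U.emeasure_space_1 by simp
  also have "\<dots> \<le> (\<integral>\<^sup>+w. f (z + w) \<partial>gauss s)"
    by (rule nn_integral_mono) (simp add: indicator_def)
  finally show ?thesis .
qed

lemma exit_chain_bound:
  fixes f :: "complex \<Rightarrow> ennreal"
  assumes W: "brownian_process M W" and W0: "\<And>x. x \<in> space M \<Longrightarrow> W 0 x = 0"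
    and f [measurable]: "f \<in> borel_measurable borel" and G [measurable]: "G \<in> sets borel" and z: "z \<in> G" and GR: "G \<subseteq> ball 0 R"
    and s: "0 < s" and V: "\<And>z. f z \<le> V"
    and sub: "\<And>z \<rho>. z \<in> G \<Longrightarrow> 0 \<le> \<rho> \<Longrightarrow> \<rho> < \<eta> \<Longrightarrow> f z \<le> (\<integral>\<^sup>+u. f (z + u * complex_of_real \<rho>) \<partial>uniform_unit_circle)"
    and out: "\<And>z. z \<notin> G \<Longrightarrow> f z \<le> m \<or> R \<le> cmod z" and K: "\<And>z. R \<le> cmod z \<Longrightarrow> f z \<le> K"
    and n: "0 < n"
  defines "E \<equiv> {x\<in>space M. \<exists>k\<le>n. (\<forall>i<k. z + W (real i * s) x \<in> G) \<and> R \<le> cmod (z + W (real k * s) x)}"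
  shows "E \<in> sets M"
    and "f z \<le> V * emeasure (gauss (real n * s)) (ball (- z) R) + m + K * emeasure M E + of_nat n * (V * emeasure (gauss s) (- ball 0 \<eta>))"
proof -
  interpret prob_space M by (rule brownian_processD[OF W])
  interpret GS: prob_space "gauss s" by (rule prob_space_gauss[OF s])
  define Z where "Z k x = z + W (real k * s) x" for k :: nat and x
  have Wm: "W t \<in> borel_measurable M" if "0 \<le> t" for t by (rule brownian_processD(2)[OF W that])
  have Zm [measurable]: "Z k \<in> borel_measurable M" for k
    unfolding Z_def using Wm[of "real k * s"] s by simp
  have Z0: "Z 0 x = z" if "x \<in> space M" for x using W0[OF that] by (simp add: Z_def)
  have E_eq: "E = {x\<in>space M. \<exists>k\<le>n. (\<forall>i<k. Z i x \<in> G) \<and> R \<le> cmod (Z k x)}"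
    by (simp add: E_def Z_def)
  show Em: "E \<in> sets M" unfolding E_eq by measurable
  let ?ind = "\<lambda>k x. indicator {x. \<forall>i\<le>k. Z i x \<in> G} x :: ennreal"
  define b where "b k = (\<integral>\<^sup>+x. ?ind k x * f (Z k x) \<partial>M)" for k
  define e where "e k = (\<integral>\<^sup>+x. indicator {x. (\<forall>i<k. Z i x \<in> G) \<and> Z k x \<notin> G} x * f (Z k x) \<partial>M)" for k
  define \<tau> where "\<tau> = emeasure (gauss s) (- ball 0 \<eta>)"
  have ind_m [measurable]: "(\<lambda>x. ?ind k x) \<in> borel_measurable M" for k
  proof -
    have "(indicator {x\<in>space M. \<forall>i\<le>k. Z i x \<in> G} :: _ \<Rightarrow> ennreal) \<in> borel_measurable M" by measurable
    then show ?thesis by (rule measurable_cong[THEN iffD1, rotated]) (simp add: indicator_def)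
  qed
  have ind'_m [measurable]: "(\<lambda>x. indicator {x. (\<forall>i<k. Z i x \<in> G) \<and> Z k x \<notin> G} x :: ennreal) \<in> borel_measurable M" for k
  proof -
    have "(indicator {x\<in>space M. (\<forall>i<k. Z i x \<in> G) \<and> Z k x \<notin> G} :: _ \<Rightarrow> ennreal) \<in> borel_measurable M" by measurable
    then show ?thesis by (rule measurable_cong[THEN iffD1, rotated]) (simp add: indicator_def)
  qed
  have total: "emeasure (gauss s) (ball 0 \<eta>) + \<tau> = 1"
  proof -
    have "emeasure (gauss s) (ball 0 \<eta>) + \<tau> = emeasure (gauss s) (ball 0 \<eta> \<union> - ball 0 \<eta>)"
      unfolding \<tau>_def by (rule plus_emeasure) auto
    then show ?thesis using GS.emeasure_space_1 by simp
  qed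
  have markov: "(\<integral>\<^sup>+x. ?ind k x * f (Z (Suc k) x) \<partial>M) = (\<integral>\<^sup>+x. ?ind k x * (\<integral>\<^sup>+y. f (Z k x + y) \<partial>gauss s) \<partial>M)" for k
  proof -
    let ?J = "(\<lambda>i. real i * s) ` {..k}"
    let ?\<Phi> = "indicator {w\<in>space (PiM ?J (\<lambda>_. borel)). \<forall>i\<in>{..k}. z + w (real i * s) \<in> G} :: (real \<Rightarrow> complex) \<Rightarrow> ennreal"
    have J: "finite ?J" "?J \<subseteq> {0..real k * s}" using s by (auto intro: mult_right_mono)
    have "{w\<in>space (PiM ?J (\<lambda>_. borel)). \<forall>i\<in>{..k}. z + w (real i * s) \<in> G} \<in> sets (PiM ?J (\<lambda>_. borel))"
    proof (rule sets.sets_Collect_finite_All')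
      fix i assume "i \<in> {..k}"
      then have [measurable]: "(\<lambda>w. w (real i * s)) \<in> borel_measurable (PiM ?J (\<lambda>_. borel :: complex measure))"
        by (intro measurable_component_singleton) auto
      show "{w\<in>space (PiM ?J (\<lambda>_. borel)). z + w (real i * s) \<in> G} \<in> sets (PiM ?J (\<lambda>_. borel))" by measurable
    qed auto
    then have \<Phi>: "?\<Phi> \<in> borel_measurable (PiM ?J (\<lambda>_. borel))" by simp
    have \<Phi>_eq: "?\<Phi> (\<lambda>i\<in>?J. W i x) = ?ind k x" for x
      by (auto simp: indicator_def Z_def space_PiM)
    have "(\<integral>\<^sup>+x. ?\<Phi> (\<lambda>i\<in>?J. W i x) * f (z + W (real (Suc k) * s) x) \<partial>M) =
        (\<integral>\<^sup>+x. ?\<Phi> (\<lambda>i\<in>?J. W i x) * (\<integral>\<^sup>+y. f (z + (W (real k * s) x + y)) \<partial>gauss (real (Suc k) * s - real k * s)) \<partial>M)"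
      by (rule brownian_processD(4)[OF W, where g="\<lambda>y. f (z + y)", OF _ _ J \<Phi>]) (use s in auto)
    moreover have "real (Suc k) * s - real k * s = s" by (simp add: algebra_simps)
    ultimately show ?thesis unfolding \<Phi>_eq by (simp add: Z_def add.assoc)
  qed
  \<comment> \<open>\<open>b\<close> is the mean of \<open>f\<close> while the walk has stayed in
    \<open>G\<close>, and \<open>e\<close> is the contribution of a first exit at the given step.
    The deficit of the submean inequality is charged to \<open>V * \<tau>\<close> in each
    step.\<close>
  have step: "b k \<le> b (Suc k) + e (Suc k) + V * \<tau>" for k
  proof -
    have "b k = b k * emeasure (gauss s) (ball 0 \<eta>) + b k * \<tau>"
      using total by (simp add: distrib_left[symmetric])
    also have "b k * emeasure (gauss s) (ball 0 \<eta>) \<le> b (Suc k) + e (Suc k)"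
    proof -
      have "b k * emeasure (gauss s) (ball 0 \<eta>) = (\<integral>\<^sup>+x. ?ind k x * f (Z k x) * emeasure (gauss s) (ball 0 \<eta>) \<partial>M)"
        unfolding b_def by (rule nn_integral_multc[symmetric]) measurable
      also have "\<dots> \<le> (\<integral>\<^sup>+x. ?ind k x * (\<integral>\<^sup>+y. f (Z k x + y) \<partial>gauss s) \<partial>M)"
      proof (rule nn_integral_mono)
        fix x assume x: "x \<in> space M"
        show "?ind k x * f (Z k x) * emeasure (gauss s) (ball 0 \<eta>) \<le> ?ind k x * (\<integral>\<^sup>+y. f (Z k x + y) \<partial>gauss s)"
        proof (cases "\<forall>i\<le>k. Z i x \<in> G")
          case True
          then have "Z k x \<in> G" by simp
          from gauss_submean[OF f s sub[OF this]] True show ?thesis by simp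
        qed simp
      qed
      also have "\<dots> = (\<integral>\<^sup>+x. ?ind k x * f (Z (Suc k) x) \<partial>M)" by (rule markov[symmetric])
      also have "\<dots> = (\<integral>\<^sup>+x. ?ind (Suc k) x * f (Z (Suc k) x) + indicator {x. (\<forall>i<Suc k. Z i x \<in> G) \<and> Z (Suc k) x \<notin> G} x * f (Z (Suc k) x) \<partial>M)"
        by (rule nn_integral_cong) (auto simp: indicator_def le_Suc_eq less_Suc_eq_le)
      also have "\<dots> = b (Suc k) + e (Suc k)"
        unfolding b_def e_def by (rule nn_integral_add) measurable
      finally show ?thesis .
    qed
    also have "b k \<le> V"
    proof -
      have "b k \<le> (\<integral>\<^sup>+x. V \<partial>M)" unfolding b_def by (rule nn_integral_mono) (simp add: indicator_def V)
      then show ?thesis using emeasure_space_1 by simp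
    qed
    finally show ?thesis by (simp add: mult_right_mono add_left_mono)
  qed
  have iter: "f z \<le> b k + (\<Sum>j=1..k. e j) + of_nat k * (V * \<tau>)" for k
  proof (induction k)
    case 0
    have "b 0 = (\<integral>\<^sup>+x. f z \<partial>M)" unfolding b_def
      by (rule nn_integral_cong) (simp add: Z0 z)
    then show ?case using emeasure_space_1 by simp
  next
    case (Suc k)
    have "f z \<le> b (Suc k) + e (Suc k) + V * \<tau> + (\<Sum>j=1..k. e j) + of_nat k * (V * \<tau>)"
      using Suc step[of k] by (meson add_right_mono order_trans)
    then show ?case by (simp add: distrib_right add_ac)
  qed
  have "b n \<le> V * emeasure (gauss (real n * s)) (ball (- z) R)"
  proof -
    have "b n \<le> (\<integral>\<^sup>+x. V * indicator (ball (- z) R) (W (real n * s) x) \<partial>M)"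
      unfolding b_def
    proof (rule nn_integral_mono)
      fix x assume x: "x \<in> space M"
      have "W (real n * s) x \<in> ball (- z) R" if "Z n x \<in> G"
        using that GR by (auto simp: Z_def dist_norm norm_minus_commute)
      then show "?ind n x * f (Z n x) \<le> V * indicator (ball (- z) R) (W (real n * s) x)"
        by (auto simp: indicator_def V)
    qed
    also have "\<dots> = (\<integral>\<^sup>+y. V * indicator (ball (- z) R) y \<partial>gauss (real n * s))"
      by (rule brownian_process_gauss[OF W W0]) (use n s in \<open>auto intro!: borel_measurable_times_ennreal borel_measurable_indicator\<close>)
    also have "\<dots> = V * emeasure (gauss (real n * s)) (ball (- z) R)"
      by (subst nn_integral_cmult) (auto intro!: borel_measurable_indicator)
    finally show ?thesis .
  qed
  moreover have "(\<Sum>j=1..n. e j) \<le> m + K * emeasure M E"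
  proof -
    have "(\<Sum>j=1..n. e j) = (\<integral>\<^sup>+x. (\<Sum>j=1..n. indicator {x. (\<forall>i<j. Z i x \<in> G) \<and> Z j x \<notin> G} x * f (Z j x)) \<partial>M)"
      unfolding e_def by (rule nn_integral_sum[symmetric]) measurable
    also have "\<dots> \<le> (\<integral>\<^sup>+x. m + K * indicator E x \<partial>M)"
    proof (rule nn_integral_mono)
      fix x assume x: "x \<in> space M"
      show "(\<Sum>j=1..n. indicator {x. (\<forall>i<j. Z i x \<in> G) \<and> Z j x \<notin> G} x * f (Z j x)) \<le> m + K * indicator E x"
      proof (cases "\<exists>j\<in>{1..n}. (\<forall>i<j. Z i x \<in> G) \<and> Z j x \<notin> G")
        case True
        then obtain j where j: "j \<in> {1..n}" "\<forall>i<j. Z i x \<in> G" "Z j x \<notin> G" by blast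
        \<comment> \<open>At most one term of the sum is nonzero, the one of the first exit.\<close>
        have uniq: "j' = j" if "(\<forall>i<j'. Z i x \<in> G) \<and> Z j' x \<notin> G" for j'
          using that j by (meson linorder_neqE_nat)
        have "(\<Sum>j=1..n. indicator {x. (\<forall>i<j. Z i x \<in> G) \<and> Z j x \<notin> G} x * f (Z j x)) =
            (\<Sum>j'=1..n. if j' = j then f (Z j x) else 0)"
        proof (rule sum.cong[OF refl])
          fix j' show "indicator {x. (\<forall>i<j'. Z i x \<in> G) \<and> Z j' x \<notin> G} x * f (Z j' x) = (if j' = j then f (Z j x) else 0)"
          proof (cases "j' = j")
            case True then show ?thesis using j(2,3) by simp
          next
            case False
            with uniq[of j'] have "\<not> ((\<forall>i<j'. Z i x \<in> G) \<and> Z j' x \<notin> G)" by (rule contrapos_nn[rotated])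
            then have "x \<notin> {x. (\<forall>i<j'. Z i x \<in> G) \<and> Z j' x \<notin> G}" by (simp only: mem_Collect_eq not_False_eq_True)
            then show ?thesis using False by (simp only: indicator_simps(2) mult_zero_left if_False not_False_eq_True)
          qed
        qed
        also have "\<dots> = f (Z j x)" using j by simp
        also have "\<dots> \<le> m + K * indicator E x"
        proof (cases "R \<le> cmod (Z j x)")
          case True
          then have "x \<in> E" unfolding E_eq using j x by auto
          then show ?thesis using K[OF True] by (simp add: add_increasing)
        next
          case False
          then show ?thesis using out[OF j(3)] by (auto intro: add_increasing2)
        qed
        finally show ?thesis .
      next
        case False
        then have "(\<Sum>j=1..n. indicator {x. (\<forall>i<j. Z i x \<in> G) \<and> Z j x \<notin> G} x * f (Z j x)) = 0"
          by (intro sum.neutral) (auto simp: indicator_def)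
        then show ?thesis by simp
      qed
    qed
    also have "\<dots> = m + K * emeasure M E"
      using Em emeasure_space_1 by (simp add: nn_integral_add nn_integral_cmult)
    finally show ?thesis .
  qed
  ultimately have "b n + (\<Sum>j=1..n. e j) + of_nat n * (V * \<tau>) \<le> V * emeasure (gauss (real n * s)) (ball (- z) R) + (m + K * emeasure M E) + of_nat n * (V * \<tau>)"
    by (intro add_mono order_refl)
  from order_trans[OF iter this] show "f z \<le> V * emeasure (gauss (real n * s)) (ball (- z) R) + m + K * emeasure M E + of_nat n * (V * emeasure (gauss s) (- ball 0 \<eta>))"
    unfolding \<tau>_def by (simp only: add.assoc)
qed

text \<open>A nonnegative function that is subharmonic on its support: optional stopping for the walk on a
  fine time grid bounds from below the probability that the path leaves the support only through the
  outer circle.\<close>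

lemma trace_in_closure_prob:
  fixes v :: "complex \<Rightarrow> real"
  assumes W: "brownian_process M W" and W0: "\<And>x. x \<in> space M \<Longrightarrow> W 0 x = 0"
    and v: "v \<in> borel_measurable borel" "\<And>z. 0 \<le> v z" "\<And>z. v z \<le> V" and G: "G \<in> sets borel" and z: "z \<in> G" and GR: "G \<subseteq> ball 0 R"
    and \<eta>: "0 < \<eta>"
    and sub: "\<And>z \<rho>. z \<in> G \<Longrightarrow> 0 \<le> \<rho> \<Longrightarrow> \<rho> < \<eta> \<Longrightarrow> ennreal (v z) \<le> (\<integral>\<^sup>+u. ennreal (v (z + u * complex_of_real \<rho>)) \<partial>uniform_unit_circle)"
    and out: "\<And>z. z \<notin> G \<Longrightarrow> v z \<le> m \<or> R \<le> cmod z" and K: "\<And>z. R \<le> cmod z \<Longrightarrow> v z \<le> K" and m: "0 \<le> m"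
  shows "\<exists>A\<in>sets M. (\<forall>x\<in>A. trace_until R (\<lambda>t. z + W t x) \<subseteq> closure G) \<and> v z \<le> m + K * measure M A"
proof -
  interpret prob_space M by (rule brownian_processD[OF W])
  have R: "0 < R" using subsetD[OF GR z] norm_ge_zero[of z] unfolding mem_ball_0 by linarith
  have V0: "0 \<le> V" and K0: "0 \<le> K" using v(2,3)[of 0] v(2)[of "complex_of_real R"] K[of "complex_of_real R"] R by auto
  define E where "E t N = {x\<in>space M. \<exists>k\<le>t * N. (\<forall>i<k. z + W (real i * (1 / real N)) x \<in> G) \<and> R \<le> cmod (z + W (real k * (1 / real N)) x)}" for t N :: nat
  have Em: "E (Suc t) (Suc N) \<in> sets M" for t N
    unfolding E_def by (rule exit_chain_bound(1)[OF W W0 _ G z GR _ ennreal_leI[OF v(3)] sub, where m="ennreal m" and K="ennreal K"])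
      (use v K out in \<open>auto intro!: ennreal_leI\<close>)
  have collect: "ennreal V' * (ennreal a * ennreal l) + ennreal m' + ennreal K' * ennreal p + ennreal r * (ennreal V' * ennreal y) =
      ennreal (V' * (a * l) + m' + K' * p + r * (V' * y))"
    if "0 \<le> V'" "0 \<le> a" "0 \<le> l" "0 \<le> m'" "0 \<le> K'" "0 \<le> p" "0 \<le> r" "0 \<le> y" for V' a l m' K' p r y
    using that by (simp add: ennreal_mult)
  define C where "C = V * (measure lborel (ball (- z) R) / (2 * pi))"
  have chain: "v z \<le> C / real (Suc t) + m + K * measure M (E (Suc t) (Suc N)) + (64 * V * real (Suc t) / \<eta> ^ 4) * (1 / real (Suc N))" for t N
  proof -
    let ?s = "1 / real (Suc N)" and ?n = "Suc t * Suc N"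
    have ns: "real ?n * ?s = real (Suc t)" by (simp del: of_nat_Suc mult_Suc mult_Suc_right)
    have "ennreal (v z) \<le> ennreal V * emeasure (gauss (real ?n * ?s)) (ball (- z) R) + ennreal m + ennreal K * emeasure M (E (Suc t) (Suc N))
        + of_nat ?n * (ennreal V * emeasure (gauss ?s) (- ball 0 \<eta>))"
      unfolding E_def by (rule exit_chain_bound(2)[OF W W0 _ G z GR _ ennreal_leI[OF v(3)] sub])
        (use v K out in \<open>auto intro!: ennreal_leI\<close>)
    also have "\<dots> \<le> ennreal V * (ennreal (1 / (2 * pi * real (Suc t))) * emeasure lborel (ball (- z) R)) + ennreal m + ennreal K * emeasure M (E (Suc t) (Suc N))
        + of_nat ?n * (ennreal V * ennreal (64 * ?s\<^sup>2 / \<eta> ^ 4))"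
      unfolding ns by (intro add_mono mult_left_mono order_refl gauss_tail emeasure_gauss_ball_le \<eta>) simp_all
    also have "\<dots> = ennreal (V * (1 / (2 * pi * real (Suc t)) * measure lborel (ball (- z) R)) + m + K * measure M (E (Suc t) (Suc N)) + real ?n * (V * (64 * ?s\<^sup>2 / \<eta> ^ 4)))"
    proof -
      have "emeasure lborel (ball (- z) R) = ennreal (measure lborel (ball (- z) R))"
        using emeasure_lborel_ball_finite[of "- z" R] by (intro emeasure_eq_ennreal_measure) auto
      moreover have "(of_nat ?n :: ennreal) = ennreal (real ?n)" by (simp add: ennreal_of_nat_eq_real_of_nat)
      ultimately show ?thesis
        by (simp only: emeasure_eq_measure) (rule collect, use V0 K0 m \<eta> in simp_all)
    qed
    finally have "v z \<le> V * (1 / (2 * pi * real (Suc t)) * measure lborel (ball (- z) R)) + m + K * measure M (E (Suc t) (Suc N)) + real ?n * (V * (64 * ?s\<^sup>2 / \<eta> ^ 4))"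
      using V0 K0 m \<eta> by (subst (asm) ennreal_le_iff) (auto intro!: add_nonneg_nonneg mult_nonneg_nonneg)
    also have "V * (1 / (2 * pi * real (Suc t)) * measure lborel (ball (- z) R)) = C / real (Suc t)" by (simp add: C_def)
    also have "real ?n * (V * (64 * ?s\<^sup>2 / \<eta> ^ 4)) = (64 * V * real (Suc t) / \<eta> ^ 4) * (1 / real (Suc N))"
    proof -
      have "real ?n = real (Suc t) * real (Suc N)" by (rule of_nat_mult)
      then show ?thesis by (simp add: power2_eq_square mult_ac del: of_nat_Suc mult_Suc mult_Suc_right)
    qed
    finally show ?thesis .
  qed
  \<comment> \<open>\<open>A\<close> says that for some horizon \<open>t\<close> there are
    arbitrarily fine meshes for which the grid walk stays in \<open>G\<close> until it reaches
    radius \<open>R\<close>. The mesh tends to 0 at a fixed horizon, which removes the long steps;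
    then the horizon grows, which removes the walks that do not leave.\<close>
  define F where "F t n = (\<Union>N\<in>{n..}. E (Suc t) (Suc N))" for t n
  define A where "A = (\<Union>t. \<Inter>n. F t n)"
  have Fm: "F t n \<in> sets M" for t n unfolding F_def using Em by auto
  have Am: "A \<in> sets M" unfolding A_def using Fm by auto
  have lim1: "(\<lambda>N. 1 / real (Suc N)) \<longlonglongrightarrow> 0" using LIMSEQ_inverse_real_of_nat by (simp add: inverse_eq_divide)
  have low1: "v z \<le> C / real (Suc t) + m + K * measure M (F t n)" for t n
  proof -
    have "(\<lambda>N. C / real (Suc t) + m + K * measure M (F t n) + (64 * V * real (Suc t) / \<eta> ^ 4) * (1 / real (Suc N)))
        \<longlonglongrightarrow> C / real (Suc t) + m + K * measure M (F t n) + (64 * V * real (Suc t) / \<eta> ^ 4) * 0"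
      by (intro tendsto_intros lim1)
    moreover have "v z \<le> C / real (Suc t) + m + K * measure M (F t n) + (64 * V * real (Suc t) / \<eta> ^ 4) * (1 / real (Suc N))" if "n \<le> N" for N
    proof -
      have "measure M (E (Suc t) (Suc N)) \<le> measure M (F t n)"
        by (rule finite_measure_mono[OF _ Fm]) (use that in \<open>auto simp: F_def\<close>)
      then have "K * measure M (E (Suc t) (Suc N)) \<le> K * measure M (F t n)" using K0 by (rule mult_left_mono)
      with chain[of t N] show ?thesis by linarith
    qed
    ultimately have "v z \<le> C / real (Suc t) + m + K * measure M (F t n) + (64 * V * real (Suc t) / \<eta> ^ 4) * 0"
      by (intro LIMSEQ_le_const[of _ _ "v z"] exI[of _ n]) blast+
    then show ?thesis by simp
  qed
  have low2: "v z \<le> C / real (Suc t) + m + K * measure M (\<Inter>n. F t n)" for t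
  proof -
    have "decseq (F t)" unfolding F_def by (intro decseq_SucI UN_mono) auto
    then have "(\<lambda>n. measure M (F t n)) \<longlonglongrightarrow> measure M (\<Inter>n. F t n)"
      using Fm by (intro finite_Lim_measure_decseq) auto
    then have "(\<lambda>n. C / real (Suc t) + m + K * measure M (F t n)) \<longlonglongrightarrow> C / real (Suc t) + m + K * measure M (\<Inter>n. F t n)"
      by (intro tendsto_intros)
    then show ?thesis by (rule LIMSEQ_le_const) (use low1 in blast)
  qed
  have "v z \<le> 0 + m + K * measure M A"
  proof (rule LIMSEQ_le_const)
    have "(\<lambda>t. C * (1 / real (Suc t)) + m + K * measure M A) \<longlonglongrightarrow> C * 0 + m + K * measure M A" by (intro tendsto_intros lim1)
    then show "(\<lambda>t. C / real (Suc t) + m + K * measure M A) \<longlonglongrightarrow> 0 + m + K * measure M A" by simp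
    have "measure M (\<Inter>n. F t n) \<le> measure M A" for t
      by (rule finite_measure_mono[OF _ Am]) (auto simp: A_def)
    then have "v z \<le> C / real (Suc t) + m + K * measure M A" for t
      using low2[of t] mult_left_mono[OF _ K0, of "measure M (\<Inter>n. F t n)" "measure M A"] by fastforce
    then show "\<exists>N. \<forall>t\<ge>N. v z \<le> C / real (Suc t) + m + K * measure M A" by blast
  qed
  moreover have "trace_until R (\<lambda>t. z + W t x) \<subseteq> closure G" if xA: "x \<in> A" for x
  proof
    define Y where "Y t = z + W t x" for t
    obtain t where xF: "\<And>n. x \<in> F t n" using xA by (auto simp: A_def)
    then have xM: "x \<in> space M" using sets.sets_into_space[OF Fm] by blast
    have Yc: "continuous_on {0..} Y" unfolding Y_def
      by (intro continuous_intros brownian_processD(3)[OF W xM])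
    have Y0: "Y 0 = z" using W0[OF xM] by (simp add: Y_def)
    have near: "\<exists>\<delta>>0. \<forall>s'\<ge>0. \<bar>s' - s\<bar> < \<delta> \<longrightarrow> dist (Y s') (Y s) < \<epsilon>" if "0 \<le> s" "0 < \<epsilon>" for s \<epsilon>
      using Yc[unfolded continuous_on_iff dist_real_def, rule_format, of s \<epsilon>] that by (simp only: atLeast_iff) blast
    fix w assume "w \<in> trace_until R (\<lambda>t. z + W t x)"
    then obtain \<tau> where \<tau>: "0 \<le> \<tau>" "w = Y \<tau>" "\<And>s. 0 \<le> s \<Longrightarrow> s < \<tau> \<Longrightarrow> cmod (Y s) \<noteq> R"
      unfolding trace_until_def Y_def by blast
    have less: "cmod (Y s) < R" if s: "0 \<le> s" "s < \<tau>" for s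
    proof (rule ccontr)
      assume "\<not> cmod (Y s) < R"
      moreover have "cmod (Y 0) \<le> R" using z GR Y0 by auto
      moreover have "continuous_on {0..s} (\<lambda>s. cmod (Y s))"
        by (intro continuous_on_norm continuous_on_subset[OF Yc]) auto
      ultimately obtain r where "0 \<le> r" "r \<le> s" "cmod (Y r) = R"
        using IVT'[of "\<lambda>s. cmod (Y s)" 0 R s] s by auto
      then show False using \<tau>(3)[of r] s by simp
    qed
    have before: "Y s \<in> closure G" if s: "0 \<le> s" "s < \<tau>" for s
      unfolding closure_approachable
    proof (intro allI impI)
      fix \<epsilon> :: real assume "0 < \<epsilon>"
      from near[OF s(1) this] obtain \<delta> where \<delta>: "0 < \<delta>" "\<And>s'. 0 \<le> s' \<Longrightarrow> \<bar>s' - s\<bar> < \<delta> \<Longrightarrow> dist (Y s') (Y s) < \<epsilon>" by blast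
      obtain n where n: "inverse (real (Suc n)) < \<delta>" using reals_Archimedean[OF \<delta>(1)] by blast
      from xF[of n] obtain N where N: "n \<le> N" "x \<in> E (Suc t) (Suc N)" by (auto simp: F_def)
      then obtain k where k: "\<forall>i<k. Y (real i * (1 / real (Suc N))) \<in> G" "R \<le> cmod (Y (real k * (1 / real (Suc N))))"
        unfolding E_def Y_def by blast
      \<comment> \<open>The last grid point up to \<open>s\<close>. It precedes \<tau>, hence also
        the grid time at which radius \<open>R\<close> has been reached, so it lies in
        \<open>G\<close>.\<close>
      define i where "i = nat \<lfloor>s * real (Suc N)\<rfloor>"
      have i: "real i \<le> s * real (Suc N)" "s * real (Suc N) < real i + 1"
        using s by (auto simp: i_def)
      have i1: "real i * (1 / real (Suc N)) \<le> s" using i(1) by (simp add: divide_le_eq)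
      have i2: "s < real i * (1 / real (Suc N)) + 1 / real (Suc N)"
        using i(2) by (simp add: less_divide_eq add_divide_distrib[symmetric])
      have "1 / real (Suc N) \<le> inverse (real (Suc n))" using N(1) by (simp add: field_simps)
      then have d: "\<bar>real i * (1 / real (Suc N)) - s\<bar> < \<delta>" using i1 i2 n by linarith
      have "\<tau> \<le> real k * (1 / real (Suc N))"
        using less[of "real k * (1 / real (Suc N))"] k(2) by (meson not_le mult_nonneg_nonneg of_nat_0_le_iff zero_le_divide_1_iff)
      then have "real i * (1 / real (Suc N)) < real k * (1 / real (Suc N))" using i1 s(2) by linarith
      then have "i < k" by (simp add: divide_less_cancel)
      then have "Y (real i * (1 / real (Suc N))) \<in> G" using k(1) by blast
      then show "\<exists>y\<in>G. dist y (Y s) < \<epsilon>" using \<delta>(2)[OF _ d] by (meson mult_nonneg_nonneg of_nat_0_le_iff zero_le_divide_1_iff)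
    qed
    \<comment> \<open>The final time is only a limit of times for which points of \<open>G\<close>
      on the grid were found.\<close>
    have "Y \<tau> \<in> closure (closure G)"
    proof (cases "\<tau> = 0")
      case True then show ?thesis using Y0 z by (simp add: closure_subset[THEN subsetD])
    next
      case False
      show ?thesis unfolding closure_approachable[of "Y \<tau>"]
      proof (intro allI impI)
        fix \<epsilon> :: real assume "0 < \<epsilon>"
        from near[OF \<tau>(1) this] obtain \<delta> where \<delta>: "0 < \<delta>" "\<And>s'. 0 \<le> s' \<Longrightarrow> \<bar>s' - \<tau>\<bar> < \<delta> \<Longrightarrow> dist (Y s') (Y \<tau>) < \<epsilon>" by blast
        define s where "s = max 0 (\<tau> - \<delta> / 2)"
        have "0 \<le> s" "s < \<tau>" "\<bar>s - \<tau>\<bar> < \<delta>" using \<delta>(1) \<tau>(1) False by (auto simp: s_def)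
        then show "\<exists>y\<in>closure G. dist y (Y \<tau>) < \<epsilon>" using before \<delta>(2) by blast
      qed
    qed
    then show "w \<in> closure G" using \<tau>(2) by simp
  qed
  ultimately show ?thesis using Am by (intro bexI[of _ A]) auto
qed

section \<open>The harmonic functions\<close>

text \<open>The argument of \<open>1 + exp (y + i t)\<close> for \<open>0 < t < pi\<close>, in a form convenient for differentiation.\<close>

definition arg_one_exp :: "real \<Rightarrow> real \<Rightarrow> real" where
  "arg_one_exp y t = pi / 2 - arctan ((exp (- y) + cos t) / sin t)"

lemma Im_Ln_one_exp:
  assumes t: "0 < t" "t < pi"
  shows "Im (Ln (1 + exp (Complex y t))) = arg_one_exp y t"
proof -
  define w where "w = 1 + exp (Complex y t)"
  have st: "0 < sin t" using t by (rule sin_gt_zero)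
  have re: "Re w = 1 + exp y * cos t" and im: "Im w = exp y * sin t"
    by (simp_all add: w_def Re_exp Im_exp)
  have im0: "0 < Im w" using st by (simp add: im)
  then have w0: "w \<noteq> 0" by auto
  define \<theta> where "\<theta> = Im (Ln w)"
  have \<theta>: "0 < \<theta>" "\<theta> < pi" unfolding \<theta>_def using im0 w0 by (simp_all add: Im_Ln_pos_lt_imp)
  have e: "w = exp (Ln w)" using w0 by simp
  have "Re w = exp (Re (Ln w)) * cos \<theta>" "Im w = exp (Re (Ln w)) * sin \<theta>"
    unfolding \<theta>_def by (metis e Re_exp, metis e Im_exp)
  then have "Re w / Im w = cos \<theta> / sin \<theta>" by simp
  also have "\<dots> = tan (pi / 2 - \<theta>)" by (simp add: tan_def cos_diff sin_diff)
  finally have "arctan (Re w / Im w) = pi / 2 - \<theta>" using \<theta> by (simp add: arctan_tan)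
  moreover have "Re w / Im w = (exp (- y) + cos t) / sin t"
    using st by (simp add: re im exp_minus field_simps)
  ultimately show ?thesis by (simp add: arg_one_exp_def \<theta>_def w_def)
qed

lemma arg_one_exp_mono:
  assumes "0 < t" "t < pi" "y \<le> y'"
  shows "arg_one_exp y t \<le> arg_one_exp y' t"
  unfolding arg_one_exp_def using assms sin_gt_zero[of t]
  by (intro diff_left_mono arctan_monotone' divide_right_mono) auto

lemma arg_one_exp_bounds:
  assumes t: "0 < t" "t < pi"
  shows "0 \<le> arg_one_exp y t" "arg_one_exp y t \<le> t"
proof -
  have st: "0 < sin t" using t by (rule sin_gt_zero)
  show "0 \<le> arg_one_exp y t" unfolding arg_one_exp_def using arctan_ubound[of "(exp (- y) + cos t) / sin t"] by simp
  have "pi / 2 - t = arctan (tan (pi / 2 - t))" using t by (subst arctan_tan) auto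
  also have "tan (pi / 2 - t) = cos t / sin t" by (simp add: tan_def cos_diff sin_diff)
  also have "arctan (cos t / sin t) \<le> arctan ((exp (- y) + cos t) / sin t)"
    using st by (intro arctan_monotone' divide_right_mono) auto
  finally show "arg_one_exp y t \<le> t" by (simp add: arg_one_exp_def)
qed

text \<open>From \<open>1 + exp w = exp w * (1 + exp (- w))\<close>: the arguments for
  \<open>y\<close> and \<open>- y\<close> add up to \<open>t\<close>. This turns the decay towards
  one end into the approach to \<open>t\<close> at the other.\<close>

lemma arg_one_exp_reflect:
  assumes t: "0 < t" "t < pi"
  shows "arg_one_exp y t = t - arg_one_exp (- y) t"
proof -
  let ?w = "Complex y t" and ?w' = "Complex (- y) t"
  have nz: "1 + exp (Complex x t) \<noteq> 0" for x
  proof -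
    have "0 < Im (1 + exp (Complex x t))" using t by (simp add: Im_exp sin_gt_zero)
    then show ?thesis by (metis less_irrefl zero_complex.simps(2))
  qed
  have "Ln (1 + exp ?w) = ?w + cnj (Ln (1 + exp ?w'))"
  proof (rule Ln_unique)
    have "exp (?w + cnj (Ln (1 + exp ?w'))) = exp ?w * (1 + exp (cnj ?w'))"
      unfolding exp_add exp_cnj[symmetric] using nz[of "- y"] by simp
    also have "\<dots> = exp ?w + exp (?w + cnj ?w')" by (simp add: distrib_left exp_add)
    also have "?w + cnj ?w' = 0" by (simp add: complex_eq_iff)
    finally show "exp (?w + cnj (Ln (1 + exp ?w'))) = 1 + exp ?w" by simp
  qed (use arg_one_exp_bounds[OF t, of "- y"] t in \<open>simp_all add: Im_Ln_one_exp\<close>)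
  then have "Im (Ln (1 + exp ?w)) = Im (?w + cnj (Ln (1 + exp ?w')))" by simp
  then show ?thesis using t by (simp add: Im_Ln_one_exp)
qed

lemma arg_one_exp_tail:
  assumes t: "0 < t" "t < pi" and y: "y < 0"
  shows "arg_one_exp y t \<le> 1 / (exp (- y) - 1)"
proof -
  let ?q = "(exp (- y) + cos t) / sin t"
  have st: "0 < sin t" using t by (rule sin_gt_zero)
  have e: "1 < exp (- y)" using y by simp
  have "exp (- y) - 1 \<le> (exp (- y) - 1) / sin t" using e st sin_le_one[of t] by (simp add: le_divide_eq mult_left_le)
  also have "\<dots> \<le> ?q" using st cos_ge_minus_one[of t] by (intro divide_right_mono) auto
  finally have q: "exp (- y) - 1 \<le> ?q" .
  then have q0: "0 < ?q" using e by linarith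
  have "arg_one_exp y t = arctan (1 / ?q)" unfolding arg_one_exp_def using arctan_inverse[of ?q] q0 by (simp add: sgn_1_pos)
  also have "\<dots> \<le> 1 / ?q" by (rule arctan_le_self) (use less_imp_le[OF q0] in \<open>simp only: zero_le_divide_1_iff\<close>)
  also have "\<dots> \<le> 1 / (exp (- y) - 1)" by (rule divide_left_mono[OF q]) (simp, rule mult_pos_pos[OF q0], use e in linarith)
  finally show ?thesis .
qed

text \<open>Measuring the distance of the derivative from \<open>1 / 2\<close> gives a sharper bound
  for differences: the derivative of a difference of two such functions is at most
  \<open>1 / sin t\<close> in absolute value. With \<open>\<rho> = exp (- y)\<close> and
  \<open>c = cos t\<close> the estimate comes down to the perfect square
  \<open>(c * (1 + \<rho>\<^sup>2) + 2 * \<rho>)\<^sup>2\<close>.\<close>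

lemma arg_one_exp_deriv:
  assumes t: "0 < t" "t < pi"
  shows "\<exists>d. (arg_one_exp y has_real_derivative d) (at t) \<and> \<bar>2 * d - 1\<bar> \<le> 1 / sin t"
proof -
  define \<rho> where "\<rho> = exp (- y)"
  define c where "c = cos t"
  define s where "s = sin t"
  have s: "0 < s" unfolding s_def using t by (rule sin_gt_zero)
  have sc: "s\<^sup>2 = 1 - c\<^sup>2" unfolding s_def c_def by (rule sin_squared_eq)
  have \<rho>: "0 < \<rho>" by (simp add: \<rho>_def)
  define N where "N = 1 + 2 * \<rho> * c + \<rho>\<^sup>2"
  have N_eq: "N = s\<^sup>2 + (\<rho> + c)\<^sup>2" unfolding N_def sc by (simp add: power2_eq_square algebra_simps)
  have N: "0 < N" unfolding N_eq using s by (simp add: add_pos_nonneg)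
  define d where "d = (1 + \<rho> * c) / N"
  have "((\<lambda>t. pi / 2 - arctan ((exp (- y) + cos t) / sin t)) has_real_derivative
      0 - inverse (1 + ((exp (- y) + cos t) / sin t)\<^sup>2) * ((- sin t * sin t - (exp (- y) + cos t) * cos t) / (sin t * sin t))) (at t)"
    using s by (auto intro!: derivative_eq_intros simp: s_def)
  moreover have "0 - inverse (1 + ((\<rho> + c) / s)\<^sup>2) * ((- s * s - (\<rho> + c) * c) / (s * s)) = d"
  proof -
    have 1: "1 + ((\<rho> + c) / s)\<^sup>2 = N / s\<^sup>2" using s by (simp add: N_eq field_simps)
    have 2: "- s * s - (\<rho> + c) * c = - (1 + \<rho> * c)" using sc by (simp add: power2_eq_square algebra_simps)
    show ?thesis unfolding 1 2 d_def using s N by (simp add: power2_eq_square field_simps)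
  qed
  ultimately have der: "(arg_one_exp y has_real_derivative d) (at t)"
    unfolding arg_one_exp_def[abs_def] \<rho>_def c_def s_def by simp
  have "2 * d - 1 = (1 - \<rho>\<^sup>2) / N" using N unfolding d_def N_def by (simp add: field_simps)
  moreover have "\<bar>1 - \<rho>\<^sup>2\<bar> * s \<le> N"
  proof (rule power2_le_imp_le)
    have "N\<^sup>2 - (\<bar>1 - \<rho>\<^sup>2\<bar> * s)\<^sup>2 = (c * (1 + \<rho>\<^sup>2) + 2 * \<rho>)\<^sup>2"
      unfolding power_mult_distrib power2_abs sc N_def by (simp add: power2_eq_square algebra_simps)
    then show "(\<bar>1 - \<rho>\<^sup>2\<bar> * s)\<^sup>2 \<le> N\<^sup>2" by (metis diff_ge_0_iff_ge zero_le_power2)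
  qed (use N in simp)
  then have "\<bar>1 - \<rho>\<^sup>2\<bar> / N \<le> 1 / s" using s N by (simp add: divide_le_eq le_divide_eq)
  ultimately have "\<bar>2 * d - 1\<bar> \<le> 1 / s" using N by (simp only: abs_divide abs_of_pos)
  with der show ?thesis unfolding s_def by blast
qed

text \<open>The argument of \<open>1 + exp (y + i t)\<close> rises from 0 to \<open>t\<close> along
  the real line, mainly near \<open>y = 0\<close>. So \<open>bump y t\<close> is near
  \<open>t\<close> for \<open>y\<close> well between 4 and 9 and near 0 far from there: a harmonic
  substitute for \<open>t\<close> times the indicator of a plateau, with margins of length 4 inside
  the block from 0 to 13.\<close>

definition bump :: "real \<Rightarrow> real \<Rightarrow> real" where
  "bump y t = arg_one_exp (y - 4) t - arg_one_exp (y - 9) t"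

lemma bump_bounds:
  assumes t: "0 < t" "t < pi"
  shows "0 \<le> bump y t" "bump y t \<le> t"
  using arg_one_exp_mono[OF t, of "y - 9" "y - 4"] arg_one_exp_bounds[OF t] unfolding bump_def by (simp, smt (verit))

lemma bump_lipschitz:
  assumes ab: "0 < a" "a \<le> b" "b < pi" and L: "\<And>t. a \<le> t \<Longrightarrow> t \<le> b \<Longrightarrow> 1 \<le> L * sin t"
  shows "\<bar>bump y b - bump y a\<bar> \<le> L * (b - a)"
proof -
  have der: "\<exists>d. (bump y has_real_derivative d) (at t) \<and> \<bar>d\<bar> \<le> L" if t: "a \<le> t" "t \<le> b" for t
  proof -
    have t': "0 < t" "t < pi" using t ab by auto
    obtain d1 d2 where d1: "(arg_one_exp (y - 4) has_real_derivative d1) (at t)" "\<bar>2 * d1 - 1\<bar> \<le> 1 / sin t"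
      and d2: "(arg_one_exp (y - 9) has_real_derivative d2) (at t)" "\<bar>2 * d2 - 1\<bar> \<le> 1 / sin t"
      using arg_one_exp_deriv[OF t'] by meson
    have "1 / sin t \<le> L" using L[OF t] sin_gt_zero[OF t'] by (simp add: divide_le_eq)
    then have "\<bar>d1 - d2\<bar> \<le> L" using d1(2) d2(2) by linarith
    moreover have "(bump y has_real_derivative d1 - d2) (at t)"
      unfolding bump_def[abs_def] by (rule DERIV_diff[OF d1(1) d2(1)])
    ultimately show ?thesis by blast
  qed
  then obtain f' where f': "\<And>t. t \<in> {a..b} \<Longrightarrow> (bump y has_real_derivative f' t) (at t)" "\<And>t. t \<in> {a..b} \<Longrightarrow> \<bar>f' t\<bar> \<le> L"
    by (metis atLeastAtMost_iff)
  have "norm (bump y b - bump y a) \<le> L * norm (b - a)"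
    by (rule field_differentiable_bound[of "{a..b}" _ f'])
      (use f' ab in \<open>auto intro: DERIV_subset\<close>)
  then show ?thesis using ab by simp
qed

text \<open>To first order the zero line of \<open>sin (2 t - c / 5 * bump y t)\<close> near \<open>t = pi / 2\<close> is
  \<open>t = pi / 2 + c / 10 * bump y (pi / 2)\<close>. The gains \<open>c\<close> are about ten times the slopes, rounded down far
  enough to absorb the second-order error, while \<open>gain_sum\<close> below still holds.\<close>

definition level_slope :: "nat \<Rightarrow> real" where
  "level_slope j = (real j - 2) / 16"

definition level_gain :: "nat \<Rightarrow> real" where
  "level_gain j = (if j = 0 then - 1.44 else if j = 1 then - 0.67 else if j = 2 then 0 else if j = 3 then 0.58 else 1.1)"

lemma level_cases: "j \<le> 4 \<Longrightarrow> j = 0 \<or> j = 1 \<or> j = 2 \<or> j = 3 \<or> j = (4 :: nat)"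
  by linarith

lemma level_gain_abs: "\<bar>level_gain j\<bar> \<le> 1.44"
  by (simp add: level_gain_def)

lemma pi_bounds: "3.14 < pi" "pi < 3.15"
  using pi_approx by simp_all

text \<open>\<open>pi / 16\<close> is the largest possible displacement
  \<open>1 / 8 * (pi / 2)\<close> of a level curve.\<close>

lemma sin_near_half_pi:
  assumes "\<bar>t - pi / 2\<bar> \<le> pi / 16"
  shows "1 \<le> 1.02 * sin t"
proof -
  define x where "x = t - pi / 2"
  have "sin t = cos x" unfolding x_def by (simp add: cos_diff)
  moreover have "cos x = 1 - 2 * (sin (x / 2))\<^sup>2" using cos_double_sin[of "x / 2"] by simp
  moreover have "(sin (x / 2))\<^sup>2 \<le> (x / 2)\<^sup>2" using abs_sin_x_le_abs_x[of "x / 2"] by (rule abs_le_square_iff[THEN iffD1])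
  moreover have "x\<^sup>2 \<le> (3.15 / 16)\<^sup>2" using assms pi_bounds by (intro abs_le_square_iff[THEN iffD1]) (simp add: x_def)
  ultimately show ?thesis by (simp add: power2_eq_square)
qed

lemma sin_middle:
  assumes "\<bar>t - pi / 2\<bar> \<le> pi / 4"
  shows "1 \<le> 1.5 * sin t"
proof -
  have "cos (pi / 4) \<le> cos \<bar>t - pi / 2\<bar>" using assms by (intro cos_monotone_0_pi_le) auto
  moreover have "cos \<bar>t - pi / 2\<bar> = sin t" by (simp add: cos_diff)
  moreover have "4 / 3 \<le> sqrt 2" by (rule real_le_rsqrt) (simp add: power2_eq_square)
  ultimately show ?thesis by (simp add: cos_45)
qed

text \<open>On the curve itself, at height \<open>pi / 2 + h\<close>, the claim is that
  \<open>level_gain j / 5\<close> times the bump there is at most \<open>2 * h\<close>. Above the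
  curve \<open>2 * t\<close> wins because \<open>0.288 * 1.5 < 2\<close>, where 0.288 is the largest
  gain 1.44 divided by 5 and 1.5 bounds \<open>1 / sin t\<close>.\<close>

lemma own_block:
  assumes j: "j \<le> 4" and t: "pi / 2 + level_slope j * bump y (pi / 2) \<le> t" "t \<le> 3 * pi / 4"
  shows "pi \<le> 2 * t - level_gain j / 5 * bump y t" "7 * pi / 16 \<le> t"
proof -
  define D0 where "D0 = bump y (pi / 2)"
  define h where "h = level_slope j * D0"
  have D0: "0 \<le> D0" "D0 \<le> pi / 2" unfolding D0_def using bump_bounds[of "pi / 2" y] by auto
  have s: "\<bar>level_slope j\<bar> \<le> 1 / 8" using level_cases[OF j] by (auto simp: level_slope_def)
  have h: "\<bar>h\<bar> \<le> pi / 16"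
    using mult_mono[OF s D0(2)] D0(1) by (simp add: h_def abs_mult)
  show t7: "7 * pi / 16 \<le> t" using t(1) h by (simp add: h_def D0_def abs_le_iff)
  have th: "pi / 2 + h \<le> t" using t(1) by (simp add: h_def D0_def)
  have L1: "\<bar>bump y (pi / 2 + h) - D0\<bar> \<le> 1.02 * \<bar>h\<bar>"
  proof (cases "0 \<le> h")
    case True
    then have "\<bar>bump y (pi / 2 + h) - bump y (pi / 2)\<bar> \<le> 1.02 * (pi / 2 + h - pi / 2)"
      using h pi_bounds by (intro bump_lipschitz sin_near_half_pi) (auto simp: abs_le_iff)
    then show ?thesis using True by (simp add: D0_def)
  next
    case False
    then have "\<bar>bump y (pi / 2) - bump y (pi / 2 + h)\<bar> \<le> 1.02 * (pi / 2 - (pi / 2 + h))"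
      using h pi_bounds by (intro bump_lipschitz sin_near_half_pi) (auto simp: abs_le_iff)
    then show ?thesis using False by (simp add: D0_def abs_minus_commute)
  qed
  have L1': "bump y (pi / 2 + h) \<le> D0 + 1.02 * \<bar>h\<bar>" "D0 - 1.02 * \<bar>h\<bar> \<le> bump y (pi / 2 + h)"
    using L1 unfolding abs_le_iff by linarith+
  have L2: "\<bar>bump y t - bump y (pi / 2 + h)\<bar> \<le> 1.5 * (t - (pi / 2 + h))"
  proof (rule bump_lipschitz)
    show "0 < pi / 2 + h" "pi / 2 + h \<le> t" "t < pi" using h th t(2) pi_bounds unfolding abs_le_iff by linarith+
    show "1 \<le> 1.5 * sin r" if "pi / 2 + h \<le> r" "r \<le> t" for r
      using h t(2) that pi_gt_zero unfolding abs_le_iff by (intro sin_middle) (simp only: abs_le_iff, linarith)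
  qed
  have "level_gain j / 5 * (bump y t - bump y (pi / 2 + h)) \<le> \<bar>level_gain j / 5\<bar> * \<bar>bump y t - bump y (pi / 2 + h)\<bar>"
    by (metis abs_ge_self abs_mult)
  also have "\<dots> \<le> 0.288 * (1.5 * (t - (pi / 2 + h)))"
    using L2 level_gain_abs[of j] by (intro mult_mono) auto
  also have "\<dots> \<le> 2 * (t - (pi / 2 + h))"
  proof -
    have "0.288 * (1.5 * X) \<le> 2 * X" if "0 \<le> X" for X :: real using that by simp
    from this[of "t - (pi / 2 + h)"] th show ?thesis by simp
  qed
  finally have A: "level_gain j / 5 * bump y t \<le> level_gain j / 5 * bump y (pi / 2 + h) + 2 * (t - (pi / 2 + h))"
    by (simp add: algebra_simps)
  \<comment> \<open>\<open>1.02 * \<bar>h\<bar>\<close> is the second-order error: it changes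
    \<open>D0\<close> by at most the fraction 0.1275 at the outer levels and 0.06375 at the inner
    ones. The gains are rounded so that each case just holds, for instance
    \<open>0.288 * 0.8725 > 0.25\<close> for \<open>j = 0\<close>.\<close>
  have B: "level_gain j / 5 * bump y (pi / 2 + h) \<le> 2 * h"
    using level_cases[OF j]
  proof (elim disjE)
    assume j: "j = 0"
    have "\<bar>h\<bar> = D0 / 8" "h = - D0 / 8" using D0 by (simp_all add: h_def j level_slope_def)
    then show ?thesis using L1' D0 by (simp add: j level_gain_def)
  next
    assume j: "j = 1"
    have "\<bar>h\<bar> = D0 / 16" "h = - D0 / 16" using D0 by (simp_all add: h_def j level_slope_def)
    then show ?thesis using L1' D0 by (simp add: j level_gain_def)
  next
    assume j: "j = 2" then show ?thesis by (simp add: h_def level_slope_def level_gain_def)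
  next
    assume j: "j = 3"
    have "\<bar>h\<bar> = D0 / 16" "h = D0 / 16" using D0 by (simp_all add: h_def j level_slope_def)
    then show ?thesis using L1' D0 by (simp add: j level_gain_def)
  next
    assume j: "j = 4"
    have "\<bar>h\<bar> = D0 / 8" "h = D0 / 8" using D0 by (simp_all add: h_def j level_slope_def)
    then show ?thesis using L1' D0 by (simp add: j level_gain_def)
  qed
  show "pi \<le> 2 * t - level_gain j / 5 * bump y t" using order_trans[OF A add_right_mono[OF B]] by (simp add: algebra_simps)
qed

text \<open>The sum nearly telescopes: from the descent of one bump to the ascent of the next, 8
  further on, the shifted argument function can only decrease, by monotonicity.\<close>

lemma sum_bump_le:
  assumes t: "0 < t" "t < pi" and ab: "a < b"
  shows "(\<Sum>i=a..<b. bump (x - 13 * real i) t) \<le> arg_one_exp (x - 13 * real a - 4) t - arg_one_exp (x - 13 * real b + 4) t"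
  using Suc_leI[OF ab]
proof (induction b rule: dec_induct)
  case base
  show ?case by (simp add: bump_def algebra_simps)
next
  case (step b)
  have "(\<Sum>i=a..<Suc b. bump (x - 13 * real i) t) = (\<Sum>i=a..<b. bump (x - 13 * real i) t) + bump (x - 13 * real b) t"
    using step.hyps by simp
  moreover have "arg_one_exp (x - 13 * real b - 4) t \<le> arg_one_exp (x - 13 * real b + 4) t" by (rule arg_one_exp_mono[OF t]) simp
  moreover have "x - 13 * real (Suc b) + 4 = x - 13 * real b - 9" by simp
  ultimately show ?case using step.IH unfolding bump_def by simp
qed

lemma exp_neg_bounds:
  fixes x :: real
  assumes "0 \<le> x"
  shows "1 - x + x\<^sup>2 / 2 - x ^ 3 / 6 \<le> exp (- x)" "exp (- x) \<le> 1 - x + x\<^sup>2 / 2 - x ^ 3 / 6 + x ^ 4 / 24"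
proof -
  obtain s where s: "exp (- x) = (\<Sum>m<4. (- x) ^ m / fact m) + exp s / fact 4 * (- x) ^ 4"
    using Maclaurin_exp_le[of "- x" 4] by blast
  have "0 \<le> exp s / fact 4 * (- x) ^ 4" by simp
  then show "1 - x + x\<^sup>2 / 2 - x ^ 3 / 6 \<le> exp (- x)"
    unfolding s by (simp add: eval_nat_numeral)
  obtain s where s: "exp (- x) = (\<Sum>m<5. (- x) ^ m / fact m) + exp s / fact 5 * (- x) ^ 5"
    using Maclaurin_exp_le[of "- x" 5] by blast
  have "(- x) ^ 5 \<le> 0" using assms by simp
  then have "exp s / fact 5 * (- x) ^ 5 \<le> 0" by (intro mult_nonneg_nonpos) auto
  then show "exp (- x) \<le> 1 - x + x\<^sup>2 / 2 - x ^ 3 / 6 + x ^ 4 / 24"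
    unfolding s by (simp add: eval_nat_numeral)
qed

lemma exp_4_ge: "50 \<le> exp (4 :: real)"
proof -
  have "exp (- 1 :: real) \<le> 0.375" using exp_neg_bounds(2)[of 1] by simp
  then have "8 / 3 \<le> exp (1 :: real)" by (simp add: exp_minus field_simps)
  then have "(8 / 3) ^ 4 \<le> exp (1 :: real) ^ 4" by (intro power_mono) auto
  then show ?thesis using exp_of_nat_mult[of 4 "1 :: real"] by (simp add: power_divide)
qed

lemma arg_one_exp_tail_num:
  assumes t: "0 < t" "t < pi"
  shows "y \<le> - 4 \<Longrightarrow> arg_one_exp y t \<le> 1 / 49" "y \<le> - 8 \<Longrightarrow> arg_one_exp y t \<le> 1 / 2499"
proof -
  assume "y \<le> - 4"
  then have "arg_one_exp y t \<le> arg_one_exp (- 4) t" by (rule arg_one_exp_mono[OF t])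
  also have "\<dots> \<le> 1 / (exp 4 - 1)" using arg_one_exp_tail[OF t, of "- 4"] by simp
  also have "\<dots> \<le> 1 / 49" using exp_4_ge by (intro divide_left_mono) auto
  finally show "arg_one_exp y t \<le> 1 / 49" .
next
  assume "y \<le> - 8"
  then have "arg_one_exp y t \<le> arg_one_exp (- 8) t" by (rule arg_one_exp_mono[OF t])
  also have "\<dots> \<le> 1 / (exp 8 - 1)" using arg_one_exp_tail[OF t, of "- 8"] by simp
  also have "\<dots> \<le> 1 / 2499"
  proof -
    have "(50::real) * 50 \<le> exp 4 * exp 4" using exp_4_ge by (intro mult_mono) auto
    then show ?thesis by (intro divide_left_mono) (simp_all add: exp_add[symmetric])
  qed
  finally show "arg_one_exp y t \<le> 1 / 2499" .
qed

lemma sum_bump_total: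
  assumes t: "0 < t" "t < pi"
  shows "(\<Sum>i=1..n. bump (x - 13 * real i) t) \<le> t"
proof -
  have "(\<Sum>i=1..n. bump (x - 13 * real i) t) = (\<Sum>i=1..<Suc n. bump (x - 13 * real i) t)"
    by (rule sum.cong) auto
  also have "\<dots> \<le> t"
  proof (cases "n = 0")
    case False
    then have "(\<Sum>i=1..<Suc n. bump (x - 13 * real i) t) \<le> arg_one_exp (x - 13 * real 1 - 4) t - arg_one_exp (x - 13 * real (Suc n) + 4) t"
      by (intro sum_bump_le[OF t]) simp
    then show ?thesis using arg_one_exp_bounds[OF t] by (smt (verit))
  qed (use t in simp)
  finally show ?thesis .
qed

text \<open>The blocks other than the one containing the point contribute little. The indices 0 and n + 1
  stand for points below all blocks and above all blocks.\<close>

lemma sum_bump_other: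
  assumes t: "0 < t" "t < pi" and m: "m \<le> Suc n"
    and lo: "0 < m \<Longrightarrow> 13 * real m \<le> x" and hi: "m \<le> n \<Longrightarrow> x \<le> 13 * real m + 13"
  shows "(\<Sum>i\<in>{1..n} - {m}. bump (x - 13 * real i) t) \<le> 1 / 49 + 1 / 2499"
proof -
  have split: "{1..n} - {m} = {1..<m} \<union> {Suc m..<Suc n}" using m by auto
  have "(\<Sum>i\<in>{1..n} - {m}. bump (x - 13 * real i) t) =
      (\<Sum>i=1..<m. bump (x - 13 * real i) t) + (\<Sum>i=Suc m..<Suc n. bump (x - 13 * real i) t)"
    unfolding split by (rule sum.union_disjoint) auto
  moreover have lower: "(\<Sum>i=1..<m. bump (x - 13 * real i) t) \<le> (if m = 0 then 0 else arg_one_exp (- (x - 13 * real m) - 4) t)"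
  proof (cases "m \<le> 1")
    case True
    then show ?thesis using arg_one_exp_bounds(1)[OF t] by simp
  next
    case False
    then have "(\<Sum>i=1..<m. bump (x - 13 * real i) t) \<le> arg_one_exp (x - 13 * real 1 - 4) t - arg_one_exp (x - 13 * real m + 4) t"
      by (intro sum_bump_le[OF t]) simp
    also have "\<dots> \<le> t - arg_one_exp (x - 13 * real m + 4) t" using arg_one_exp_bounds(2)[OF t] by simp
    also have "\<dots> = arg_one_exp (- (x - 13 * real m) - 4) t" using arg_one_exp_reflect[OF t, of "x - 13 * real m + 4"] by (simp add: algebra_simps)
    finally show ?thesis using False by simp
  qed
  moreover have upper: "(\<Sum>i=Suc m..<Suc n. bump (x - 13 * real i) t) \<le> (if n < m then 0 else arg_one_exp (x - 13 * real m - 17) t)"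
  proof (cases "n \<le> m")
    case True
    then show ?thesis using arg_one_exp_bounds(1)[OF t] by simp
  next
    case False
    then have "(\<Sum>i=Suc m..<Suc n. bump (x - 13 * real i) t) \<le> arg_one_exp (x - 13 * real (Suc m) - 4) t - arg_one_exp (x - 13 * real (Suc n) + 4) t"
      by (intro sum_bump_le[OF t]) simp
    also have "\<dots> \<le> arg_one_exp (x - 13 * real m - 17) t" using arg_one_exp_bounds(1)[OF t] by (simp add: algebra_simps)
    finally show ?thesis using False by simp
  qed
  moreover have "(if m = 0 then 0 else arg_one_exp (- (x - 13 * real m) - 4) t) + (if n < m then 0 else arg_one_exp (x - 13 * real m - 17) t) \<le> 1 / 49 + 1 / 2499"
  \<comment> \<open>Ascents and descents of other bumps are at least 4 away from the block. A point
    in its left part is at least 8 away from those on the right, and conversely, so only one of the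
    two tails can be as large as \<open>1 / 49\<close>.\<close>
  proof (cases "x - 13 * real m \<le> 6")
    case True
    have "(if m = 0 then 0 else arg_one_exp (- (x - 13 * real m) - 4) t) \<le> 1 / 49" using lo arg_one_exp_tail_num(1)[OF t, of "- (x - 13 * real m) - 4"] by (cases "m = 0") simp_all
    moreover have "(if n < m then 0 else arg_one_exp (x - 13 * real m - 17) t) \<le> 1 / 2499" using True arg_one_exp_tail_num(2)[OF t, of "x - 13 * real m - 17"] by simp
    ultimately show ?thesis by linarith
  next
    case False
    have "(if m = 0 then 0 else arg_one_exp (- (x - 13 * real m) - 4) t) \<le> 1 / 2499" using False arg_one_exp_tail_num(2)[OF t, of "- (x - 13 * real m) - 4"] by simp
    moreover have "(if n < m then 0 else arg_one_exp (x - 13 * real m - 17) t) \<le> 1 / 49" using hi arg_one_exp_tail_num(1)[OF t, of "x - 13 * real m - 17"] by (cases "n < m") simp_all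
    ultimately show ?thesis by linarith
  qed
  ultimately show ?thesis by linarith
qed

text \<open>The factor \<open>1 + 1 / 400\<close> absorbs the influence of the other blocks.\<close>

definition phase :: "nat \<Rightarrow> (nat \<Rightarrow> nat) \<Rightarrow> real \<Rightarrow> real \<Rightarrow> real" where
  "phase n w x t = 2 * (1 + 1 / 400) * t - (\<Sum>i=1..n. level_gain (w i) / 5 * bump (x - 13 * real i) t)"

lemma abs_weighted_sum_bump_le:
  assumes t: "0 < t" "t < pi"
  shows "\<bar>\<Sum>i\<in>I. level_gain (w i) / 5 * bump (x - 13 * real i) t\<bar> \<le> 0.288 * (\<Sum>i\<in>I. bump (x - 13 * real i) t)"
proof -
  have "\<bar>\<Sum>i\<in>I. level_gain (w i) / 5 * bump (x - 13 * real i) t\<bar> \<le> (\<Sum>i\<in>I. \<bar>level_gain (w i) / 5 * bump (x - 13 * real i) t\<bar>)"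
    by (rule sum_abs)
  also have "\<dots> \<le> (\<Sum>i\<in>I. 0.288 * bump (x - 13 * real i) t)"
  proof (rule sum_mono)
    fix i
    have "\<bar>level_gain (w i) / 5\<bar> \<le> 0.288" using level_gain_abs[of "w i"] by simp
    then show "\<bar>level_gain (w i) / 5 * bump (x - 13 * real i) t\<bar> \<le> 0.288 * bump (x - 13 * real i) t"
      using mult_right_mono[OF _ bump_bounds(1)[OF t, of "x - 13 * real i"], of "\<bar>level_gain (w i) / 5\<bar>" "0.288"]
        bump_bounds(1)[OF t, of "x - 13 * real i"] by (simp only: abs_mult abs_of_nonneg)
  qed
  finally show ?thesis by (simp add: sum_distrib_left)
qed

lemma phase_near:
  assumes t: "0 < t" "t < pi"
  shows "\<bar>phase n w x t - 2 * (1 + 1 / 400) * t\<bar> \<le> 0.288 * t"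
proof -
  have "0.288 * (\<Sum>i=1..n. bump (x - 13 * real i) t) \<le> 0.288 * t"
    by (intro mult_left_mono sum_bump_total[OF t]) simp
  then show ?thesis using abs_weighted_sum_bump_le[OF t, of w x "{1..n}"] by (simp add: phase_def)
qed

text \<open>The other blocks disturb the phase by at most about 0.006, and the surplus
  \<open>t / 200\<close> exceeds this as soon as \<open>t\<close> is at least
  \<open>7 * pi / 16\<close>. The upper bound is crude: \<open>2.005 + 0.288 = 2.293\<close>, and
  2.293 times \<open>3 * pi / 4\<close> is below \<open>2 * pi\<close>.\<close>

lemma phase_pi_2pi:
  assumes t: "7 * pi / 16 \<le> t" "t \<le> 3 * pi / 4" and m: "m \<le> Suc n"
    and lo: "0 < m \<Longrightarrow> 13 * real m \<le> x" and hi: "m \<le> n \<Longrightarrow> x \<le> 13 * real m + 13"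
    and own: "pi \<le> 2 * t - (if m \<in> {1..n} then level_gain (w m) / 5 * bump (x - 13 * real m) t else 0)"
  shows "pi < phase n w x t" "phase n w x t < 2 * pi"
proof -
  have t': "0 < t" "t < pi" using t pi_gt_zero by linarith+
  let ?f = "\<lambda>i. level_gain (w i) / 5 * bump (x - 13 * real i) t"
  have "(\<Sum>i=1..n. ?f i) = (if m \<in> {1..n} then ?f m else 0) + (\<Sum>i\<in>{1..n} - {m}. ?f i)"
    by (simp add: sum.remove)
  moreover have "\<bar>\<Sum>i\<in>{1..n} - {m}. ?f i\<bar> \<le> 0.288 * (1 / 49 + 1 / 2499)"
    by (rule order_trans[OF abs_weighted_sum_bump_le[OF t'] mult_left_mono[OF sum_bump_other[OF t' m lo hi]]]) auto
  moreover have "0.288 * (1 / 49 + 1 / 2499) < 1 / 200 * t" using t pi_bounds by simp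
  ultimately show "pi < phase n w x t" using own unfolding phase_def by (simp add: algebra_simps)
  have "phase n w x t - 2 * (1 + 1 / 400) * t \<le> 0.288 * t" by (rule order_trans[OF abs_ge_self phase_near[OF t']])
  then have "phase n w x t * 1000 \<le> t * 2293" by (simp add: field_simps)
  then show "phase n w x t < 2 * pi" using t(2) pi_gt_zero by linarith
qed

lemma phase_in_block:
  assumes w: "w m \<le> 4" and m: "1 \<le> m" "m \<le> n" and x: "13 * real m \<le> x" "x \<le> 13 * real m + 13"
    and t: "pi / 2 + level_slope (w m) * bump (x - 13 * real m) (pi / 2) \<le> t" "t \<le> 3 * pi / 4"
  shows "pi < phase n w x t \<and> phase n w x t < 2 * pi"
  using phase_pi_2pi[of t m n x w] own_block[OF w t] t m x by simp

lemma phase_outside: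
  assumes x: "x \<le> 13 \<or> 13 * real (Suc n) \<le> x" and t: "pi / 2 \<le> t" "t \<le> 3 * pi / 4"
  shows "pi < phase n w x t \<and> phase n w x t < 2 * pi"
  using x
proof
  assume "x \<le> 13"
  then show ?thesis using phase_pi_2pi[of t 0 n x w] t pi_gt_zero by simp
next
  assume "13 * real (Suc n) \<le> x"
  then show ?thesis using phase_pi_2pi[of t "Suc n" n x w] t pi_gt_zero by simp
qed

section \<open>Circle averages of imaginary parts of holomorphic functions\<close>

lemma nn_integral_circle_unit:
  assumes f [measurable]: "f \<in> borel_measurable borel"
  shows "(\<integral>\<^sup>+u. f u \<partial>uniform_unit_circle) = (\<integral>\<^sup>+x. f (cis (2 * pi * x)) * indicator {0..1} x \<partial>lborel)"
proof -
  have [measurable]: "cis \<in> borel_measurable borel"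
    by (intro borel_measurable_continuous_onI continuous_intros)
  have "(\<integral>\<^sup>+\<theta>. f (cis \<theta>) * indicator {0..2 * pi} \<theta> \<partial>lborel) =
      ennreal \<bar>2 * pi\<bar> * (\<integral>\<^sup>+x. f (cis (0 + 2 * pi * x)) * indicator {0..2 * pi} (0 + 2 * pi * x) \<partial>lborel)"
  proof (rule nn_integral_real_affine)
    show "(\<lambda>\<theta>. f (cis \<theta>) * indicator {0..2 * pi} \<theta>) \<in> borel_measurable borel"
      by (intro borel_measurable_times_ennreal borel_measurable_indicator measurable_compose[OF _ f]) simp_all
  qed simp
  also have "\<dots> = ennreal (2 * pi) * (\<integral>\<^sup>+x. f (cis (2 * pi * x)) * indicator {0..1} x \<partial>lborel)"
    by (auto intro!: arg_cong[where f="\<lambda>x. ennreal (2 * pi) * x"] nn_integral_cong simp: indicator_def zero_le_mult_iff not_le[THEN iffD2, OF pi_gt_zero])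
  finally show ?thesis
    unfolding nn_integral_circle[OF f]
    by (simp add: ennreal_mult_divide_eq mult.commute[of "ennreal (2 * pi)"])
qed

text \<open>By Cauchy's formula \<open>F z\<close> is the mean of \<open>F\<close> over the circle.
  The positive part of \<open>Im F\<close>, which \<open>v\<close> dominates, links this signed
  integral to the nonnegative one on the right.\<close>

lemma circle_mean_value_le:
  assumes F: "F holomorphic_on S" and S: "open S" "cball z \<rho> \<subseteq> S" and \<rho>: "0 \<le> \<rho>"
    and v [measurable]: "v \<in> borel_measurable borel" and v0: "\<And>y. 0 \<le> v y" and le: "\<And>y. y \<in> cball z \<rho> \<Longrightarrow> Im (F y) \<le> v y"
  shows "ennreal (Im (F z)) \<le> (\<integral>\<^sup>+u. ennreal (v (z + u * complex_of_real \<rho>)) \<partial>uniform_unit_circle)"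
proof (cases "\<rho> = 0")
  case True
  interpret U: prob_space uniform_unit_circle by (rule prob_space_circle)
  show ?thesis using True le[of z] U.emeasure_space_1 by (simp add: ennreal_leI)
next
  case False
  with \<rho> have \<rho>: "0 < \<rho>" by simp
  define c where "c x = z + cis (2 * pi * x) * complex_of_real \<rho>" for x
  have c: "c x \<in> cball z \<rho>" for x using \<rho> by (simp add: c_def dist_norm norm_mult)
  have Fc: "continuous_on S F" by (rule holomorphic_on_imp_continuous_on[OF F])
  have "((\<lambda>u. F u / (u - z)) has_contour_integral (2 * of_real pi * \<i> * F z)) (circlepath z \<rho>)"
    by (rule Cauchy_integral_circlepath) (use S \<rho> in \<open>auto intro: continuous_on_subset[OF Fc] holomorphic_on_subset[OF F subset_trans[OF ball_subset_cball S(2)]]\<close>)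
  then have "((\<lambda>x. F (circlepath z \<rho> x) / (circlepath z \<rho> x - z) * vector_derivative (circlepath z \<rho>) (at x within {0..1})) has_integral (2 * of_real pi * \<i> * F z)) {0..1}"
    by (simp add: has_contour_integral_def)
  then have "((\<lambda>x. 2 * of_real pi * \<i> * F (c x)) has_integral (2 * of_real pi * \<i> * F z)) {0..1}"
  proof (rule has_integral_eq[rotated])
    fix x :: real assume x: "x \<in> {0..1}"
    have "circlepath z \<rho> x = c x" by (simp add: circlepath c_def cis_conv_exp mult_ac)
    moreover have "vector_derivative (circlepath z \<rho>) (at x within {0..1}) = 2 * of_real pi * \<i> * (c x - z)"
      using x by (simp add: vector_derivative_circlepath01 c_def cis_conv_exp mult_ac)
    moreover have "c x - z \<noteq> 0" using \<rho> by (simp add: c_def)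
    ultimately show "F (circlepath z \<rho> x) / (circlepath z \<rho> x - z) * vector_derivative (circlepath z \<rho>) (at x within {0..1}) = 2 * of_real pi * \<i> * F (c x)"
      by simp
  qed
  then have "((\<lambda>x. inverse (2 * of_real pi * \<i>) * (2 * of_real pi * \<i> * F (c x))) has_integral (inverse (2 * of_real pi * \<i>) * (2 * of_real pi * \<i> * F z))) {0..1}"
    by (rule has_integral_mult_right)
  moreover have "inverse (2 * of_real pi * \<i>) * (2 * of_real pi * \<i> * y) = y" for y by (simp add: field_simps)
  ultimately have "((\<lambda>x. F (c x)) has_integral F z) {0..1}" by (simp only:)
  then have I: "((\<lambda>x. Im (F (c x))) has_integral Im (F z)) {0..1}" by (rule has_integral_Im)
  define p where "p x = max 0 (Im (F (c x)))" for x
  have "continuous_on {0..1} p" unfolding p_def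
  proof (intro continuous_on_max continuous_intros continuous_on_compose2[OF Fc])
    show "continuous_on {0..1} c" unfolding c_def by (intro continuous_intros)
    show "c ` {0..1} \<subseteq> S" using c S by auto
  qed
  then obtain J where J: "(p has_integral J) {0..1}" using integrable_continuous_interval by (metis integrable_on_def)
  have "Im (F z) \<le> J" by (rule has_integral_le[OF I J]) (simp add: p_def)
  then have "ennreal (Im (F z)) \<le> ennreal J" by (rule ennreal_leI)
  also have "\<dots> = (\<integral>\<^sup>+x. indicator {0..1} x * p x \<partial>lborel)"
    by (rule nn_integral_has_integral_lebesgue[symmetric, OF _ J]) (simp add: p_def)
  also have "\<dots> \<le> (\<integral>\<^sup>+x. ennreal (v (c x)) * indicator {0..1} x \<partial>lborel)"
    by (rule nn_integral_mono) (use le[OF c] v0 in \<open>auto simp: indicator_def p_def intro!: ennreal_leI\<close>)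
  also have "\<dots> = (\<integral>\<^sup>+u. ennreal (v (z + u * complex_of_real \<rho>)) \<partial>uniform_unit_circle)"
    unfolding c_def by (rule nn_integral_circle_unit[symmetric]) measurable
  finally show ?thesis .
qed

section \<open>The holomorphic potential with imaginary part \<open>phase\<close>\<close>

definition log_one_exp :: "complex \<Rightarrow> complex" where
  "log_one_exp l = Ln (1 + exp l)"

lemma one_exp_nonpos:
  assumes "\<bar>Im l\<bar> < pi"
  shows "1 + exp l \<notin> \<real>\<^sub>\<le>\<^sub>0"
proof
  assume "1 + exp l \<in> \<real>\<^sub>\<le>\<^sub>0"
  then have "exp (Re l) * sin (Im l) = 0" "1 + exp (Re l) * cos (Im l) \<le> 0"
    by (auto simp: complex_nonpos_Reals_iff Re_exp Im_exp)
  then have "sin (Im l) = 0" and c: "1 + exp (Re l) * cos (Im l) \<le> 0" by auto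
  then have "Im l = 0" using assms by (metis abs_less_iff minus_less_iff sin_eq_0_pi)
  then show False using c exp_gt_zero[of "Re l"] by simp
qed

lemma log_one_exp_holomorphic:
  assumes "f holomorphic_on S" "\<And>l. l \<in> S \<Longrightarrow> \<bar>Im (f l)\<bar> < pi"
  shows "(\<lambda>l. log_one_exp (f l)) holomorphic_on S"
  unfolding log_one_exp_def using assms one_exp_nonpos by (intro holomorphic_intros) auto

lemma Re_log_one_exp:
  assumes "\<bar>Im l\<bar> < pi"
  shows "Re (log_one_exp l) = ln (cmod (1 + exp l))"
  using one_exp_nonpos[OF assms] unfolding log_one_exp_def by (subst Re_Ln) auto

lemma Re_log_one_exp_small:
  assumes "\<bar>Im l\<bar> < pi" "Re l \<le> - 1"
  shows "\<bar>Re (log_one_exp l)\<bar> \<le> 2 * exp (Re l)"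
proof -
  have "exp (Re l) \<le> exp (- 1)" using assms by simp
  also have "\<dots> < 1 / 2" using exp_neg_bounds(2)[of 1] by simp
  finally have "cmod (Ln (1 + exp l)) \<le> 2 * cmod (exp l)" by (intro norm_Ln_le) simp
  then show ?thesis unfolding log_one_exp_def using abs_Re_le_cmod[of "Ln (1 + exp l)"] by simp
qed

lemma Re_log_one_exp_large:
  assumes "\<bar>Im l\<bar> < pi" "1 \<le> Re l"
  shows "\<bar>Re (log_one_exp l) - Re l\<bar> \<le> 2 * exp (- Re l)"
proof -
  have m: "\<bar>Im (- l)\<bar> < pi" using assms by simp
  have "1 + exp l = exp l * (1 + exp (- l))" by (simp add: distrib_left exp_minus)
  then have "cmod (1 + exp l) = exp (Re l) * cmod (1 + exp (- l))" by (metis norm_exp_eq_Re norm_mult)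
  moreover have "0 < cmod (1 + exp (- l))" using one_exp_nonpos[OF m] by auto
  ultimately have "Re (log_one_exp l) = Re l + Re (log_one_exp (- l))"
    unfolding Re_log_one_exp[OF assms(1)] Re_log_one_exp[OF m] by (simp add: ln_mult)
  then show ?thesis using Re_log_one_exp_small[OF m] assms(2) by simp
qed

text \<open>For angles up to \<open>3 * pi / 4\<close> the cosine is at least
  \<open>- 3 / 4\<close>, so the squared modulus of \<open>1 + exp l\<close> is at least
  \<open>7 / 16\<close>, the minimum of \<open>r\<^sup>2 - 3 / 2 * r + 1\<close>. The zero of
  \<open>1 + exp l\<close> thus stays at a distance.\<close>

lemma Re_log_one_exp_bound:
  assumes "\<bar>Im l\<bar> \<le> 3 * pi / 4"
  shows "\<bar>Re (log_one_exp l)\<bar> \<le> max 0 (Re l) + 1"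
proof -
  have l: "\<bar>Im l\<bar> < pi" using assms pi_gt_zero by linarith
  define r where "r = exp (Re l)"
  have r: "0 < r" by (simp add: r_def)
  have pos: "0 < cmod (1 + exp l)" using one_exp_nonpos[OF l] by auto
  have "cos (3 * pi / 4) \<le> cos \<bar>Im l\<bar>" using assms by (intro cos_monotone_0_pi_le) auto
  moreover have "cos (3 * pi / 4) = - (sqrt 2 / 2)"
    using cos_minus_pi[of "pi / 4"] cos_pi_minus[of "pi / 4"] by (simp add: cos_45)
  moreover have "sqrt 2 \<le> 3 / 2" by (rule real_le_lsqrt) (simp_all add: power2_eq_square)
  ultimately have c: "- (3 / 4) \<le> cos (Im l)" by simp
  have "(cmod (1 + exp l))\<^sup>2 = (1 + r * cos (Im l))\<^sup>2 + (r * sin (Im l))\<^sup>2"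
    unfolding cmod_power2 by (simp add: Re_exp Im_exp r_def)
  also have "\<dots> = 1 + 2 * r * cos (Im l) + r\<^sup>2 * ((cos (Im l))\<^sup>2 + (sin (Im l))\<^sup>2)"
    by (simp only: power2_eq_square) (simp only: algebra_simps mult_2)
  also have "\<dots> = 1 + 2 * r * cos (Im l) + r\<^sup>2" by simp
  also have "\<dots> \<ge> 1 + 2 * r * (- (3 / 4)) + r\<^sup>2" using c r by (intro add_mono mult_left_mono order_refl) auto
  also have "1 + 2 * r * (- (3 / 4)) + r\<^sup>2 = (r - 3 / 4)\<^sup>2 + 7 / 16" by (simp add: power2_eq_square algebra_simps)
  finally have "7 / 16 \<le> (cmod (1 + exp l))\<^sup>2" using zero_le_power2[of "r - 3 / 4"] by linarith
  then have "(1 / 2)\<^sup>2 \<le> (cmod (1 + exp l))\<^sup>2" by (simp add: power2_eq_square)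
  then have "1 / 2 \<le> cmod (1 + exp l)" by (rule power2_le_imp_le) simp
  moreover have "exp (- 1) \<le> (1 / 2 :: real)" using exp_neg_bounds(2)[of 1] by simp
  ultimately have "- 1 \<le> Re (log_one_exp l)" unfolding Re_log_one_exp[OF l]
    using pos by (subst ln_ge_iff) auto
  moreover have "Re (log_one_exp l) \<le> max 0 (Re l) + 1"
  proof -
    have "cmod (1 + exp l) \<le> 1 + exp (Re l)" using norm_triangle_ineq[of 1 "exp l"] by simp
    also have "\<dots> \<le> 2 * exp (max 0 (Re l))" by (simp add: max_def)
    also have "\<dots> \<le> exp 1 * exp (max 0 (Re l))" using exp_ge_add_one_self[of 1] by (intro mult_right_mono) auto
    also have "\<dots> = exp (max 0 (Re l) + 1)" by (simp add: exp_add)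
    finally show ?thesis unfolding Re_log_one_exp[OF l] using pos by (metis ln_exp ln_mono)
  qed
  ultimately show ?thesis by (simp add: abs_le_iff)
qed

text \<open>The imaginary part is \<open>bump\<close>. The real part rises from 0 to 5 across a
  block and is exponentially close to these values outside of it; this 5 is the reason for dividing
  the gains by 5.\<close>

definition bump_potential :: "complex \<Rightarrow> complex" where
  "bump_potential l = log_one_exp (l - 4) - log_one_exp (l - 9)"

lemma Re_bump_potential_left:
  assumes "\<bar>Im l\<bar> < pi" "Re l \<le> 0"
  shows "\<bar>Re (bump_potential l)\<bar> \<le> exp (Re l)"
proof -
  have "\<bar>Re (bump_potential l)\<bar> \<le> 2 * exp (Re l - 4) + 2 * exp (Re l - 9)"
    using Re_log_one_exp_small[of "l - 4"] Re_log_one_exp_small[of "l - 9"] assms by (simp add: bump_potential_def)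
  also have "\<dots> \<le> 4 * exp (Re l - 4)" by simp
  also have "\<dots> = 4 / exp 4 * exp (Re l)" by (simp add: exp_diff)
  also have "\<dots> \<le> 1 * exp (Re l)" using exp_4_ge by (intro mult_right_mono) auto
  finally show ?thesis by simp
qed

lemma Re_bump_potential_right:
  assumes "\<bar>Im l\<bar> < pi" "13 \<le> Re l"
  shows "\<bar>Re (bump_potential l) - 5\<bar> \<le> exp (13 - Re l)"
proof -
  have "\<bar>Re (bump_potential l) - 5\<bar> \<le> 2 * exp (4 - Re l) + 2 * exp (9 - Re l)"
    using Re_log_one_exp_large[of "l - 4"] Re_log_one_exp_large[of "l - 9"] assms by (simp add: bump_potential_def)
  also have "\<dots> \<le> 4 * exp (9 - Re l)" by simp
  also have "\<dots> = 4 / exp 4 * exp (13 - Re l)" by (simp add: exp_diff exp_add[symmetric] field_simps)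
  also have "\<dots> \<le> 1 * exp (13 - Re l)" using exp_4_ge by (intro mult_right_mono) auto
  finally show ?thesis by simp
qed

lemma Re_bump_potential_bound:
  assumes "\<bar>Im l\<bar> \<le> 3 * pi / 4"
  shows "\<bar>Re (bump_potential l)\<bar> \<le> 2 * (max 0 (Re l) + 1)"
  using Re_log_one_exp_bound[of "l - 4"] Re_log_one_exp_bound[of "l - 9"] assms by (simp add: bump_potential_def)

lemma Im_bump_potential:
  assumes "0 < t" "t < pi"
  shows "Im (bump_potential (Complex x t)) = bump x t"
proof -
  have "Complex x t - 4 = Complex (x - 4) t" "Complex x t - 9 = Complex (x - 9) t" by (simp_all add: complex_eq_iff)
  then show ?thesis using assms by (simp add: bump_potential_def log_one_exp_def Im_Ln_one_exp bump_def)
qed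

text \<open>The imaginary part of \<open>exp (potential n w l)\<close> is a bent version of
  \<open>exp (2 * x) * sin (2 * t)\<close>, the positive harmonic function of the straight tube
  between \<open>t = 0\<close> and \<open>t = pi / 2\<close>. It is positive where the phase lies
  between 0 and \<open>pi\<close>, and each block lowers its exponent at the far end by
  \<open>level_gain (w i)\<close>. A smaller bound there means a larger probability of getting
  through.\<close>

definition potential :: "nat \<Rightarrow> (nat \<Rightarrow> nat) \<Rightarrow> complex \<Rightarrow> complex" where
  "potential n w l = of_real (2 * (1 + 1 / 400)) * l - (\<Sum>i=1..n. of_real (level_gain (w i) / 5) * bump_potential (l - of_real (13 * real i)))"

lemma potential_holomorphic:
  assumes "f holomorphic_on S" "\<And>l. l \<in> S \<Longrightarrow> \<bar>Im (f l)\<bar> < pi"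
  shows "(\<lambda>l. potential n w (f l)) holomorphic_on S"
  unfolding potential_def bump_potential_def
  by (intro holomorphic_intros log_one_exp_holomorphic assms) (use assms(2) in simp_all)

lemma potential_cnj:
  assumes "\<bar>Im l\<bar> < pi"
  shows "potential n w (cnj l) = cnj (potential n w l)"
proof -
  have L: "log_one_exp (cnj m) = cnj (log_one_exp m)" if "\<bar>Im m\<bar> < pi" for m
    using cnj_Ln[OF one_exp_nonpos[OF that]] by (simp add: log_one_exp_def exp_cnj)
  have "bump_potential (cnj l - of_real y) = cnj (bump_potential (l - of_real y))" for y
    using L[of "l - of_real y - 4"] L[of "l - of_real y - 9"] assms by (simp add: bump_potential_def)
  then show ?thesis by (simp add: potential_def del: of_real_mult of_real_divide)
qed

lemma Im_potential:
  assumes "0 < t" "t < pi"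
  shows "Im (potential n w (Complex x t)) = phase n w x t"
proof -
  have "Complex x t - of_real (13 * real i) = Complex (x - 13 * real i) t" for i by (simp add: complex_eq_iff)
  then show ?thesis using assms unfolding potential_def phase_def
    by (simp add: Im_bump_potential del: of_real_mult of_real_divide)
qed

text \<open>By reflection the phase is odd in \<open>t\<close>, and for \<open>t\<close> up to 1 it
  is at most \<open>2.293 < pi\<close>. So the harmonic function extends below the lower side
  \<open>t = 0\<close> of the tube with nonpositive values, which makes room for small circles
  around points near that side.\<close>

lemma sin_Im_potential_nonpos:
  assumes "- 1 \<le> t" "t \<le> 0"
  shows "sin (Im (potential n w (Complex x t))) \<le> 0"
proof (cases "t = 0")
  case True
  have "cnj (Complex x 0) = Complex x 0" by (simp add: complex_eq_iff)
  then have "Im (potential n w (Complex x 0)) = 0"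
    using potential_cnj[of "Complex x 0" n w] by (metis complex_cnj add.inverse_neutral complex.sel(2) abs_zero pi_gt_zero complex_cnj_cancel_iff equation_minus_iff neg_equal_zero cnj.simps(2))
  then show ?thesis using True by simp
next
  case False
  then have t: "0 < - t" "- t < pi" using assms pi_bounds by auto
  have "cnj (Complex x (- t)) = Complex x t" by (simp add: complex_eq_iff)
  then have "Im (potential n w (Complex x t)) = - phase n w x (- t)"
    using potential_cnj[of "Complex x (- t)" n w] Im_potential[OF t, of n w x] t by simp
  moreover have "0 \<le> phase n w x (- t)" "phase n w x (- t) \<le> pi"
    using phase_near[OF t, of n w x] assms t pi_bounds by (simp_all add: abs_le_iff)
  ultimately show ?thesis by (simp add: sin_ge_zero)
qed

lemma Re_potential:
  "Re (potential n w l) = 2 * (1 + 1 / 400) * Re l - (\<Sum>i=1..n. level_gain (w i) / 5 * Re (bump_potential (l - of_real (13 * real i))))"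
  unfolding potential_def by (simp del: of_real_mult of_real_divide)

text \<open>Each further block reduces the error by a factor of at least \<open>exp (- 13)\<close>,
  so the total is bounded independently of \<open>n\<close>. The comparison of the potential with a
  linear function thus costs one constant factor in all, not one per block.\<close>

lemma geometric_sum_le:
  fixes f :: "nat \<Rightarrow> real"
  assumes "\<And>i. i \<in> {1..n} \<Longrightarrow> \<bar>f i\<bar> \<le> exp (- 13 * (real n - real i))"
  shows "\<bar>\<Sum>i=1..n. level_gain (w i) / 5 * f i\<bar> \<le> 1"
proof -
  have e: "exp (- 13 :: real) \<le> 1 / 2"
  proof -
    have "exp (- 13 :: real) \<le> exp (- 1)" by simp
    also have "\<dots> \<le> 1 / 2" using exp_neg_bounds(2)[of 1] by simp
    finally show ?thesis .
  qed
  have "\<bar>\<Sum>i=1..n. level_gain (w i) / 5 * f i\<bar> \<le> (\<Sum>i=1..n. 1 / 2 * (1 / 2) ^ (n - i))"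
  proof (rule order_trans[OF sum_abs sum_mono])
    fix i assume i: "i \<in> {1..n}"
    have "\<bar>f i\<bar> \<le> exp (- 13 * (real n - real i))" by (rule assms[OF i])
    also have "\<dots> = exp (- 13) ^ (n - i)" using i by (simp add: exp_of_nat_mult[symmetric] of_nat_diff algebra_simps)
    also have "\<dots> \<le> (1 / 2) ^ (n - i)" using e by (intro power_mono) auto
    finally have "\<bar>f i\<bar> \<le> (1 / 2) ^ (n - i)" .
    moreover have "\<bar>level_gain (w i) / 5\<bar> \<le> 1 / 2" using level_gain_abs[of "w i"] by simp
    ultimately have "\<bar>level_gain (w i) / 5\<bar> * \<bar>f i\<bar> \<le> 1 / 2 * (1 / 2) ^ (n - i)" by (intro mult_mono) auto
    then show "\<bar>level_gain (w i) / 5 * f i\<bar> \<le> 1 / 2 * (1 / 2) ^ (n - i)" by (simp only: abs_mult)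
  qed
  also have "(\<Sum>i=1..n. 1 / 2 * (1 / 2) ^ (n - i)) = (1 / 2 :: real) * (\<Sum>i<n. (1 / 2) ^ i)"
    unfolding sum_distrib_left[symmetric]
    by (rule arg_cong[where f="\<lambda>x. 1 / 2 * x"], rule sum.reindex_bij_witness[of _ "\<lambda>i. n - i" "\<lambda>i. n - i"]) auto
  also have "\<dots> \<le> 1"
  proof -
    have "(\<Sum>i<n. (1 / 2 :: real) ^ i) = 2 * (1 - (1 / 2) ^ n)" by (simp add: sum_gp_strict)
    then show ?thesis by simp
  qed
  finally show ?thesis .
qed

lemma Re_potential_left:
  assumes "\<bar>Im l\<bar> < pi" "Re l \<le> 0"
  shows "\<bar>Re (potential n w l) - 2 * (1 + 1 / 400) * Re l\<bar> \<le> 1"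
proof -
  have "\<bar>\<Sum>i=1..n. level_gain (w i) / 5 * Re (bump_potential (l - of_real (13 * real i)))\<bar> \<le> 1"
  proof -
    let ?f = "\<lambda>i. Re (bump_potential (l - of_real (13 * real i)))"
    \<comment> \<open>At the left end the first block is the nearest one; reversing the order of the
      blocks brings the errors into the form of \<open>geometric_sum_le\<close>.\<close>
    have "(\<Sum>i=1..n. level_gain (w i) / 5 * ?f i) = (\<Sum>i=1..n. level_gain (w (Suc n - i)) / 5 * ?f (Suc n - i))"
      by (rule sum.reindex_bij_witness[of _ "\<lambda>i. Suc n - i" "\<lambda>i. Suc n - i"]) auto
    moreover have "\<bar>\<Sum>i=1..n. level_gain (w (Suc n - i)) / 5 * ?f (Suc n - i)\<bar> \<le> 1"
    proof (rule geometric_sum_le)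
      fix i assume i: "i \<in> {1..n}"
      have "\<bar>?f (Suc n - i)\<bar> \<le> exp (Re l - 13 * real (Suc n - i))"
        using Re_bump_potential_left[of "l - of_real (13 * real (Suc n - i))"] assms by simp
      also have "\<dots> \<le> exp (- 13 * (real n - real i))" using i assms by (simp add: of_nat_diff)
      finally show "\<bar>?f (Suc n - i)\<bar> \<le> exp (- 13 * (real n - real i))" .
    qed
    ultimately show ?thesis by simp
  qed
  then show ?thesis unfolding Re_potential by simp
qed

lemma Re_potential_right:
  assumes "\<bar>Im l\<bar> < pi" "13 * real (Suc n) \<le> Re l"
  shows "\<bar>Re (potential n w l) - (2 * (1 + 1 / 400) * Re l - (\<Sum>i=1..n. level_gain (w i)))\<bar> \<le> 1"
proof -
  let ?f = "\<lambda>i. Re (bump_potential (l - of_real (13 * real i)))"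
  have "\<bar>\<Sum>i=1..n. level_gain (w i) / 5 * (?f i - 5)\<bar> \<le> 1"
  proof (rule geometric_sum_le)
    fix i assume i: "i \<in> {1..n}"
    have "\<bar>?f i - 5\<bar> \<le> exp (13 - (Re l - 13 * real i))"
      using Re_bump_potential_right[of "l - of_real (13 * real i)"] assms i by simp
    also have "\<dots> \<le> exp (- 13 * (real n - real i))" using assms by simp
    finally show "\<bar>?f i - 5\<bar> \<le> exp (- 13 * (real n - real i))" .
  qed
  moreover have "(\<Sum>i=1..n. level_gain (w i) / 5 * (?f i - 5)) = (\<Sum>i=1..n. level_gain (w i) / 5 * ?f i) - (\<Sum>i=1..n. level_gain (w i))"
    by (simp add: sum_subtractf[symmetric] right_diff_distrib)
  ultimately show ?thesis unfolding Re_potential by simp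
qed

text \<open>The growth with \<open>n\<close> is harmless: this bound only serves to make the stopped
  function bounded, and it disappears in the limits taken in
  \<open>trace_in_closure_prob\<close>.\<close>

lemma Re_potential_bound:
  assumes "\<bar>Im l\<bar> \<le> 3 * pi / 4" "Re l \<le> X" "0 \<le> X"
  shows "Re (potential n w l) \<le> 2 * (1 + 1 / 400) * X + real n * (2 * (X + 1))"
proof -
  have "\<bar>\<Sum>i=1..n. level_gain (w i) / 5 * Re (bump_potential (l - of_real (13 * real i)))\<bar> \<le> (\<Sum>i=1..n. 2 * (X + 1))"
  proof (rule order_trans[OF sum_abs sum_mono])
    fix i assume "i \<in> {1..n}"
    have "\<bar>Re (bump_potential (l - of_real (13 * real i)))\<bar> \<le> 2 * (X + 1)"
    proof -
      have "max 0 (Re l - 13 * real i) \<le> X" using assms by (simp add: max_def)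
      then have "2 * (max 0 (Re l - 13 * real i) + 1) \<le> 2 * (X + 1)" by simp
      moreover have "\<bar>Re (bump_potential (l - of_real (13 * real i)))\<bar> \<le> 2 * (max 0 (Re l - 13 * real i) + 1)"
        using Re_bump_potential_bound[of "l - of_real (13 * real i)"] assms by simp
      ultimately show ?thesis by (rule order_trans[rotated])
    qed
    moreover have "\<bar>level_gain (w i) / 5\<bar> \<le> 1" using level_gain_abs[of "w i"] by simp
    ultimately have "\<bar>level_gain (w i) / 5\<bar> * \<bar>Re (bump_potential (l - of_real (13 * real i)))\<bar> \<le> 1 * (2 * (X + 1))" by (intro mult_mono) auto
    then show "\<bar>level_gain (w i) / 5 * Re (bump_potential (l - of_real (13 * real i)))\<bar> \<le> 2 * (X + 1)" by (simp only: abs_mult mult_1)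
  qed
  moreover have "2 * (1 + 1 / 400) * Re l \<le> 2 * (1 + 1 / 400) * X" using assms by simp
  ultimately show ?thesis unfolding Re_potential by simp
qed

lemma block_cases:
  fixes x :: real
  obtains "x \<le> 13 \<or> 13 * real (Suc n) \<le> x" | i where "i \<in> {1..n}" "13 * real i \<le> x" "x \<le> 13 * real i + 13"
proof (cases "x \<le> 13 \<or> 13 * real (Suc n) \<le> x")
  case False
  then have x: "13 < x" "x < 13 * real (Suc n)" by linarith+
  define i where "i = nat \<lfloor>x / 13\<rfloor>"
  have "real i = of_int \<lfloor>x / 13\<rfloor>" using False by (simp add: i_def)
  then have i: "real i \<le> x / 13" "x / 13 < real i + 1"
    using of_int_floor_le[of "x / 13"] real_of_int_floor_add_one_gt[of "x / 13"] by simp_all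
  have "0 < real i" using i(2) x by linarith
  moreover have "x / 13 < real (Suc n)" using x(2) by (simp add: divide_less_eq mult.commute del: of_nat_Suc)
  then have "real i < real (Suc n)" by (rule order_le_less_trans[OF i(1)])
  ultimately have "i \<in> {1..n}" by auto
  moreover have "13 * real i \<le> x" "x \<le> 13 * real i + 13" using i by linarith+
  ultimately show ?thesis using that(2) by blast
qed (use that(1) in blast)

text \<open>No level curve rises above \<open>pi / 2 + pi / 16\<close>, which is below
  \<open>2 * pi / 3\<close>. In the strip from there up to \<open>3 * pi / 4\<close> the harmonic
  function is negative, which separates the tube from the edge of the domain.\<close>

lemma phase_high:
  assumes w: "\<And>i. i \<in> {1..n} \<Longrightarrow> w i \<le> 4" and t: "2 * pi / 3 \<le> t" "t \<le> 3 * pi / 4"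
  shows "pi < phase n w x t \<and> phase n w x t < 2 * pi"
proof (cases rule: block_cases[of x n])
  case 1
  then show ?thesis by (rule phase_outside) (use t pi_gt_zero in linarith)+
next
  case (2 i)
  have "level_slope (w i) * bump (x - 13 * real i) (pi / 2) \<le> 1 / 8 * (pi / 2)"
  proof (rule mult_mono)
    show "level_slope (w i) \<le> 1 / 8" using w[OF 2(1)] by (simp add: level_slope_def)
  qed (use bump_bounds[of "pi / 2"] in simp_all)
  then have "pi / 2 + level_slope (w i) * bump (x - 13 * real i) (pi / 2) \<le> t" using t(1) pi_gt_zero by linarith
  from phase_in_block[where w=w and m=i, OF w[OF 2(1)] _ _ 2(2,3) this t(2)] 2(1) show ?thesis by simp
qed

text \<open>At \<open>x = 0\<close> all blocks are far away, so starting points in the middle of the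
  tube have a phase whose sine is bounded below independently of \<open>n\<close> and
  \<open>w\<close>.\<close>

lemma phase_start:
  assumes t: "pi / 4 \<le> t" "t \<le> pi / 3"
  shows "\<bar>phase n w 0 t - pi / 2\<bar> \<le> pi / 4"
proof -
  have t': "0 < t" "t < pi" using t pi_gt_zero by linarith+
  have "{1..n} - {0} = {1..n}" by auto
  then have "(\<Sum>i=1..n. bump (0 - 13 * real i) t) \<le> 1 / 49 + 1 / 2499"
    using sum_bump_other[OF t', of 0 n 0] by simp
  then have "0.288 * (\<Sum>i=1..n. bump (0 - 13 * real i) t) \<le> 0.288 * (1 / 49 + 1 / 2499)" by (intro mult_left_mono) auto
  then have "\<bar>\<Sum>i=1..n. level_gain (w i) / 5 * bump (0 - 13 * real i) t\<bar> \<le> 1 / 100"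
    using abs_weighted_sum_bump_le[OF t', where w=w and x=0 and I="{1..n}"] by simp
  then have "phase n w 0 t \<le> 401 / 200 * t + 1 / 100" "401 / 200 * t - 1 / 100 \<le> phase n w 0 t"
    unfolding phase_def by (simp_all add: abs_le_iff)
  then show ?thesis using t pi_gt3 unfolding abs_le_iff by linarith
qed

text \<open>In the coordinates \<open>x = k ln (cmod y)\<close> and \<open>t = k arg y + pi / 2\<close>.\<close>

definition tube :: "real \<Rightarrow> nat \<Rightarrow> (nat \<Rightarrow> nat) \<Rightarrow> complex set" where
  "tube k n w = {y. y \<noteq> 0 \<and> - (pi / 2) \<le> k * Im (Ln y) \<and>
     (\<forall>i\<in>{1..n}. 13 * real i \<le> k * ln (cmod y) \<and> k * ln (cmod y) \<le> 13 * real i + 13 \<longrightarrow>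
        k * Im (Ln y) < level_slope (w i) * bump (k * ln (cmod y) - 13 * real i) (pi / 2)) \<and>
     (k * ln (cmod y) \<le> 13 \<or> 13 * real (Suc n) \<le> k * ln (cmod y) \<longrightarrow> k * Im (Ln y) < 0)}"

text \<open>Of the starting value \<open>1 / 6\<close> half is given up to exits at an inner circle,
  which leaves \<open>1 / 12\<close>; this is divided by the bound of the harmonic function beyond
  the outer circle, apart from the factors that depend on \<open>n\<close> and \<open>w\<close>. The
  \<open>k * ln 2\<close> comes from admitting moduli up to twice the outer radius.\<close>

definition tube_const :: "real \<Rightarrow> real" where
  "tube_const k = exp (- (401 / 200 * (13 + k * ln 2) + 1)) / 12"

text \<open>This is \<open>trace_in_closure_prob\<close> for the positive part \<open>v\<close> of
  the harmonic function \<open>u\<close>, with \<open>G\<close> the region between two circles where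
  \<open>u\<close> is positive. Outside \<open>G\<close> the value is at most \<open>1 / 12\<close>,
  except beyond the outer circle, where it is at most \<open>K\<close>.\<close>

lemma tube_prob:
  assumes W: "brownian_process M W" and W0: "\<And>x. x \<in> space M \<Longrightarrow> W 0 x = 0"
    and k: "1 / 2 < k" and w: "\<And>i. i \<in> {1..n} \<Longrightarrow> w i \<le> 4"
    and z: "cmod z = 1" "z \<notin> \<real>\<^sub>\<le>\<^sub>0" "pi / 4 \<le> k * Im (Ln z) + pi / 2" "k * Im (Ln z) + pi / 2 \<le> pi / 3"
  shows "\<exists>A\<in>sets M. (\<forall>x\<in>A. trace_until (exp (13 * real (Suc n) / k)) (\<lambda>t. z + W t x) \<subseteq> tube k n w) \<and>
    tube_const k * exp (- (401 / 200 * 13 * real n) + (\<Sum>i=1..n. level_gain (w i))) \<le> measure M A"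
proof -
  define R where "R = exp (13 * real (Suc n) / k)"
  \<comment> \<open>The inner circle, at \<open>x = - 2\<close>: inside it the exponent is at most
    \<open>2.005 * (- 2) + 1\<close>, below \<open>- 3\<close>, and
    \<open>exp (- 3) \<le> 1 / 12\<close>. It keeps \<open>G\<close> away from the singularity at
    the origin.\<close>
  define d where "d = exp (- 2 / k)"
  have k0: "0 < k" using k by simp
  have R1: "1 < R" using k0 by (simp add: R_def)
  have d1: "0 < d" "d < 1" using k0 by (simp_all add: d_def)
  define lam where "lam y = of_real k * Ln y + \<i> * of_real (pi / 2)" for y
  have lam_eq: "lam y = Complex (k * ln (cmod y)) (k * Im (Ln y) + pi / 2)" if "y \<noteq> 0" for y
    using that by (simp add: lam_def complex_eq_iff)
  have Im_lam: "Im (lam y) = k * Im (Ln y) + pi / 2" for y by (simp add: lam_def)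
  have lam_cont: "continuous_on (- \<real>\<^sub>\<le>\<^sub>0) (\<lambda>y. Im (lam y))"
    unfolding lam_def by (intro continuous_intros) auto
  \<comment> \<open>A domain larger than the tube on both sides; in the two extra strips, below
    \<open>t = 0\<close> and above \<open>t = 2 * pi / 3\<close>, the harmonic function is not
    positive.\<close>
  define \<Omega> where "\<Omega> = (- \<real>\<^sub>\<le>\<^sub>0) \<inter> (\<lambda>y. Im (lam y)) -` {- 1<..<3 * pi / 4}"
  have \<Omega>_open: "open \<Omega>" unfolding \<Omega>_def
    by (rule continuous_open_preimage[OF lam_cont]) (simp_all add: open_Compl)
  have \<Omega>D: "y \<notin> \<real>\<^sub>\<le>\<^sub>0" "y \<noteq> 0" "- 1 < Im (lam y)" "Im (lam y) < 3 * pi / 4" if "y \<in> \<Omega>" for y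
    using that by (auto simp: \<Omega>_def)
  have \<Omega>_pi: "\<bar>Im (lam y)\<bar> \<le> 3 * pi / 4" "\<bar>Im (lam y)\<bar> < pi" if "y \<in> \<Omega>" for y
    using \<Omega>D(3,4)[OF that] pi_bounds by (auto simp: abs_le_iff abs_less_iff)
  define F where "F y = exp (potential n w (lam y))" for y
  have F_hol: "F holomorphic_on \<Omega>"
    unfolding F_def
  proof (intro holomorphic_intros potential_holomorphic)
    show "lam holomorphic_on \<Omega>" unfolding lam_def by (intro holomorphic_intros) (use \<Omega>D in auto)
  qed (use \<Omega>_pi in auto)
  define u where "u y = Im (F y)" for y
  have u_eq: "u y = exp (Re (potential n w (lam y))) * sin (Im (potential n w (lam y)))" for y
    by (simp add: u_def F_def Im_exp)
  have u_le: "u y \<le> exp (Re (potential n w (lam y)))" for y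
    unfolding u_eq using sin_le_one by (simp add: mult_left_le)
  have u_cont: "continuous_on \<Omega> u" unfolding u_def
    by (intro continuous_intros holomorphic_on_imp_continuous_on[OF F_hol])
  have u_neg: "u y < 0" if "y \<noteq> 0" "pi < phase n w (k * ln (cmod y)) (Im (lam y)) \<and> phase n w (k * ln (cmod y)) (Im (lam y)) < 2 * pi" "0 < Im (lam y)" "Im (lam y) < pi" for y
  proof -
    have "lam y = Complex (k * ln (cmod y)) (Im (lam y))" using lam_eq[OF that(1)] Im_lam by simp
    then have "Im (potential n w (lam y)) = phase n w (k * ln (cmod y)) (Im (lam y))" using Im_potential[OF that(3,4)] by metis
    then have "sin (Im (potential n w (lam y))) < 0" using that(2) by (auto intro: sin_lt_zero)
    then show ?thesis unfolding u_eq by (simp add: mult_pos_neg)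
  qed
  define G where "G = {y \<in> \<Omega>. 0 < u y \<and> d < cmod y \<and> cmod y < R}"
  have G\<Omega>: "G \<subseteq> \<Omega>" by (auto simp: G_def)
  have G_open: "open G"
  proof -
    have "open {y. d < cmod y \<and> cmod y < R}" by (intro open_Collect_conj open_Collect_less continuous_intros)
    then have "open ((\<Omega> \<inter> u -` {0<..}) \<inter> {y. d < cmod y \<and> cmod y < R})"
      by (intro open_Int continuous_open_preimage[OF u_cont \<Omega>_open]) auto
    moreover have "(\<Omega> \<inter> u -` {0<..}) \<inter> {y. d < cmod y \<and> cmod y < R} = G" by (auto simp: G_def)
    ultimately show ?thesis by simp
  qed
  \<comment> \<open>A box in the coordinate \<open>Ln y\<close>, from \<open>t = 0\<close> to
    \<open>t = 2 * pi / 3\<close>. Its image \<open>K0\<close> is compact, contains \<open>G\<close>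
    and lies in \<Omega>, which yields a uniform radius \<eta> for the mean value
    inequality.\<close>
  define B where "B = cbox (Complex (- 2 / k) (- pi / (2 * k))) (Complex (13 * real (Suc n) / k) (pi / (6 * k)))"
  have B: "Ln (exp \<mu>) = \<mu>" "0 \<le> k * Im \<mu> + pi / 2" "k * Im \<mu> + pi / 2 \<le> 2 * pi / 3" "exp \<mu> \<notin> \<real>\<^sub>\<le>\<^sub>0" "cmod (exp \<mu>) \<le> R" if "\<mu> \<in> B" for \<mu>
  proof -
    have b: "- pi / (2 * k) \<le> Im \<mu>" "Im \<mu> \<le> pi / (6 * k)" "Re \<mu> \<le> 13 * real (Suc n) / k"
      using that unfolding B_def in_cbox_complex_iff by simp_all
    have 1: "pi / (2 * k) < pi" using k by (simp add: divide_less_eq)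
    moreover have 2: "pi / (6 * k) < pi" using k by (simp add: divide_less_eq)
    ultimately have i: "- pi < Im \<mu>" "Im \<mu> < pi" using b by linarith+
    show L: "Ln (exp \<mu>) = \<mu>" using i by simp
    have "k * (- pi / (2 * k)) \<le> k * Im \<mu>" "k * Im \<mu> \<le> k * (pi / (6 * k))" using b k0 by (simp_all only: mult_le_cancel_left_pos)
    then show "0 \<le> k * Im \<mu> + pi / 2" "k * Im \<mu> + pi / 2 \<le> 2 * pi / 3" using k0 by simp_all
    show "exp \<mu> \<notin> \<real>\<^sub>\<le>\<^sub>0"
    proof
      assume "exp \<mu> \<in> \<real>\<^sub>\<le>\<^sub>0"
      then have "exp (Re \<mu>) * sin (Im \<mu>) = 0" "exp (Re \<mu>) * cos (Im \<mu>) \<le> 0"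
        by (auto simp: complex_nonpos_Reals_iff Re_exp Im_exp)
      then have "sin (Im \<mu>) = 0" "cos (Im \<mu>) \<le> 0" by (auto simp: mult_le_0_iff)
      moreover have "Im \<mu> = 0" using sin_eq_0_pi[of "Im \<mu>"] i \<open>sin (Im \<mu>) = 0\<close> by simp
      ultimately show False by simp
    qed
    show "cmod (exp \<mu>) \<le> R" using b(3) by (simp add: R_def)
  qed
  define K0 where "K0 = exp ` B"
  have K0_compact: "compact K0" unfolding K0_def B_def
    by (intro compact_continuous_image continuous_intros compact_cbox)
  have K0\<Omega>: "K0 \<subseteq> \<Omega> \<inter> ball 0 (2 * R)"
  proof
    fix y assume "y \<in> K0"
    then obtain \<mu> where \<mu>: "\<mu> \<in> B" "y = exp \<mu>" by (auto simp: K0_def)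
    have "k * Im \<mu> + pi / 2 < 3 * pi / 4" using B(3)[OF \<mu>(1)] pi_gt_zero by linarith
    then show "y \<in> \<Omega> \<inter> ball 0 (2 * R)"
      using B(1,2,4,5)[OF \<mu>(1)] \<mu>(2) R1 by (simp add: \<Omega>_def Im_lam)
  qed
  have GK0: "G \<subseteq> K0"
  proof
    fix y assume "y \<in> G"
    then have y: "y \<in> \<Omega>" "0 < u y" "d < cmod y" "cmod y < R" by (auto simp: G_def)
    have y0: "y \<noteq> 0" and t: "- 1 < Im (lam y)" "Im (lam y) < 3 * pi / 4" using \<Omega>D[OF y(1)] by auto
    have t0: "0 < Im (lam y)"
    proof (rule ccontr)
      assume "\<not> 0 < Im (lam y)"
      then have "sin (Im (potential n w (Complex (k * ln (cmod y)) (Im (lam y))))) \<le> 0"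
        using t by (intro sin_Im_potential_nonpos) auto
      then have "u y \<le> 0" unfolding u_eq lam_eq[OF y0] Im_lam by (simp add: mult_nonneg_nonpos)
      then show False using y(2) by simp
    qed
    have t1: "Im (lam y) < 2 * pi / 3"
    proof (rule ccontr)
      assume "\<not> Im (lam y) < 2 * pi / 3"
      then have "pi < phase n w (k * ln (cmod y)) (Im (lam y)) \<and> phase n w (k * ln (cmod y)) (Im (lam y)) < 2 * pi"
        using t by (intro phase_high w) auto
      from u_neg[OF y0 this t0] t y(2) pi_gt_zero show False by linarith
    qed
    have "- pi / (2 * k) \<le> Im (Ln y)" "Im (Ln y) \<le> pi / (6 * k)"
      using t0 t1 k0 unfolding Im_lam by (simp_all add: field_simps)
    moreover have "- 2 / k \<le> ln (cmod y)"
      using y(3) y0 unfolding d_def by (subst ln_ge_iff) auto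
    moreover have "ln (cmod y) \<le> 13 * real (Suc n) / k"
      using y(4) y0 unfolding R_def by (metis less_imp_le ln_exp ln_mono zero_less_norm_iff)
    ultimately have "Ln y \<in> B" using y0 unfolding B_def in_cbox_complex_iff by simp
    then show "y \<in> K0" unfolding K0_def using y0 by (metis exp_Ln image_eqI)
  qed
  have clG: "closure G \<subseteq> K0" by (rule closure_minimal[OF GK0 compact_imp_closed[OF K0_compact]])
  have clG_tube: "closure G \<subseteq> tube k n w"
  proof
    fix y assume y: "y \<in> closure G"
    then obtain \<mu> where \<mu>: "\<mu> \<in> B" "y = exp \<mu>" using clG by (auto simp: K0_def)
    have y0: "y \<noteq> 0" using \<mu>(2) by simp
    have a: "0 \<le> Im (lam y)" "Im (lam y) \<le> 2 * pi / 3" using B(1,2,3)[OF \<mu>(1)] \<mu>(2) by (simp_all add: Im_lam)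
    have "continuous_on (closure G) u" by (rule continuous_on_subset[OF u_cont]) (use clG K0\<Omega> in auto)
    then have u0: "0 \<le> u y" by (rule continuous_ge_on_closure[OF _ y]) (simp add: G_def)
    \<comment> \<open>On the closure \<open>u\<close> is still nonnegative, while on and above the
      level curve it is strictly negative. Hence even the closure satisfies the strict upper bounds
      in \<open>tube\<close>.\<close>
    have nophase: "\<not> (pi < phase n w (k * ln (cmod y)) (Im (lam y)) \<and> phase n w (k * ln (cmod y)) (Im (lam y)) < 2 * pi)" if "0 < Im (lam y)"
    proof -
      have "Im (lam y) < pi" using a pi_gt_zero by linarith
      then show ?thesis using u_neg[OF y0 _ that] u0 by linarith
    qed
    have a': "Im (lam y) \<le> 3 * pi / 4" using a pi_gt_zero by linarith
    have "k * Im (Ln y) < level_slope (w i) * bump (k * ln (cmod y) - 13 * real i) (pi / 2)"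
      if i: "i \<in> {1..n}" and x: "13 * real i \<le> k * ln (cmod y)" "k * ln (cmod y) \<le> 13 * real i + 13" for i
    proof (rule ccontr)
      assume "\<not> ?thesis"
      then have ge: "pi / 2 + level_slope (w i) * bump (k * ln (cmod y) - 13 * real i) (pi / 2) \<le> Im (lam y)" by (simp add: Im_lam)
      have "0 < Im (lam y)" using own_block(2)[OF w[OF i] ge a'] pi_gt_zero by linarith
      from nophase[OF this] phase_in_block[where w=w and m=i, OF w[OF i] _ _ x ge a'] i show False by simp
    qed
    moreover have "k * Im (Ln y) < 0" if x: "k * ln (cmod y) \<le> 13 \<or> 13 * real (Suc n) \<le> k * ln (cmod y)"
    proof (rule ccontr)
      assume "\<not> ?thesis"
      then have ge: "pi / 2 \<le> Im (lam y)" by (simp add: Im_lam)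
      then have "0 < Im (lam y)" using pi_gt_zero by linarith
      from nophase[OF this] phase_outside[OF x ge a'] show False by blast
    qed
    ultimately show "y \<in> tube k n w" using y0 a(1) unfolding tube_def Im_lam by auto
  qed
  \<comment> \<open>Cutting off at twice the outer radius makes \<open>v\<close> bounded on the
    whole plane and leaves room for small circles around points of \<open>G\<close>.\<close>
  define v where "v y = (if y \<in> \<Omega> \<inter> ball 0 (2 * R) then max 0 (u y) else 0)" for y
  have v_meas: "v \<in> borel_measurable borel"
    unfolding v_def using \<Omega>_open
    by (intro borel_measurable_continuous_on_if borel_open open_Int continuous_intros continuous_on_subset[OF u_cont]) auto
  have v0: "0 \<le> v y" for y by (simp add: v_def)
  define X where "X = 13 * real (Suc n) + k * ln 2"
  have X0: "0 \<le> X" using k0 by (simp add: X_def)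
  have Re_lam: "Re (lam y) = k * ln (cmod y)" if "y \<noteq> 0" for y using lam_eq[OF that] by simp
  have lnX: "k * ln (cmod y) \<le> X" if "y \<noteq> 0" "cmod y < 2 * R" for y
  proof -
    have "ln (cmod y) \<le> ln (2 * R)" using that by (intro ln_mono) auto
    also have "\<dots> = ln 2 + 13 * real (Suc n) / k" using R1 by (simp add: ln_mult R_def)
    finally have "k * ln (cmod y) \<le> k * (ln 2 + 13 * real (Suc n) / k)" using k0 by (intro mult_left_mono) auto
    also have "\<dots> = X" using k0 unfolding X_def by (simp add: distrib_left del: of_nat_Suc)
    finally show ?thesis .
  qed
  define V where "V = exp (2 * (1 + 1 / 400) * X + real n * (2 * (X + 1)))"
  have vV: "v y \<le> V" for y
  proof (cases "y \<in> \<Omega> \<inter> ball 0 (2 * R)")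
    case True
    then have "Re (potential n w (lam y)) \<le> 2 * (1 + 1 / 400) * X + real n * (2 * (X + 1))"
      using \<Omega>_pi[of y] \<Omega>D[of y] lnX[of y] X0 by (intro Re_potential_bound) (auto simp: Re_lam)
    then have "u y \<le> V" using u_le[of y] unfolding V_def by (meson exp_le_cancel_iff order_trans)
    then show ?thesis using True by (simp add: v_def V_def)
  next
    case False
    then show ?thesis by (simp only: v_def if_False V_def exp_ge_zero)
  qed
  define K where "K = exp (401 / 200 * X - (\<Sum>i=1..n. level_gain (w i)) + 1)"
  have K: "v y \<le> K" if yR: "R \<le> cmod y" for y
  proof (cases "y \<in> \<Omega> \<inter> ball 0 (2 * R)")
    case True
    then have y: "y \<in> \<Omega>" "y \<noteq> 0" "cmod y < 2 * R" using \<Omega>D by auto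
    have "ln R \<le> ln (cmod y)" using yR R1 by (intro ln_mono) auto
    then have "k * (13 * real (Suc n) / k) \<le> k * ln (cmod y)" using k0 by (intro mult_left_mono) (simp_all add: R_def)
    then have "13 * real (Suc n) \<le> Re (lam y)" using k0 by (simp add: Re_lam[OF y(2)] del: of_nat_Suc)
    from Re_potential_right[OF \<Omega>_pi(2)[OF y(1)] this, of w]
    have "Re (potential n w (lam y)) \<le> 401 / 200 * X - (\<Sum>i=1..n. level_gain (w i)) + 1"
      using lnX[OF y(2,3)] Re_lam[OF y(2)] by (simp add: abs_le_iff)
    then have "u y \<le> K" using u_le[of y] unfolding K_def by (meson exp_le_cancel_iff order_trans)
    then show ?thesis using True by (simp add: v_def K_def)
  next
    case False
    then show ?thesis by (simp only: v_def if_False K_def exp_ge_zero)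
  qed
  have out: "v y \<le> 1 / 12 \<or> R \<le> cmod y" if yG: "y \<notin> G" for y
  proof (cases "y \<in> \<Omega> \<and> cmod y \<le> d \<and> 0 < u y")
    case True
    then have y: "y \<in> \<Omega>" "y \<noteq> 0" "cmod y \<le> d" using \<Omega>D by auto
    have "ln (cmod y) \<le> ln d" using y by (intro ln_mono) auto
    then have "k * ln (cmod y) \<le> k * (- 2 / k)" using k0 by (intro mult_left_mono) (auto simp: d_def)
    then have x: "Re (lam y) \<le> - 2" using k0 by (simp add: Re_lam[OF y(2)])
    have "Re (potential n w (lam y)) \<le> - 3"
      using Re_potential_left[OF \<Omega>_pi(2)[OF y(1)], of n w] x by (simp add: abs_le_iff)
    then have "u y \<le> exp (- 3)" using u_le[of y] by (meson exp_le_cancel_iff order_trans)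
    also have "exp (- 3) = exp (- 1 :: real) ^ 3" using exp_of_nat_mult[of 3 "- 1 :: real"] by simp
    also have "\<dots> \<le> (3 / 8) ^ 3" using exp_neg_bounds(2)[of 1] by (intro power_mono) auto
    also have "\<dots> \<le> 1 / 12" by (simp add: power_divide)
    finally have "u y \<le> 1 / 12" .
    then have "max 0 (u y) \<le> 1 / 12" by simp
    then show ?thesis by (simp add: v_def)
  next
    case False
    then show ?thesis using yG by (auto simp: v_def G_def)
  qed
  obtain \<eta> where \<eta>: "0 < \<eta>" "(\<Union>y\<in>K0. ball y \<eta>) \<subseteq> \<Omega> \<inter> ball 0 (2 * R)"
    using compact_subset_open_imp_ball_epsilon_subset[OF K0_compact _ K0\<Omega>] \<Omega>_open by (metis open_Int open_ball)
  have sub: "ennreal (v y) \<le> (\<integral>\<^sup>+s. ennreal (v (y + s * complex_of_real \<rho>)) \<partial>uniform_unit_circle)"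
    if y: "y \<in> G" and \<rho>: "0 \<le> \<rho>" "\<rho> < \<eta>" for y \<rho>
  proof -
    have "cball y \<rho> \<subseteq> ball y \<eta>" using \<rho> by auto
    then have c: "cball y \<rho> \<subseteq> \<Omega> \<inter> ball 0 (2 * R)" using \<eta>(2) y GK0 by blast
    have "v y = Im (F y)" using y R1 by (auto simp: v_def G_def u_def)
    moreover have "ennreal (Im (F y)) \<le> (\<integral>\<^sup>+s. ennreal (v (y + s * complex_of_real \<rho>)) \<partial>uniform_unit_circle)"
    proof (rule circle_mean_value_le[OF F_hol \<Omega>_open _ \<rho>(1) v_meas v0])
      show "cball y \<rho> \<subseteq> \<Omega>" using c by blast
      show "Im (F y') \<le> v y'" if "y' \<in> cball y \<rho>" for y' using c that by (auto simp: v_def u_def)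
    qed
    ultimately show ?thesis by simp
  qed
  have z0: "z \<noteq> 0" using z(1) by auto
  have zlam: "lam z = Complex 0 (Im (lam z))" using lam_eq[OF z0] z(1) by (simp add: Im_lam)
  have zt: "pi / 4 \<le> Im (lam z)" "Im (lam z) \<le> pi / 3" using z by (simp_all add: Im_lam)
  have z\<Omega>: "z \<in> \<Omega>" using z zt pi_bounds by (simp add: \<Omega>_def)
  \<comment> \<open>At \<open>x = 0\<close> the real part of the potential is at least
    \<open>- 1\<close>, and \<open>exp (- 1) \<ge> 1 / 3\<close>; the sine of a phase within
    \<open>pi / 4\<close> of \<open>pi / 2\<close> is at least \<open>1 / 2\<close>.\<close>
  have uz: "1 / 6 \<le> u z"
  proof -
    have "- 1 \<le> Re (potential n w (lam z))"
      using Re_potential_left[OF \<Omega>_pi(2)[OF z\<Omega>], of n w] z(1) by (simp add: Re_lam[OF z0] abs_le_iff)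
    then have "exp (- 1) \<le> exp (Re (potential n w (lam z)))" by simp
    moreover have "1 / 3 \<le> exp (- 1 :: real)" using exp_neg_bounds(1)[of 1] by simp
    ultimately have e: "1 / 3 \<le> exp (Re (potential n w (lam z)))" by linarith
    have "Im (potential n w (lam z)) = phase n w 0 (Im (lam z))"
      by (subst zlam, rule Im_potential) (use zt pi_gt_zero in linarith)+
    then have "1 \<le> 1.5 * sin (Im (potential n w (lam z)))"
      using sin_middle[OF phase_start[OF zt]] by simp
    then have s: "1 / 2 \<le> sin (Im (potential n w (lam z)))" by simp
    have "1 / 3 * (1 / 2) \<le> u z" unfolding u_eq by (rule mult_mono[OF e s]) auto
    then show ?thesis by simp
  qed
  have zG: "z \<in> G" using z\<Omega> uz z(1) d1 R1 by (simp add: G_def)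
  have vz: "1 / 6 \<le> v z" using z\<Omega> uz z(1) R1 by (simp add: v_def)
  have "\<exists>A\<in>sets M. (\<forall>x\<in>A. trace_until R (\<lambda>t. z + W t x) \<subseteq> closure G) \<and> v z \<le> 1 / 12 + K * measure M A"
    by (rule trace_in_closure_prob[OF W W0 v_meas v0 vV borel_open[OF G_open] zG _ \<eta>(1) sub out K]) (auto simp: G_def)
  then obtain A where A: "A \<in> sets M" "\<And>x. x \<in> A \<Longrightarrow> trace_until R (\<lambda>t. z + W t x) \<subseteq> closure G" "v z \<le> 1 / 12 + K * measure M A"
    by blast
  have "tube_const k * exp (- (401 / 200 * 13 * real n) + (\<Sum>i=1..n. level_gain (w i))) = 1 / 12 / K"
  proof -
    have "- (401 / 200 * (13 + k * ln 2) + 1) + (- (401 / 200 * 13 * real n) + (\<Sum>i=1..n. level_gain (w i))) =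
        - (401 / 200 * X - (\<Sum>i=1..n. level_gain (w i)) + 1)"
      by (simp add: X_def algebra_simps add_divide_distrib)
    then have "exp (- (401 / 200 * (13 + k * ln 2) + 1)) * exp (- (401 / 200 * 13 * real n) + (\<Sum>i=1..n. level_gain (w i))) = 1 / K"
      unfolding K_def exp_add[symmetric] by (simp only: exp_minus inverse_eq_divide)
    then show ?thesis by (simp add: tube_const_def)
  qed
  also have "\<dots> \<le> measure M A"
  proof -
    have "0 < K" by (simp add: K_def)
    moreover have "1 / 12 \<le> K * measure M A" using vz A(3) by simp
    ultimately show ?thesis by (simp add: divide_le_eq mult_ac)
  qed
  finally show ?thesis using A(1,2) clG_tube unfolding R_def by (intro bexI[of _ A]) blast+
qed

lemma cis_eq_1_imp: "cis \<delta> = 1 \<Longrightarrow> 0 < \<delta> \<Longrightarrow> \<delta> < 2 * pi \<Longrightarrow> False"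
proof -
  assume a: "cis \<delta> = 1" "0 < \<delta>" "\<delta> < 2 * pi"
  then have "cos \<delta> = 1" by (metis cis.simps(1) one_complex.simps(1))
  then have "sin (\<delta> / 2) = 0" using cos_double_sin[of "\<delta> / 2"] by simp
  moreover have "0 < sin (\<delta> / 2)" using a by (intro sin_gt_zero) auto
  ultimately show False by simp
qed

text \<open>The arguments \<open>a1\<close> of \<open>y1\<close> and \<open>a2\<close> of the
  conjugate of \<open>y2\<close> satisfy \<open>- (pi / k) \<le> a1 + a2\<close> and
  \<open>a1 + a2 < 0\<close>. A rotation by \<theta> from \<open>y2\<close> to \<open>y1\<close>
  would make \<open>\<theta> - (a1 + a2)\<close> a multiple of \<open>2 * pi\<close>, but it lies
  strictly between 0 and \<open>2 * pi\<close>. At a given radius a single block decides, so lying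
  in all tubes of \<open>J\<close> is as good as lying in the tube of the selection
  \<open>ws\<close>, even if \<open>ws\<close> itself is not in \<open>J\<close>.\<close>

lemma tubes_disjoint:
  assumes k: "0 < k" "\<alpha> + pi / k < 2 * pi" and J: "J \<noteq> {}"
    and ws: "\<And>i. i \<in> {1..n} \<Longrightarrow> \<exists>w\<in>J. w i = ws i" and wm: "\<And>i. i \<in> {1..n} \<Longrightarrow> ws i \<le> 4 \<and> wm i = 4 - ws i"
    and y: "\<And>w. w \<in> J \<Longrightarrow> y1 \<in> tube k n w" "cnj y2 \<in> tube k n wm" and \<theta>: "0 \<le> \<theta>" "\<theta> \<le> \<alpha>"
  shows "y1 \<noteq> cis \<theta> * y2"
proof
  assume eq: "y1 = cis \<theta> * y2"
  define a1 where "a1 = Im (Ln y1)"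
  define a2 where "a2 = Im (Ln (cnj y2))"
  define x where "x = k * ln (cmod y1)"
  have cm: "cmod y2 = cmod y1" using eq by (simp add: norm_mult)
  obtain w0 where w0: "w0 \<in> J" using J by blast
  have nz: "y1 \<noteq> 0" "y2 \<noteq> 0" using y(1)[OF w0] y(2) by (auto simp: tube_def)
  have sum_neg: "k * a1 + k * a2 < 0"
  proof (cases rule: block_cases[of x n])
    case 1
    then have "k * a1 < 0" using y(1)[OF w0] by (auto simp: tube_def x_def a1_def)
    moreover have "k * a2 < 0" using y(2) 1 unfolding tube_def by (auto simp: cm a2_def x_def)
    ultimately show ?thesis by simp
  next
    case (2 i)
    obtain w where w: "w \<in> J" "w i = ws i" using ws[OF 2(1)] by blast
    have "k * a1 < level_slope (ws i) * bump (x - 13 * real i) (pi / 2)"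
      using y(1)[OF w(1)] 2 w(2) by (auto simp: tube_def x_def a1_def)
    moreover have "k * a2 < level_slope (wm i) * bump (x - 13 * real i) (pi / 2)"
      using y(2) 2 unfolding tube_def by (simp add: cm a2_def x_def)
    \<comment> \<open>The slopes are antisymmetric about level 2, so the mirror image of the curve
      of level \<open>4 - j\<close> is the curve of level \<open>j\<close>.\<close>
    moreover have "level_slope (wm i) = - level_slope (ws i)"
      using wm[OF 2(1)] by (simp add: level_slope_def of_nat_diff field_simps)
    ultimately show ?thesis by simp
  qed
  then have neg: "a1 + a2 < 0" using k(1) by (simp add: distrib_left[symmetric] mult_less_0_iff)
  have "- (pi / 2) \<le> k * a1" "- (pi / 2) \<le> k * a2" using y(1)[OF w0] y(2) by (auto simp: tube_def a1_def a2_def)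
  then have "- pi \<le> k * (a1 + a2)" by (simp add: distrib_left)
  then have low: "- (pi / k) \<le> a1 + a2" using k(1) by (simp add: field_simps)
  have polar: "y = of_real (cmod y) * cis (Im (Ln y))" if "y \<noteq> 0" for y
  proof -
    have "y = exp (Ln y)" using that by simp
    also have "\<dots> = of_real (exp (Re (Ln y))) * cis (Im (Ln y))" by (rule exp_eq_polar)
    also have "exp (Re (Ln y)) = cmod y" using that by simp
    finally show ?thesis .
  qed
  have p1: "y1 = of_real (cmod y1) * cis a1" unfolding a1_def by (rule polar[OF nz(1)])
  have "cnj y2 = of_real (cmod (cnj y2)) * cis a2" unfolding a2_def by (rule polar) (use nz(2) in simp)
  then have "cnj (cnj y2) = cnj (of_real (cmod y1) * cis a2)" using cm by simp
  then have p2: "y2 = of_real (cmod y1) * cis (- a2)" by (simp add: cis_cnj)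
  have "of_real (cmod y1) * cis a1 = y1" by (rule p1[symmetric])
  also have "\<dots> = cis \<theta> * y2" by (rule eq)
  also have "\<dots> = cis \<theta> * (of_real (cmod y1) * cis (- a2))" by (rule arg_cong[OF p2])
  also have "\<dots> = of_real (cmod y1) * (cis \<theta> * cis (- a2))" by (simp only: mult.left_commute)
  finally have "of_real (cmod y1) * cis a1 = of_real (cmod y1) * (cis \<theta> * cis (- a2))" .
  then have "cis a1 = cis (\<theta> - a2)" using nz by (simp add: cis_mult)
  then have "cis (\<theta> - a2) * cis (- a1) = cis a1 * cis (- a1)" by simp
  then have "cis (\<theta> - a2 - a1) = 1" by (simp add: cis_mult)
  then show False by (rule cis_eq_1_imp) (use neg low \<theta> k(2) in linarith)+
qed

section \<open>The lower bound\<close>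

text \<open>Differences of consecutive values of \<open>exp (level_gain (4 - l))\<close>, so that
  the tail sum from \<open>l\<close> on recovers this value, the gain of the second path at the
  mirrored level. They are nonnegative because the gains increase with the level.\<close>

definition step_weight :: "nat \<Rightarrow> real" where
  "step_weight j = (if j < 4 then exp (level_gain (4 - j)) - exp (level_gain (3 - j)) else exp (level_gain 0))"

lemma step_weight_nonneg: "j \<le> 4 \<Longrightarrow> 0 \<le> step_weight j"
  using level_cases[of j] by (auto simp: step_weight_def level_gain_def)

lemma sum_step_weight: "l \<le> 4 \<Longrightarrow> (\<Sum>j=l..4. step_weight j) = exp (level_gain (4 - l))"
proof -
  have s: "{0..4} = {0, 1, 2, 3, 4 :: nat}" "{1..4} = {1, 2, 3, 4 :: nat}" "{2..4} = {2, 3, 4 :: nat}" "{3..4} = {3, 4 :: nat}" "{4..4} = {4 :: nat}" by auto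
  assume "l \<le> 4"
  from level_cases[OF this] show ?thesis
    by (elim disjE) (simp_all only: s, simp_all add: step_weight_def)
qed

text \<open>Expanded, the sum is \<open>1 + 2 * (exp (- 0.34) + exp (- 0.09) - exp (- 0.86) - exp (-
  0.67))\<close>. The 1 and the positive terms are the products of the gains of opposite levels, one
  for each separating level; the negative terms correct for pairs that fit two neighbouring levels
  at once.\<close>

lemma gain_sum: "exp 0.8 \<le> (\<Sum>j=0..4. step_weight j * exp (level_gain j))"
proof -
  have "{0..4} = {0, 1, 2, 3, 4 :: nat}" by auto
  then have "(\<Sum>j=0..4. step_weight j * exp (level_gain j)) =
      (exp 1.1 - exp 0.58) * exp (- 1.44) + ((exp 0.58 - 1) * exp (- 0.67) + ((1 - exp (- 0.67)) * 1 + ((exp (- 0.67) - exp (- 1.44)) * exp 0.58 + exp (- 1.44) * exp 1.1)))"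
    by (simp add: step_weight_def level_gain_def)
  also have "\<dots> = 1 + 2 * (exp (1.1 + - 1.44) + exp (0.58 + - 0.67) - exp (0.58 + - 1.44) - exp (- 0.67))"
    unfolding exp_add by (simp only: algebra_simps mult_2)
  also have "\<dots> \<ge> 2.31"
  proof -
    have "0.71 \<le> exp (- 0.34 :: real)" using exp_neg_bounds(1)[of "0.34"] by (simp add: power2_eq_square power3_eq_cube)
    moreover have "0.91 \<le> exp (- 0.09 :: real)" using exp_neg_bounds(1)[of "0.09"] by (simp add: power2_eq_square power3_eq_cube)
    moreover have "exp (- 0.86 :: real) \<le> 0.43" using exp_neg_bounds(2)[of "0.86"] by (simp add: power2_eq_square power3_eq_cube power4_eq_xxxx)
    moreover have "exp (- 0.67 :: real) \<le> 0.52" using exp_neg_bounds(2)[of "0.67"] by (simp add: power2_eq_square power3_eq_cube power4_eq_xxxx)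
    ultimately show ?thesis by simp
  qed
  finally have "2.31 \<le> (\<Sum>j=0..4. step_weight j * exp (level_gain j))" .
  moreover have "exp 0.8 \<le> (2.31 :: real)"
  proof -
    have "100 / 231 \<le> exp (- 0.8 :: real)" using exp_neg_bounds(1)[of "0.8"] by (simp add: power2_eq_square power3_eq_cube)
    then show ?thesis by (simp add: exp_minus field_simps)
  qed
  ultimately show ?thesis by linarith
qed

lemma trace_until_cnj: "trace_until R (\<lambda>t. cnj (f t)) = cnj ` trace_until R f"
  unfolding trace_until_def by auto

text \<open>All sequences in \<open>J\<close> lie above \<open>ws\<close>, so \<open>J\<close> is
  part of a box, over which the sum of products factorises. Since the weights are nonnegative,
  enlarging \<open>J\<close> to the box only increases the sum.\<close>

lemma sum_step_weight_prod_le: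
  fixes n :: nat
  assumes J: "J \<subseteq> PiE {1..n} (\<lambda>_. {0..4})" and ws: "\<And>w i. w \<in> J \<Longrightarrow> i \<in> {1..n} \<Longrightarrow> ws i \<le> w i" "\<And>i. i \<in> {1..n} \<Longrightarrow> ws i \<le> 4"
  shows "(\<Sum>w\<in>J. \<Prod>i=1..n. step_weight (w i)) \<le> (\<Prod>i=1..n. exp (level_gain (4 - ws i)))"
proof -
  have "(\<Sum>w\<in>J. \<Prod>i=1..n. step_weight (w i)) \<le> (\<Sum>w\<in>PiE {1..n} (\<lambda>i. {ws i..4}). \<Prod>i=1..n. step_weight (w i))"
  proof (rule sum_mono2)
    show "finite (PiE {1..n} (\<lambda>i. {ws i..4}))" by (intro finite_PiE) auto
    show "J \<subseteq> PiE {1..n} (\<lambda>i. {ws i..4})"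
    proof
      fix w assume w: "w \<in> J"
      then have "w \<in> PiE {1..n} (\<lambda>_. {0..4})" using J by blast
      then show "w \<in> PiE {1..n} (\<lambda>i. {ws i..4})" using ws(1)[OF w] by (simp add: PiE_iff)
    qed
    fix w assume "w \<in> PiE {1..n} (\<lambda>i. {ws i..4}) - J"
    then show "0 \<le> (\<Prod>i=1..n. step_weight (w i))" by (intro prod_nonneg step_weight_nonneg) (auto simp: PiE_iff)
  qed
  also have "\<dots> = (\<Prod>i=1..n. \<Sum>j=ws i..4. step_weight j)"
    by (rule prod_sum_PiE[symmetric]) auto
  also have "\<dots> = (\<Prod>i=1..n. exp (level_gain (4 - ws i)))"
    by (intro prod.cong refl sum_step_weight ws(2))
  finally show ?thesis .
qed

lemma sum_weight_gain: "(\<Sum>w\<in>PiE {1..n} (\<lambda>_. {0..4}). (\<Prod>i=1..n. step_weight (w i)) * (\<Prod>i=1..n. exp (level_gain (w i)))) =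
    (\<Sum>j=0..4. step_weight j * exp (level_gain j)) ^ n"
proof -
  have "(\<Prod>i=1..n. \<Sum>j=0..4. step_weight j * exp (level_gain j)) =
      (\<Sum>w\<in>PiE {1..n} (\<lambda>_. {0..4}). \<Prod>i=1..n. step_weight (w i) * exp (level_gain (w i)))"
    by (rule prod_sum_PiE) auto
  then show ?thesis by (simp add: prod.distrib)
qed

definition start_arc :: "real \<Rightarrow> complex set" where
  "start_arc k = {z. cmod z = 1 \<and> z \<notin> \<real>\<^sub>\<le>\<^sub>0 \<and> pi / 4 \<le> k * Im (Ln z) + pi / 2 \<and> k * Im (Ln z) + pi / 2 \<le> pi / 3}"

context wiener
begin

text \<open>Given the first path, let J be the set of level sequences whose tube contains it. The second
  path, reflected in the real axis, is kept in the tube of the mirrored pointwise minimum of J. The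
  weights are chosen such that the sum over J is at most the gain of that mirrored minimum. The rate
  is \<open>51.33 = 2 * 13 * 2 * (1 + 1 / 400) - 0.8\<close>.\<close>

lemma Q_lower:
  assumes k: "1 / 2 < k" "\<alpha> + pi / k < 2 * pi" and z1: "z1 \<in> start_arc k" and z2: "cnj z2 \<in> start_arc k"
  shows "ennreal ((tube_const k)\<^sup>2 * exp (- 51.33) ^ n) \<le> Q (exp (13 * real (Suc n) / k)) z1 z2"
proof -
  define R where "R = exp (13 * real (Suc n) / k)"
  define Ws where "Ws = PiE {1..n} (\<lambda>_. {0..4 :: nat})"
  have fW: "finite Ws" unfolding Ws_def by (intro finite_PiE) auto
  have Ws4: "w i \<le> 4" if "w \<in> Ws" "i \<in> {1..n}" for w i using that by (auto simp: Ws_def PiE_iff)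
  define D where "D = tube_const k * exp (- (401 / 200 * 13 * real n))"
  have D0: "0 \<le> D" by (simp add: D_def tube_const_def)
  have Deq: "tube_const k * exp (- (401 / 200 * 13 * real n) + (\<Sum>i=1..n. level_gain (w i))) = D * (\<Prod>i=1..n. exp (level_gain (w i)))" for w
    unfolding D_def exp_add exp_sum[OF finite_atLeastAtMost] by (simp only: mult.assoc)
  have z: "cmod z = 1" "z \<notin> \<real>\<^sub>\<le>\<^sub>0" "pi / 4 \<le> k * Im (Ln z) + pi / 2" "k * Im (Ln z) + pi / 2 \<le> pi / 3" if "z \<in> start_arc k" for z
    using that by (simp_all add: start_arc_def)
  have "\<exists>A\<in>sets M. (\<forall>x\<in>A. trace_until R (\<lambda>t. z1 + W t x) \<subseteq> tube k n w) \<and> D * (\<Prod>i=1..n. exp (level_gain (w i))) \<le> measure M A" if "w \<in> Ws" for w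
    unfolding Deq[symmetric] R_def by (rule tube_prob[OF W W0 k(1) Ws4[OF that] z[OF z1]])
  then obtain A1 where A1: "\<And>w. w \<in> Ws \<Longrightarrow> A1 w \<in> sets M" "\<And>w x. w \<in> Ws \<Longrightarrow> x \<in> A1 w \<Longrightarrow> trace_until R (\<lambda>t. z1 + W t x) \<subseteq> tube k n w"
      "\<And>w. w \<in> Ws \<Longrightarrow> D * (\<Prod>i=1..n. exp (level_gain (w i))) \<le> measure M (A1 w)"
    by metis
  have W0': "cnj (W 0 x) = 0" if "x \<in> space M" for x using W0[OF that] by simp
  have "\<exists>A\<in>sets M. (\<forall>x\<in>A. trace_until R (\<lambda>t. cnj z2 + cnj (W t x)) \<subseteq> tube k n w) \<and> D * (\<Prod>i=1..n. exp (level_gain (w i))) \<le> measure M A" if "w \<in> Ws" for w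
    unfolding Deq[symmetric] R_def by (rule tube_prob[OF brownian_process_cnj[OF W] W0' k(1) Ws4[OF that] z[OF z2]])
  then obtain A2 where A2: "\<And>w. w \<in> Ws \<Longrightarrow> A2 w \<in> sets M" "\<And>w x. w \<in> Ws \<Longrightarrow> x \<in> A2 w \<Longrightarrow> trace_until R (\<lambda>t. cnj z2 + cnj (W t x)) \<subseteq> tube k n w"
      "\<And>w. w \<in> Ws \<Longrightarrow> D * (\<Prod>i=1..n. exp (level_gain (w i))) \<le> measure M (A2 w)"
    by metis
  define E where "E = {p\<in>space (M \<Otimes>\<^sub>M M). avoids (circle_arc \<alpha>) R (\<lambda>t. start z1 t (fst p)) (\<lambda>t. start z2 t (snd p))}"
  have Em: "E \<in> sets (M \<Otimes>\<^sub>M M)" unfolding E_def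
  proof (rule sets_avoids[OF _ _ _ _ \<alpha>])
    fix t :: real assume t: "0 \<le> t"
    note [measurable] = brownian_processD(2)[OF W t]
    show "(\<lambda>q. start z1 t (fst q)) \<in> borel_measurable (M \<Otimes>\<^sub>M M)" by measurable
    show "(\<lambda>q. start z2 t (snd q)) \<in> borel_measurable (M \<Otimes>\<^sub>M M)" by measurable
  qed (auto simp: space_pair_measure intro!: start_continuous)
  define C where "C w = (\<Prod>i=1..n. step_weight (w i))" for w
  have C0: "0 \<le> C w" if "w \<in> Ws" for w unfolding C_def by (intro prod_nonneg step_weight_nonneg Ws4[OF that]) auto
  \<comment> \<open>With the first path fixed only the second one is random: the weighted
    contributions of all tubes that contain the first path are paid for by one tube of the second
    path.\<close>
  have pointwise: "(\<Sum>w\<in>Ws. ennreal (D * C w) * indicator (A1 w) x) \<le> emeasure M (Pair x -` E)" if x: "x \<in> space M" for x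
  proof -
    define J where "J = {w\<in>Ws. x \<in> A1 w}"
    have JW: "J \<subseteq> Ws" and fJ: "finite J" using fW by (auto simp: J_def)
    have "(\<Sum>w\<in>Ws. ennreal (D * C w) * indicator (A1 w) x) = (\<Sum>w\<in>J. ennreal (D * C w))"
      unfolding J_def sum.inter_filter[OF fW] by (intro sum.cong) (auto simp: indicator_def)
    also have "\<dots> = ennreal (\<Sum>w\<in>J. D * C w)" using C0 JW D0 by (intro sum_ennreal) auto
    also have "\<dots> \<le> emeasure M (Pair x -` E)"
    proof (cases "J = {}")
      case False
      define ws where "ws i = Min ((\<lambda>w. w i) ` J)" for i
      have ws_in: "\<exists>w\<in>J. w i = ws i" for i
      proof -
        have "ws i \<in> (\<lambda>w. w i) ` J" unfolding ws_def by (rule Min_in) (use fJ False in simp_all)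
        then obtain w where "ws i = w i" "w \<in> J" by (rule imageE)
        then show ?thesis by (intro bexI[of _ w]) simp_all
      qed
      have ws_le: "ws i \<le> w i" if "w \<in> J" for w i unfolding ws_def using fJ that by simp
      have ws4: "ws i \<le> 4" if "i \<in> {1..n}" for i
      proof -
        obtain w where w: "w \<in> J" "w i = ws i" using ws_in by blast
        show ?thesis using Ws4[OF subsetD[OF JW w(1)] that] w(2) by simp
      qed
      define wm where "wm = (\<lambda>i\<in>{1..n}. 4 - ws i)"
      have wm: "wm \<in> Ws" by (auto simp: wm_def Ws_def PiE_iff extensional_def)
      have "A2 wm \<subseteq> Pair x -` E"
      proof
        fix y assume y: "y \<in> A2 wm"
        then have yM: "y \<in> space M" using A2(1)[OF wm] sets.sets_into_space by blast
        have "trace_until R (\<lambda>t. start z1 t x) \<inter> (circle_arc \<alpha> * trace_until R (\<lambda>t. start z2 t y)) = {}"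
        proof (rule ccontr)
          assume "\<not> ?thesis"
          then obtain y1 y2 \<theta> where h: "y1 \<in> trace_until R (\<lambda>t. start z1 t x)" "y2 \<in> trace_until R (\<lambda>t. start z2 t y)" "0 \<le> \<theta>" "\<theta> \<le> \<alpha>" "y1 = cis \<theta> * y2"
            by (auto simp: circle_arc_def elim!: set_times_elim)
          have t1: "y1 \<in> tube k n w" if "w \<in> J" for w using A1(2)[of w x] that h(1) by (auto simp: J_def)
          have "cnj y2 \<in> trace_until R (\<lambda>t. cnj (start z2 t y))" unfolding trace_until_cnj using h(2) by blast
          then have t2: "cnj y2 \<in> tube k n wm" using A2(2)[OF wm y] by auto
          have "0 < k" using k(1) by simp
          have "y1 \<noteq> cis \<theta> * y2"
          proof (rule tubes_disjoint[where ws=ws and J=J and wm=wm])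
            show "ws i \<le> 4 \<and> wm i = 4 - ws i" if "i \<in> {1..n}" for i using ws4[OF that] that by (simp add: wm_def)
          qed (use k False ws_in t1 t2 h in auto)
          then show False using h(5) by blast
        qed
        then show "y \<in> Pair x -` E" using x yM by (simp add: E_def avoids_def space_pair_measure)
      qed
      then have "emeasure M (A2 wm) \<le> emeasure M (Pair x -` E)" by (intro emeasure_mono sets_Pair1[OF Em])
      moreover have "(\<Sum>w\<in>J. D * C w) \<le> measure M (A2 wm)"
      proof -
        have "(\<Sum>w\<in>J. C w) \<le> (\<Prod>i=1..n. exp (level_gain (4 - ws i)))"
          unfolding C_def by (rule sum_step_weight_prod_le) (use JW ws_le ws4 in \<open>auto simp: Ws_def\<close>)
        also have "\<dots> = (\<Prod>i=1..n. exp (level_gain (wm i)))" by (intro prod.cong) (auto simp: wm_def)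
        finally have "D * (\<Sum>w\<in>J. C w) \<le> D * (\<Prod>i=1..n. exp (level_gain (wm i)))" using D0 by (rule mult_left_mono)
        also have "\<dots> \<le> measure M (A2 wm)" by (rule A2(3)[OF wm])
        finally show ?thesis by (simp add: sum_distrib_left)
      qed
      ultimately show ?thesis unfolding emeasure_eq_measure by (meson ennreal_leI order_trans)
    qed simp
    finally show ?thesis .
  qed
  have "(tube_const k)\<^sup>2 * exp (- 51.33) ^ n \<le> D * D * (\<Sum>j=0..4. step_weight j * exp (level_gain j)) ^ n"
  proof -
    have "D * D * exp 0.8 ^ n = (tube_const k)\<^sup>2 * (exp (- (401 / 200 * 13 * real n)) * exp (- (401 / 200 * 13 * real n)) * exp 0.8 ^ n)"
      by (simp add: D_def power2_eq_square)
    also have "exp (- (401 / 200 * 13 * real n)) * exp (- (401 / 200 * 13 * real n)) * exp 0.8 ^ n = exp (- 51.33) ^ n"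
      unfolding exp_of_nat_mult[symmetric] exp_add[symmetric] by (rule arg_cong[where f=exp]) (simp add: algebra_simps)
    finally have "(tube_const k)\<^sup>2 * exp (- 51.33) ^ n = D * D * exp 0.8 ^ n" ..
    also have "\<dots> \<le> D * D * (\<Sum>j=0..4. step_weight j * exp (level_gain j)) ^ n"
      using gain_sum D0 by (intro mult_left_mono power_mono) auto
    finally show ?thesis .
  qed
  also have "\<dots> = (\<Sum>w\<in>Ws. (D * C w) * (D * (\<Prod>i=1..n. exp (level_gain (w i)))))"
    unfolding sum_weight_gain[symmetric] Ws_def C_def sum_distrib_left by (intro sum.cong) (auto simp: mult_ac)
  also have "\<dots> \<le> (\<Sum>w\<in>Ws. (D * C w) * measure M (A1 w))"
    using C0 D0 A1(3) by (intro sum_mono mult_left_mono) auto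
  finally have "ennreal ((tube_const k)\<^sup>2 * exp (- 51.33) ^ n) \<le> ennreal (\<Sum>w\<in>Ws. (D * C w) * measure M (A1 w))"
    by (rule ennreal_leI)
  also have "\<dots> = (\<Sum>w\<in>Ws. ennreal (D * C w) * emeasure M (A1 w))"
    using C0 D0 by (subst sum_ennreal[symmetric]) (auto simp: emeasure_eq_measure ennreal_mult)
  also have "\<dots> = (\<Sum>w\<in>Ws. (\<integral>\<^sup>+x. ennreal (D * C w) * indicator (A1 w) x \<partial>M))"
    using A1(1) by (intro sum.cong refl nn_integral_cmult_indicator[symmetric]) auto
  also have "\<dots> = (\<integral>\<^sup>+x. (\<Sum>w\<in>Ws. ennreal (D * C w) * indicator (A1 w) x) \<partial>M)"
    using A1(1) by (intro nn_integral_sum[symmetric]) auto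
  also have "\<dots> \<le> (\<integral>\<^sup>+x. emeasure M (Pair x -` E) \<partial>M)" by (rule nn_integral_mono[OF pointwise])
  also have "\<dots> = Q R z1 z2" unfolding Q_def noninter_def E_def[symmetric] by (rule emeasure_pair_measure_alt[symmetric, OF Em])
  finally show ?thesis by (simp add: R_def)
qed

end

lemma nn_integral_circle_ge:
  assumes f [measurable]: "f \<in> borel_measurable borel" and ab: "0 \<le> a" "a \<le> b" "b \<le> 1"
    and q: "\<And>x. a \<le> x \<Longrightarrow> x \<le> b \<Longrightarrow> q \<le> f (cis (2 * pi * x))"
  shows "q * ennreal (b - a) \<le> (\<integral>\<^sup>+u. f u \<partial>uniform_unit_circle)"
proof -
  have "q * ennreal (b - a) = (\<integral>\<^sup>+x. q * indicator {a..b} x \<partial>lborel)"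
    using ab by (subst nn_integral_cmult_indicator) auto
  also have "\<dots> \<le> (\<integral>\<^sup>+x. f (cis (2 * pi * x)) * indicator {0..1} x \<partial>lborel)"
    by (rule nn_integral_mono) (use ab q in \<open>auto simp: indicator_def\<close>)
  also have "\<dots> = (\<integral>\<^sup>+u. f u \<partial>uniform_unit_circle)" by (rule nn_integral_circle_unit[OF f, symmetric])
  finally show ?thesis .
qed

lemma cis_in_start_arc:
  assumes k: "1 / 2 < k" and a: "- (pi / 4) \<le> k * a" "k * a \<le> - (pi / 6)"
  shows "cis a \<in> start_arc k"
proof -
  have "k * a < 0" using a pi_gt_zero by linarith
  then have a0: "a < 0" using k by (simp add: mult_less_0_iff)
  have "1 / 2 * (- a) \<le> k * (- a)" using k a0 by (intro mult_right_mono) auto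
  then have "- a \<le> - (2 * (k * a))" by simp
  then have a1: "- pi < a" using a pi_gt_zero by linarith
  have L: "Ln (cis a) = \<i> * of_real a"
    by (rule Ln_unique) (use a0 a1 pi_gt_zero in \<open>simp_all add: cis_conv_exp\<close>)
  have "sin (- a) > 0" using a0 a1 by (intro sin_gt_zero) auto
  then have "cis a \<notin> \<real>\<^sub>\<le>\<^sub>0" by (auto simp: complex_nonpos_Reals_iff)
  then show ?thesis using a by (simp add: start_arc_def L)
qed

text \<open>Uniform starting points fall into the two admissible arcs with positive probability:
  these arcs have angles between \<open>pi / (6 * k)\<close> and \<open>pi / (4 * k)\<close>, on
  opposite sides of the real axis, and each is a fraction \<open>1 / (24 * k)\<close> of the
  circle.\<close>

lemma (in wiener) QU_lower:
  assumes k: "1 / 2 < k" "\<alpha> + pi / k < 2 * pi"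
  shows "ennreal ((tube_const k / (24 * k))\<^sup>2 * exp (- 51.33) ^ n) \<le> QU (exp (13 * real (Suc n) / k))"
proof -
  let ?R = "exp (13 * real (Suc n) / k)" and ?l = "1 / (24 * k)" and ?q = "(tube_const k)\<^sup>2 * exp (- 51.33) ^ n"
  interpret U: prob_space uniform_unit_circle by (rule prob_space_circle)
  have k0: "0 < k" using k by simp
  have pair: "ennreal ?q \<le> Q ?R (cis (2 * pi * x)) (cis (2 * pi * y))"
    if x: "1 - 1 / (8 * k) \<le> x" "x \<le> 1 - 1 / (12 * k)" and y: "1 / (12 * k) \<le> y" "y \<le> 1 / (8 * k)" for x y
  proof (rule Q_lower[OF k])
    \<comment> \<open>The parameter runs through the unit interval, so the negative angles of the
      first start correspond to \<open>x\<close> near 1.\<close>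
    have "cis (2 * pi * x) = cis (2 * pi * (x - 1))" by (simp add: complex_eq_iff right_diff_distrib cos_diff sin_diff)
    moreover have "cis (2 * pi * (x - 1)) \<in> start_arc k"
    proof (rule cis_in_start_arc[OF k(1)])
      have "- (1 / 8) \<le> k * (x - 1)" "k * (x - 1) \<le> - (1 / 12)" using x k0 by (simp_all add: field_simps)
      then have "2 * pi * (- (1 / 8)) \<le> 2 * pi * (k * (x - 1))" "2 * pi * (k * (x - 1)) \<le> 2 * pi * (- (1 / 12))"
        by (intro mult_left_mono; simp)+
      then show "- (pi / 4) \<le> k * (2 * pi * (x - 1))" "k * (2 * pi * (x - 1)) \<le> - (pi / 6)" by (simp_all add: mult_ac)
    qed
    ultimately show "cis (2 * pi * x) \<in> start_arc k" by simp
    have "cis (2 * pi * (- y)) \<in> start_arc k"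
    proof (rule cis_in_start_arc[OF k(1)])
      have "- (1 / 8) \<le> k * (- y)" "k * (- y) \<le> - (1 / 12)" using y k0 by (simp_all add: field_simps)
      then have "2 * pi * (- (1 / 8)) \<le> 2 * pi * (k * (- y))" "2 * pi * (k * (- y)) \<le> 2 * pi * (- (1 / 12))"
        by (intro mult_left_mono; simp)+
      then show "- (pi / 4) \<le> k * (2 * pi * (- y))" "k * (2 * pi * (- y)) \<le> - (pi / 6)" by (simp_all add: mult_ac)
    qed
    then show "cnj (cis (2 * pi * y)) \<in> start_arc k" by (simp add: cis_cnj)
  qed
  have l8: "1 / (8 * k) \<le> 1" using k by (simp add: divide_le_eq)
  have l12: "1 / (12 * k) \<le> 1 / (8 * k)" "0 \<le> 1 / (12 * k)" using k0 by (simp_all add: field_simps)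
  have d: "1 - 1 / (12 * k) - (1 - 1 / (8 * k)) = ?l" "1 / (8 * k) - 1 / (12 * k) = ?l" using k0 by (simp_all add: field_simps)
  have inner: "ennreal ?q * ennreal ?l \<le> (\<integral>\<^sup>+u2. Q ?R (cis (2 * pi * x)) u2 \<partial>uniform_unit_circle)"
    if x: "1 - 1 / (8 * k) \<le> x" "x \<le> 1 - 1 / (12 * k)" for x
    using nn_integral_circle_ge[where f="\<lambda>u2. Q ?R (cis (2 * pi * x)) u2" and a="1 / (12 * k)" and b="1 / (8 * k)" and q="ennreal ?q"]
      l8 l12 pair[OF x] unfolding d by simp
  have "(\<lambda>u1. \<integral>\<^sup>+u2. Q ?R u1 u2 \<partial>uniform_unit_circle) \<in> borel_measurable borel" by measurable
  from nn_integral_circle_ge[OF this, where a="1 - 1 / (8 * k)" and b="1 - 1 / (12 * k)" and q="ennreal ?q * ennreal ?l"]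
  have "ennreal ?q * ennreal ?l * ennreal ?l \<le> QU ?R" unfolding QU_def d using inner l8 l12 by simp
  moreover have "ennreal ?q * ennreal ?l * ennreal ?l = ennreal ((tube_const k / (24 * k))\<^sup>2 * exp (- 51.33) ^ n)"
  proof -
    have "ennreal x * ennreal l * ennreal l = ennreal (x * l * l)" if "0 \<le> x" "0 \<le> l" for x l
      using that by (simp add: ennreal_mult)
    moreover have "0 \<le> ?q" by (intro mult_nonneg_nonneg zero_le_power2) simp
    moreover have "0 \<le> ?l" using k0 by simp
    ultimately have "ennreal ?q * ennreal ?l * ennreal ?l = ennreal (?q * ?l * ?l)" by blast
    also have "?q * ?l * ?l = (tube_const k / (24 * k))\<^sup>2 * exp (- 51.33) ^ n" by (simp add: power2_eq_square mult_ac)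
    finally show ?thesis .
  qed
  ultimately show ?thesis by simp
qed

lemma ln_2_le: "ln 2 \<le> (0.697 :: real)"
proof -
  have "exp (- 0.697) \<le> (1 / 2 :: real)"
    using exp_neg_bounds(2)[of "0.697"] by (simp add: power2_eq_square power3_eq_cube power4_eq_xxxx)
  then have "2 \<le> exp (0.697 :: real)" by (simp add: exp_minus field_simps)
  then show ?thesis by (metis exp_ge_zero exp_gt_zero ln_exp ln_mono zero_less_numeral)
qed

theorem proposition6:
  fixes M :: "'w measure"
    and B1 B2 :: "real \<Rightarrow> 'w \<Rightarrow> complex"
    and \<alpha> :: real
  assumes "independent_brownian_pair M B1 B2"
    and "\<alpha> \<in> {0<..<2 * pi}"
  shows "nonintersection_exponent M B1 B2 (circle_arc \<alpha>)
           \<le> ereal (4 * pi / (2 * pi - \<alpha>) * (1 - (ln 2)\<^sup>2 / (4 * pi\<^sup>2)))"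
proof -
  have \<alpha>: "0 < \<alpha>" "\<alpha> < 2 * pi" using assms(2) by auto
  define b where "b = 2 * pi - \<alpha>"
  have b: "0 < b" "b < 2 * pi" using \<alpha> by (simp_all add: b_def)
  \<comment> \<open>The extra factor makes \<open>\<alpha> + pi / k < 2 * pi\<close> strict, so that
    the tubes do not meet around the far side either. It costs \<open>52 / 2001\<close>, about
    0.026, of the 0.67 gained per block.\<close>
  define k where "k = pi / b * (2001 / 2000)"
  have "1 / 2 < pi / b" using b by (simp add: less_divide_eq)
  then have k1: "1 / 2 < k" unfolding k_def by simp
  then have k0: "0 < k" by simp
  have "pi / k = b * (2000 / 2001)" using b by (simp add: k_def)
  also have "\<dots> < b" using b by simp
  finally have k2: "\<alpha> + pi / k < 2 * pi" by (simp add: b_def)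
  interpret W: wiener M "\<lambda>t \<omega>. B1 t \<omega> - B1 0 \<omega>" \<alpha>
    by (rule nonintersection_prob_eq_QU(1)[OF assms(1)]) (use \<alpha> in simp)
  have pQU: "ennreal (nonintersection_prob M B1 B2 (circle_arc \<alpha>) R) = W.QU R" for R
    by (rule nonintersection_prob_eq_QU(2)[OF assms(1)]) (use \<alpha> in simp)
  define L where "L = (ln 2)\<^sup>2 / (4 * pi\<^sup>2)"
  define \<kappa> where "\<kappa> = 4 * pi / b * (1 - L)"
  have L: "L \<le> 0.01235"
  proof -
    have "(ln 2)\<^sup>2 \<le> (0.697 :: real)\<^sup>2" using ln_2_le by (intro power_mono) auto
    moreover have "(3.14 :: real)\<^sup>2 \<le> pi\<^sup>2" using pi_bounds by (intro power_mono) auto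
    ultimately have "(ln 2)\<^sup>2 \<le> 0.01235 * (4 * pi\<^sup>2)" by (simp add: power2_eq_square)
    then show ?thesis unfolding L_def by (simp add: divide_le_eq)
  qed
  have "4 * pi / b * 0.98765 \<le> \<kappa>" unfolding \<kappa>_def using L b by (intro mult_left_mono) auto
  moreover have "0 < 4 * pi / b * 0.98765" using b by simp
  ultimately have \<kappa>0: "0 < \<kappa>" by linarith
  \<comment> \<open>The margin is small: with the numerical bound for \<open>L\<close> the
    right-hand side comes out as about 51.332.\<close>
  have \<kappa>k: "51.33 \<le> 13 / k * \<kappa>"
  proof -
    have "13 / k * \<kappa> = 13 * 4 * (2000 / 2001) * (1 - L)" using b by (simp add: k_def \<kappa>_def)
    also have "\<dots> \<ge> 13 * 4 * (2000 / 2001) * 0.98765" using L by (intro mult_left_mono) auto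
    finally show ?thesis by simp
  qed
  define c where "c = (tube_const k / (24 * k))\<^sup>2"
  have c: "0 < c" using k0 by (simp add: c_def tube_const_def)
  have "nonintersection_exponent M B1 B2 (circle_arc \<alpha>) \<le> ereal \<kappa>"
  \<comment> \<open>One block multiplies the radius by \<open>exp (13 / k)\<close>; the first such
    factor, \<sigma>, is the straight stretch before the blocks.\<close>
  proof (rule nonintersection_exponent_le[OF assms(1) _ c, where \<sigma>="exp (13 / k)" and \<rho>="exp (13 / k)"])
    fix n :: nat
    have R: "exp (13 / k) * exp (13 / k) ^ n = exp (13 * real (Suc n) / k)"
      unfolding exp_of_nat_mult[symmetric] exp_add[symmetric] by (simp add: add_divide_distrib distrib_left)
    have "exp (13 * real (Suc n) / k) powr (- \<kappa>) = exp (- (13 / k * \<kappa>)) * exp (- (13 / k * \<kappa>)) ^ n"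
      unfolding exp_of_nat_mult[symmetric] exp_add[symmetric] powr_def by (simp add: algebra_simps add_divide_distrib)
    also have "\<dots> \<le> 1 * exp (- 51.33) ^ n" using \<kappa>k by (intro mult_mono power_mono) auto
    finally have "c * exp (13 * real (Suc n) / k) powr (- \<kappa>) \<le> c * exp (- 51.33) ^ n"
      using c by simp
    moreover have "ennreal (c * exp (- 51.33) ^ n) \<le> ennreal (nonintersection_prob M B1 B2 (circle_arc \<alpha>) (exp (13 * real (Suc n) / k)))"
      unfolding pQU c_def by (rule W.QU_lower[OF k1 k2])
    then have "c * exp (- 51.33) ^ n \<le> nonintersection_prob M B1 B2 (circle_arc \<alpha>) (exp (13 * real (Suc n) / k))"
      by (simp add: nonintersection_prob_def)
    ultimately show "c * (exp (13 / k) * exp (13 / k) ^ n) powr (- \<kappa>) \<le> nonintersection_prob M B1 B2 (circle_arc \<alpha>) (exp (13 / k) * exp (13 / k) ^ n)"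
      unfolding R by linarith
  qed (use k0 \<kappa>0 \<alpha> in auto)
  then show ?thesis by (simp only: \<kappa>_def b_def L_def)
qed

end
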